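(* (i) The $\mathbb{C}$-span of multiple Eisenstein series is graded by weight: $\mathcal{E}^{\mathbb{C}}=\bigoplus_{k\ge0}\mathcal{E}_k^{\mathbb{C}}$. In particular, the $\mathbb{Q}$-algebra of multiple Eisenstein series is graded by weight: $\mathcal{E}=\bigoplus_{k\ge0}\mathcal{E}_k$. (ii) For $k\ge 0$ the assignment $$\Phi_k:\mathcal{E}_k\longrightarrow\operatorname{gr}^W_k\mathsf{qMZV},\qquad G_{k_1,\dots,k_r}\longmapsto g_{k_1,\dots,k_r}\bmod\operatorname{Fil}^W_{k-1}\mathsf{qMZV}$$ (for $k_1,\dots,k_r\ge2$ with $k_1+\cdots+k_r=k$), where $\Phi_0(1)=1$, is a well-defined isomorphism of $\mathbb{Q}$-vector spaces. These maps give an isomorphism of graded $\mathbb{Q}$-algebras $\Phi:\mathcal{E}\xrightarrow{\sim}\operatorname{gr}^W\mathsf{qMZV}$. Moreover, the natural map $\mathcal{E}\otimes_{\mathbb{Q}}\mathbb{C}\to\mathcal{E}^{\mathbb{C}}$ is an isomorphism.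
   Context: $\mathbb{H}$ is the complex upper half-plane and $q=e^{2\pi i\tau}$. For $r\ge1$ and integers $k_1,\dots,k_r\ge2$ the multiple Eisenstein series is the holomorphic function on $\mathbb{H}$ $$G_{k_1,\dots,k_r}(\tau)=\lim_{M\to\infty}\lim_{N\to\infty}\sum_{\substack{\lambda_1,\dots,\lambda_r\in\mathbb{Z}_M\tau+\mathbb{Z}_N\\ \lambda_1\succ\cdots\succ\lambda_r\succ0}}\frac1{\lambda_1^{k_1}\cdots\lambda_r^{k_r}},$$ where $\mathbb{Z}_M=\{m\in\mathbb{Z}\mid |m|<M\}$ and $m_1\tau+n_1\succ m_2\tau+n_2$ iff $m_1>m_2$, or $m_1=m_2$ and $n_1>n_2$. Also $G_\varnothing=1$. $\mathcal{E}$ is the $\mathbb{Q}$-span of $1$ and all $G_{k_1,\dots,k_r}$ ($r\ge1$, all $k_i\ge2$); it is a $\mathbb{Q}$-algebra under multiplication of functions. For $k\ge1$, $\mathcal{E}_k$ (resp. $\mathcal{E}_k^{\mathbb{C}}$) is the $\mathbb{Q}$-span (resp. $\mathbb{C}$-span, inside the holomorphic functions on $\mathbb{H}$) of all $G_{k_1,\dots,k_r}$ with $k_1,\dots,k_r\ge2$ and $k_1+\cdots+k_r=k$; $\mathcal{E}_0=\mathbb{Q}$, $\mathcal{E}_0^{\mathbb{C}}=\mathbb{C}$. $\mathcal{E}^{\mathbb{C}}=\sum_{k\ge0}\mathcal{E}_k^{\mathbb{C}}$ is the $\mathbb{C}$-span of $\mathcal{E}$ as a space of holomorphic functions. For $k_1,\dots,k_r\ge1$,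 $$g_{k_1,\dots,k_r}(\tau)=\frac{1}{(k_1-1)!\cdots(k_r-1)!}\sum_{\substack{c_1>\cdots>c_r>0\\ d_1,\dots,d_r>0}}d_1^{k_1-1}\cdots d_r^{k_r-1}q^{c_1d_1+\cdots+c_rd_r}.$$ $\mathsf{qMZV}=\mathbb{Q}+\operatorname{span}_{\mathbb{Q}}\{g_{k_1,\dots,k_r}\mid r\ge1,\ k_1,\dots,k_r\ge2\}$, which is a $\mathbb{Q}$-algebra. For $k\ge0$, $\operatorname{Fil}^W_k\mathsf{qMZV}$ is the $\mathbb{Q}$-span of $1$ and all $g_{k_1,\dots,k_r}$ with all $k_i\ge2$ and $k_1+\cdots+k_r\le k$; $\operatorname{Fil}^W_{-1}\mathsf{qMZV}=0$. This filtration is multiplicative ($\operatorname{Fil}^W_k\cdot\operatorname{Fil}^W_\ell\subset\operatorname{Fil}^W_{k+\ell}$). $\operatorname{gr}^W_k\mathsf{qMZV}=\operatorname{Fil}^W_k\mathsf{qMZV}/\operatorname{Fil}^W_{k-1}\mathsf{qMZV}$ and $\operatorname{gr}^W\mathsf{qMZV}=\bigoplus_{k\ge0}\operatorname{gr}^W_k\mathsf{qMZV}$ is the associated graded algebra. *)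

theory Defs
  imports
    "HOL-Analysis.Analysis"
    "HOL-Library.Function_Algebras"
    "HOL-Library.Set_Algebras"
    "HOL-Library.Poly_Mapping"
    "HOL-Algebra.Algebra"
    "HOL-Algebra.Algebraic_Closure_Type"
begin

typedef uhp = "{z :: complex. Im z > 0}"
  morphisms complex_of_uhp Abs_uhp
  by (rule exI[of _ "\<i>"]) simp

text \<open>
  Functions on the upper half-plane form a commutative ring under the pointwise operations of
  \<^theory>\<open>HOL-Library.Function_Algebras\<close>. All spans below are taken in this ring; as the
  generators are holomorphic, they agree with the spans inside the holomorphic functions.
\<close>

type_synonym hfun = "uhp \<Rightarrow> complex"

definition qscale :: "rat \<Rightarrow> hfun \<Rightarrow> hfun"
  where "qscale a f = (\<lambda>\<tau>. of_rat a * f \<tau>)"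

definition cscale :: "complex \<Rightarrow> hfun \<Rightarrow> hfun"
  where "cscale c f = (\<lambda>\<tau>. c * f \<tau>)"

lemma vector_space_qscale: "vector_space qscale"
  by unfold_locales (auto simp: qscale_def fun_eq_iff of_rat_add of_rat_mult algebra_simps)

lemma vector_space_cscale: "vector_space cscale"
  by unfold_locales (auto simp: cscale_def fun_eq_iff algebra_simps)

abbreviation qspan :: "hfun set \<Rightarrow> hfun set"
  where "qspan \<equiv> Modules.module.span qscale"

abbreviation cspan :: "hfun set \<Rightarrow> hfun set"
  where "cspan \<equiv> Modules.module.span cscale"


section \<open>Multiple Eisenstein series\<close>

text \<open>The pair \<open>(m, n)\<close> encodes the lattice point \<open>m \<tau> + n\<close>.\<close>

definition lattice_pt :: "uhp \<Rightarrow> int \<times> int \<Rightarrow> complex"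
  where "lattice_pt \<tau> p = of_int (fst p) * complex_of_uhp \<tau> + of_int (snd p)"

definition lattice_succ :: "int \<times> int \<Rightarrow> int \<times> int \<Rightarrow> bool"  (infix "\<succ>\<^sub>L" 50)
  where "p \<succ>\<^sub>L p' \<longleftrightarrow> fst p > fst p' \<or> (fst p = fst p' \<and> snd p > snd p')"

definition lattice_chains :: "nat \<Rightarrow> nat \<Rightarrow> nat \<Rightarrow> (int \<times> int) list set"
  where "lattice_chains M N r =
    {ps. length ps = r \<and> set ps \<subseteq> {m. \<bar>m\<bar> < int M} \<times> {n. \<bar>n\<bar> < int N} \<and>
         sorted_wrt (\<succ>\<^sub>L) (ps @ [(0, 0)])}"

lemma finite_lattice_chains: "finite (lattice_chains M N r)"
proof -
  have "{m :: int. \<bar>m\<bar> < int K} = {- int K<..<int K}" for K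
    by auto
  then have "finite ({m :: int. \<bar>m\<bar> < int M} \<times> {n :: int. \<bar>n\<bar> < int N})"
    by simp
  from finite_lists_length_eq[OF this, of r] show ?thesis
    by (rule finite_subset[rotated]) (auto simp: lattice_chains_def)
qed

definition mes :: "nat list \<Rightarrow> hfun"
  where "mes ks = (\<lambda>\<tau>. lim (\<lambda>M. lim (\<lambda>N.
    \<Sum>ps\<in>lattice_chains M N (length ks).
      1 / (\<Prod>i<length ks. lattice_pt \<tau> (ps ! i) ^ (ks ! i)))))"

lemma mes_Nil: "mes [] = 1"
proof -
  have "lattice_chains M N 0 = {[]}" for M N
    by (auto simp: lattice_chains_def)
  then show ?thesis
    by (simp add: mes_def fun_eq_iff)
qed

definition admissible :: "nat list \<Rightarrow> bool"
  where "admissible ks \<longleftrightarrow> ks \<noteq> [] \<and> (\<forall>k\<in>set ks. k \<ge> 2)"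

definition Eis :: "hfun set"
  where "Eis = qspan (insert 1 {mes ks | ks. admissible ks})"

definition Eis_wt :: "nat \<Rightarrow> hfun set"
  where "Eis_wt k =
    (if k = 0 then qspan {1} else qspan {mes ks | ks. admissible ks \<and> sum_list ks = k})"

definition Eis\<^sub>C :: "hfun set"
  where "Eis\<^sub>C = cspan Eis"

definition Eis_wt\<^sub>C :: "nat \<Rightarrow> hfun set"
  where "Eis_wt\<^sub>C k =
    (if k = 0 then cspan {1} else cspan {mes ks | ks. admissible ks \<and> sum_list ks = k})"


section \<open>\<open>q\<close>-analogues of multiple zeta values\<close>

definition qpar :: "uhp \<Rightarrow> complex"
  where "qpar \<tau> = exp (2 * of_real pi * \<i> * complex_of_uhp \<tau>)"

definition g_index :: "nat \<Rightarrow> (nat list \<times> nat list) set"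
  where "g_index r =
    {(cs, ds). length cs = r \<and> length ds = r \<and> sorted_wrt (>) (cs @ [0]) \<and> (\<forall>d\<in>set ds. d > 0)}"

definition g :: "nat list \<Rightarrow> hfun"
  where "g ks = (\<lambda>\<tau>. 1 / (\<Prod>i<length ks. fact (ks ! i - 1)) *
    (\<Sum>\<^sub>\<infinity>(cs, ds)\<in>g_index (length ks).
       (\<Prod>i<length ks. of_nat (ds ! i) ^ (ks ! i - 1)) *
       qpar \<tau> ^ (\<Sum>i<length ks. cs ! i * ds ! i)))"

text \<open>
  The weight filtration on the span of \<open>1\<close> and all \<open>g ks\<close> with \<open>ks\<close> admissible, which is the
  union of its steps; it is only used for indices \<open>k \<ge> -1\<close>.
\<close>

definition FilW :: "int \<Rightarrow> hfun set"
  where "FilW k =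
    (if k < 0 then {0} else qspan (insert 1 {g ks | ks. admissible ks \<and> int (sum_list ks) \<le> k}))"


section \<open>Direct sums, modules and algebras\<close>

text \<open>
  \<open>V\<close> is the internal direct sum of the \<open>W k\<close>: the summation map from the external direct sum
  of the \<open>W k\<close> to \<open>V\<close> is a bijection.
\<close>

definition internal_direct_sum :: "'v::comm_monoid_add set \<Rightarrow> (nat \<Rightarrow> 'v set) \<Rightarrow> bool"
  where "internal_direct_sum V W \<longleftrightarrow>
    bij_betw (\<lambda>x. \<Sum>k | x k \<noteq> 0. x k) {x. (\<forall>k. x k \<in> W k) \<and> finite {k. x k \<noteq> 0}} V"

definition graded_algebra :: "'v::comm_ring_1 set \<Rightarrow> (nat \<Rightarrow> 'v set) \<Rightarrow> bool"
  where "graded_algebra V W \<longleftrightarrow>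
    internal_direct_sum V W \<and> 1 \<in> W 0 \<and>
    (\<forall>k l. \<forall>f\<in>W k. \<forall>h\<in>W l. f * h \<in> W (k + l))"

text \<open>
  The record \<open>module\<close> is also used for plain modules; \<^const>\<open>Module.module\<close> does not
  look at the multiplicative fields.
\<close>

definition module_iso ::
  "'k ring \<Rightarrow> ('k, 'a) module \<Rightarrow> ('k, 'b) module \<Rightarrow> ('a \<Rightarrow> 'b) \<Rightarrow> bool"
  where "module_iso K A B \<phi> \<longleftrightarrow>
    Module.module K A \<and> Module.module K B \<and> bij_betw \<phi> (carrier A) (carrier B) \<and>
    (\<forall>x\<in>carrier A. \<forall>y\<in>carrier A. \<phi> (x \<oplus>\<^bsub>A\<^esub> y) = \<phi> x \<oplus>\<^bsub>B\<^esub> \<phi> y) \<and>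
    (\<forall>a\<in>carrier K. \<forall>x\<in>carrier A. \<phi> (a \<odot>\<^bsub>A\<^esub> x) = a \<odot>\<^bsub>B\<^esub> \<phi> x)"

definition algebra_iso ::
  "'k ring \<Rightarrow> ('k, 'a) module \<Rightarrow> ('k, 'b) module \<Rightarrow> ('a \<Rightarrow> 'b) \<Rightarrow> bool"
  where "algebra_iso K A B \<phi> \<longleftrightarrow>
    Module.algebra K A \<and> Module.algebra K B \<and> \<phi> \<in> ring_iso A B \<and> module_iso K A B \<phi>"

abbreviation rat_ring :: "rat ring"
  where "rat_ring \<equiv> ring_of_type_algebra"

abbreviation complex_ring :: "complex ring"
  where "complex_ring \<equiv> ring_of_type_algebra"

definition sub_algebra :: "('k \<Rightarrow> 'v \<Rightarrow> 'v) \<Rightarrow> 'v::comm_ring_1 set \<Rightarrow> ('k, 'v) module"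
  where "sub_algebra sc V =
    \<lparr>carrier = V, monoid.mult = (*), one = 1, ring.zero = 0, add = (+), smult = sc\<rparr>"


section \<open>The associated graded algebra of a filtration\<close>

text \<open>
  Elements of \<open>F k / F (k - 1)\<close> are cosets \<open>f +o F (k - 1)\<close>. Sums and products of sets are
  the elementwise ones of \<^theory>\<open>HOL-Library.Set_Algebras\<close>; adding \<open>F (n - 1)\<close> to such a
  product or scalar multiple of cosets turns it into a full coset.
\<close>

definition gr_piece ::
  "('k \<Rightarrow> 'v \<Rightarrow> 'v) \<Rightarrow> (int \<Rightarrow> 'v::comm_ring_1 set) \<Rightarrow> nat \<Rightarrow> ('k, 'v set) module"
  where "gr_piece sc F k =
    \<lparr>carrier = {f +o F (int k - 1) | f. f \<in> F (int k)},
     monoid.mult = undefined, one = undefined,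
     ring.zero = F (int k - 1),
     add = (+),
     smult = (\<lambda>a A. sc a ` A + F (int k - 1))\<rparr>"

text \<open>Elements of the direct sum are families of cosets, almost all of them zero.\<close>

definition gr_algebra ::
  "('k \<Rightarrow> 'v \<Rightarrow> 'v) \<Rightarrow> (int \<Rightarrow> 'v::comm_ring_1 set) \<Rightarrow> ('k, nat \<Rightarrow> 'v set) module"
  where "gr_algebra sc F =
    \<lparr>carrier = {x. (\<forall>k. x k \<in> carrier (gr_piece sc F k)) \<and>
                   finite {k. x k \<noteq> F (int k - 1)}},
     monoid.mult = (\<lambda>x y n. (\<Sum>i\<le>n. x i * y (n - i)) + F (int n - 1)),
     one = (\<lambda>k. F (int k - 1))(0 := 1 +o F (-1)),
     ring.zero = (\<lambda>k. F (int k - 1)),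
     add = (\<lambda>x y k. x k \<oplus>\<^bsub>gr_piece sc F k\<^esub> y k),
     smult = (\<lambda>a x k. a \<odot>\<^bsub>gr_piece sc F k\<^esub> x k)\<rparr>"

definition gr_incl :: "(int \<Rightarrow> 'v set) \<Rightarrow> nat \<Rightarrow> 'v set \<Rightarrow> nat \<Rightarrow> 'v set"
  where "gr_incl F k A = (\<lambda>j. F (int j - 1))(k := A)"


section \<open>Extension of scalars from the rationals to the complex numbers\<close>

text \<open>
  The tensor product of a rational subalgebra \<open>V\<close> with the complex numbers is the free abelian
  group on \<open>V \<times> UNIV\<close> modulo the usual relations (biadditive and balanced over the rationals).
\<close>

definition tensor_rel :: "hfun set \<Rightarrow> (hfun \<times> complex \<Rightarrow>\<^sub>0 int) set"
  where "tensor_rel V = Modules.module.span frag_cmul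
    ({frag_of (f + h, z) - frag_of (f, z) - frag_of (h, z) | f h z. f \<in> V \<and> h \<in> V} \<union>
     {frag_of (f, z + w) - frag_of (f, z) - frag_of (f, w) | f z w. f \<in> V} \<union>
     {frag_of (qscale a f, z) - frag_of (f, of_rat a * z) | a f z. f \<in> V})"

lemma module_frag_cmul: "Modules.module frag_cmul"
  by unfold_locales (auto simp: frag_cmul_distrib frag_cmul_distrib2)

definition pure_tensor :: "hfun set \<Rightarrow> hfun \<Rightarrow> complex \<Rightarrow> (hfun \<times> complex \<Rightarrow>\<^sub>0 int) set"
  where "pure_tensor V f z = frag_of (f, z) +o tensor_rel V"

definition tensor_scale ::
  "complex \<Rightarrow> (hfun \<times> complex \<Rightarrow>\<^sub>0 int) \<Rightarrow> (hfun \<times> complex \<Rightarrow>\<^sub>0 int)"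
  where "tensor_scale c = frag_extend (\<lambda>(f, z). frag_of (f, c * z))"

definition tensor_mult ::
  "(hfun \<times> complex \<Rightarrow>\<^sub>0 int) \<Rightarrow> (hfun \<times> complex \<Rightarrow>\<^sub>0 int) \<Rightarrow> (hfun \<times> complex \<Rightarrow>\<^sub>0 int)"
  where "tensor_mult p q =
    frag_extend (\<lambda>(f, z). frag_extend (\<lambda>(h, w). frag_of (f * h, z * w)) q) p"

definition tensor_algebra ::
  "hfun set \<Rightarrow> (complex, (hfun \<times> complex \<Rightarrow>\<^sub>0 int) set) module"
  where "tensor_algebra V =
    \<lparr>carrier = {p +o tensor_rel V | p. Poly_Mapping.keys p \<subseteq> V \<times> UNIV},
     monoid.mult = (\<lambda>A B. {tensor_mult p q | p q. p \<in> A \<and> q \<in> B} + tensor_rel V),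
     one = pure_tensor V 1 1,
     ring.zero = tensor_rel V,
     add = (+),
     smult = (\<lambda>c A. tensor_scale c ` A + tensor_rel V)\<rparr>"

end

theory Submission
  imports Defs "HOL-Complex_Analysis.Complex_Analysis" "HOL-Real_Asymp.Real_Asymp"
begin

text \<open>
  Summing over the second coordinates first turns \<open>G_k\<close> into a chain sum of multitangent functions
  at the points \<open>m \<tau>\<close>. By Liouville's theorem these are polynomials in \<open>1 / (1 - q\<^sup>m)\<close>, so
  \<open>G_k = (-2\<pi>\<i>)\<^sup>w g_k\<close> up to terms \<open>g_l\<close> of weight less than \<open>w = |k|\<close>.
  The grading over the complex numbers comes from the asymptotics along
  \<open>\<tau>\<^sub>d = 1/d + \<i> y/d\<^sup>2\<close>: writing \<open>m = j d + n\<close> with \<open>|n| < d/2\<close>, one has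
  \<open>m \<tau>\<^sub>d = j + (n + (j + n/d) \<i> y) / d\<close>, so that the \<open>q\<close>-series at \<open>\<tau>\<^sub>d\<close> becomes a Riemann sum over
  lattice points and \<open>d\<^sup>-\<^sup>w f(\<tau>\<^sub>d) \<longlonglongrightarrow> f(\<i> y)\<close> for every \<open>f\<close> of weight \<open>w\<close>.
  Hence in a linear relation the component of top weight vanishes on the imaginary axis, and so identically.
  The rational statements follow by applying rational functionals to the coefficients of the
  \<open>q\<close>-expansions, which are rational for \<open>g_k\<close>.
\<close>

subsection \<open>Sums over chains and the stuffle product\<close>

text \<open>The path \<open>\<tau>_d\<close> is suggested by modularity:
  \<open>-1/\<tau>_d + d\<close> tends to \<open>\<i> y\<close> and \<open>d \<tau>_d\<close> tends
  to 1, so a modular form f of weight w satisfies f(\<open>\<tau>_d\<close>) ~ d^w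
  f(\<open>\<i> y\<close>). Multiple Eisenstein series are not modular in general, yet they keep
  this leading behaviour. The obstacle is convergence. Lattice sums are two-dimensional, so an entry
  2 lies exactly on the border of absolute convergence. For the points after the first one a small
  power of the row index repairs this. The first point has to pay for these powers and therefore
  needs exponent 3. For remainders of lower weight a surplus factor 1/d supplies the missing
  exponent; a leading entry 2 in top weight has to be treated separately. The factor (-2 pi i)^w
  between G and g depends on the weight alone. Inside one weight it can be divided out, so that
  rational relations between the G correspond to rational relations between the g modulo lower
  weight; this is why the grading comes first and the rational statements after it.\<close>

fun chain_sum :: "('k \<Rightarrow> 'x \<Rightarrow> 'a::comm_semiring_1) \<Rightarrow> 'x list \<Rightarrow> 'k list \<Rightarrow> 'a" where
  "chain_sum F xs [] = 1"
| "chain_sum F [] (k # ks) = 0"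
| "chain_sum F (x # xs) (k # ks) = chain_sum F xs (k # ks) + F k x * chain_sum F xs ks"

lemma chain_sum_map: "chain_sum F (map h xs) ks = chain_sum (\<lambda>k x. F k (h x)) xs ks"
  by (induction "\<lambda>k x. F k (h x)" xs ks rule: chain_sum.induct) auto

lemma chain_sum_cong:
  "(\<And>k x. k \<in> set ks \<Longrightarrow> x \<in> set xs \<Longrightarrow> F k x = G k x) \<Longrightarrow> chain_sum F xs ks = chain_sum G xs ks"
  by (induction F xs ks rule: chain_sum.induct) auto

text \<open>The lists are read from the largest point to the smallest, so a chain in
  \<open>xs @ ys\<close> meets \<open>xs\<close> in an initial segment; \<open>i\<close> is the
  length of that segment. This cuts a row into halves and the lattice into rows.\<close>

lemma chain_sum_append:
  "chain_sum F (xs @ ys) ks =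
     (\<Sum>i\<le>length ks. chain_sum F xs (take i ks) * chain_sum F ys (drop i ks))"
proof (induction F xs ks rule: chain_sum.induct)
  case (2 F k ks)
  have "(\<Sum>i\<le>length (k # ks). chain_sum F [] (take i (k # ks)) * chain_sum F ys (drop i (k # ks)))
      = (\<Sum>i\<in>{0::nat}. chain_sum F [] (take i (k # ks)) * chain_sum F ys (drop i (k # ks)))"
    by (rule sum.mono_neutral_right) (auto simp: take_Cons split: nat.splits)
  then show ?case by simp
next
  case (3 F x xs k ks)
  have "chain_sum F ((x # xs) @ ys) (k # ks) = 
     chain_sum F (xs @ ys) (k # ks) + F k x * chain_sum F (xs @ ys) ks" by simp
  also have "\<dots> = (\<Sum>i\<le>length (k # ks). chain_sum F xs (take i (k # ks)) * chain_sum F ys (drop i (k # ks)))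
     + F k x * (\<Sum>i\<le>length ks. chain_sum F xs (take i ks) * chain_sum F ys (drop i ks))"
    unfolding 3 ..
  also have "\<dots> = chain_sum F ys (k # ks) + (\<Sum>i\<le>length ks. chain_sum F (x # xs) (take (Suc i) (k # ks)) * chain_sum F ys (drop (Suc i) (k # ks)))"
    by (simp add: sum.atMost_Suc_shift sum_distrib_left algebra_simps sum.distrib del: sum.atMost_Suc)
  also have "\<dots> = (\<Sum>i\<le>length (k # ks). chain_sum F (x # xs) (take i (k # ks)) * chain_sum F ys (drop i (k # ks)))"
    by (simp add: sum.atMost_Suc_shift del: sum.atMost_Suc)
  finally show ?case .
qed simp

lemma chain_sum_single:
  "chain_sum F [x] ks = (case ks of [] \<Rightarrow> 1 | [k] \<Rightarrow> F k x | _ \<Rightarrow> 0)"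
  by (auto split: list.splits)

lemma chain_sum_snoc:
  "chain_sum F (xs @ [x]) (ks @ [k]) = chain_sum F xs (ks @ [k]) + F k x * chain_sum F xs ks"
proof -
  have "chain_sum F (xs @ [x]) (ks @ [k]) =
    (\<Sum>i\<in>{length ks, Suc (length ks)}. chain_sum F xs (take i (ks @ [k])) * chain_sum F [x] (drop i (ks @ [k])))"
    unfolding chain_sum_append
  proof (rule sum.mono_neutral_right, goal_cases)
    case 3
    show ?case
    proof
      fix i assume i: "i \<in> {..length (ks @ [k])} - {length ks, Suc (length ks)}"
      then have "length (drop i (ks @ [k])) \<ge> 2" by auto
      then show "chain_sum F xs (take i (ks @ [k])) * chain_sum F [x] (drop i (ks @ [k])) = 0"
        unfolding chain_sum_single by (auto split: list.splits)
    qed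
  qed auto
  then show ?thesis by (simp add: algebra_simps)
qed

text \<open>Needed for the negative half of a row, which a decreasing enumeration lists from the
  point nearest to 0 outwards, whereas limits are taken with the outermost point first.\<close>

lemma chain_sum_rev: "chain_sum F (rev xs) (rev ks) = chain_sum F xs ks"
proof (induction F xs ks rule: chain_sum.induct)
  case (2 F k ks)
  then show ?case by (cases "rev ks @ [k]") auto
qed (simp_all add: chain_sum_snoc)

lemma norm_chain_sum_le:
  fixes F :: "'k \<Rightarrow> 'x \<Rightarrow> 'a::real_normed_field"
  shows "norm (chain_sum F xs ks) \<le> chain_sum (\<lambda>k x. norm (F k x)) xs ks"
proof (induction F xs ks rule: chain_sum.induct)
  case (3 F x xs k ks)
  have "norm (chain_sum F (x # xs) (k # ks)) \<le> norm (chain_sum F xs (k # ks)) + norm (F k x) * norm (chain_sum F xs ks)"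
    by (simp add: norm_triangle_le norm_mult)
  also have "\<dots> \<le> chain_sum (\<lambda>k x. norm (F k x)) (x # xs) (k # ks)"
    using 3 by (auto intro!: add_mono mult_left_mono)
  finally show ?case .
qed auto

lemma chain_sum_nonneg:
  fixes F :: "'k \<Rightarrow> 'x \<Rightarrow> 'a::linordered_idom"
  assumes "\<And>k x. k \<in> set ks \<Longrightarrow> x \<in> set xs \<Longrightarrow> F k x \<ge> 0"
  shows "chain_sum F xs ks \<ge> 0"
  using assms by (induction F xs ks rule: chain_sum.induct) auto

text \<open>Giving up the order condition on chains only adds nonnegative terms, and the
  unrestricted sum factors.\<close>

lemma chain_sum_le_prod:
  fixes F :: "'k \<Rightarrow> 'x \<Rightarrow> 'a::linordered_idom"
  assumes "\<And>k x. k \<in> set ks \<Longrightarrow> x \<in> set xs \<Longrightarrow> F k x \<ge> 0"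
  shows "chain_sum F xs ks \<le> (\<Prod>k\<leftarrow>ks. \<Sum>x\<leftarrow>xs. F k x)"
  using assms
proof (induction F xs ks rule: chain_sum.induct)
  case (3 F x xs k ks)
  have nn: "(\<Prod>k\<leftarrow>ks. \<Sum>x\<leftarrow>xs. F k x) \<ge> 0" "(\<Prod>k\<leftarrow>ks. \<Sum>x\<leftarrow>xs. F k x) \<le> (\<Prod>k\<leftarrow>ks. \<Sum>x\<leftarrow>x#xs. F k x)"
    "(\<Sum>x\<leftarrow>xs. F k x) \<ge> 0" "F k x \<ge> 0"
  proof -
    show "(\<Prod>k\<leftarrow>ks. \<Sum>x\<leftarrow>xs. F k x) \<ge> 0"
      using 3(3) by (intro prod_list_nonneg) (auto intro!: sum_list_nonneg)
    have nonneg: "(\<Sum>x\<leftarrow>xs. F l x) \<ge> 0" "F l x \<ge> 0" if "l \<in> set ks" for l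
      using 3(3) that by (auto intro!: sum_list_nonneg)
    have "set ks' \<subseteq> set ks \<Longrightarrow> (\<Prod>k\<leftarrow>ks'. \<Sum>x\<leftarrow>xs. F k x) \<le> (\<Prod>k\<leftarrow>ks'. \<Sum>x\<leftarrow>x#xs. F k x)" for ks'
    proof (induction ks')
      case (Cons l ks')
      have "(\<Sum>x\<leftarrow>xs. F l x) * (\<Prod>k\<leftarrow>ks'. \<Sum>x\<leftarrow>xs. F k x) \<le> (\<Sum>x\<leftarrow>x#xs. F l x) * (\<Prod>k\<leftarrow>ks'. \<Sum>x\<leftarrow>x#xs. F k x)"
        using Cons nonneg by (intro mult_mono prod_list_nonneg) auto
      then show ?case by simp
    qed simp
    from this[of ks] show "(\<Prod>k\<leftarrow>ks. \<Sum>x\<leftarrow>xs. F k x) \<le> (\<Prod>k\<leftarrow>ks. \<Sum>x\<leftarrow>x#xs. F k x)" by simp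
    show "(\<Sum>x\<leftarrow>xs. F k x) \<ge> 0" "F k x \<ge> 0"
      using 3(3) by (auto intro!: sum_list_nonneg)
  qed
  have "chain_sum F (x # xs) (k # ks) = chain_sum F xs (k # ks) + F k x * chain_sum F xs ks" by simp
  also have "\<dots> \<le> (\<Sum>x\<leftarrow>xs. F k x) * (\<Prod>k\<leftarrow>ks. \<Sum>x\<leftarrow>xs. F k x) + F k x * (\<Prod>k\<leftarrow>ks. \<Sum>x\<leftarrow>xs. F k x)"
    using 3 by (intro add_mono mult_left_mono) auto
  also have "\<dots> = (\<Sum>x\<leftarrow>x#xs. F k x) * (\<Prod>k\<leftarrow>ks. \<Sum>x\<leftarrow>xs. F k x)" by (simp add: algebra_simps)
  also have "\<dots> \<le> (\<Sum>x\<leftarrow>x#xs. F k x) * (\<Prod>k\<leftarrow>ks. \<Sum>x\<leftarrow>x#xs. F k x)"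
    using nn by (intro mult_left_mono) auto
  finally show ?case by simp
qed (auto intro!: mult_nonneg_nonneg sum_list_nonneg prod_list_nonneg)

text \<open>Bridge between the set of chains in the definition of \<open>mes\<close> and the
  recursive form, in which all later arguments are carried out.\<close>

lemma sum_chains_eq_chain_sum:
  fixes F :: "'k \<Rightarrow> 'x \<Rightarrow> 'a::comm_semiring_1"
  assumes "sorted_wrt R xs" "\<And>x. \<not> R x x" "\<And>x y. R x y \<Longrightarrow> \<not> R y x"
  shows "(\<Sum>ps | length ps = length ks \<and> set ps \<subseteq> set xs \<and> sorted_wrt R ps. \<Prod>i<length ks. F (ks ! i) (ps ! i))
     = chain_sum F xs ks"
  using assms
proof (induction F xs ks rule: chain_sum.induct)
  case (1 F xs)
  have "{ps. length ps = length ([] :: 'k list) \<and> set ps \<subseteq> set xs \<and> sorted_wrt R ps} = {[]}" by auto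
  then show ?case by simp
next
  case (2 F k ks)
  have "{ps. length ps = length (k # ks) \<and> set ps \<subseteq> set ([] :: 'x list) \<and> sorted_wrt R ps} = {}" by auto
  then show ?case by (simp only: sum.empty chain_sum.simps)
next
  case (3 F x xs k ks)
  let ?C = "\<lambda>xs ks. {ps. length ps = length ks \<and> set ps \<subseteq> set xs \<and> sorted_wrt R ps}"
  have fin: "finite (?C ys ls)" for ys and ls :: "'k list"
    by (rule finite_subset[OF _ finite_lists_length_eq[of "set ys" "length ls"]]) auto
  have xR: "\<forall>y\<in>set xs. R x y" "x \<notin> set xs" using 3(3,4) by auto
  have eq: "?C (x # xs) (k # ks) = ?C xs (k # ks) \<union> Cons x ` ?C xs ks"
  proof (intro equalityI subsetI)
    fix ps assume ps: "ps \<in> ?C (x # xs) (k # ks)"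
    then obtain p qs where pq: "ps = p # qs" by (cases ps) auto
    have qs: "set qs \<subseteq> set xs"
    proof
      fix y assume y: "y \<in> set qs"
      then have "R p y" "p \<in> set (x # xs)" "y \<in> set (x # xs)" using ps pq by auto
      then show "y \<in> set xs" using xR 3(4,5) by auto
    qed
    show "ps \<in> ?C xs (k # ks) \<union> Cons x ` ?C xs ks"
    proof (cases "p = x")
      case True
      then show ?thesis using qs ps pq by auto
    next
      case False
      then show ?thesis using qs ps pq by auto
    qed
  qed (use xR in \<open>auto simp: subset_iff\<close>)
  have disj: "?C xs (k # ks) \<inter> Cons x ` ?C xs ks = {}" using xR by auto
  have "(\<Sum>ps\<in>?C (x # xs) (k # ks). \<Prod>i<length (k # ks). F ((k # ks) ! i) (ps ! i)) =
     (\<Sum>ps\<in>?C xs (k # ks). \<Prod>i<length (k # ks). F ((k # ks) ! i) (ps ! i)) +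
     (\<Sum>ps\<in>Cons x ` ?C xs ks. \<Prod>i<length (k # ks). F ((k # ks) ! i) (ps ! i))"
    unfolding eq by (rule sum.union_disjoint[OF fin finite_imageI[OF fin] disj])
  also have "(\<Sum>ps\<in>?C xs (k # ks). \<Prod>i<length (k # ks). F ((k # ks) ! i) (ps ! i)) = chain_sum F xs (k # ks)"
    using 3 by simp
  also have "(\<Sum>ps\<in>Cons x ` ?C xs ks. \<Prod>i<length (k # ks). F ((k # ks) ! i) (ps ! i)) =
     (\<Sum>ps\<in>?C xs ks. F k x * (\<Prod>i<length ks. F (ks ! i) (ps ! i)))"
    by (subst sum.reindex) (auto simp: prod.lessThan_Suc_shift simp del: prod.lessThan_Suc)
  also have "\<dots> = F k x * chain_sum F xs ks"
    using 3 by (simp add: sum_distrib_left[symmetric])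
  finally show ?case by simp
qed

fun stuffle :: "'k::plus list \<Rightarrow> 'k list \<Rightarrow> 'k list list" where
  "stuffle [] v = [v]"
| "stuffle u [] = [u]"
| "stuffle (a # u) (b # v) =
     map ((#) a) (stuffle u (b # v)) @ map ((#) b) (stuffle (a # u) v) @ map ((#) (a + b)) (stuffle u v)"

lemma stuffle_Nil2 [simp]: "stuffle u [] = [u]"
  by (cases u) auto

text \<open>The largest point \<open>x\<close> is the first point of neither chain, of one of them,
  or of both. In the last case the two factors merge because \<open>F\<close> turns addition of
  exponents into multiplication, as 1/x^k does.\<close>

lemma chain_sum_stuffle:
  assumes "\<And>k l x. F (k + l) x = F k x * F l x"
  shows "chain_sum F xs u * chain_sum F xs v = (\<Sum>w\<leftarrow>stuffle u v. chain_sum F xs w)"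
proof (induction xs arbitrary: u v)
  case Nil
  have "[] \<notin> set (stuffle u v)" if "u \<noteq> []" "v \<noteq> []" using that 
    by (induction u v rule: stuffle.induct) auto
  moreover have "(\<Sum>w\<leftarrow>W. chain_sum F [] w) = 0" if "[] \<notin> set W" for W
  proof -
    have "chain_sum F [] w = 0" if "w \<noteq> []" for w
      using that by (cases w) auto
    with that show ?thesis by (induction W) auto
  qed
  ultimately have "(\<Sum>w\<leftarrow>stuffle u v. chain_sum F [] w) = 0" if "u \<noteq> []" "v \<noteq> []"
    using that by blast
  then show ?case by (cases u; cases v) (simp_all del: stuffle.simps(3))
next
  case (Cons x xs)
  have cons: "(\<Sum>w\<leftarrow>map ((#) a) W. chain_sum F (x # xs) w) =
     (\<Sum>w\<leftarrow>map ((#) a) W. chain_sum F xs w) + F a x * (\<Sum>w\<leftarrow>W. chain_sum F xs w)" for a W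
    by (induction W) (auto simp: algebra_simps)
  show ?case
  proof (cases u; cases v)
    fix a u' b v' assume uv: "u = a # u'" "v = b # v'"
    have "chain_sum F (x # xs) u * chain_sum F (x # xs) v =
       chain_sum F xs u * chain_sum F xs v
       + F a x * (chain_sum F xs u' * chain_sum F xs v)
       + F b x * (chain_sum F xs u * chain_sum F xs v')
       + F (a + b) x * (chain_sum F xs u' * chain_sum F xs v')"
      by (simp add: uv assms algebra_simps)
    also have "\<dots> = (\<Sum>w\<leftarrow>stuffle u v. chain_sum F (x # xs) w)"
      unfolding Cons.IH unfolding uv stuffle.simps map_append sum_list_append cons
      by (simp add: algebra_simps)
    finally show ?thesis .
  qed auto
qed

lemma sum_list_stuffle: "w \<in> set (stuffle u v) \<Longrightarrow> sum_list w = sum_list u + sum_list (v :: 'k::comm_monoid_add list)"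
  by (induction u v arbitrary: w rule: stuffle.induct) (auto simp: algebra_simps)

lemma stuffle_ge: "w \<in> set (stuffle u v) \<Longrightarrow> \<forall>k\<in>set u. k \<ge> c \<Longrightarrow> \<forall>k\<in>set v. k \<ge> c \<Longrightarrow> \<forall>k\<in>set w. k \<ge> (c::nat)"
  by (induction u v arbitrary: w rule: stuffle.induct) fastforce+

lemma prod_list_mono:
  fixes f g :: "'a \<Rightarrow> real"
  assumes "\<And>x. x \<in> set xs \<Longrightarrow> 0 \<le> f x \<and> f x \<le> g x"
  shows "(\<Prod>x\<leftarrow>xs. f x) \<le> (\<Prod>x\<leftarrow>xs. g x)"
  using assms
proof (induction xs)
  case (Cons x xs)
  have "0 \<le> g x" and "0 \<le> (\<Prod>x\<leftarrow>xs. f x)" and "(\<Prod>x\<leftarrow>xs. f x) \<le> (\<Prod>x\<leftarrow>xs. g x)" and "0 \<le> f x" and "f x \<le> g x"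
    subgoal using Cons.prems[of x] by (auto intro: order.trans)
    subgoal by (rule prod_list_nonneg) (use Cons.prems in auto)
    subgoal by (rule Cons.IH) (use Cons.prems in auto)
    subgoal using Cons.prems[of x] by simp
    subgoal using Cons.prems[of x] by simp
    done
  then show ?case by (auto intro!: mult_mono)
qed simp

lemma sum_list_rev_upt: "(\<Sum>x\<leftarrow>rev [0..<M]. f x) = (\<Sum>m<M. (f m :: 'a::comm_monoid_add))"
  by (induction M) (auto simp: algebra_simps)

lemma norm_chain_sum_le_prod_suminf:
  fixes F :: "'k \<Rightarrow> nat \<Rightarrow> 'a::real_normed_field"
  assumes "\<And>k m. k \<in> set ks \<Longrightarrow> norm (F k m) \<le> B k m" "\<And>k. k \<in> set ks \<Longrightarrow> summable (B k)"
  shows "norm (chain_sum F (rev [0..<M]) ks) \<le> (\<Prod>k\<leftarrow>ks. suminf (B k))"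
proof -
  have "norm (chain_sum F (rev [0..<M]) ks) \<le> chain_sum (\<lambda>k x. norm (F k x)) (rev [0..<M]) ks"
    by (rule norm_chain_sum_le)
  also have "\<dots> \<le> (\<Prod>k\<leftarrow>ks. \<Sum>x\<leftarrow>rev [0..<M]. norm (F k x))"
    by (rule chain_sum_le_prod) auto
  also have "\<dots> \<le> (\<Prod>k\<leftarrow>ks. suminf (B k))"
  proof (rule prod_list_mono)
    fix k assume k: "k \<in> set ks"
    have "(\<Sum>m<M. norm (F k m)) \<le> (\<Sum>m<M. B k m)" using assms(1) k by (intro sum_mono) auto
    also have "\<dots> \<le> suminf (B k)"
      using assms k by (intro sum_le_suminf) (auto intro: order.trans[OF norm_ge_zero])
    finally show "0 \<le> (\<Sum>x\<leftarrow>rev [0..<M]. norm (F k x)) \<and> (\<Sum>x\<leftarrow>rev [0..<M]. norm (F k x)) \<le> suminf (B k)"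
      unfolding sum_list_rev_upt by (simp add: sum_nonneg)
  qed
  finally show ?thesis .
qed

lemma chain_sum_rev_upt_Cons:
  "chain_sum F (rev [0..<M]) (k # ks) = (\<Sum>m<M. F k m * chain_sum F (rev [0..<m]) ks)"
  by (induction M) (auto simp: algebra_simps)

text \<open>Expanding by the first point leaves one infinite sum; the inner truncated sums are
  bounded independently of the truncation by \<open>norm_chain_sum_le_prod_suminf\<close>, so the
  Weierstrass test in the outer variable suffices.\<close>

lemma uniform_limit_chain_sum:
  fixes F :: "'p \<Rightarrow> 'k \<Rightarrow> nat \<Rightarrow> 'a::{real_normed_field,banach}"
  assumes "\<And>x k m. x \<in> K \<Longrightarrow> k \<in> set ks \<Longrightarrow> norm (F x k m) \<le> B k m"
    and "\<And>k. k \<in> set ks \<Longrightarrow> summable (B k)"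
  shows "uniform_limit K (\<lambda>M x. chain_sum (F x) (rev [0..<M]) ks)
     (\<lambda>x. lim (\<lambda>M. chain_sum (F x) (rev [0..<M]) ks)) sequentially"
proof (cases ks)
  case (Cons k ls)
  have "uniform_limit K (\<lambda>M x. \<Sum>m<M. F x k m * chain_sum (F x) (rev [0..<m]) ls)
     (\<lambda>x. suminf (\<lambda>m. F x k m * chain_sum (F x) (rev [0..<m]) ls)) sequentially"
  proof (rule Weierstrass_m_test)
    fix m x assume x: "x \<in> K"
    have "norm (F x k m) \<le> B k m" using assms(1)[of x k m] x Cons by simp
    moreover have "norm (chain_sum (F x) (rev [0..<m]) ls) \<le> (\<Prod>k\<leftarrow>ls. suminf (B k))"
      by (rule norm_chain_sum_le_prod_suminf) (use assms x Cons in auto)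
    ultimately show "norm (F x k m * chain_sum (F x) (rev [0..<m]) ls) \<le> B k m * (\<Prod>k\<leftarrow>ls. suminf (B k))"
      unfolding norm_mult by (intro mult_mono) (auto intro: order.trans[OF norm_ge_zero])
  next
    show "summable (\<lambda>m. B k m * (\<Prod>k\<leftarrow>ls. suminf (B k)))"
      using assms Cons by (intro summable_mult2) auto
  qed
  then have ul: "uniform_limit K (\<lambda>M x. chain_sum (F x) (rev [0..<M]) ks)
     (\<lambda>x. suminf (\<lambda>m. F x k m * chain_sum (F x) (rev [0..<m]) ls)) sequentially"
    unfolding Cons chain_sum_rev_upt_Cons .
  moreover have "suminf (\<lambda>m. F x k m * chain_sum (F x) (rev [0..<m]) ls) = lim (\<lambda>M. chain_sum (F x) (rev [0..<M]) ks)"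
    if "x \<in> K" for x
    using tendsto_uniform_limitI[OF ul that] by (rule limI[symmetric])
  ultimately show ?thesis
    using uniform_limit_cong'[of K "\<lambda>M x. chain_sum (F x) (rev [0..<M]) ks" "\<lambda>M x. chain_sum (F x) (rev [0..<M]) ks"
      "\<lambda>x. suminf (\<lambda>m. F x k m * chain_sum (F x) (rev [0..<m]) ls)"
      "\<lambda>x. lim (\<lambda>M. chain_sum (F x) (rev [0..<M]) ks)" sequentially] by auto
qed (simp add: uniform_limit_const)

lemma tendsto_chain_sum:
  fixes F :: "'k \<Rightarrow> nat \<Rightarrow> 'a::{real_normed_field,banach}"
  assumes "\<And>k. k \<in> set ks \<Longrightarrow> summable (\<lambda>m. norm (F k m))"
  shows "(\<lambda>M. chain_sum F (rev [0..<M]) ks) \<longlonglongrightarrow> lim (\<lambda>M. chain_sum F (rev [0..<M]) ks)"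
proof -
  have "uniform_limit {0::nat} (\<lambda>M x. chain_sum F (rev [0..<M]) ks)
    (\<lambda>x. lim (\<lambda>M. chain_sum F (rev [0..<M]) ks)) sequentially"
    by (rule uniform_limit_chain_sum[of "{0::nat}" ks "\<lambda>_. F" "\<lambda>k m. norm (F k m)"])
      (rule order.refl, erule assms)
  from tendsto_uniform_limitI[OF this] show ?thesis by simp
qed

lemma norm_lim_chain_sum_le:
  fixes F :: "'k \<Rightarrow> nat \<Rightarrow> 'a::{real_normed_field,banach}"
  assumes "\<And>k m. k \<in> set ks \<Longrightarrow> norm (F k m) \<le> B k m" "\<And>k. k \<in> set ks \<Longrightarrow> summable (B k)"
  shows "norm (lim (\<lambda>M. chain_sum F (rev [0..<M]) ks)) \<le> (\<Prod>k\<leftarrow>ks. suminf (B k))"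
proof (rule LIMSEQ_le_const2)
  have "summable (\<lambda>m. norm (F k m))" if "k \<in> set ks" for k
    by (rule summable_comparison_test'[of "B k" 0]) (use assms that in simp_all)
  then show "(\<lambda>M. norm (chain_sum F (rev [0..<M]) ks)) \<longlonglongrightarrow> norm (lim (\<lambda>M. chain_sum F (rev [0..<M]) ks))"
    by (intro tendsto_norm tendsto_chain_sum)
  show "\<exists>N. \<forall>M\<ge>N. norm (chain_sum F (rev [0..<M]) ks) \<le> (\<Prod>k\<leftarrow>ks. suminf (B k))"
    using norm_chain_sum_le_prod_suminf[of ks F B] assms by blast
qed

section \<open>One-sided sums over a row of the lattice\<close>

lemma power_inverse_le:
  fixes x :: complex and n :: int
  assumes "norm x \<le> R" "norm (x + of_int n) \<ge> \<delta>" "\<delta> > 0" "k \<ge> 2"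
  shows "norm (1 / (x + of_int n) ^ k) \<le> (2 + (2 * R\<^sup>2 + 1) / \<delta>\<^sup>2) * (1 / \<delta>) ^ (k - 2) / (1 + (of_int n)\<^sup>2)"
proof -
  define a where "a = norm (x + of_int n)"
  have a: "a \<ge> \<delta>" "a > 0" using assms by (auto simp: a_def)
  have "norm (of_int n :: complex) \<le> norm (x + of_int n) + norm x"
    using norm_triangle_ineq4[of "x + of_int n" x] by simp
  then have "\<bar>of_int n\<bar> \<le> a + R" using assms by (simp add: a_def)
  then have "(of_int n)\<^sup>2 \<le> (a + R)\<^sup>2"
    by (metis abs_ge_zero power2_abs power_mono)
  also have "(a + R)\<^sup>2 \<le> 2 * a\<^sup>2 + 2 * R\<^sup>2"
    using zero_le_power2[of "a - R"] by (simp add: power2_eq_square algebra_simps)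
  finally have n2: "1 + (of_int n)\<^sup>2 \<le> 2 * a\<^sup>2 + (2 * R\<^sup>2 + 1)" by simp
  have "(2 * R\<^sup>2 + 1) * \<delta>\<^sup>2 \<le> (2 * R\<^sup>2 + 1) * a\<^sup>2"
    using a assms by (intro mult_left_mono power_mono) auto
  then have "2 * R\<^sup>2 + 1 \<le> (2 * R\<^sup>2 + 1) / \<delta>\<^sup>2 * a\<^sup>2"
    using \<open>\<delta> > 0\<close> by (simp add: pos_le_divide_eq)
  with n2 have main: "1 + (of_int n)\<^sup>2 \<le> (2 + (2 * R\<^sup>2 + 1) / \<delta>\<^sup>2) * a\<^sup>2"
    unfolding distrib_right by linarith
  have pos: "1 + (of_int n)\<^sup>2 > (0::real)" by (simp add: add_pos_nonneg)
  have "1 / a\<^sup>2 \<le> (2 + (2 * R\<^sup>2 + 1) / \<delta>\<^sup>2) / (1 + (of_int n)\<^sup>2)"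
    using main a pos by (simp add: pos_divide_le_eq pos_le_divide_eq mult.commute)
  moreover have "(1 / a) ^ (k - 2) \<le> (1 / \<delta>) ^ (k - 2)"
    using a assms by (intro power_mono divide_left_mono) auto
  ultimately have "(1 / a\<^sup>2) * (1 / a) ^ (k - 2) \<le> ((2 + (2 * R\<^sup>2 + 1) / \<delta>\<^sup>2) / (1 + (of_int n)\<^sup>2)) * (1 / \<delta>) ^ (k - 2)"
    using a pos assms by (intro mult_mono) (simp_all add: add_nonneg_nonneg)
  moreover have "(1 / a\<^sup>2) * (1 / a) ^ (k - 2) = (1 / a) ^ k"
    using assms(4) by (metis le_add_diff_inverse power_add power_one_over)
  moreover have "norm (1 / (x + of_int n) ^ k) = (1 / a) ^ k"
    by (simp add: a_def norm_divide norm_power power_one_over)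
  ultimately show ?thesis
    by (simp only: times_divide_eq_left times_divide_eq_right mult.commute)
qed

lemma summable_inverse_one_plus_square: "summable (\<lambda>m::nat. c / (1 + (of_nat m + 1)\<^sup>2) :: real)"
proof (rule summable_comparison_test'[of "\<lambda>m. \<bar>c\<bar> * (1 / of_nat (Suc m) ^ 2)" 0])
  show "summable (\<lambda>m. \<bar>c\<bar> * (1 / real (Suc m) ^ 2))"
  proof (rule summable_mult)
    have "summable (\<lambda>m. inverse (real m ^ 2))" by (rule inverse_power_summable) simp
    then show "summable (\<lambda>m. 1 / real (Suc m) ^ 2)"
      using summable_Suc_iff[of "\<lambda>m. inverse (real m ^ 2)"] by (simp only: inverse_eq_divide)
  qed
  fix m :: nat
  have "\<bar>c\<bar> * inverse (1 + (of_nat m + 1)\<^sup>2) \<le> \<bar>c\<bar> * inverse (real (Suc m) ^ 2)"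
    by (intro mult_left_mono le_imp_inverse_le) (auto simp: algebra_simps)
  then show "norm (c / (1 + (of_nat m + 1)\<^sup>2) :: real) \<le> \<bar>c\<bar> * (1 / real (Suc m) ^ 2)"
    by (simp add: field_simps)
qed

text \<open>The part of a row on the side \<open>s = 1\<close> or \<open>s = -1\<close> of the
  origin, listed from the far end. For \<open>s = -1\<close> this is opposite to the order of the
  row, which explains the reversed words in \<open>multitangent\<close>.\<close>

definition half_tangent :: "int \<Rightarrow> nat list \<Rightarrow> complex \<Rightarrow> complex" where
  "half_tangent s ks x = lim (\<lambda>M. chain_sum (\<lambda>k m. 1 / (x + of_int (s * (int m + 1))) ^ k) (rev [0..<M]) ks)"

text \<open>Kept explicit in \<open>R\<close> and \<open>\<delta>\<close>: in the strip estimate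
  both grow with the imaginary part, and the bound has to stay finite there.\<close>

definition half_bound :: "real \<Rightarrow> real \<Rightarrow> nat list \<Rightarrow> real" where
  "half_bound R \<delta> ks = (\<Prod>k\<leftarrow>ks. suminf (\<lambda>m. (2 + (2 * R\<^sup>2 + 1) / \<delta>\<^sup>2) * (1 / \<delta>) ^ (k - 2) / (1 + (of_nat m + 1)\<^sup>2)))"

lemma away_from_Ints:
  fixes x :: complex
  assumes "x \<notin> \<int>"
  obtains \<delta> where "\<delta> > 0" "cball x \<delta> \<subseteq> -\<int>" "\<And>y n. y \<in> cball x \<delta> \<Longrightarrow> norm (y + of_int n) \<ge> \<delta>"
proof -
  have "closed (\<int> :: complex set)" by (rule closed_Ints)
  then have "open (-\<int> :: complex set)" by (simp add: open_Compl)
  then obtain e where e: "e > 0" "cball x e \<subseteq> -\<int>" using assms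
    by (meson ComplI open_contains_cball)
  show ?thesis
  proof (rule that[of "e / 2"])
    fix y n assume y: "y \<in> cball x (e / 2)"
    have "- of_int n \<notin> cball x e" using e(2) by (metis ComplD Ints_minus Ints_of_int subsetD)
    then have "dist x (- of_int n) > e" by simp
    moreover have "dist x (- of_int n) \<le> dist x y + dist y (- of_int n)" by (rule dist_triangle)
    ultimately show "norm (y + of_int n) \<ge> e / 2" using y by (simp add: dist_norm)
  qed (use e in \<open>auto simp: subset_iff\<close>)
qed

context
  fixes s :: int and ks :: "nat list" 
  assumes s: "s\<^sup>2 = 1" and ks: "\<forall>k\<in>set ks. k \<ge> 2"
begin

lemma half_term_le:
  fixes x :: complex
  assumes "norm x \<le> R" "\<And>m. norm (x + of_int (s * (int m + 1))) \<ge> \<delta>" "\<delta> > 0" "k \<in> set ks"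
  shows "norm (1 / (x + of_int (s * (int m + 1))) ^ k) \<le> (2 + (2 * R\<^sup>2 + 1) / \<delta>\<^sup>2) * (1 / \<delta>) ^ (k - 2) / (1 + (of_nat m + 1)\<^sup>2)"
proof -
  have "(real_of_int (s * (int m + 1)))\<^sup>2 = (of_nat m + 1)\<^sup>2"
    using s by (simp add: power_mult_distrib flip: of_int_power)
  then show ?thesis
    using power_inverse_le[OF assms(1) assms(2)[of m] assms(3), of k] ks assms(4) by simp
qed

lemma half_tangent_uniform_limit:
  fixes K :: "complex set"
  assumes "\<And>x. x \<in> K \<Longrightarrow> norm x \<le> R" "\<And>x m. x \<in> K \<Longrightarrow> norm (x + of_int (s * (int m + 1))) \<ge> \<delta>" "\<delta> > 0"
  shows "uniform_limit K (\<lambda>M x. chain_sum (\<lambda>k m. 1 / (x + of_int (s * (int m + 1))) ^ k) (rev [0..<M]) ks)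
    (half_tangent s ks) sequentially"
proof -
  have "uniform_limit K (\<lambda>M x. chain_sum (\<lambda>k m. 1 / (x + of_int (s * (int m + 1))) ^ k) (rev [0..<M]) ks)
    (\<lambda>x. half_tangent s ks x) sequentially"
    unfolding half_tangent_def
    by (rule uniform_limit_chain_sum[where B = "\<lambda>k m. (2 + (2 * R\<^sup>2 + 1) / \<delta>\<^sup>2) * (1 / \<delta>) ^ (k - 2) / (1 + (of_nat m + 1)\<^sup>2)"])
       (use assms in \<open>blast intro: half_term_le summable_inverse_one_plus_square\<close>)+
  then show ?thesis by simp
qed

lemma half_tangent_norm_le:
  fixes x :: complex
  assumes "norm x \<le> R" "\<And>m. norm (x + of_int (s * (int m + 1))) \<ge> \<delta>" "\<delta> > 0"
  shows "norm (half_tangent s ks x) \<le> half_bound R \<delta> ks"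
    unfolding half_tangent_def half_bound_def
    by (rule norm_lim_chain_sum_le) (use assms in \<open>blast intro: half_term_le summable_inverse_one_plus_square\<close>)+

text \<open>The point 0 of the row is left out, so a half sum has no pole at \<open>x = 0\<close>;
  for |x| at most 1/2 every remaining point stays at distance at least 1/2.\<close>

lemma half_tangent_near_zero:
  assumes "norm x \<le> 1 / 2"
  shows "norm (half_tangent s ks x) \<le> half_bound (1/2) (1/2) ks"
proof (rule half_tangent_norm_le)
  fix m :: nat
  have "s = 1 \<or> s = -1" using s by (simp add: power2_eq_1_iff)
  then have "\<bar>s * (int m + 1)\<bar> \<ge> 1" by auto
  then have "norm (of_int (s * (int m + 1)) :: complex) \<ge> 1" 
    unfolding norm_of_int by linarith
  then show "norm (x + of_int (s * (int m + 1))) \<ge> 1 / 2"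
    using norm_triangle_ineq2[of "of_int (s * (int m + 1))" "-x"] assms by (simp add: algebra_simps)
qed (use assms in auto)

lemma half_tangent_lim:
  assumes "x \<notin> \<int>"
  shows "(\<lambda>M. chain_sum (\<lambda>k m. 1 / (x + of_int (s * (int m + 1))) ^ k) (rev [0..<M]) ks)
    \<longlonglongrightarrow> half_tangent s ks x"
proof -
  obtain \<delta> where d: "\<delta> > 0" "cball x \<delta> \<subseteq> -\<int>" "\<And>y n. y \<in> cball x \<delta> \<Longrightarrow> norm (y + of_int n) \<ge> \<delta>"
    using away_from_Ints[OF assms] by blast
  have "uniform_limit {x} (\<lambda>M x. chain_sum (\<lambda>k m. 1 / (x + of_int (s * (int m + 1))) ^ k) (rev [0..<M]) ks)
    (half_tangent s ks) sequentially"
    by (rule half_tangent_uniform_limit[of _ "norm x" \<delta>]) (use d in \<open>auto simp del: of_int_mult\<close>)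
  then show ?thesis by (rule tendsto_uniform_limitI) simp
qed

lemma half_tangent_holomorphic: "half_tangent s ks holomorphic_on -\<int>"
proof (rule holomorphic_uniform_sequence)
  show "open (-\<int> :: complex set)" using closed_Ints by (simp add: open_Compl)
  fix M
  have "(\<lambda>x. chain_sum (\<lambda>k m. 1 / (x + of_int (s * (int m + 1))) ^ k) xs ls) holomorphic_on -\<int>" for xs ls
  proof (induction xs arbitrary: ls)
    case Nil
    then show ?case by (cases ls) auto
  next
    case (Cons m xs)
    have nz: "x + of_int (s * (int m + 1)) \<noteq> 0" if "x \<in> -\<int>" for x :: complex
      using that by (metis ComplD Ints_minus Ints_of_int add_eq_0_iff2)
    show ?case
    proof (cases ls)
      case (Cons k ls')
      show ?thesis unfolding Cons chain_sum.simps
        using nz by (intro holomorphic_intros Cons.IH) auto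
    qed simp
  qed
  then show "(\<lambda>x. chain_sum (\<lambda>k m. 1 / (x + of_int (s * (int m + 1))) ^ k) (rev [0..<M]) ks) holomorphic_on -\<int>" .
next
  fix x :: complex assume "x \<in> -\<int>"
  then have "x \<notin> \<int>" by simp
  then obtain \<delta> where d: "\<delta> > 0" "cball x \<delta> \<subseteq> -\<int>" "\<And>y n. y \<in> cball x \<delta> \<Longrightarrow> norm (y + of_int n) \<ge> \<delta>"
    using away_from_Ints by blast
  have "norm y \<le> norm x + \<delta>" if "y \<in> cball x \<delta>" for y
    using that norm_triangle_ineq3[of y x] by (simp add: dist_norm norm_minus_commute)
  then have "uniform_limit (cball x \<delta>) (\<lambda>M x. chain_sum (\<lambda>k m. 1 / (x + of_int (s * (int m + 1))) ^ k) (rev [0..<M]) ks)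
    (half_tangent s ks) sequentially"
    by (rule half_tangent_uniform_limit[of _ "norm x + \<delta>" \<delta>]) (use d in blast)+
  then show "\<exists>d>0. cball x d \<subseteq> -\<int> \<and> uniform_limit (cball x d) (\<lambda>M x. chain_sum (\<lambda>k m. 1 / (x + of_int (s * (int m + 1))) ^ k) (rev [0..<M]) ks)
    (half_tangent s ks) sequentially" using d by blast
qed

end

subsection \<open>Tangent functions\<close>

definition qexp :: "complex \<Rightarrow> complex" where "qexp x = exp (2 * of_real pi * \<i> * x)"

definition qden :: "complex \<Rightarrow> complex" where "qden x = 1 / (1 - qexp x)"

text \<open>In the variable u = 1/(1-q) this is the sum of d^(k-1) q^d / (k-1)! over d > 0, see
  \<open>tangent_poly_sums\<close>. The recursion is the derivation q d/dq, which acts on u by q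
  du/dq = u^2 - u.\<close>

fun tangent_poly :: "nat \<Rightarrow> complex poly" where
  "tangent_poly 0 = 0"
| "tangent_poly (Suc 0) = [:-1, 1:]"
| "tangent_poly (Suc (Suc n)) = Polynomial.smult (1 / of_nat (Suc n)) ([:0, -1, 1:] * pderiv (tangent_poly (Suc n)))"

lemma qexp_add: "qexp (x + y) = qexp x * qexp y"
  by (simp add: qexp_def exp_add ring_distribs)

lemma qexp_of_int [simp]: "qexp (of_int n) = 1"
proof -
  have "qexp (of_int n) = exp (of_real (2 * of_int n * pi) * \<i>)"
    by (simp add: qexp_def algebra_simps)
  then show ?thesis by (simp add: exp_eq_1)
qed

lemma qexp_eq_1_iff: "qexp x = 1 \<longleftrightarrow> x \<in> \<int>"
proof
  assume "qexp x = 1"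
  then obtain n :: int where "Re (2 * of_real pi * \<i> * x) = 0" "Im (2 * of_real pi * \<i> * x) = of_int (2 * n) * pi"
    unfolding qexp_def exp_eq_1 by blast
  then have "Im x = 0" "Re x = of_int n" by auto
  then have "x = of_int n" by (simp add: complex_eq_iff)
  then show "x \<in> \<int>" by simp
qed (auto elim!: Ints_cases)

lemma norm_qexp: "norm (qexp x) = exp (- 2 * pi * Im x)"
  by (simp add: qexp_def norm_exp_eq_Re)

lemma qexp_plus_1 [simp]: "qexp (x + 1) = qexp x"
  using qexp_of_int[of 1] by (simp add: qexp_add)

lemma qden_plus_1 [simp]: "qden (x + 1) = qden x"
  by (simp add: qden_def)

lemma qexp_holomorphic [holomorphic_intros]: "qexp holomorphic_on A"
  unfolding qexp_def by (intro holomorphic_intros)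

lemma qden_holomorphic [holomorphic_intros]: "qden holomorphic_on -\<int>"
  unfolding qden_def by (intro holomorphic_intros) (metis ComplD diff_eq_eq add_0 qexp_eq_1_iff)

lemma coeff_tangent_poly:
  "Polynomial.coeff (tangent_poly (Suc n)) (Suc n) = 1 \<and> Polynomial.degree (tangent_poly (Suc n)) \<le> Suc n"
proof (induction n)
  case (Suc n)
  let ?p = "tangent_poly (Suc n)"
  have eq: "[:0, -1, 1:] * pderiv ?p = pCons 0 (pCons 0 (pderiv ?p) - pderiv ?p)"
    by (simp add: algebra_simps)
  have "Polynomial.degree (pderiv ?p) \<le> n" using Suc degree_pderiv[of ?p] by linarith
  then have d: "Polynomial.coeff (pderiv ?p) (Suc n) = 0" by (simp add: coeff_eq_0)
  have "Polynomial.degree ([:0, -1, 1:] * pderiv ?p) \<le> Suc (Suc n)"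
    by (rule order.trans[OF degree_mult_le]) (use \<open>Polynomial.degree (pderiv ?p) \<le> n\<close> in simp)
  then have "Polynomial.degree (tangent_poly (Suc (Suc n))) \<le> Suc (Suc n)"
    by (simp only: tangent_poly.simps) (metis degree_smult_le order.trans)
  moreover have "Polynomial.coeff (tangent_poly (Suc (Suc n))) (Suc (Suc n)) = 1"
    unfolding tangent_poly.simps eq using Suc d by (simp add: coeff_pderiv of_nat_neq_0 del: of_nat_Suc)
  ultimately show ?case by blast
qed simp

text \<open>The arguments 1 and 0 are the limits of \<open>qden\<close> at the upper and the lower
  end of the imaginary axis, so these zeros give the two vanishing conditions of
  \<open>tangent_like\<close>. For index 1 the value at 0 is -1, which is why expansions start at
  index 2.\<close>

lemma poly_tangent_poly_0_1:
  assumes "k \<ge> 2" shows "poly (tangent_poly k) 0 = 0" "poly (tangent_poly k) 1 = 0"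
proof -
  obtain n where "k = Suc (Suc n)" using assms by (metis add_2_eq_Suc le_Suc_ex)
  then show "poly (tangent_poly k) 0 = 0" "poly (tangent_poly k) 1 = 0" by simp_all
qed

lemma tangent_poly_sums:
  assumes "norm x < 1"
  shows "(\<lambda>d. of_nat (Suc d) ^ n / fact n * x ^ Suc d) sums poly (tangent_poly (Suc n)) (1 / (1 - x))"
  using assms
proof (induction n arbitrary: x)
  case 0
  then have nz: "1 - x \<noteq> 0" by auto
  have "(\<lambda>d. x * x ^ d) sums (x * (1 / (1 - x)))"
    by (intro sums_mult geometric_sums 0)
  moreover have "x * (1 / (1 - x)) = poly (tangent_poly (Suc 0)) (1 / (1 - x))"
    using nz by (simp add: field_simps)
  ultimately show ?case by simp
next
  case (Suc n)
  \<comment> \<open>The constant coefficient is set to 0 by hand, because for \<open>n = 0\<close>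
    the formula would give \<open>0 ^ 0 = 1\<close> there.\<close>
  define c where "c d = (if d = 0 then 0 else of_nat d ^ n / fact n :: complex)" for d
  define p where "p = tangent_poly (Suc n)"
  have nz: "1 - x \<noteq> 0" using Suc.prems by auto
  have sums: "(\<lambda>d. c d * z ^ d) sums poly p (1 / (1 - z))" if "norm z < 1" for z
    using Suc.IH[OF that] sums_Suc_iff[of "\<lambda>d. c d * z ^ d" "poly p (1 / (1 - z))"]
    by (simp add: c_def p_def del: of_nat_Suc power_Suc)
  have der: "((\<lambda>z. poly p (1 / (1 - z))) has_field_derivative (poly (pderiv p) (1 / (1 - x)) * (1 / (1 - x)^2))) (at x)"
    by (rule DERIV_chain2[where f = "poly p"]) (use nz in \<open>auto intro!: derivative_eq_intros simp: power2_eq_square\<close>)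
  have "(\<lambda>d. diffs c d * x ^ d) sums (poly (pderiv p) (1 / (1 - x)) * (1 / (1 - x)^2))"
    by (rule termdiffs_sums_strong[OF sums der Suc.prems])
  from sums_mult[OF this, of "x / of_nat (Suc n)"]
  have "(\<lambda>d. x / of_nat (Suc n) * (diffs c d * x ^ d)) sums
     (x / of_nat (Suc n) * (poly (pderiv p) (1 / (1 - x)) * (1 / (1 - x)^2)))" .
  moreover have "x / of_nat (Suc n) * (diffs c d * x ^ d) = of_nat (Suc d) ^ Suc n / fact (Suc n) * x ^ Suc d" for d
    by (simp add: diffs_def c_def field_simps del: of_nat_Suc)
  moreover have "x / of_nat (Suc n) * (poly (pderiv p) (1 / (1 - x)) * (1 / (1 - x)^2)) =
    poly (tangent_poly (Suc (Suc n))) (1 / (1 - x))"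
  proof -
    define y where "y = 1 / (1 - x)"
    have "y * (-1 + y) = x * (1 / (1 - x)^2)" 
      using nz by (simp add: y_def field_simps power2_eq_square)
    moreover have "poly (tangent_poly (Suc (Suc n))) y = 1 / of_nat (Suc n) * ((y * (-1 + y)) * poly (pderiv p) y)"
      by (simp add: p_def algebra_simps)
    ultimately show ?thesis by (simp add: y_def del: tangent_poly.simps)
  qed
  ultimately show ?case by simp
qed

text \<open>Both vanishing conditions at \<open>\<plusminus>\<i>\<infinity>\<close> are needed to exclude a simple pole at the integers.\<close>

definition tangent_like :: "nat \<Rightarrow> (complex \<Rightarrow> complex) \<Rightarrow> bool" where
  "tangent_like K f \<longleftrightarrow> f holomorphic_on -\<int> \<and> (\<forall>x. x \<notin> \<int> \<longrightarrow> f (x + 1) = f x) \<and>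
     f \<in> O[at 0](\<lambda>x. 1 / x ^ K) \<and>
     (\<exists>C. \<forall>x. 0 \<le> Re x \<longrightarrow> Re x \<le> 1 \<longrightarrow> 1 / 2 \<le> \<bar>Im x\<bar> \<longrightarrow> norm (f x) \<le> C) \<and>
     ((\<lambda>Y. f (\<i> * of_real Y)) \<longlongrightarrow> 0) at_top \<and> ((\<lambda>Y. f (\<i> * of_real Y)) \<longlongrightarrow> 0) at_bot"

lemma periodic_shift:
  assumes "\<forall>x. x \<notin> \<int> \<longrightarrow> f (x + 1) = f x" "x \<notin> \<int>"
  shows "f (x + of_int n) = (f x :: complex)"
proof -
  have nat: "f (x + of_nat m) = f x" if "x \<notin> \<int>" for m x
  proof (induction m)
    case (Suc m)
    have "x + of_nat m \<notin> \<int>" using that by (metis Ints_diff Ints_of_nat add_diff_cancel_right')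
    then have "f (x + of_nat m + 1) = f (x + of_nat m)" using assms by blast
    then show ?case using Suc by (simp add: algebra_simps)
  qed simp
  show ?thesis
  proof (cases "n \<ge> 0")
    case True
    then show ?thesis using nat[OF assms(2), of "nat n"] by simp
  next
    case False
    have "x + of_int n \<notin> \<int>" using assms(2) by (metis Ints_diff Ints_of_int add_diff_cancel_right')
    from nat[OF this, of "nat (-n)"] show ?thesis using False by simp
  qed
qed

text \<open>Riemann's theorem on removable singularities for x^K f; the radius 1 is the distance
  from 0 to the next integers.\<close>

lemma extend_near_zero:
  assumes "f holomorphic_on -\<int>" "f \<in> O[at 0](\<lambda>x. 1 / x ^ K)"
  obtains G where "G holomorphic_on ball 0 1" "\<And>x. x \<in> ball 0 1 - {0} \<Longrightarrow> G x = x ^ K * f x"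
proof -
  have sub: "ball 0 1 - {0} \<subseteq> (-\<int> :: complex set)"
  proof
    fix x :: complex assume x: "x \<in> ball 0 1 - {0}"
    show "x \<in> -\<int>"
    proof
      assume "x \<in> \<int>"
      then obtain n where "x = of_int n" by (auto elim: Ints_cases)
      then have "\<bar>n\<bar> < 1" "n \<noteq> 0" using x by (auto simp: norm_of_int)
      then show False by simp
    qed
  qed
  have hol: "(\<lambda>x. x ^ K * f x) holomorphic_on (ball 0 1 - {0})"
    by (intro holomorphic_intros holomorphic_on_subset[OF assms(1) sub])
  from assms(2) obtain c where c: "eventually (\<lambda>x. norm (f x) \<le> c * norm (1 / x ^ K)) (at 0)" by (auto elim: landau_o.bigE)
  have ne: "eventually (\<lambda>x::complex. x \<noteq> 0) (at 0)" by (simp add: eventually_at_filter)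
  have bd: "\<exists>B. eventually (\<lambda>x. norm (x ^ K * f x) \<le> B) (at 0)"
    using c ne by (intro exI[of _ c]; eventually_elim) (simp add: norm_mult norm_divide norm_power field_simps)
  obtain G where "G holomorphic_on ball 0 1" "\<forall>x\<in>ball 0 1 - {0}. G x = x ^ K * f x"
    using holomorphic_on_extend_bounded[OF hol, of ] bd by auto
  then show ?thesis using that by blast
qed

lemma pole_limit:
  assumes "f holomorphic_on -\<int>" "f \<in> O[at 0](\<lambda>x. 1 / x ^ K)"
  obtains L where "((\<lambda>x. x ^ K * f x) \<longlongrightarrow> L) (at 0)"
proof -
  obtain G where G: "G holomorphic_on ball 0 1" "\<And>x. x \<in> ball 0 1 - {0} \<Longrightarrow> G x = x ^ K * f x"
    using extend_near_zero[OF assms] by blast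
  have "G field_differentiable (at 0)" using G(1) by (simp add: holomorphic_on_imp_differentiable_at)
  then have "isCont G 0" by (rule field_differentiable_imp_continuous_at)
  then have "(G \<longlongrightarrow> G 0) (at 0)" by (simp add: isCont_def)
  moreover have "eventually (\<lambda>x. G x = x ^ K * f x) (at 0)"
    using eventually_at_ball'[of 1 0 UNIV] G(2) by (auto elim: eventually_mono)
  ultimately have "((\<lambda>x. x ^ K * f x) \<longlongrightarrow> G 0) (at 0)" by (rule Lim_transform_eventually)
  then show ?thesis using that by blast
qed

text \<open>A vanishing leading Laurent coefficient lowers the pole order by one: the holomorphic
  extension of x^(K+1) f vanishes at 0, so its quotient by x is bounded.\<close>

lemma tendsto_zero_imp_bigo:
  assumes "f holomorphic_on -\<int>" "f \<in> O[at 0](\<lambda>x. 1 / x ^ Suc K)" "((\<lambda>x. x ^ Suc K * f x) \<longlongrightarrow> 0) (at 0)"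
  shows "f \<in> O[at 0](\<lambda>x. 1 / x ^ K)"
proof -
  obtain G where G: "G holomorphic_on ball 0 1" "\<And>x. x \<in> ball 0 1 - {0} \<Longrightarrow> G x = x ^ Suc K * f x"
    using extend_near_zero[OF assms(1,2)] by blast
  have ev: "eventually (\<lambda>x::complex. x \<in> ball 0 1 - {0}) (at 0)"
    using eventually_at_ball'[of 1 0 UNIV] by (auto elim: eventually_mono)
  have "G field_differentiable (at 0)" using G(1)
    by (simp add: holomorphic_on_imp_differentiable_at)
  then obtain D where D: "(G has_field_derivative D) (at 0)" by (auto simp: field_differentiable_def)
  then have "isCont G 0" by (rule DERIV_isCont)
  then have "(G \<longlongrightarrow> G 0) (at 0)" by (simp add: isCont_def)
  moreover have "(G \<longlongrightarrow> 0) (at 0)"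
    by (rule Lim_transform_eventually[OF assms(3)]) (use ev in eventually_elim, use G(2) in simp)
  ultimately have "G 0 = 0" using tendsto_unique[of "at (0::complex)"] by auto
  have "((\<lambda>x. G x / x) \<longlongrightarrow> D) (at 0)" using D \<open>G 0 = 0\<close> by (simp add: has_field_derivative_iff)
  then have "(\<lambda>x. G x / x) \<in> O[at 0](\<lambda>_. 1)" by (intro bigoI_tendsto) simp_all 
  then have "(\<lambda>x. G x / x * (1 / x ^ K)) \<in> O[at 0](\<lambda>x. 1 * (1 / x ^ K))"
    by (intro landau_o.big.mult) auto
  moreover have "eventually (\<lambda>x. G x / x * (1 / x ^ K) = f x) (at 0)"
    using ev
  proof eventually_elim
    case (elim x)
    then show ?case using G(2)[of x] by (simp add: field_simps)
  qed
  ultimately show ?thesis by (subst (asm) landau_o.big.in_cong) auto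
qed

lemma qden_times_bigo: "((\<lambda>x. x * qden x) \<longlongrightarrow> - 1 / (2 * of_real pi * \<i>)) (at 0)"
proof -
  have "(qexp has_field_derivative (2 * of_real pi * \<i>)) (at 0)"
    unfolding qexp_def by (auto intro!: derivative_eq_intros)
  then have "((\<lambda>x. (qexp x - 1) / x) \<longlongrightarrow> 2 * of_real pi * \<i>) (at 0)"
    using qexp_of_int[of 0] by (simp add: has_field_derivative_iff)
  then have "((\<lambda>x. - inverse ((qexp x - 1) / x)) \<longlongrightarrow> - inverse (2 * of_real pi * \<i>)) (at 0)"
    by (intro tendsto_minus tendsto_inverse) simp_all
  moreover have "- inverse ((qexp x - 1) / x) = x * qden x" for x
    by (cases "qexp x = 1") (auto simp: qden_def divide_simps algebra_simps)
  ultimately show ?thesis by (simp add: inverse_eq_divide)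
qed

text \<open>Since x times \<open>qden x\<close> has a finite limit, the coefficient of degree i
  contributes a multiple of x^(k-i). Only the top coefficient survives, and it is 1.\<close>

lemma poly_qden_tendsto:
  assumes "k \<ge> 1"
  shows "((\<lambda>x. x ^ k * poly (tangent_poly k) (qden x)) \<longlongrightarrow> (- 1 / (2 * of_real pi * \<i>)) ^ k) (at 0)"
proof -
  obtain n where n: "k = Suc n" using assms by (cases k) auto
  let ?p = "tangent_poly k" and ?a = "- 1 / (2 * of_real pi * \<i>) :: complex"
  have deg: "Polynomial.degree ?p \<le> k" "Polynomial.coeff ?p k = 1" using coeff_tangent_poly[of n] n by auto
  have "((\<lambda>x. \<Sum>i\<le>k. Polynomial.coeff ?p i * ((x * qden x) ^ i * x ^ (k - i))) \<longlongrightarrow>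
     (\<Sum>i\<le>k. Polynomial.coeff ?p i * (?a ^ i * 0 ^ (k - i)))) (at 0)"
    by (intro tendsto_intros qden_times_bigo)
  moreover have "(\<Sum>i\<le>k. Polynomial.coeff ?p i * (?a ^ i * 0 ^ (k - i))) = (\<Sum>i\<in>{k}. Polynomial.coeff ?p i * (?a ^ i * 0 ^ (k - i)))"
    by (rule sum.mono_neutral_right) auto
  moreover have "(\<Sum>i\<le>k. Polynomial.coeff ?p i * ((x * qden x) ^ i * x ^ (k - i))) = x ^ k * poly ?p (qden x)" for x
  proof -
    have "poly ?p (qden x) = (\<Sum>i\<le>k. Polynomial.coeff ?p i * qden x ^ i)"
      unfolding poly_altdef by (rule sum.mono_neutral_left) (use deg in \<open>auto intro: coeff_eq_0\<close>)
    then have "x ^ k * poly ?p (qden x) = (\<Sum>i\<le>k. x ^ k * (Polynomial.coeff ?p i * qden x ^ i))"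
      by (simp add: sum_distrib_left)
    also have "\<dots> = (\<Sum>i\<le>k. Polynomial.coeff ?p i * ((x * qden x) ^ i * x ^ (k - i)))"
    proof (rule sum.cong)
      fix i assume "i \<in> {..k}"
      then have "x ^ k = x ^ i * x ^ (k - i)" by (simp flip: power_add)
      then show "x ^ k * (Polynomial.coeff ?p i * qden x ^ i) = Polynomial.coeff ?p i * ((x * qden x) ^ i * x ^ (k - i))"
        by (simp add: power_mult_distrib)
    qed simp
    finally show ?thesis by simp
  qed
  ultimately show ?thesis using deg by simp
qed

lemma tendsto_imp_bigo_pole:
  assumes "((\<lambda>x. x ^ K * f x) \<longlongrightarrow> L) (at (0::complex))"
  shows "f \<in> O[at 0](\<lambda>x. 1 / x ^ K :: complex)"
proof -
  from assms have "(\<lambda>x. x ^ K * f x) \<in> O[at 0](\<lambda>_. 1 :: complex)" by (intro bigoI_tendsto) simp_all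
  then have "(\<lambda>x. (x ^ K * f x) * (1 / x ^ K)) \<in> O[at 0](\<lambda>x. 1 * (1 / x ^ K))"
    by (intro landau_o.big.mult) auto
  moreover have "eventually (\<lambda>x. (x ^ K * f x) * (1 / x ^ K) = f x) (at 0)"
    unfolding eventually_at_filter by (auto simp: field_simps)
  ultimately show ?thesis by (subst (asm) landau_o.big.in_cong) auto
qed

text \<open>For |Im x| at least 1/2 the modulus of q is at most exp(-pi) or at least exp(pi). The
  second case gives the same constant because cosh(pi) is at least 1, that is, exp(pi) - 1 is at
  least 1 - exp(-pi).\<close>

lemma qden_bounded:
  assumes "1 / 2 \<le> \<bar>Im x\<bar>"
  shows "norm (qden x) \<le> 1 / (1 - exp (- pi))"
proof -
  have e: "exp (- pi) < 1" by simp
  have "norm (1 - qexp x) \<ge> 1 - exp (- pi)"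
  proof (cases "Im x \<ge> 0")
    case True
    then have "norm (qexp x) \<le> exp (- pi)" using assms unfolding norm_qexp by (simp add: field_simps)
    then show ?thesis using norm_triangle_ineq2[of 1 "qexp x"] by simp
  next
    case False
    then have "- Im x * 2 \<ge> 1" using assms by simp
    then have "(- Im x * 2) * pi \<ge> 1 * pi" by (intro mult_right_mono) auto
    then have "norm (qexp x) \<ge> exp pi" unfolding norm_qexp by (simp add: mult_ac)
    moreover have "exp pi + exp (-pi) \<ge> 2" using arcosh_real_def cosh_real_ge_1[of pi] by (simp add: cosh_def)
    ultimately show ?thesis using norm_triangle_ineq3[of "qexp x" 1] by (simp add: norm_minus_commute)
  qed
  then show ?thesis using e unfolding qden_def norm_divide by (simp add: frac_le)
qed

lemma qden_at_top: "((\<lambda>Y. qden (\<i> * of_real Y)) \<longlongrightarrow> 1) at_top"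
proof -
  have "((\<lambda>Y. norm (qexp (\<i> * of_real Y))) \<longlongrightarrow> 0) at_top"
    unfolding norm_qexp by simp real_asymp
  then have "((\<lambda>Y. qexp (\<i> * of_real Y)) \<longlongrightarrow> 0) at_top" by (rule tendsto_norm_zero_cancel)
  then have "((\<lambda>Y. 1 / (1 - qexp (\<i> * of_real Y))) \<longlongrightarrow> 1 / (1 - 0)) at_top" by (intro tendsto_intros) auto
  then show ?thesis by (simp add: qden_def)
qed

lemma qden_at_bot: "((\<lambda>Y. qden (\<i> * of_real Y)) \<longlongrightarrow> 0) at_bot"
proof (rule Lim_null_comparison)
  show "((\<lambda>Y. 1 / (exp (- 2 * pi * Y) - 1)) \<longlongrightarrow> 0) at_bot" by real_asymp
  show "eventually (\<lambda>Y. norm (qden (\<i> * of_real Y)) \<le> 1 / (exp (- 2 * pi * Y) - 1)) at_bot"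
    using eventually_gt_at_bot[of "0::real"]
  proof eventually_elim
    case (elim Y)
    then have "exp (- 2 * pi * Y) > 1" by (simp add: mult_pos_neg)
    moreover have "norm (1 - qexp (\<i> * of_real Y)) \<ge> exp (- 2 * pi * Y) - 1"
      using norm_triangle_ineq2[of "qexp (\<i> * of_real Y)" 1] by (simp add: norm_qexp norm_minus_commute)
    ultimately show ?case by (simp add: qden_def norm_divide frac_le)
  qed
qed

lemma tangent_like_tangent_poly:
  assumes "k \<ge> 2"
  shows "tangent_like k (\<lambda>x. poly (tangent_poly k) (qden x))"
proof -
  have cont: "isCont (poly (tangent_poly k)) z" for z by (rule poly_isCont)
  have "continuous_on (cball 0 (1 / (1 - exp (- pi)))) (poly (tangent_poly k))"
    by (intro continuous_at_imp_continuous_on ballI cont)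
  then have "compact (poly (tangent_poly k) ` cball 0 (1 / (1 - exp (- pi))))"
    by (rule compact_continuous_image) simp
  then obtain C where C: "\<And>y. norm y \<le> 1 / (1 - exp (- pi)) \<Longrightarrow> norm (poly (tangent_poly k) y) \<le> C"
    by (metis (no_types, lifting) bounded_iff compact_imp_bounded imageI mem_cball_0)
  have "((\<lambda>Y. poly (tangent_poly k) (qden (\<i> * of_real Y))) \<longlongrightarrow> poly (tangent_poly k) 1) at_top"
    by (rule isCont_tendsto_compose[OF cont qden_at_top])
  moreover have "((\<lambda>Y. poly (tangent_poly k) (qden (\<i> * of_real Y))) \<longlongrightarrow> poly (tangent_poly k) 0) at_bot"
    by (rule isCont_tendsto_compose[OF cont qden_at_bot])
  ultimately show ?thesis
    unfolding tangent_like_def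
    using poly_tangent_poly_0_1[OF assms] C qden_bounded tendsto_imp_bigo_pole[OF poly_qden_tendsto[of k]] assms
    by (auto intro!: holomorphic_intros)
qed

lemma tangent_like_diff:
  assumes "tangent_like K f" "tangent_like K h"
  shows "tangent_like K (\<lambda>x. f x - c * h x)"
proof -
  obtain C D where CD: "\<And>x. 0 \<le> Re x \<Longrightarrow> Re x \<le> 1 \<Longrightarrow> 1 / 2 \<le> \<bar>Im x\<bar> \<Longrightarrow> norm (f x) \<le> C"
    "\<And>x. 0 \<le> Re x \<Longrightarrow> Re x \<le> 1 \<Longrightarrow> 1 / 2 \<le> \<bar>Im x\<bar> \<Longrightarrow> norm (h x) \<le> D"
    using assms unfolding tangent_like_def by meson
  have "norm (f x - c * h x) \<le> C + norm c * D" if "0 \<le> Re x" "Re x \<le> 1" "1 / 2 \<le> \<bar>Im x\<bar>" for x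
    using CD[OF that] by (intro order.trans[OF norm_triangle_ineq4] add_mono) (auto simp: norm_mult intro: mult_left_mono)
  moreover have "((\<lambda>Y. f (\<i> * of_real Y) - c * h (\<i> * of_real Y)) \<longlongrightarrow> 0 - c * 0) F" if
    "((\<lambda>Y. f (\<i> * of_real Y)) \<longlongrightarrow> 0) F" "((\<lambda>Y. h (\<i> * of_real Y)) \<longlongrightarrow> 0) F" for F
    using that by (intro tendsto_intros)
  moreover have "(\<lambda>x. f x - c * h x) \<in> O[at 0](\<lambda>x. 1 / x ^ K)"
    using assms unfolding tangent_like_def by (intro sum_in_bigo) auto
  ultimately show ?thesis using assms unfolding tangent_like_def
    by (auto intro!: holomorphic_intros)
qed

text \<open>Periodicity translates the extension across 0 to every integer, and on overlaps the
  translates agree with the function itself.\<close>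

lemma tangent_like_0_extend:
  assumes hol: "f holomorphic_on -\<int>" and per: "\<forall>x. x \<notin> \<int> \<longrightarrow> f (x + 1) = f x" and big: "f \<in> O[at 0](\<lambda>x. 1 / x ^ 0)"
  obtains h where "h holomorphic_on UNIV" "\<And>x. x \<notin> \<int> \<Longrightarrow> h x = f x" "\<And>x n. h (x + of_int n) = h x"
proof -
  obtain G where G: "G holomorphic_on ball 0 1" "\<And>x. x \<in> ball 0 1 - {0} \<Longrightarrow> G x = f x"
    using extend_near_zero[OF hol big] by auto
  define h where "h x = (if x \<in> \<int> then G 0 else f x)" for x
  have op: "open (-\<int> :: complex set)" using closed_Ints by (simp add: open_Compl)
  have h1: "h holomorphic_on -\<int>" 
    using hol by (rule holomorphic_cong[THEN iffD1, rotated -1]) (auto simp: h_def)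
  have h2: "h holomorphic_on ball (of_int n) 1" for n
  proof -
    have "(\<lambda>y. G (y - of_int n)) holomorphic_on ball (of_int n) 1"
      by (rule holomorphic_on_compose_gen[of "\<lambda>y. y - of_int n" _ G "ball 0 1", unfolded o_def])
        (auto simp: dist_norm norm_minus_commute intro!: holomorphic_intros G(1))
    then show ?thesis
    proof (rule holomorphic_cong[THEN iffD1, rotated -1])
      fix y :: complex assume y: "y \<in> ball (of_int n) 1"
      show "G (y - of_int n) = h y"
      proof (cases "y \<in> \<int>")
        case True
        then obtain m where m: "y = of_int m" by (auto elim: Ints_cases)
        then have "norm (of_int (n - m) :: complex) < 1" using y by (simp add: dist_norm)
        then have "n = m" by (simp only: norm_of_int)
        then show ?thesis using m by (simp add: h_def)
      next
        case False
        then have "y - of_int n \<in> ball 0 1 - {0}" using y by (auto simp: dist_norm norm_minus_commute)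
        then have "G (y - of_int n) = f (y + of_int (-n))" using G(2) by simp
        also have "\<dots> = f y" by (rule periodic_shift[OF per False])
        finally show ?thesis using False by (simp add: h_def)
      qed
    qed simp
  qed
  have "(-\<int> :: complex set) \<union> (\<Union>n. ball (of_int n) 1) = UNIV"
    by (auto elim!: Ints_cases) (metis dist_self zero_less_one)
  moreover have "h holomorphic_on (-\<int> \<union> (\<Union>n. ball (of_int n) 1))"
    by (intro holomorphic_on_Un holomorphic_on_UN_open h1 h2 op open_ball open_UN ballI)
  ultimately have "h holomorphic_on UNIV" by simp
  moreover have "h (x + of_int n) = h x" for x n
  proof -
    have "x + of_int n \<in> \<int> \<longleftrightarrow> x \<in> \<int>"
      by (metis Ints_add Ints_diff Ints_of_int add_diff_cancel_right')
    then show ?thesis using periodic_shift[OF per, of x n] by (auto simp: h_def)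
  qed
  ultimately show ?thesis using that[of h] by (simp add: h_def)
qed

lemma entire_periodic_const:
  assumes hol: "h holomorphic_on UNIV" and per: "\<And>x n. h (x + of_int n) = h x"
    and bd: "\<And>x. 0 \<le> Re x \<Longrightarrow> Re x \<le> 1 \<Longrightarrow> 1 / 2 \<le> \<bar>Im x\<bar> \<Longrightarrow> norm (h x) \<le> C"
  obtains c where "\<And>x. h x = c"
proof -
  have "compact (h ` cbox 0 (Complex 1 1))" and "compact (h ` cbox (Complex 0 (-1)) (Complex 1 0))"
    by (intro compact_continuous_image holomorphic_on_imp_continuous_on holomorphic_on_subset[OF hol]; simp)+
  then obtain A B where AB: "\<And>x. x \<in> cbox 0 (Complex 1 1) \<Longrightarrow> norm (h x) \<le> A" 
     "\<And>x. x \<in> cbox (Complex 0 (-1)) (Complex 1 0) \<Longrightarrow> norm (h x) \<le> B"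
    by (metis bounded_iff compact_imp_bounded imageI)
  have strip: "norm (h x) \<le> max C (max A B)" if x: "0 \<le> Re x" "Re x \<le> 1" for x
  proof -
    consider "1 / 2 \<le> \<bar>Im x\<bar>" | "0 \<le> Im x" "Im x \<le> 1" | "-1 \<le> Im x" "Im x \<le> 0" by linarith
    then show ?thesis
    proof cases
      case 1
      then show ?thesis using bd[OF x] by simp
    next
      case 2
      then have "x \<in> cbox 0 (Complex 1 1)" using x by (simp add: in_cbox_complex_iff)
      then show ?thesis using AB(1)[of x] by simp
    next
      case 3
      then have "x \<in> cbox (Complex 0 (-1)) (Complex 1 0)" using x by (simp add: in_cbox_complex_iff)
      then show ?thesis using AB(2)[of x] by simp
    qed
  qed
  have "norm (h x) \<le> max C (max A B)" for x
  proof -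
    have "h x = h (x + of_int (- \<lfloor>Re x\<rfloor>))" by (rule per[symmetric])
    moreover have "norm (h (x + of_int (- \<lfloor>Re x\<rfloor>))) \<le> max C (max A B)"
      by (rule strip) (simp_all, linarith+)
    ultimately show ?thesis by simp
  qed
  then have "bounded (range h)" by (auto simp: bounded_iff)
  then have "h constant_on UNIV" by (rule Liouville_theorem[OF hol])
  then show ?thesis using that by (auto simp: constant_on_def)
qed

lemma imag_not_Ints: "Y \<noteq> 0 \<Longrightarrow> \<i> * of_real Y \<notin> \<int>"
  by (auto elim!: Ints_cases simp: complex_eq_iff)

text \<open>Subtracting a multiple \<open>a\<close> of \<open>qden\<close> removes all poles, and
  Liouville's theorem turns the difference into a constant \<open>c\<close>. As \<open>qden\<close>
  tends to 1 at the upper and to 0 at the lower end, comparing limits gives c = -a and c =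
  0.\<close>

lemma tangent_like_1_zero:
  assumes f: "tangent_like (Suc 0) f" and x: "x \<notin> \<int>"
  shows "f x = 0"
proof -
  have hol: "f holomorphic_on -\<int>" and per: "\<forall>x. x \<notin> \<int> \<longrightarrow> f (x + 1) = f x" 
    and big: "f \<in> O[at 0](\<lambda>x. 1 / x ^ Suc 0)"
    and top: "((\<lambda>Y. f (\<i> * of_real Y)) \<longlongrightarrow> 0) at_top" and bot: "((\<lambda>Y. f (\<i> * of_real Y)) \<longlongrightarrow> 0) at_bot"
    using f unfolding tangent_like_def by auto
  obtain C where C: "\<And>x. 0 \<le> Re x \<Longrightarrow> Re x \<le> 1 \<Longrightarrow> 1 / 2 \<le> \<bar>Im x\<bar> \<Longrightarrow> norm (f x) \<le> C"
    using f unfolding tangent_like_def by auto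
  obtain L where lim: "((\<lambda>x. x ^ Suc 0 * f x) \<longlongrightarrow> L) (at 0)"
    using pole_limit[OF hol big] by blast
  define a where "a = L * (- (2 * of_real pi * \<i>))"
  define F where "F x = f x - a * qden x" for x
  have "((\<lambda>x. x ^ Suc 0 * f x - a * (x * qden x)) \<longlongrightarrow> L - a * (- 1 / (2 * of_real pi * \<i>))) (at 0)"
    by (intro tendsto_intros lim qden_times_bigo)
  then have limF: "((\<lambda>x. x ^ Suc 0 * F x) \<longlongrightarrow> 0) (at 0)" by (simp add: F_def a_def algebra_simps)
  have "(\<lambda>x. x ^ 1 * qden x) \<midarrow>0\<rightarrow> - 1 / (2 * of_real pi * \<i>)" using qden_times_bigo by simp
  from tendsto_imp_bigo_pole[OF this] have "qden \<in> O[at 0](\<lambda>x. 1 / x ^ Suc 0)" by simp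
  then have bigF: "F \<in> O[at 0](\<lambda>x. 1 / x ^ Suc 0)"
    unfolding F_def using big by (intro sum_in_bigo) auto
  have holF: "F holomorphic_on -\<int>" unfolding F_def by (intro holomorphic_intros hol)
  have perF: "\<forall>x. x \<notin> \<int> \<longrightarrow> F (x + 1) = F x" using per by (simp add: F_def)
  obtain h where h: "h holomorphic_on UNIV" "\<And>x. x \<notin> \<int> \<Longrightarrow> h x = F x" "\<And>x n. h (x + of_int n) = h x"
    using tangent_like_0_extend[OF holF perF tendsto_zero_imp_bigo[OF holF bigF limF]] by blast
  have "norm (h x) \<le> C + norm a * (1 / (1 - exp (- pi)))" if "0 \<le> Re x" "Re x \<le> 1" "1 / 2 \<le> \<bar>Im x\<bar>" for x
  proof -
    have "x \<notin> \<int>" using that by (auto elim!: Ints_cases)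
    then have "norm (h x) = norm (f x - a * qden x)" using h(2) by (simp add: F_def)
    also have "\<dots> \<le> C + norm a * (1 / (1 - exp (- pi)))"
      using C[OF that] mult_left_mono[OF qden_bounded[OF that(3)], of "norm a"] 
      by (intro order.trans[OF norm_triangle_ineq4] add_mono) (auto simp: norm_mult)
    finally show ?thesis .
  qed
  from entire_periodic_const[OF h(1) h(3) this] obtain c where c: "\<And>x. h x = c" by blast
  have eq: "f (\<i> * of_real Y) - a * qden (\<i> * of_real Y) = c" if "Y \<noteq> 0" for Y
    using h(2)[OF imag_not_Ints[OF that]] c by (simp add: F_def)
  have "((\<lambda>Y. f (\<i> * of_real Y) - a * qden (\<i> * of_real Y)) \<longlongrightarrow> 0 - a * 1) at_top"
    by (intro tendsto_intros top qden_at_top)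
  moreover have "((\<lambda>Y. f (\<i> * of_real Y) - a * qden (\<i> * of_real Y)) \<longlongrightarrow> c) at_top"
    by (rule tendsto_eventually) (use eventually_gt_at_top[of 0] in eventually_elim, use eq in auto)
  ultimately have 1: "0 - a * 1 = c" using tendsto_unique[OF trivial_limit_at_top_linorder] by blast
  have "((\<lambda>Y. f (\<i> * of_real Y) - a * qden (\<i> * of_real Y)) \<longlongrightarrow> 0 - a * 0) at_bot"
    by (intro tendsto_intros bot qden_at_bot)
  moreover have "((\<lambda>Y. f (\<i> * of_real Y) - a * qden (\<i> * of_real Y)) \<longlongrightarrow> c) at_bot"
    by (rule tendsto_eventually) (use eventually_gt_at_bot[of 0] in eventually_elim, use eq in auto)
  ultimately have 2: "0 - a * 0 = c" using tendsto_unique[OF trivial_limit_at_bot_linorder] by blast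
  show ?thesis using 1 2 c h(2)[OF x] by (simp add: F_def)
qed

text \<open>The pole at 0 is reduced order by order: its leading coefficient is matched by a
  multiple of \<open>tangent_poly\<close> of the same order. The process ends at a simple pole,
  which \<open>tangent_like_1_zero\<close> excludes.\<close>

theorem tangent_like_expansion:
  assumes "tangent_like (Suc K) f"
  shows "\<exists>c. \<forall>x. x \<notin> \<int> \<longrightarrow> f x = (\<Sum>j\<in>{2..Suc K}. c j * poly (tangent_poly j) (qden x))"
  using assms
proof (induction K arbitrary: f)
  case 0
  then show ?case using tangent_like_1_zero by auto
next
  case (Suc K)
  let ?k = "Suc (Suc K)"
  have hol: "f holomorphic_on -\<int>" and big: "f \<in> O[at 0](\<lambda>x. 1 / x ^ ?k)"
    using Suc.prems unfolding tangent_like_def by auto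
  obtain L where lim: "((\<lambda>x. x ^ ?k * f x) \<longlongrightarrow> L) (at 0)"
    using pole_limit[OF hol big] by blast
  define a where "a = L * (- (2 * of_real pi * \<i>)) ^ ?k"
  define F where "F x = f x - a * poly (tangent_poly ?k) (qden x)" for x
  have F: "tangent_like ?k F"
    unfolding F_def by (intro tangent_like_diff Suc.prems tangent_like_tangent_poly) simp
  have "((\<lambda>x. x ^ ?k * f x - a * (x ^ ?k * poly (tangent_poly ?k) (qden x))) \<longlongrightarrow> L - a * (- 1 / (2 * of_real pi * \<i>)) ^ ?k) (at 0)"
    by (intro tendsto_intros lim poly_qden_tendsto) simp
  moreover have "L - a * (- 1 / (2 * of_real pi * \<i>)) ^ ?k = 0"
  proof -
    have "(- (2 * of_real pi * \<i>)) ^ ?k * (- 1 / (2 * of_real pi * \<i>)) ^ ?k = (1 :: complex)"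
      by (subst power_mult_distrib[symmetric]) simp
    then show ?thesis by (simp add: a_def mult.assoc del: power_Suc)
  qed
  ultimately have limF: "((\<lambda>x. x ^ ?k * F x) \<longlongrightarrow> 0) (at 0)" by (simp add: F_def algebra_simps del: power_Suc tangent_poly.simps)
  have "F \<in> O[at 0](\<lambda>x. 1 / x ^ Suc K)"
    by (rule tendsto_zero_imp_bigo[OF _ _ limF]) (use F in \<open>auto simp: tangent_like_def\<close>)
  then have "tangent_like (Suc K) F" using F unfolding tangent_like_def by blast
  from Suc.IH[OF this] obtain c where c: "\<And>x. x \<notin> \<int> \<Longrightarrow> F x = (\<Sum>j\<in>{2..Suc K}. c j * poly (tangent_poly j) (qden x))" by blast
  have "f x = (\<Sum>j\<in>{2..?k}. (c(?k := a)) j * poly (tangent_poly j) (qden x))" if "x \<notin> \<int>" for x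
  proof -
    have "{2..?k} = insert ?k {2..Suc K}" by auto
    moreover have "(\<Sum>j\<in>{2..Suc K}. (c(?k := a)) j * poly (tangent_poly j) (qden x)) = (\<Sum>j\<in>{2..Suc K}. c j * poly (tangent_poly j) (qden x))"
      by (rule sum.cong) auto
    ultimately show ?thesis using c[OF that] by (simp add: F_def algebra_simps del: tangent_poly.simps)
  qed
  then show ?case by blast
qed

subsection \<open>Multitangent functions\<close>

text \<open>The integers with absolute value at most \<open>M\<close>, in decreasing order. The
  truncation sets of the theorem use a strict inequality, hence the shift by \<open>Suc\<close> when
  the two are compared.\<close>

definition desc_ints :: "nat \<Rightarrow> int list" where
  "desc_ints M = map (\<lambda>m. int m + 1) (rev [0..<M]) @ 0 # map (\<lambda>m. - (int m + 1)) [0..<M]"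

text \<open>
  The sum is split according to the position of the point \<open>n = 0\<close>, the only one that may be close to \<open>-x\<close>.
\<close>

definition multitangent :: "nat list \<Rightarrow> complex \<Rightarrow> complex" where
  "multitangent ks x = (\<Sum>i\<le>length ks. half_tangent 1 (take i ks) x *
     (half_tangent (-1) (rev (drop i ks)) x +
      (if i < length ks then 1 / x ^ (ks ! i) * half_tangent (-1) (rev (drop (Suc i) ks)) x else 0)))"

lemma half_tangent_Nil [simp]: "half_tangent s [] x = 1"
  by (simp add: half_tangent_def)

lemma multitangent_Nil [simp]: "multitangent [] x = 1"
  by (simp add: multitangent_def)

text \<open>A decreasing chain has a positive part, possibly the point 0, and a negative part. For
  the negative part the list and the word are reversed together, which brings it into the
  outermost-first form.\<close>

lemma chain_sum_desc_ints:
  "chain_sum F (desc_ints M) ks = (\<Sum>i\<le>length ks. chain_sum (\<lambda>k m. F k (int m + 1)) (rev [0..<M]) (take i ks) *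
     (chain_sum (\<lambda>k m. F k (- (int m + 1))) (rev [0..<M]) (rev (drop i ks)) +
      (if i < length ks then F (ks ! i) 0 * chain_sum (\<lambda>k m. F k (- (int m + 1))) (rev [0..<M]) (rev (drop (Suc i) ks)) else 0)))"
proof -
  have A: "chain_sum F (0 # ys) (drop i ks) = chain_sum F ys (drop i ks) +
      (if i < length ks then F (ks ! i) 0 * chain_sum F ys (drop (Suc i) ks) else 0)" for ys i
    by (cases "i < length ks") (simp_all flip: Cons_nth_drop_Suc)
  have B: "chain_sum F (map (\<lambda>m. - (int m + 1)) [0..<M]) ls = chain_sum (\<lambda>k m. F k (- (int m + 1))) (rev [0..<M]) (rev ls)" for ls
    unfolding chain_sum_map by (rule chain_sum_rev[symmetric])
  show ?thesis
    by (simp only: desc_ints_def chain_sum_append A B chain_sum_map[of F "\<lambda>m. int m + 1"])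
qed

lemma multitangent_lim:
  assumes "\<forall>k\<in>set ks. k \<ge> 2" "x \<notin> \<int>"
  shows "(\<lambda>M. chain_sum (\<lambda>k n. 1 / (x + of_int n) ^ k) (desc_ints M) ks) \<longlonglongrightarrow> multitangent ks x"
proof -
  have 1: "(\<lambda>M. chain_sum (\<lambda>k m. 1 / (x + of_int (int m + 1)) ^ k) (rev [0..<M]) ls) \<longlonglongrightarrow> half_tangent 1 ls x"
   and 2: "(\<lambda>M. chain_sum (\<lambda>k m. 1 / (x + of_int (- (int m + 1))) ^ k) (rev [0..<M]) ls) \<longlonglongrightarrow> half_tangent (-1) ls x"
    if "set ls \<subseteq> set ks" for ls
    using half_tangent_lim[of 1 ls x] half_tangent_lim[of "-1" ls x] assms that by (auto simp: subset_iff)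
  show ?thesis unfolding chain_sum_desc_ints multitangent_def
  proof (intro tendsto_sum tendsto_mult tendsto_add 1 2)
    fix i
    show "(\<lambda>M. if i < length ks then 1 / (x + of_int 0) ^ (ks ! i) * chain_sum (\<lambda>k m. 1 / (x + of_int (- (int m + 1))) ^ k) (rev [0..<M]) (rev (drop (Suc i) ks)) else 0)
      \<longlonglongrightarrow> (if i < length ks then 1 / x ^ (ks ! i) * half_tangent (-1) (rev (drop (Suc i) ks)) x else 0)"
      using tendsto_mult[OF tendsto_const[of "1 / x ^ (ks ! i)"] 2[of "rev (drop (Suc i) ks)"]]
      by (auto simp: set_drop_subset)
  qed (auto simp: set_take_subset set_drop_subset)
qed

lemma inverse_shift_tendsto_0:
  fixes x :: complex
  assumes "k \<ge> 2" "x \<notin> \<int>" "s\<^sup>2 = 1"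
  shows "(\<lambda>M. 1 / (x + of_int (s * (int M + 1))) ^ k) \<longlonglongrightarrow> 0"
proof -
  obtain \<delta> where d: "\<delta> > 0" "cball x \<delta> \<subseteq> -\<int>" "\<And>y n. y \<in> cball x \<delta> \<Longrightarrow> norm (y + of_int n) \<ge> \<delta>"
    using away_from_Ints[OF assms(2)] by blast
  have "norm (1 / (x + of_int (s * (int m + 1))) ^ k) \<le> (2 + (2 * (norm x)\<^sup>2 + 1) / \<delta>\<^sup>2) * (1 / \<delta>) ^ (k - 2) / (1 + (of_nat m + 1)\<^sup>2)" for m
    by (rule half_term_le[of s "[k]"]) (use assms d(1) d(3)[of x] in \<open>auto simp del: of_int_mult\<close>)
  then show ?thesis
    using summable_LIMSEQ_zero[OF summable_inverse_one_plus_square[of "(2 + (2 * (norm x)\<^sup>2 + 1) / \<delta>\<^sup>2) * (1 / \<delta>) ^ (k - 2)"]]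
    by (rule Lim_null_comparison[OF always_eventually[OF allI]])
qed

text \<open>The window [-M, M] and its translate by 1 differ in one point at each end. Adding the
  missing end points makes the two lists equal, and the terms at these points tend to 0.\<close>

lemma multitangent_periodic:
  assumes ks: "\<forall>k\<in>set ks. k \<ge> 2" and x: "x \<notin> \<int>"
  shows "multitangent ks (x + 1) = multitangent ks x"
proof (cases "ks = []")
  case False
  define F where "F = (\<lambda>k n. 1 / (x + of_int n) ^ k)"
  define L where "L M = map (\<lambda>n. n + 1) (desc_ints M)" for M
  have x1: "x + 1 \<notin> \<int>" using x by (metis Ints_1 Ints_diff add_diff_cancel_right')
  have L: "(\<lambda>M. chain_sum F (L M) ls) \<longlonglongrightarrow> multitangent ls (x + 1)" if "\<forall>k\<in>set ls. k \<ge> 2" for ls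
    using multitangent_lim[OF that x1] by (simp add: L_def chain_sum_map F_def add_ac)
  have D: "(\<lambda>M. chain_sum F (desc_ints M) ls) \<longlonglongrightarrow> multitangent ls x" if "\<forall>k\<in>set ls. k \<ge> 2" for ls
    using multitangent_lim[OF that x] by (simp add: F_def)
  have lists: "L M @ [- int M] = (int M + 1) # desc_ints M" for M
  proof -
    have 1: "map (\<lambda>m. int m + 2) (rev [0..<M]) @ [1] = (int M + 1) # map (\<lambda>m. int m + 1) (rev [0..<M])"
      by (induction M) auto
    have 2: "map (\<lambda>m. - int m) [0..<M] @ [- int M] = 0 # map (\<lambda>m. - (int m + 1)) [0..<M]"
      by (induction M) auto
    have "L M @ [- int M] = (map (\<lambda>m. int m + 2) (rev [0..<M]) @ [1]) @ (map (\<lambda>m. - int m) [0..<M] @ [- int M])"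
      by (simp add: L_def desc_ints_def o_def add.commute)
    also have "\<dots> = (int M + 1) # desc_ints M"
      unfolding 1 2 desc_ints_def by simp
    finally show ?thesis .
  qed
  obtain ls k where lsk: "ks = ls @ [k]" using False by (cases ks rule: rev_cases) auto
  obtain k' ls' where lsk': "ks = k' # ls'" using False by (cases ks) auto
  have k2: "k \<ge> 2" "\<forall>k\<in>set ls. k \<ge> 2" using ks unfolding lsk by auto
  have k2': "k' \<ge> 2" "\<forall>k\<in>set ls'. k \<ge> 2" using ks unfolding lsk' by auto
  have F1: "(\<lambda>M. F k (- int M)) \<longlonglongrightarrow> 0"
  proof (rule LIMSEQ_imp_Suc)
    show "(\<lambda>M. F k (- int (Suc M))) \<longlonglongrightarrow> 0"
      using inverse_shift_tendsto_0[of k x "-1"] k2 x by (simp add: F_def algebra_simps)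
  qed
  have F2: "(\<lambda>M. F k' (int M + 1)) \<longlonglongrightarrow> 0"
    using inverse_shift_tendsto_0[of k' x 1] k2' x by (simp add: F_def)
  have "(\<lambda>M. chain_sum F (L M @ [- int M]) ks) \<longlonglongrightarrow> multitangent ks (x + 1) + 0 * multitangent ls (x + 1)"
    unfolding lsk chain_sum_snoc using ks lsk by (intro tendsto_intros F1 L k2) auto
  moreover have "(\<lambda>M. chain_sum F (L M @ [- int M]) ks) \<longlonglongrightarrow> multitangent ks x + 0 * multitangent ls' x"
    unfolding lists lsk' chain_sum.simps using ks lsk' by (intro tendsto_intros F2 D k2') auto
  ultimately show ?thesis using LIMSEQ_unique by fastforce
qed simp

lemma multitangent_holomorphic:
  assumes "\<forall>k\<in>set ks. k \<ge> 2"
  shows "multitangent ks holomorphic_on -\<int>"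
proof -
  have h: "half_tangent s ls holomorphic_on -\<int>" if "set ls \<subseteq> set ks" "s = 1 \<or> s = -1" for s ls
    by (rule half_tangent_holomorphic) (use assms that in auto)
  have "(\<lambda>x. \<Sum>i\<le>length ks. half_tangent 1 (take i ks) x *
     (half_tangent (-1) (rev (drop i ks)) x +
      (if i < length ks then 1 / x ^ (ks ! i) * half_tangent (-1) (rev (drop (Suc i) ks)) x else 0))) holomorphic_on -\<int>"
  proof (intro holomorphic_intros h)
    fix i
    show "(\<lambda>x. if i < length ks then 1 / x ^ (ks ! i) * half_tangent (-1) (rev (drop (Suc i) ks)) x else 0) holomorphic_on -\<int>"
      by (cases "i < length ks") (auto intro!: holomorphic_intros h dest: in_set_dropD)
  qed (auto simp: set_take_subset set_drop_subset)
  then show ?thesis by (simp add: multitangent_def[abs_def])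
qed

lemma half_tangent_bigo:
  assumes "\<forall>k\<in>set ks. k \<ge> 2" "s\<^sup>2 = 1"
  shows "half_tangent s ks \<in> O[at 0](\<lambda>_. 1)"
proof (rule bigoI)
  have "eventually (\<lambda>x::complex. norm x < 1 / 2) (at 0)"
    using eventually_at_ball'[of "1/2" "0::complex" UNIV] by (auto elim: eventually_mono)
  then show "eventually (\<lambda>x. norm (half_tangent s ks x) \<le> half_bound (1/2) (1/2) ks * norm (1::complex)) (at 0)"
    by eventually_elim (use half_tangent_near_zero[OF assms(2,1)] in auto)
qed

lemma inverse_power_bigo: "j \<le> K \<Longrightarrow> (\<lambda>x::complex. 1 / x ^ j) \<in> O[at 0](\<lambda>x. 1 / x ^ K)"
proof (rule bigoI)
  assume jK: "j \<le> K"
  have "eventually (\<lambda>x::complex. norm x < 1 \<and> x \<noteq> 0) (at 0)"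
    using eventually_at_ball'[of "1" "0::complex" UNIV] by (auto elim: eventually_mono)
  then show "eventually (\<lambda>x::complex. norm (1 / x ^ j) \<le> 1 * norm (1 / x ^ K)) (at 0)"
  proof eventually_elim
    case (elim x)
    then have "norm x ^ K \<le> norm x ^ j" using jK by (intro power_decreasing) auto
    then show ?case using elim by (simp add: norm_divide norm_power frac_le)
  qed
qed

text \<open>Half sums are bounded near 0, and at most one point of a strictly decreasing chain can
  be 0. So the pole order is governed by the largest entry and not by the weight; this is what makes
  rows with several points drop in weight.\<close>

lemma multitangent_bigo:
  assumes ks: "\<forall>k\<in>set ks. k \<ge> 2" and K: "\<forall>k\<in>set ks. k \<le> K"
  shows "multitangent ks \<in> O[at 0](\<lambda>x. 1 / x ^ K)"
proof -
  have h: "half_tangent s ls \<in> O[at 0](\<lambda>_. 1)" if "set ls \<subseteq> set ks" "s = 1 \<or> s = -1" for s ls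
    by (rule half_tangent_bigo) (use assms that in auto)
  have one: "(\<lambda>_. 1) \<in> O[at 0](\<lambda>x::complex. 1 / x ^ K)"
    using inverse_power_bigo[of 0 K] by simp
  have "(\<lambda>x. \<Sum>i\<le>length ks. half_tangent 1 (take i ks) x *
     (half_tangent (-1) (rev (drop i ks)) x +
      (if i < length ks then 1 / x ^ (ks ! i) * half_tangent (-1) (rev (drop (Suc i) ks)) x else 0))) \<in> O[at 0](\<lambda>x. 1 / x ^ K)"
  proof (rule big_sum_in_bigo)
    fix i
    have "(\<lambda>x. if i < length ks then 1 / x ^ (ks ! i) * half_tangent (-1) (rev (drop (Suc i) ks)) x else 0) \<in> O[at 0](\<lambda>x. 1 / x ^ K)"
    proof (cases "i < length ks")
      case True
      have "(\<lambda>x. 1 / x ^ (ks ! i) * half_tangent (-1) (rev (drop (Suc i) ks)) x) \<in> O[at 0](\<lambda>x. 1 / x ^ K * 1)"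
        by (intro landau_o.big.mult inverse_power_bigo h) (use True K in \<open>auto simp: set_drop_subset\<close>)
      then show ?thesis using True by simp
    qed simp
    moreover have "half_tangent (-1) (rev (drop i ks)) \<in> O[at 0](\<lambda>x. 1 / x ^ K)"
      by (rule landau_o.big_trans[OF h one]) (auto simp: set_drop_subset)
    ultimately have "(\<lambda>x. half_tangent 1 (take i ks) x *
     (half_tangent (-1) (rev (drop i ks)) x +
      (if i < length ks then 1 / x ^ (ks ! i) * half_tangent (-1) (rev (drop (Suc i) ks)) x else 0))) \<in> O[at 0](\<lambda>x. 1 * (1 / x ^ K))"
      by (intro landau_o.big.mult h sum_in_bigo) (auto simp: set_take_subset)
    then show "(\<lambda>x. half_tangent 1 (take i ks) x *
     (half_tangent (-1) (rev (drop i ks)) x +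
      (if i < length ks then 1 / x ^ (ks ! i) * half_tangent (-1) (rev (drop (Suc i) ks)) x else 0))) \<in> O[at 0](\<lambda>x. 1 / x ^ K)" by simp
  qed
  then show ?thesis by (simp add: multitangent_def[abs_def])
qed

lemma multitangent_single_limit:
  assumes "k \<ge> 2"
  shows "((\<lambda>x. x ^ k * multitangent [k] x) \<longlongrightarrow> 1) (at 0)"
proof -
  have z: "((\<lambda>x. x ^ k * half_tangent s [k] x) \<longlongrightarrow> 0) (at 0)" if "s = 1 \<or> s = -1" for s
  proof -
    have "(\<lambda>x. x ^ k * half_tangent s [k] x) \<in> o[at 0](\<lambda>_. 1 * 1 :: complex)"
    proof (rule landau_o.small_big_mult)
      have "((\<lambda>x::complex. x ^ k) \<longlongrightarrow> 0 ^ k) (at 0)" by (intro tendsto_intros)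
      then show "(\<lambda>x::complex. x ^ k) \<in> o[at 0](\<lambda>_. 1)" using assms by (intro smalloI_tendsto) (simp_all add: power_0_left)
      show "half_tangent s [k] \<in> O[at 0](\<lambda>_. 1)" by (rule half_tangent_bigo) (use assms that in auto)
    qed
    from smalloD_tendsto[OF this] show ?thesis by simp
  qed
  have "((\<lambda>x. 1 + x ^ k * half_tangent 1 [k] x + x ^ k * half_tangent (-1) [k] x) \<longlongrightarrow> 1 + 0 + 0) (at 0)"
    by (intro tendsto_intros z) auto
  moreover have "eventually (\<lambda>x. 1 + x ^ k * half_tangent 1 [k] x + x ^ k * half_tangent (-1) [k] x = x ^ k * multitangent [k] x) (at 0)"
    unfolding eventually_at_filter
  proof (intro always_eventually allI impI)
    fix x :: complex assume "x \<noteq> 0"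
    have "multitangent [k] x = half_tangent (-1) [k] x + 1 / x ^ k + half_tangent 1 [k] x"
      by (simp add: multitangent_def)
    then show "1 + x ^ k * half_tangent 1 [k] x + x ^ k * half_tangent (-1) [k] x = x ^ k * multitangent [k] x"
      using \<open>x \<noteq> 0\<close> by (simp add: ring_distribs)
  qed
  ultimately show ?thesis using Lim_transform_eventually by fastforce
qed

lemma half_tangent_bounded_strip:
  assumes ks: "\<forall>k\<in>set ks. k \<ge> 2" "s\<^sup>2 = 1"
  obtains C where "\<And>x. 0 \<le> Re x \<Longrightarrow> Re x \<le> 1 \<Longrightarrow> 1 / 2 \<le> \<bar>Im x\<bar> \<Longrightarrow> norm (half_tangent s ks x) \<le> C"
proof
  fix x assume x: "0 \<le> Re x" "Re x \<le> 1" "1 / 2 \<le> \<bar>Im x\<bar>"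
  define Y where "Y = \<bar>Im x\<bar>"
  have Y: "Y \<ge> 1 / 2" using x by (simp add: Y_def)
  have "norm x \<le> 1 + Y" using cmod_le[of x] x by (simp add: Y_def)
  moreover have "norm (x + of_int n) \<ge> Y" for n using abs_Im_le_cmod[of "x + of_int n"] by (simp add: Y_def)
  ultimately have "norm (half_tangent s ks x) \<le> half_bound (1 + Y) Y ks"
    using Y assms by (intro half_tangent_norm_le) (auto simp del: of_int_mult)
  \<comment> \<open>For Y at least 1/2 one has (1+Y)^2 <= 9 Y^2 and 1 <= 4 Y^2, so the first factor
    is at most 2 + 18 + 4 = 24; and 1/Y is at most 2.\<close>
  also have "\<dots> \<le> (\<Prod>k\<leftarrow>ks. suminf (\<lambda>m. 24 * 2 ^ (k - 2) / (1 + (of_nat m + 1)\<^sup>2)))"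
    unfolding half_bound_def
  proof (rule prod_list_mono, rule conjI)
    fix k
    have "(1 + Y)\<^sup>2 \<le> (3 * Y)\<^sup>2" using Y by (intro power_mono) auto
    moreover have "(1/2)\<^sup>2 \<le> Y\<^sup>2" using Y by (intro power_mono) auto
    ultimately have "2 * (1 + Y)\<^sup>2 + 1 \<le> 22 * Y\<^sup>2" by (simp add: power_mult_distrib power_divide)
    then have 1: "2 + (2 * (1 + Y)\<^sup>2 + 1) / Y\<^sup>2 \<le> 24" using Y by (simp add: field_simps)
    have 2: "(1 / Y) ^ (k - 2) \<le> 2 ^ (k - 2)" using Y by (intro power_mono) (auto simp: field_simps)
    have nn: "0 \<le> 2 + (2 * (1 + Y)\<^sup>2 + 1) / Y\<^sup>2" using Y by (auto intro!: add_nonneg_nonneg divide_nonneg_nonneg)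
    show "0 \<le> suminf (\<lambda>m. (2 + (2 * (1 + Y)\<^sup>2 + 1) / Y\<^sup>2) * (1 / Y) ^ (k - 2) / (1 + (of_nat m + 1)\<^sup>2))"
      using nn Y by (intro suminf_nonneg summable_inverse_one_plus_square) (auto intro!: divide_nonneg_nonneg mult_nonneg_nonneg)
    have "(2 + (2 * (1 + Y)\<^sup>2 + 1) / Y\<^sup>2) * (1 / Y) ^ (k - 2) \<le> 24 * 2 ^ (k - 2)"
      using Y by (intro mult_mono[OF 1 2]) auto
    then show "suminf (\<lambda>m. (2 + (2 * (1 + Y)\<^sup>2 + 1) / Y\<^sup>2) * (1 / Y) ^ (k - 2) / (1 + (of_nat m + 1)\<^sup>2))
      \<le> suminf (\<lambda>m. 24 * 2 ^ (k - 2) / (1 + (of_nat m + 1)\<^sup>2))"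
      by (intro suminf_le summable_inverse_one_plus_square divide_right_mono) auto
  qed
  finally show "norm (half_tangent s ks x) \<le> (\<Prod>k\<leftarrow>ks. suminf (\<lambda>m. 24 * 2 ^ (k - 2) / (1 + (of_nat m + 1)\<^sup>2)))" .
qed

lemma multitangent_bounded_strip:
  assumes ks: "\<forall>k\<in>set ks. k \<ge> 2"
  shows "\<exists>C. \<forall>x. 0 \<le> Re x \<longrightarrow> Re x \<le> 1 \<longrightarrow> 1 / 2 \<le> \<bar>Im x\<bar> \<longrightarrow> norm (multitangent ks x) \<le> C"
proof -
  define P where "P s ls C \<longleftrightarrow> (\<forall>x. 0 \<le> Re x \<longrightarrow> Re x \<le> 1 \<longrightarrow> 1 / 2 \<le> \<bar>Im x\<bar> \<longrightarrow> norm (half_tangent s ls x) \<le> C)" for s ls C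
  define C where "C s ls = (SOME C. P s ls C)" for s ls
  have C: "norm (half_tangent s ls x) \<le> C s ls"
    if sl: "set ls \<subseteq> set ks" "s = 1 \<or> s = -1" and x: "0 \<le> Re x" "Re x \<le> 1" "1 / 2 \<le> \<bar>Im x\<bar>" for s ls x
  proof -
    have "\<forall>k\<in>set ls. k \<ge> 2" "s\<^sup>2 = 1" using ks sl by auto
    then obtain D where "P s ls D" using half_tangent_bounded_strip[of ls s] unfolding P_def by blast
    then have "P s ls (C s ls)" unfolding C_def by (rule someI)
    then show ?thesis using x unfolding P_def by blast
  qed
  show ?thesis
  proof (intro exI allI impI)
    fix x assume x: "0 \<le> Re x" "Re x \<le> 1" "1 / 2 \<le> \<bar>Im x\<bar>"
    have nx: "norm (1 / x ^ k) \<le> 2 ^ k" for k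
    proof -
      have "1 / 2 \<le> norm x" using abs_Im_le_cmod[of x] x by linarith
      then have "0 < norm x" "1 / norm x \<le> 2" by (linarith, subst pos_divide_le_eq) linarith+
      then have "(1 / norm x) ^ k \<le> 2 ^ k" by (intro power_mono) auto
      then show ?thesis by (simp add: norm_divide norm_power power_one_over)
    qed
    have C1: "norm (half_tangent 1 (take i ks) x) \<le> C 1 (take i ks)" and C2: "norm (half_tangent (-1) (rev (drop i ks)) x) \<le> C (-1) (rev (drop i ks))" for i
      by (rule C; use x in \<open>auto simp: set_take_subset set_drop_subset\<close>)+
    then have nn: "0 \<le> C 1 (take i ks)" "0 \<le> C (-1) (rev (drop i ks))" for i
      by (meson norm_ge_zero order.trans)+
    show "norm (multitangent ks x) \<le> (\<Sum>i\<le>length ks. C 1 (take i ks) * (C (-1) (rev (drop i ks)) + (2 ^ (ks ! i) * C (-1) (rev (drop (Suc i) ks)))))"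
      unfolding multitangent_def norm_mult
    proof (intro order.trans[OF norm_sum] sum_mono)
      fix i
      have "norm (if i < length ks then 1 / x ^ (ks ! i) * half_tangent (-1) (rev (drop (Suc i) ks)) x else 0) \<le> 2 ^ (ks ! i) * C (-1) (rev (drop (Suc i) ks))"
        using mult_mono[OF nx[of "ks ! i"] C2[of "Suc i"]] nn(2)[of "Suc i"] by (auto simp: norm_mult norm_divide)
      then show "norm (half_tangent 1 (take i ks) x *
     (half_tangent (-1) (rev (drop i ks)) x +
      (if i < length ks then 1 / x ^ (ks ! i) * half_tangent (-1) (rev (drop (Suc i) ks)) x else 0)))
        \<le> C 1 (take i ks) * (C (-1) (rev (drop i ks)) + (2 ^ (ks ! i) * C (-1) (rev (drop (Suc i) ks))))"
        unfolding norm_mult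
        by (intro mult_mono C1 order.trans[OF norm_triangle_ineq] add_mono C2 nn norm_ge_zero)
    qed
  qed
qed

text \<open>Each entry contributes a factor 2/|Y|: the squares are compared with the telescoping
  terms 2/((m+y)(m+1+y)), whose sum is 2/y. Here decay is needed, while the strip estimate only
  gives boundedness.\<close>

lemma half_tangent_imag_le:
  assumes ks: "\<forall>k\<in>set ks. k \<ge> 2" "s\<^sup>2 = 1" and Y: "\<bar>Y\<bar> \<ge> 1"
  shows "norm (half_tangent s ks (\<i> * of_real Y)) \<le> (2 / \<bar>Y\<bar>) ^ length ks"
proof -
  define y where "y = \<bar>Y\<bar>"
  define B where "B = (\<lambda>m::nat. - 2 / (of_nat (Suc m) + y) - (- 2 / (of_nat m + y)))"
  have "(\<lambda>m::nat. - 2 / (of_nat m + y)) \<longlonglongrightarrow> 0" by real_asymp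
  from telescope_sums[OF this] have sums: "B sums (2 / y)"
    by (simp add: B_def)
  have "norm (half_tangent s ks (\<i> * of_real Y)) \<le> (\<Prod>k\<leftarrow>ks. suminf B)"
    unfolding half_tangent_def
  proof (rule norm_lim_chain_sum_le)
    fix k m assume k: "k \<in> set ks"
    define a where "a = norm (\<i> * of_real Y + of_int (s * (int m + 1)) :: complex)"
    have "(real_of_int (s * (int m + 1)))\<^sup>2 = (of_nat m + 1)\<^sup>2"
      using assms by (simp add: power_mult_distrib flip: of_int_power)
    then have a2: "a\<^sup>2 = (of_nat m + 1)\<^sup>2 + y\<^sup>2" unfolding a_def y_def cmod_power2 by simp
    have y1: "y \<ge> 1" using Y by (simp add: y_def)
    have "1 \<le> y\<^sup>2" using y1 by simp
    then have "1\<^sup>2 \<le> a\<^sup>2" unfolding a2 by (simp add: add_increasing)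
    then have a1: "a \<ge> 1" by (rule power2_le_imp_le) (simp add: a_def)
    have "norm (1 / (\<i> * of_real Y + of_int (s * (int m + 1))) ^ k) = (1 / a) ^ k"
      by (simp add: a_def norm_divide norm_power power_one_over)
    also have "\<dots> \<le> (1 / a) ^ 2" using ks(1) k a1 by (intro power_decreasing) auto
    also have "\<dots> = 1 / ((of_nat m + 1)\<^sup>2 + y\<^sup>2)" unfolding power_one_over a2 ..
    also have "\<dots> \<le> 2 / ((of_nat m + y) * (of_nat (Suc m) + y))"
    proof -
      have "(of_nat m + y) * (of_nat (Suc m) + y) \<le> (of_nat m + 1 + y) * (of_nat m + 1 + y)"
        using y1 by (intro mult_mono) auto
      also have "\<dots> \<le> 2 * ((of_nat m + 1)\<^sup>2 + y\<^sup>2)"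
        using zero_le_power2[of "of_nat m + 1 - y"] by (simp add: power2_eq_square algebra_simps)
      finally have *: "(of_nat m + y) * (of_nat (Suc m) + y) \<le> 2 * ((of_nat m + 1)\<^sup>2 + y\<^sup>2)" .
      have "0 < (of_nat m + y) * (of_nat (Suc m) + y)" using y1 by (intro mult_pos_pos) auto
      moreover have "0 < (of_nat m + 1)\<^sup>2 + y\<^sup>2" using y1 by (intro add_nonneg_pos) auto
      ultimately show ?thesis using * by (simp add: pos_divide_le_eq pos_le_divide_eq mult.commute)
    qed
    also have "\<dots> = B m" using y1 by (simp add: B_def divide_simps add_pos_nonneg)
    finally show "norm (1 / (\<i> * of_real Y + of_int (s * (int m + 1))) ^ k) \<le> B m" .
  qed (use sums in \<open>auto simp: sums_iff\<close>)
  also have "\<dots> = (2 / \<bar>Y\<bar>) ^ length ks" 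
  proof -
    have "(\<Prod>k\<leftarrow>ks. c) = c ^ length ks" for c :: real by (induction ks) auto
    then show ?thesis using sums by (simp add: sums_iff y_def)
  qed
  finally show ?thesis .
qed

lemma multitangent_imag_le:
  assumes ks: "\<forall>k\<in>set ks. k \<ge> 2" "ks \<noteq> []" and Y: "\<bar>Y\<bar> \<ge> 2"
  shows "norm (multitangent ks (\<i> * of_real Y)) \<le> real (Suc (length ks)) * (3 / \<bar>Y\<bar>)"
proof -
  have H: "norm (half_tangent s ls (\<i> * of_real Y)) \<le> 1" 
    "ls \<noteq> [] \<Longrightarrow> norm (half_tangent s ls (\<i> * of_real Y)) \<le> 2 / \<bar>Y\<bar>" if "set ls \<subseteq> set ks" "s = 1 \<or> s = -1" for s ls
  proof -
    have 1: "norm (half_tangent s ls (\<i> * of_real Y)) \<le> (2 / \<bar>Y\<bar>) ^ length ls"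
      by (rule half_tangent_imag_le) (use assms that in auto)
    also have "\<dots> \<le> 1" using Y by (intro power_le_one) auto
    finally show "norm (half_tangent s ls (\<i> * of_real Y)) \<le> 1" .
    assume "ls \<noteq> []"
    then have "(2 / \<bar>Y\<bar>) ^ length ls \<le> (2 / \<bar>Y\<bar>) ^ 1" using Y by (intro power_decreasing) (auto simp: Suc_le_eq)
    with 1 show "norm (half_tangent s ls (\<i> * of_real Y)) \<le> 2 / \<bar>Y\<bar>" by simp
  qed
  have H1: "norm (half_tangent 1 (take i ks) (\<i> * of_real Y)) \<le> 1" and
       H2: "norm (half_tangent (-1) (rev (drop i ks)) (\<i> * of_real Y)) \<le> 1" for i
    by (rule H; auto simp: set_take_subset set_drop_subset)+
  have "norm (multitangent ks (\<i> * of_real Y)) \<le> (\<Sum>i\<le>length ks. 3 / \<bar>Y\<bar>)"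
    unfolding multitangent_def
  proof (intro order.trans[OF norm_sum] sum_mono)
    fix i
    let ?a = "half_tangent 1 (take i ks) (\<i> * of_real Y)" and ?b = "half_tangent (-1) (rev (drop i ks)) (\<i> * of_real Y)"
    let ?c = "if i < length ks then 1 / (\<i> * of_real Y) ^ (ks ! i) * half_tangent (-1) (rev (drop (Suc i) ks)) (\<i> * of_real Y) else 0"
    \<comment> \<open>The word is not empty, so at least one of the two half sums belongs to a
      nonempty word and decays: the right one for i = 0, the left one otherwise.\<close>
    have ab: "norm ?a * norm ?b \<le> 2 / \<bar>Y\<bar>"
    proof (cases "i = 0")
      case True
      then have "norm ?b \<le> 2 / \<bar>Y\<bar>" using ks by (intro H) auto
      then show ?thesis using mult_mono[OF H1[of i], of "norm ?b" "2 / \<bar>Y\<bar>"] by simp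
    next
      case False
      then have "norm ?a \<le> 2 / \<bar>Y\<bar>" using ks by (intro H) (auto simp: set_take_subset)
      then show ?thesis using mult_mono[OF _ H2[of i], of "norm ?a" "2 / \<bar>Y\<bar>"] by simp
    qed
    have c: "norm ?c \<le> 1 / \<bar>Y\<bar>"
    proof (cases "i < length ks")
      case True
      then have "ks ! i \<ge> 2" using ks by auto
      then have "(1 / \<bar>Y\<bar>) ^ (ks ! i) \<le> (1 / \<bar>Y\<bar>) ^ 1" using Y by (intro power_decreasing) auto
      then have "(1 / \<bar>Y\<bar>) ^ (ks ! i) * norm (half_tangent (-1) (rev (drop (Suc i) ks)) (\<i> * of_real Y)) \<le> 1 / \<bar>Y\<bar> * 1"
        by (intro mult_mono H2) auto
      then show ?thesis using True by (simp add: norm_mult norm_divide norm_power power_one_over power_mult_distrib)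
    qed simp
    have gen: "norm (u * (v + w)) \<le> norm u * norm v + norm u * norm w" for u v w :: complex
      using norm_triangle_ineq[of "u * v" "u * w"] by (simp add: distrib_left norm_mult)
    have "norm (?a * (?b + ?c)) \<le> norm ?a * norm ?b + norm ?a * norm ?c"
      by (rule gen)
    also have "\<dots> \<le> 2 / \<bar>Y\<bar> + 1 * (1 / \<bar>Y\<bar>)" by (intro add_mono ab mult_mono H1 c) auto
    finally show "norm (?a * (?b + ?c)) \<le> 3 / \<bar>Y\<bar>" by simp
  qed
  then show ?thesis by simp
qed

lemma multitangent_tangent_like:
  assumes ks: "\<forall>k\<in>set ks. k \<ge> 2" "ks \<noteq> []" and K: "\<forall>k\<in>set ks. k \<le> K"
  shows "tangent_like K (multitangent ks)"
proof -
  have "((\<lambda>Y. multitangent ks (\<i> * of_real Y)) \<longlongrightarrow> 0) at_top"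
  proof (rule Lim_null_comparison)
    show "((\<lambda>Y. real (Suc (length ks)) * (3 / \<bar>Y\<bar>)) \<longlongrightarrow> 0) at_top" by real_asymp
    show "eventually (\<lambda>Y. norm (multitangent ks (\<i> * of_real Y)) \<le> real (Suc (length ks)) * (3 / \<bar>Y\<bar>)) at_top"
      using eventually_ge_at_top[of 2] by eventually_elim (rule multitangent_imag_le, use ks in auto)
  qed
  moreover have "((\<lambda>Y. multitangent ks (\<i> * of_real Y)) \<longlongrightarrow> 0) at_bot"
  proof (rule Lim_null_comparison)
    show "((\<lambda>Y. real (Suc (length ks)) * (3 / \<bar>Y\<bar>)) \<longlongrightarrow> 0) at_bot" by real_asymp
    show "eventually (\<lambda>Y. norm (multitangent ks (\<i> * of_real Y)) \<le> real (Suc (length ks)) * (3 / \<bar>Y\<bar>)) at_bot"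
      using eventually_le_at_bot[of "-2"] by eventually_elim (rule multitangent_imag_le, use ks in auto)
  qed
  ultimately show ?thesis
    unfolding tangent_like_def using multitangent_bounded_strip[OF ks(1)] multitangent_bigo[OF ks(1) K]
      multitangent_holomorphic[OF ks(1)] multitangent_periodic[OF ks(1)] by blast
qed

text \<open>For a single entry the coefficient of top weight is read off from the pole 1/x^k. With
  two or more entries, each is at least 2, so the largest is at most the weight minus 2; the pole
  order then stays below the weight and no top term occurs.\<close>

lemma multitangent_expansion:
  assumes ks: "\<forall>k\<in>set ks. k \<ge> 2" "ks \<noteq> []"
  shows "\<exists>c. \<forall>x. x \<notin> \<int> \<longrightarrow> multitangent ks x =
    (if length ks = 1 then (- (2 * of_real pi * \<i>)) ^ sum_list ks * poly (tangent_poly (sum_list ks)) (qden x) else 0)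
     + (\<Sum>j\<in>{2..<sum_list ks}. c j * poly (tangent_poly j) (qden x))"
proof (cases "length ks = 1")
  case True
  then obtain k where k: "ks = [k]" by (auto simp: length_Suc_conv)
  have k2: "k \<ge> 2" using ks k by auto
  let ?a = "(- (2 * of_real pi * \<i>)) ^ k :: complex"
  define F where "F x = multitangent [k] x - ?a * poly (tangent_poly k) (qden x)" for x
  have F: "tangent_like k F"
    unfolding F_def by (intro tangent_like_diff multitangent_tangent_like tangent_like_tangent_poly) (use k2 in auto)
  have "((\<lambda>x. x ^ k * multitangent [k] x - ?a * (x ^ k * poly (tangent_poly k) (qden x))) \<longlongrightarrow> 1 - ?a * (- 1 / (2 * of_real pi * \<i>)) ^ k) (at 0)"
    by (intro tendsto_intros multitangent_single_limit poly_qden_tendsto) (use k2 in auto)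
  moreover have "?a * (- 1 / (2 * of_real pi * \<i>)) ^ k = 1"
    by (subst power_mult_distrib[symmetric]) simp
  ultimately have lim: "((\<lambda>x. x ^ k * F x) \<longlongrightarrow> 0) (at 0)" by (simp add: F_def algebra_simps)
  obtain K where K: "k = Suc (Suc K)" using k2 by (metis add_2_eq_Suc le_Suc_ex)
  have "F \<in> O[at 0](\<lambda>x. 1 / x ^ Suc K)"
    by (rule tendsto_zero_imp_bigo) (use F lim K in \<open>auto simp: tangent_like_def\<close>)
  then have "tangent_like (Suc K) F" using F unfolding tangent_like_def by blast
  from tangent_like_expansion[OF this] obtain c where "\<And>x. x \<notin> \<int> \<Longrightarrow> F x = (\<Sum>j\<in>{2..Suc K}. c j * poly (tangent_poly j) (qden x))" by blast
  moreover have "{2..Suc K} = {2..<k}" using K by auto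
  ultimately show ?thesis using k by (intro exI[of _ c]) (simp add: F_def algebra_simps)
next
  case False
  then obtain a b ls where l: "ks = a # b # ls" using ks(2) by (cases ks; cases "tl ks") auto
  have "tangent_like (Suc (sum_list ks - 2)) (multitangent ks)"
  proof (rule multitangent_tangent_like[OF ks], rule ballI)
    fix k assume k: "k \<in> set ks"
    have "a \<ge> 2" "b \<ge> 2" using ks l by auto
    moreover have "k \<le> sum_list ls" if "k \<in> set ls" using that by (intro member_le_sum_list) auto
    ultimately show "k \<le> Suc (sum_list ks - 2)" using k l by auto
  qed
  from tangent_like_expansion[OF this] obtain c where "\<And>x. x \<notin> \<int> \<Longrightarrow> multitangent ks x = (\<Sum>j\<in>{2..Suc (sum_list ks - 2)}. c j * poly (tangent_poly j) (qden x))" by blast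
  moreover have "{2..Suc (sum_list ks - 2)} = {2..<sum_list ks}" using ks l by auto
  ultimately show ?thesis using False by (intro exI[of _ c]) simp
qed

section \<open>Truncated lattice sums and multiple Eisenstein series\<close>

lemma Im_uhp: "Im (complex_of_uhp \<tau>) > 0"
  using complex_of_uhp[of \<tau>] by simp

lemma uhp_multiple_not_Ints: "of_nat (Suc m) * complex_of_uhp \<tau> \<notin> \<int>"
proof
  assume "of_nat (Suc m) * complex_of_uhp \<tau> \<in> \<int>"
  then obtain n where n: "of_nat (Suc m) * complex_of_uhp \<tau> = of_int n" by (auto elim: Ints_cases)
  have "Im (of_nat (Suc m) * complex_of_uhp \<tau>) = real (Suc m) * Im (complex_of_uhp \<tau>)" by simp
  moreover have "\<dots> > 0" using Im_uhp[of \<tau>] by (intro mult_pos_pos) auto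
  ultimately show False unfolding n by simp
qed

text \<open>The positive points of the truncated lattice in decreasing order, with rows 0 to
  \<open>M\<close> included. It matches \<open>lattice_chains (Suc M) (Suc N)\<close>; row 0
  contributes its positive half only.\<close>

primrec lattice_list :: "nat \<Rightarrow> nat \<Rightarrow> (int \<times> int) list" where
  "lattice_list 0 N = map (\<lambda>n. (0, int n + 1)) (rev [0..<N])"
| "lattice_list (Suc M) N = map (Pair (int M + 1)) (desc_ints N) @ lattice_list M N"

lemma set_desc_ints: "set (desc_ints N) = {n. \<bar>n\<bar> < int (Suc N)}"
proof (intro equalityI subsetI)
  fix n assume n: "n \<in> {n. \<bar>n\<bar> < int (Suc N)}"
  consider "n = 0" | "n > 0" | "n < 0" by linarith
  then show "n \<in> set (desc_ints N)"
  proof cases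
    case 2
    then have "n = int (nat n - 1) + 1" "nat n - 1 < N" using n by auto
    then show ?thesis unfolding desc_ints_def by (auto intro!: image_eqI[of _ _ "nat n - 1"])
  next
    case 3
    then have "n = - (int (nat (-n) - 1) + 1)" "nat (-n) - 1 < N" using n by auto
    then show ?thesis unfolding desc_ints_def by (auto intro!: image_eqI[of _ _ "nat (-n) - 1"])
  qed (simp add: desc_ints_def)
qed (auto simp: desc_ints_def)

lemma sorted_desc_ints: "sorted_wrt (>) (desc_ints N)"
proof -
  have "sorted_wrt (\<lambda>m n. int n + 1 < int m + 1) (rev [0..<N])"
    by (induction N) (auto simp: sorted_wrt_append)
  moreover have "sorted_wrt (\<lambda>m n. - (int n + 1) < - (int m + 1)) [0..<N]"
    by (induction N) (auto simp: sorted_wrt_append)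
  ultimately show ?thesis
    unfolding desc_ints_def by (auto simp: sorted_wrt_append sorted_wrt_map)
qed

lemma set_lattice_list:
  "set (lattice_list M N) = {p. \<bar>fst p\<bar> < int (Suc M) \<and> \<bar>snd p\<bar> < int (Suc N) \<and> p \<succ>\<^sub>L (0, 0)}"
proof (induction M)
  case 0
  show ?case
  proof (intro equalityI subsetI)
    fix p assume p: "p \<in> {p. \<bar>fst p\<bar> < int (Suc 0) \<and> \<bar>snd p\<bar> < int (Suc N) \<and> p \<succ>\<^sub>L (0, 0)}"
    then have "p = (0, int (nat (snd p) - 1) + 1)" "nat (snd p) - 1 < N"
      by (cases p; auto simp: lattice_succ_def)+
    then show "p \<in> set (lattice_list 0 N)" by auto
  qed (auto simp: lattice_succ_def)
next
  case (Suc M)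
  show ?case unfolding lattice_list.simps set_append Suc set_map set_desc_ints
    by (auto simp: lattice_succ_def image_iff)
qed

lemma sorted_lattice_list: "sorted_wrt (\<succ>\<^sub>L) (lattice_list M N)"
proof (induction M)
  case 0
  have "sorted_wrt (\<lambda>m n. int n + 1 < int m + 1) (rev [0..<N])"
    by (induction N) (auto simp: sorted_wrt_append)
  then show ?case by (simp add: sorted_wrt_map lattice_succ_def)
next
  case (Suc M)
  have "sorted_wrt (\<succ>\<^sub>L) (map (Pair (int M + 1)) (desc_ints N))"
    using sorted_desc_ints[of N] by (simp add: sorted_wrt_map lattice_succ_def)
  moreover have "x \<succ>\<^sub>L y" if "x \<in> set (map (Pair (int M + 1)) (desc_ints N))" "y \<in> set (lattice_list M N)" for x y
  proof -
    have "fst x = int M + 1" using that(1) by auto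
    moreover have "fst y < int M + 1" using that(2) unfolding set_lattice_list by auto
    ultimately show ?thesis by (simp add: lattice_succ_def)
  qed
  ultimately show ?case using Suc unfolding lattice_list.simps sorted_wrt_append by blast
qed

lemma sum_lattice_chains:
  "(\<Sum>ps\<in>lattice_chains (Suc M) (Suc N) (length ks). 1 / (\<Prod>i<length ks. lattice_pt \<tau> (ps ! i) ^ (ks ! i)))
    = chain_sum (\<lambda>k p. 1 / lattice_pt \<tau> p ^ k) (lattice_list M N) ks"
proof -
  have eq: "lattice_chains (Suc M) (Suc N) (length ks) =
    {ps. length ps = length ks \<and> set ps \<subseteq> set (lattice_list M N) \<and> sorted_wrt (\<succ>\<^sub>L) ps}"
    unfolding lattice_chains_def set_lattice_list by (auto simp: sorted_wrt_append subset_iff)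
  have "(\<Sum>ps\<in>lattice_chains (Suc M) (Suc N) (length ks). 1 / (\<Prod>i<length ks. lattice_pt \<tau> (ps ! i) ^ (ks ! i)))
     = (\<Sum>ps\<in>lattice_chains (Suc M) (Suc N) (length ks). \<Prod>i<length ks. 1 / lattice_pt \<tau> (ps ! i) ^ (ks ! i))"
    by (simp add: prod_dividef)
  also have "\<dots> = chain_sum (\<lambda>k p. 1 / lattice_pt \<tau> p ^ k) (lattice_list M N) ks"
    unfolding eq by (rule sum_chains_eq_chain_sum[OF sorted_lattice_list]) (auto simp: lattice_succ_def)
  finally show ?thesis .
qed

text \<open>The inner limit over \<open>N\<close> with the rows up to \<open>M\<close> kept. The
  index \<open>i\<close> counts the points of a chain in the top row, which form a multitangent; row
  0 yields the multiple zeta value of the word, as a half sum at the argument 0.\<close>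

primrec eis_part :: "uhp \<Rightarrow> nat \<Rightarrow> nat list \<Rightarrow> complex" where
  "eis_part \<tau> 0 ks = half_tangent 1 ks 0"
| "eis_part \<tau> (Suc M) ks = (\<Sum>i\<le>length ks. multitangent (take i ks) (of_nat (Suc M) * complex_of_uhp \<tau>) * eis_part \<tau> M (drop i ks))"

lemma eis_part_lim:
  assumes "\<forall>k\<in>set ks. k \<ge> 2"
  shows "(\<lambda>N. chain_sum (\<lambda>k p. 1 / lattice_pt \<tau> p ^ k) (lattice_list M N) ks) \<longlonglongrightarrow> eis_part \<tau> M ks"
  using assms
proof (induction M arbitrary: ks)
  case 0
  have n1: "1 \<le> norm (of_nat m + 1 :: complex)" for m
    using norm_of_nat[of "Suc m", where ?'a = complex] by (simp add: add.commute)
  \<comment> \<open>\<open>half_tangent_lim\<close> excludes integers. At the argument 0 the half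
    row itself still keeps distance 1, so the uniform statement is applied to the set {0}.\<close>
  have "uniform_limit {0} (\<lambda>M x. chain_sum (\<lambda>k m. 1 / (x + of_int (1 * (int m + 1))) ^ k) (rev [0..<M]) ks)
    (half_tangent 1 ks) sequentially"
    by (rule half_tangent_uniform_limit[of _ _ _ 0 1]) (use 0 n1 in auto)
  then have "(\<lambda>N. chain_sum (\<lambda>k m. 1 / (0 + of_int (1 * (int m + 1))) ^ k) (rev [0..<N]) ks) \<longlonglongrightarrow> half_tangent 1 ks 0"
    by (rule tendsto_uniform_limitI) simp
  then show ?case by (simp add: chain_sum_map lattice_pt_def)
next
  case (Suc M)
  have row: "chain_sum (\<lambda>k p. 1 / lattice_pt \<tau> p ^ k) (map (Pair (int M + 1)) (desc_ints N)) ls =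
     chain_sum (\<lambda>k n. 1 / (of_nat (Suc M) * complex_of_uhp \<tau> + of_int n) ^ k) (desc_ints N) ls" for N ls
    unfolding chain_sum_map by (simp add: lattice_pt_def add.commute)
  show ?case
    unfolding lattice_list.simps eis_part.simps chain_sum_append row
    by (intro tendsto_sum tendsto_mult multitangent_lim Suc.IH uhp_multiple_not_Ints)
      (use Suc.prems in \<open>auto dest: in_set_takeD in_set_dropD\<close>)
qed

lemma mes_eq_lim_eis_part:
  assumes "\<forall>k\<in>set ks. k \<ge> 2"
  shows "mes ks \<tau> = lim (\<lambda>M. eis_part \<tau> M ks)"
proof -
  let ?S = "\<lambda>M N. \<Sum>ps\<in>lattice_chains M N (length ks). 1 / (\<Prod>i<length ks. lattice_pt \<tau> (ps ! i) ^ (ks ! i))"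
  have inner: "lim (\<lambda>N. ?S (Suc M) N) = eis_part \<tau> M ks" for M
  proof (rule limI, rule LIMSEQ_imp_Suc)
    show "(\<lambda>N. ?S (Suc M) (Suc N)) \<longlonglongrightarrow> eis_part \<tau> M ks"
      unfolding sum_lattice_chains by (rule eis_part_lim[OF assms])
  qed
  have "lim (\<lambda>M. lim (\<lambda>N. ?S M N)) = lim (\<lambda>M. lim (\<lambda>N. ?S (Suc M) N))"
  proof -
    \<comment> \<open>A shift of the index preserves the set of limits, and \<open>lim\<close>
      depends on nothing else; so no convergence is required at this point.\<close>
    have "lim f = lim (\<lambda>M. f (Suc M))" for f :: "nat \<Rightarrow> complex"
    proof -
      have "(\<lambda>L. f \<longlonglongrightarrow> L) = (\<lambda>L. (\<lambda>M. f (Suc M)) \<longlonglongrightarrow> L)"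
        by (rule ext) (rule filterlim_sequentially_Suc[symmetric])
      then show ?thesis by (simp add: lim_def)
    qed
    from this[of "\<lambda>M. lim (\<lambda>N. ?S M N)"] show ?thesis .
  qed
  then show ?thesis unfolding mes_def inner .
qed

subsection \<open>Expansion in terms of q-series\<close>

text \<open>The index \<open>m\<close> stands for the multiple m+1 of tau, so this is the sum of
  d^(k-1)/(k-1)! q^((m+1)d) over d > 0 in closed form.\<close>

definition qterm :: "uhp \<Rightarrow> nat \<Rightarrow> nat \<Rightarrow> complex" where
  "qterm \<tau> k m = poly (tangent_poly k) (qden (of_nat (Suc m) * complex_of_uhp \<tau>))"

text \<open>The series g with its outer summation variable truncated to at most
  \<open>M\<close>.\<close>

definition gpart :: "nat list \<Rightarrow> nat \<Rightarrow> uhp \<Rightarrow> complex" where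
  "gpart ks M \<tau> = chain_sum (qterm \<tau>) (rev [0..<M]) ks"

definition good_word :: "nat list \<Rightarrow> bool" where "good_word ks \<longleftrightarrow> (\<forall>k\<in>set ks. k \<ge> 2)"

lemma good_word_simps [simp]: "good_word []" "good_word (k # ks) \<longleftrightarrow> k \<ge> 2 \<and> good_word ks"
  by (auto simp: good_word_def)

text \<open>Linear combinations are formed before the limit in \<open>M\<close>: the recursion over
  rows sums against earlier truncations, so the dependence on \<open>M\<close> has to survive the
  induction. The bound \<open>w\<close> on the weight is strict.\<close>

inductive_set gspace :: "nat \<Rightarrow> (nat \<Rightarrow> uhp \<Rightarrow> complex) set" for w where
  gspace_base: "good_word ls \<Longrightarrow> sum_list ls < w \<Longrightarrow> gpart ls \<in> gspace w"
| gspace_zero: "(\<lambda>M \<tau>. 0) \<in> gspace w"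
| gspace_add: "U \<in> gspace w \<Longrightarrow> V \<in> gspace w \<Longrightarrow> (\<lambda>M \<tau>. U M \<tau> + V M \<tau>) \<in> gspace w"
| gspace_scale: "U \<in> gspace w \<Longrightarrow> (\<lambda>M \<tau>. c * U M \<tau>) \<in> gspace w"

lemma gspace_mono: "U \<in> gspace w \<Longrightarrow> w \<le> w' \<Longrightarrow> U \<in> gspace w'"
  by (induction rule: gspace.induct) (auto intro: gspace.intros)

lemma gspace_sum: "finite A \<Longrightarrow> (\<And>i. i \<in> A \<Longrightarrow> U i \<in> gspace w) \<Longrightarrow> (\<lambda>M \<tau>. \<Sum>i\<in>A. U i M \<tau>) \<in> gspace w"
  by (induction A rule: finite_induct) (auto intro: gspace.intros)

lemma gpart_Cons: "gpart (k # ks) M \<tau> = (\<Sum>m<M. qterm \<tau> k m * gpart ks m \<tau>)"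
  unfolding gpart_def by (rule chain_sum_rev_upt_Cons)

text \<open>Summation against \<open>qterm\<close> prefixes the letter \<open>j\<close> to every
  word, which raises the weight bound by \<open>j\<close>.\<close>

lemma gspace_qterm:
  assumes "U \<in> gspace w" "j \<ge> 2"
  shows "(\<lambda>M \<tau>. \<Sum>m<M. qterm \<tau> j m * U m \<tau>) \<in> gspace (w + j)"
  using assms(1)
proof (induction rule: gspace.induct)
  case (gspace_base ls)
  have "gpart (j # ls) \<in> gspace (w + j)"
    using gspace_base assms(2) by (intro gspace.gspace_base) auto
  then show ?case by (simp add: gpart_Cons[abs_def])
next
  case (gspace_add U V)
  show ?case using gspace.gspace_add[OF gspace_add.IH] by (simp add: algebra_simps sum.distrib)
next
  case (gspace_scale U c)
  have "(\<lambda>M \<tau>. c * (\<Sum>m<M. qterm \<tau> j m * U m \<tau>)) = (\<lambda>M \<tau>. \<Sum>m<M. qterm \<tau> j m * (c * U m \<tau>))"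
    by (simp add: sum_distrib_left mult.left_commute)
  then show ?case using gspace.gspace_scale[OF gspace_scale.IH, of c] by simp
qed (auto intro: gspace.intros)

text \<open>The factor in the Lipschitz formula: the sum of 1/(x+n)^k over all integers n is (-2 pi
  i)^k times the sum of d^(k-1)/(k-1)! q^d.\<close>

definition pfac :: complex where "pfac = - (2 * of_real pi * \<i>)"

text \<open>Unrolls the recursion according to the row m+1 of the first point. Chains without a
  point in the top row telescope, and what remains at the end lies in row 0.\<close>

lemma eis_part_eq_sum:
  "eis_part \<tau> M ks = half_tangent 1 ks 0 + (\<Sum>i\<in>{1..length ks}. \<Sum>m<M.
     multitangent (take i ks) (of_nat (Suc m) * complex_of_uhp \<tau>) * eis_part \<tau> m (drop i ks))"
proof (induction M)
  case (Suc M)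
  have "{..length ks} = insert 0 {1..length ks}" by auto
  then have "eis_part \<tau> (Suc M) ks = eis_part \<tau> M ks + (\<Sum>i\<in>{1..length ks}.
     multitangent (take i ks) (of_nat (Suc M) * complex_of_uhp \<tau>) * eis_part \<tau> M (drop i ks))" by simp
  then show ?case using Suc by (simp add: sum.distrib)
qed simp

text \<open>Full weight arises only when the first point is alone in its row (\<open>i = 1\<close>),
  with the top coefficient of its tangent function and the top part of the remaining word. Every
  other contribution loses weight by \<open>multitangent_expansion\<close> or by induction.\<close>

lemma eis_part_expansion:
  assumes "good_word ks"
  shows "\<exists>R\<in>gspace (sum_list ks). \<forall>M \<tau>. eis_part \<tau> M ks = pfac ^ sum_list ks * gpart ks M \<tau> + R M \<tau>"
  using assms
proof (induction ks rule: length_induct)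
  case (1 ks)
  show ?case
  proof (cases "ks = []")
    case True
    have "eis_part \<tau> M [] = 1" for \<tau> M by (induction M) auto
    then show ?thesis using True by (intro bexI[of _ "\<lambda>M \<tau>. 0"]) (auto simp: gpart_def intro: gspace.intros)
  next
    case False
    have "\<exists>R\<in>gspace (sum_list ks). \<forall>M \<tau>. (\<Sum>m<M. multitangent (take i ks) (of_nat (Suc m) * complex_of_uhp \<tau>) * eis_part \<tau> m (drop i ks)) 
       = (if i = 1 then pfac ^ sum_list ks * gpart ks M \<tau> else 0) + R M \<tau>" if i: "i \<in> {1..length ks}" for i
    proof -
      let ?a = "take i ks" and ?b = "drop i ks"
      have sum: "sum_list ks = sum_list ?a + sum_list ?b" by (metis append_take_drop_id sum_list_append)
      have good: "\<forall>k\<in>set ?a. k \<ge> 2" "good_word ?b" "?a \<noteq> []" using "1.prems" i False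
        by (auto simp: good_word_def dest: in_set_takeD in_set_dropD)
      obtain c where c: "\<And>x. x \<notin> \<int> \<Longrightarrow> multitangent ?a x =
        (if length ?a = 1 then pfac ^ sum_list ?a * poly (tangent_poly (sum_list ?a)) (qden x) else 0)
          + (\<Sum>j\<in>{2..<sum_list ?a}. c j * poly (tangent_poly j) (qden x))"
        using multitangent_expansion[OF good(1,3)] unfolding pfac_def by blast
      have la: "length ?a = 1 \<longleftrightarrow> i = 1" using i by auto
      obtain R where R: "R \<in> gspace (sum_list ?b)" "\<And>M \<tau>. eis_part \<tau> M ?b = pfac ^ sum_list ?b * gpart ?b M \<tau> + R M \<tau>"
        using "1.IH"[rule_format, of ?b] good i by auto
      have b: "(\<lambda>M \<tau>. eis_part \<tau> M ?b) \<in> gspace (Suc (sum_list ?b))"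
        unfolding R(2) by (intro gspace.intros gspace_mono[OF R(1)] good) auto
      define R1 where "R1 = (\<lambda>M \<tau>. \<Sum>j\<in>{2..<sum_list ?a}. c j * (\<Sum>m<M. qterm \<tau> j m * eis_part \<tau> m ?b))"
      have R1: "R1 \<in> gspace (sum_list ks)"
        unfolding R1_def
        by (intro gspace_sum gspace_scale gspace_mono[OF gspace_qterm[OF b]]) (auto simp: sum)
      have split: "(\<Sum>m<M. multitangent ?a (of_nat (Suc m) * complex_of_uhp \<tau>) * eis_part \<tau> m ?b) =
        (if i = 1 then pfac ^ sum_list ?a * (\<Sum>m<M. qterm \<tau> (sum_list ?a) m * eis_part \<tau> m ?b) else 0) + R1 M \<tau>" for M \<tau>
      proof -
        have "multitangent ?a (of_nat (Suc m) * complex_of_uhp \<tau>) * eis_part \<tau> m ?b =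
          (if i = 1 then pfac ^ sum_list ?a * (qterm \<tau> (sum_list ?a) m * eis_part \<tau> m ?b) else 0) +
          (\<Sum>j\<in>{2..<sum_list ?a}. c j * (qterm \<tau> j m * eis_part \<tau> m ?b))" for m
          unfolding c[OF uhp_multiple_not_Ints] la qterm_def
          by (simp add: ring_distribs sum_distrib_right mult.assoc)
        then have "(\<Sum>m<M. multitangent ?a (of_nat (Suc m) * complex_of_uhp \<tau>) * eis_part \<tau> m ?b) =
           (if i = 1 then pfac ^ sum_list ?a * (\<Sum>m<M. qterm \<tau> (sum_list ?a) m * eis_part \<tau> m ?b) else 0) +
          (\<Sum>m<M. \<Sum>j\<in>{2..<sum_list ?a}. c j * (qterm \<tau> j m * eis_part \<tau> m ?b))"
          by (simp add: sum.distrib sum_distrib_left)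
        also have "(\<Sum>m<M. \<Sum>j\<in>{2..<sum_list ?a}. c j * (qterm \<tau> j m * eis_part \<tau> m ?b)) = R1 M \<tau>"
          unfolding R1_def by (subst sum.swap) (simp add: sum_distrib_left)
        finally show ?thesis .
      qed
      show ?thesis
      proof (cases "i = 1")
        case True
        then obtain k where k: "?a = [k]" "ks = k # ?b" "k \<ge> 2" using False good by (cases ks) auto
        define R2 where "R2 = (\<lambda>M \<tau>. pfac ^ k * (\<Sum>m<M. qterm \<tau> k m * R m \<tau>))"
        have R2: "R2 \<in> gspace (sum_list ks)" unfolding R2_def
          by (intro gspace_scale gspace_mono[OF gspace_qterm[OF R(1)]]) (use k sum in auto)
        have "pfac ^ sum_list ?a * (\<Sum>m<M. qterm \<tau> (sum_list ?a) m * eis_part \<tau> m ?b) = pfac ^ sum_list ks * gpart ks M \<tau> + R2 M \<tau>" for M \<tau>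
        proof -
          have "gpart ks M \<tau> = (\<Sum>m<M. qterm \<tau> k m * gpart ?b m \<tau>)" by (subst k(2)) (rule gpart_Cons)
          moreover have "sum_list ks = k + sum_list ?b" using sum k(1) by simp
          ultimately show ?thesis unfolding R(2) R2_def k(1)
            by (simp add: ring_distribs sum.distrib sum_distrib_left power_add mult_ac)
        qed
        then show ?thesis using True split gspace_add[OF R2 R1]
          by (intro bexI[of _ "\<lambda>M \<tau>. R2 M \<tau> + R1 M \<tau>"]) auto
      next
        case False
        then show ?thesis using split R1 by (intro bexI[of _ R1]) auto
      qed
    qed
    then have "\<forall>i\<in>{1..length ks}. \<exists>R. R \<in> gspace (sum_list ks) \<and> (\<forall>M \<tau>. (\<Sum>m<M. multitangent (take i ks) (of_nat (Suc m) * complex_of_uhp \<tau>) * eis_part \<tau> m (drop i ks)) 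
       = (if i = 1 then pfac ^ sum_list ks * gpart ks M \<tau> else 0) + R M \<tau>)" by blast
    from bchoice[OF this] obtain R where R0: "\<forall>i\<in>{1..length ks}. R i \<in> gspace (sum_list ks) \<and> (\<forall>M \<tau>. (\<Sum>m<M. multitangent (take i ks) (of_nat (Suc m) * complex_of_uhp \<tau>) * eis_part \<tau> m (drop i ks)) 
       = (if i = 1 then pfac ^ sum_list ks * gpart ks M \<tau> else 0) + R i M \<tau>)" by blast
    then have R: "\<And>i. i \<in> {1..length ks} \<Longrightarrow> R i \<in> gspace (sum_list ks)"
      "\<And>i M \<tau>. i \<in> {1..length ks} \<Longrightarrow> (\<Sum>m<M. multitangent (take i ks) (of_nat (Suc m) * complex_of_uhp \<tau>) * eis_part \<tau> m (drop i ks)) 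
       = (if i = 1 then pfac ^ sum_list ks * gpart ks M \<tau> else 0) + R i M \<tau>"
      by blast+
    have pos: "sum_list ks > 0" using False "1.prems" by (cases ks) auto
    \<comment> \<open>The zeta value of row 0 is a constant of weight 0 in this filtration, which is
      below the weight of the nonempty word.\<close>
    have Z: "(\<lambda>M \<tau>. half_tangent 1 ks 0 * gpart [] M \<tau>) \<in> gspace (sum_list ks)"
      by (intro gspace.intros) (use pos in auto)
    show ?thesis
    proof (intro bexI[of _ "\<lambda>M \<tau>. half_tangent 1 ks 0 * gpart [] M \<tau> + (\<Sum>i\<in>{1..length ks}. R i M \<tau>)"] allI)
      show "(\<lambda>M \<tau>. half_tangent 1 ks 0 * gpart [] M \<tau> + (\<Sum>i\<in>{1..length ks}. R i M \<tau>)) \<in> gspace (sum_list ks)"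
        by (intro gspace_add Z gspace_sum R) auto
      fix M \<tau>
      have "eis_part \<tau> M ks = half_tangent 1 ks 0 + (\<Sum>i\<in>{1..length ks}. (if i = 1 then pfac ^ sum_list ks * gpart ks M \<tau> else 0) + R i M \<tau>)"
        by (subst eis_part_eq_sum) (simp only: R(2) cong: sum.cong)
      also have "\<dots> = half_tangent 1 ks 0 + (pfac ^ sum_list ks * gpart ks M \<tau> + (\<Sum>i\<in>{1..length ks}. R i M \<tau>))"
        using False by (simp add: sum.distrib Suc_le_eq)
      finally show "eis_part \<tau> M ks = pfac ^ sum_list ks * gpart ks M \<tau> + (half_tangent 1 ks 0 * gpart [] M \<tau> + (\<Sum>i\<in>{1..length ks}. R i M \<tau>))"
        by (simp add: gpart_def)
    qed
  qed
qed

section \<open>Convergence of the q-series\<close>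

lemma qexp_multiple: "qexp (of_nat n * complex_of_uhp \<tau>) = qpar \<tau> ^ n"
proof -
  have "qexp (of_nat n * complex_of_uhp \<tau>) = exp (of_nat n * (2 * of_real pi * \<i> * complex_of_uhp \<tau>))"
    by (simp add: qexp_def mult_ac)
  then show ?thesis by (simp add: qpar_def exp_of_nat_mult)
qed

lemma norm_qpar: "norm (qpar \<tau>) < 1" "qpar \<tau> \<noteq> 0"
  using Im_uhp[of \<tau>] by (auto simp: qpar_def norm_exp_eq_Re)

lemma qterm_eq: "qterm \<tau> k m = poly (tangent_poly k) (1 / (1 - qpar \<tau> ^ Suc m))"
  by (simp add: qterm_def qden_def qexp_multiple del: of_nat_Suc power_Suc)

text \<open>From index 2 on the polynomial has the factor u(u-1), which equals x u^2; this extracts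
  the factor x responsible for exponential decay.\<close>

lemma tangent_poly_bound:
  assumes "k \<ge> 2" "\<rho> < 1"
  obtains C where "\<And>q. norm q \<le> \<rho> \<Longrightarrow> norm (poly (tangent_poly k) (1 / (1 - q))) \<le> C * norm q"
proof -
  obtain n where n: "k = Suc (Suc n)" using assms by (metis add_2_eq_Suc le_Suc_ex)
  define r where "r = 1 / (1 - \<rho>)"
  let ?p = "pderiv (tangent_poly (Suc n))"
  have "continuous_on (cball 0 r) (poly ?p)"
    by (intro continuous_at_imp_continuous_on ballI poly_isCont)
  then have "compact (poly ?p ` cball 0 r)" by (rule compact_continuous_image) simp
  then obtain C where C: "\<And>y. norm y \<le> r \<Longrightarrow> norm (poly ?p y) \<le> C"
    by (metis (no_types, lifting) bounded_iff compact_imp_bounded imageI mem_cball_0)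
  have "norm (poly (tangent_poly k) (1 / (1 - x))) \<le> (r\<^sup>2 * C) * norm x" if x: "norm x \<le> \<rho>" for x
  proof -
    define u where "u = 1 / (1 - x)"
    have "norm (1 - x) \<ge> 1 - \<rho>" using x norm_triangle_ineq2[of 1 x] by simp
    then have u: "norm u \<le> r" using assms by (simp add: u_def r_def norm_divide frac_le)
    have nz: "1 - x \<noteq> 0" using x assms by auto
    have "u * (-1 + u) = x * u\<^sup>2" using nz by (simp add: u_def field_simps power2_eq_square)
    moreover have "poly (tangent_poly k) u = 1 / of_nat (Suc n) * ((u * (-1 + u)) * poly ?p u)"
      by (simp add: n algebra_simps)
    ultimately have eq: "poly (tangent_poly k) u = 1 / of_nat (Suc n) * (x * u\<^sup>2 * poly ?p u)" by simp
    have "norm (poly (tangent_poly k) u) \<le> 1 * (norm x * r\<^sup>2 * C)"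
      unfolding eq norm_mult norm_power by (intro mult_mono power_mono u C) (auto simp: norm_divide simp del: of_nat_Suc)
    then show ?thesis by (simp add: u_def mult_ac)
  qed
  then show ?thesis using that by blast
qed

lemma summable_qterm:
  assumes "k \<ge> 2"
  shows "summable (\<lambda>m. norm (qterm \<tau> k m))"
proof -
  define q where "q = qpar \<tau>"
  have q: "norm q < 1" unfolding q_def by (rule norm_qpar)
  obtain C where C: "\<And>x. norm x \<le> norm q \<Longrightarrow> norm (poly (tangent_poly k) (1 / (1 - x))) \<le> C * norm x"
    using tangent_poly_bound[OF assms q] by blast
  have "norm (qterm \<tau> k m) \<le> C * norm q ^ Suc m" for m
  proof -
    have "norm q ^ Suc m \<le> norm q ^ 1" by (rule power_decreasing) (use q in auto)
    then show ?thesis unfolding qterm_eq using C[of "q ^ Suc m"] by (simp add: q_def norm_power del: power_Suc)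
  qed
  moreover have "summable (\<lambda>m. C * norm q ^ Suc m)"
    using q by (intro summable_mult) (subst summable_Suc_iff, simp)
  ultimately show ?thesis
    by - (rule summable_comparison_test'[of "\<lambda>m. C * norm q ^ Suc m" 0], simp_all del: power_Suc)
qed

text \<open>The iterated form of \<open>g\<close>, summed along the outer variable;
  \<open>g_eq_gser\<close> identifies the two.\<close>

definition gser :: "nat list \<Rightarrow> hfun" where
  "gser ks \<tau> = lim (\<lambda>M. gpart ks M \<tau>)"

lemma gpart_tendsto: "good_word ks \<Longrightarrow> (\<lambda>M. gpart ks M \<tau>) \<longlonglongrightarrow> gser ks \<tau>"
  unfolding gser_def gpart_def by (rule tendsto_chain_sum) (auto simp: good_word_def intro: summable_qterm)

interpretation cvs: vector_space cscale by (rule vector_space_cscale)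
interpretation qvs: vector_space qscale by (rule vector_space_qscale)

text \<open>The complex version of the weight filtration with the index shifted by one:
  \<open>FilC w\<close> corresponds to \<open>FilW (int w - 1)\<close>, so that natural numbers also
  cover the zero step.\<close>

definition FilC :: "nat \<Rightarrow> hfun set" where
  "FilC w = cspan {gser ls | ls. good_word ls \<and> sum_list ls < w}"

lemma gspace_lim: "U \<in> gspace w \<Longrightarrow> \<exists>f\<in>FilC w. \<forall>\<tau>. (\<lambda>M. U M \<tau>) \<longlonglongrightarrow> f \<tau>"
proof (induction rule: gspace.induct)
  case (gspace_base ls)
  then show ?case unfolding FilC_def
    by (intro bexI[of _ "gser ls"] cvs.span_base) (auto intro: gpart_tendsto)
next
  case gspace_zero
  then show ?case unfolding FilC_def by (intro bexI[of _ 0] cvs.span_zero) auto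
next
  case (gspace_add U V)
  then obtain f h where "f \<in> FilC w" "h \<in> FilC w" "\<forall>\<tau>. (\<lambda>M. U M \<tau>) \<longlonglongrightarrow> f \<tau>" "\<forall>\<tau>. (\<lambda>M. V M \<tau>) \<longlonglongrightarrow> h \<tau>" by blast
  then show ?case unfolding FilC_def
    by (intro bexI[of _ "f + h"] cvs.span_add) (auto intro: tendsto_add)
next
  case (gspace_scale U c)
  then obtain f where "f \<in> FilC w" "\<forall>\<tau>. (\<lambda>M. U M \<tau>) \<longlonglongrightarrow> f \<tau>" by blast
  then show ?case unfolding FilC_def
    by (intro bexI[of _ "cscale c f"] cvs.span_scale) (auto simp: cscale_def intro: tendsto_mult_left)
qed

lemma mes_expansion:
  assumes "good_word ks"
  shows "mes ks - cscale (pfac ^ sum_list ks) (gser ks) \<in> FilC (sum_list ks)"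
    and eis_part_tendsto: "(\<lambda>M. eis_part \<tau> M ks) \<longlonglongrightarrow> mes ks \<tau>"
proof -
  obtain R where R: "R \<in> gspace (sum_list ks)" "\<And>M \<tau>. eis_part \<tau> M ks = pfac ^ sum_list ks * gpart ks M \<tau> + R M \<tau>"
    using eis_part_expansion[OF assms] by blast
  obtain f where f: "f \<in> FilC (sum_list ks)" "\<And>\<tau>. (\<lambda>M. R M \<tau>) \<longlonglongrightarrow> f \<tau>" using gspace_lim[OF R(1)] by blast
  have lim: "(\<lambda>M. eis_part \<tau> M ks) \<longlonglongrightarrow> pfac ^ sum_list ks * gser ks \<tau> + f \<tau>" for \<tau>
    unfolding R(2) by (intro tendsto_intros gpart_tendsto assms f)
  moreover have m: "mes ks \<tau> = pfac ^ sum_list ks * gser ks \<tau> + f \<tau>" for \<tau>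
    using mes_eq_lim_eis_part[of ks \<tau>] limI[OF lim] assms by (simp add: good_word_def)
  ultimately show "(\<lambda>M. eis_part \<tau> M ks) \<longlonglongrightarrow> mes ks \<tau>" by simp
  have "mes ks - cscale (pfac ^ sum_list ks) (gser ks) = f" by (auto simp: fun_eq_iff m cscale_def)
  then show "mes ks - cscale (pfac ^ sum_list ks) (gser ks) \<in> FilC (sum_list ks)" using f by simp
qed

text \<open>The product formula holds exactly for each finite set of lattice points and passes
  through the two limits one after the other.\<close>

theorem mes_stuffle:
  assumes "good_word u" "good_word v"
  shows "mes u * mes v = (\<Sum>w\<leftarrow>stuffle u v. mes w)"
proof
  fix \<tau>
  let ?F = "\<lambda>k p. 1 / lattice_pt \<tau> p ^ k"
  have good: "good_word w" if "w \<in> set (stuffle u v)" for w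
    using stuffle_ge[OF that, of 2] assms by (auto simp: good_word_def)
  have sl: "(\<Sum>w\<leftarrow>W. f w) = (\<Sum>i<length W. f (W ! i))" for W :: "nat list list" and f :: "nat list \<Rightarrow> complex"
    by (simp add: sum_list_sum_nth atLeast0LessThan)
  have part: "eis_part \<tau> M u * eis_part \<tau> M v = (\<Sum>w\<leftarrow>stuffle u v. eis_part \<tau> M w)" for M
  proof (rule LIMSEQ_unique)
    have eq: "chain_sum ?F (lattice_list M N) u * chain_sum ?F (lattice_list M N) v = (\<Sum>w\<leftarrow>stuffle u v. chain_sum ?F (lattice_list M N) w)" for N
      by (rule chain_sum_stuffle) (simp add: power_add)
    show "(\<lambda>N. chain_sum ?F (lattice_list M N) u * chain_sum ?F (lattice_list M N) v) \<longlonglongrightarrow> eis_part \<tau> M u * eis_part \<tau> M v"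
      by (intro tendsto_mult eis_part_lim) (use assms in \<open>auto simp: good_word_def\<close>)
    show "(\<lambda>N. chain_sum ?F (lattice_list M N) u * chain_sum ?F (lattice_list M N) v) \<longlonglongrightarrow> (\<Sum>w\<leftarrow>stuffle u v. eis_part \<tau> M w)"
      unfolding eq sl by (intro tendsto_sum eis_part_lim) (use good[OF nth_mem] in \<open>auto simp: good_word_def\<close>)
  qed
  have "(\<lambda>M. eis_part \<tau> M u * eis_part \<tau> M v) \<longlonglongrightarrow> mes u \<tau> * mes v \<tau>"
    by (intro tendsto_mult eis_part_tendsto assms)
  moreover have "(\<lambda>M. eis_part \<tau> M u * eis_part \<tau> M v) \<longlonglongrightarrow> (\<Sum>w\<leftarrow>stuffle u v. mes w \<tau>)"
    unfolding part sl by (intro tendsto_sum eis_part_tendsto) (use good in auto)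
  ultimately have "mes u \<tau> * mes v \<tau> = (\<Sum>w\<leftarrow>stuffle u v. mes w \<tau>)" by (rule LIMSEQ_unique)
  moreover have "(\<Sum>w\<leftarrow>W. mes w) \<tau> = (\<Sum>w\<leftarrow>W. mes w \<tau>)" for W by (induction W) auto
  ultimately show "(mes u * mes v) \<tau> = (\<Sum>w\<leftarrow>stuffle u v. mes w) \<tau>" by simp
qed

section \<open>The series g as an absolutely convergent sum over its index set\<close>

definition idx :: "nat \<Rightarrow> nat \<Rightarrow> (nat list \<times> nat list) set" where
  "idx r M = {(cs, ds) \<in> g_index r. \<forall>c\<in>set cs. c \<le> M}"

text \<open>Splits off the first pair: its outer variable is \<open>Suc m\<close>, and the remaining
  ones are then at most \<open>m\<close>.\<close>

definition idx_cons :: "nat \<times> nat \<times> nat list \<times> nat list \<Rightarrow> nat list \<times> nat list" where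
  "idx_cons = (\<lambda>(m, d, cs, ds). (Suc m # cs, d # ds))"

definition idx_term :: "(nat \<Rightarrow> nat \<Rightarrow> nat \<Rightarrow> 'a::comm_ring_1) \<Rightarrow> nat list \<Rightarrow> nat list \<times> nat list \<Rightarrow> 'a" where
  "idx_term a ks = (\<lambda>(cs, ds). \<Prod>i<length ks. a (ks ! i) (cs ! i) (ds ! i))"

lemma idx_0 [simp]: "idx 0 M = {([], [])}" "g_index 0 = {([], [])}"
  by (auto simp: idx_def g_index_def)

lemma g_index_Suc: "g_index (Suc r) = idx_cons ` (SIGMA m:UNIV. {0<..} \<times> idx r m)"
proof (intro equalityI subsetI)
  fix p assume "p \<in> g_index (Suc r)"
  then obtain c cs d ds where p: "p = (c # cs, d # ds)" and 1: "length cs = r" "length ds = r"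
    "sorted_wrt (>) (c # cs @ [0])" "d > 0" "\<forall>d\<in>set ds. d > 0"
    by (cases p; cases "fst p"; cases "snd p") (auto simp: g_index_def)
  from 1(3) have c: "c > 0" "\<forall>c'\<in>set cs. c' < c" "sorted_wrt (>) (cs @ [0])" by auto
  then have "(cs, ds) \<in> idx r (c - 1)" using 1 by (auto simp: idx_def g_index_def)
  moreover have "p = idx_cons (c - 1, d, cs, ds)" using c p by (simp add: idx_cons_def)
  ultimately show "p \<in> idx_cons ` (SIGMA m:UNIV. {0<..} \<times> idx r m)" using 1 by blast
next
  fix p assume "p \<in> idx_cons ` (SIGMA m:UNIV. {0<..} \<times> idx r m)"
  then obtain m d cs ds where "p = (Suc m # cs, d # ds)" "d > 0" "(cs, ds) \<in> idx r m" by (auto simp: idx_cons_def)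
  then show "p \<in> g_index (Suc r)" by (auto simp: idx_def g_index_def)
qed

lemma idx_Suc: "idx (Suc r) M = idx_cons ` (SIGMA m:{..<M}. {0<..} \<times> idx r m)"
proof -
  have "idx (Suc r) M = {p \<in> g_index (Suc r). \<forall>c\<in>set (fst p). c \<le> M}" by (auto simp: idx_def)
  also have "\<dots> = idx_cons ` (SIGMA m:{..<M}. {0<..} \<times> idx r m)"
    unfolding g_index_Suc by (auto simp: idx_cons_def idx_def image_iff Suc_le_eq) (force intro: less_imp_le order.trans)+
  finally show ?thesis .
qed

lemma inj_idx_cons: "inj_on idx_cons A"
  by (auto simp: inj_on_def idx_cons_def)

lemma idx_term_cons: "idx_term a (k # ks) (idx_cons (m, d, p)) = a k (Suc m) d * idx_term a ks p"
  by (cases p) (simp add: idx_term_def idx_cons_def prod.lessThan_Suc_shift del: prod.lessThan_Suc)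

lemma has_sum_product:
  fixes f :: "'b \<Rightarrow> 'a::{real_normed_field,banach}"
  assumes "(f has_sum s) A" "(h has_sum t) B" "(\<lambda>x. norm (f x)) summable_on A" "(\<lambda>x. norm (h x)) summable_on B"
  shows "(\<lambda>x. norm ((\<lambda>(x, y). f x * h y) x)) summable_on A \<times> B" "((\<lambda>(x, y). f x * h y) has_sum (s * t)) (A \<times> B)"
proof -
  have "(\<lambda>x. norm (f x) * infsum (\<lambda>y. norm (h y)) B) summable_on A"
    by (intro summable_on_cmult_left assms)
  moreover have "0 \<le> infsum (\<lambda>y. norm (h y)) B" by (rule infsum_nonneg) auto
  ultimately show abs: "(\<lambda>x. norm ((\<lambda>(x, y). f x * h y) x)) summable_on A \<times> B"
    unfolding Infinite_Sum.abs_summable_on_Sigma_iff using assms(4)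
    by (auto simp: norm_mult infsum_cmult_right' intro!: summable_on_cmult_right)
  show "((\<lambda>(x, y). f x * h y) has_sum (s * t)) (A \<times> B)"
  proof (rule has_sum_SigmaI)
    show "((\<lambda>y. case (x, y) of (x, y) \<Rightarrow> f x * h y) has_sum (f x * t)) B" for x
      using has_sum_cmult_right[OF assms(2)] by simp
    show "((\<lambda>x. f x * t) has_sum (s * t)) A" by (rule has_sum_cmult_left[OF assms(1)])
    show "(\<lambda>(x, y). f x * h y) summable_on A \<times> B" by (rule abs_summable_summable[OF abs])
  qed
qed

text \<open>The bound \<open>M\<close> leaves finitely many values of the outer variables but all
  values of the inner ones, so each outer value contributes its complete inner sum
  \<open>A k c\<close>.\<close>

lemma has_sum_idx:
  fixes a :: "nat \<Rightarrow> nat \<Rightarrow> nat \<Rightarrow> 'a::{real_normed_field,banach}"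
  assumes "\<And>k c. k \<in> set ks \<Longrightarrow> c > 0 \<Longrightarrow> (\<lambda>x. norm (a k c x)) summable_on {0<..}"
    and "\<And>k c. k \<in> set ks \<Longrightarrow> c > 0 \<Longrightarrow> (a k c has_sum A k c) {0<..}"
  shows "(\<lambda>x. norm (idx_term a ks x)) summable_on idx (length ks) M \<and>
    (idx_term a ks has_sum chain_sum (\<lambda>k m. A k (Suc m)) (rev [0..<M]) ks) (idx (length ks) M)"
  using assms
proof (induction ks arbitrary: M)
  case Nil
  have "(idx_term a [] has_sum (\<Sum>x\<in>{([], [])}. idx_term a [] x)) {([], [])}" by (rule has_sum_finite) simp
  moreover have "idx_term a [] = (\<lambda>_. 1)" by (auto simp: idx_term_def fun_eq_iff)
  ultimately show ?case by simp
next
  case (Cons k ks)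
  let ?f = "\<lambda>(m, d, p). a k (Suc m) d * idx_term a ks p"
  let ?G = "\<lambda>m. chain_sum (\<lambda>k m. A k (Suc m)) (rev [0..<m]) ks"
  have IH: "(\<lambda>x. norm (idx_term a ks x)) summable_on idx (length ks) m"
    "(idx_term a ks has_sum ?G m) (idx (length ks) m)" for m
    using Cons.IH[of m] Cons.prems by auto
  have prod: "(\<lambda>x. norm ((\<lambda>(d, p). a k (Suc m) d * idx_term a ks p) x)) summable_on {0<..} \<times> idx (length ks) m"
    "((\<lambda>(d, p). a k (Suc m) d * idx_term a ks p) has_sum (A k (Suc m) * ?G m)) ({0<..} \<times> idx (length ks) m)" for m
    subgoal by (rule has_sum_product(1)[OF _ IH(2) _ IH(1)]) (use Cons.prems in auto)
    subgoal by (rule has_sum_product(2)[OF _ IH(2) _ IH(1)]) (use Cons.prems in auto)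
    done
  have abs: "(\<lambda>x. norm (?f x)) summable_on (SIGMA m:{..<M}. {0<..} \<times> idx (length ks) m)"
    by (subst Infinite_Sum.abs_summable_on_Sigma_iff) (use prod(1) in \<open>auto simp: case_prod_unfold\<close>)
  have sum: "(?f has_sum (\<Sum>m<M. A k (Suc m) * ?G m)) (SIGMA m:{..<M}. {0<..} \<times> idx (length ks) m)"
  proof (rule has_sum_SigmaI)
    show "((\<lambda>m. A k (Suc m) * ?G m) has_sum (\<Sum>m<M. A k (Suc m) * ?G m)) {..<M}" by (rule has_sum_finite) simp
    show "?f summable_on (SIGMA m:{..<M}. {0<..} \<times> idx (length ks) m)" by (rule abs_summable_summable[OF abs])
  qed (use prod(2) in \<open>simp add: case_prod_unfold\<close>)
  have comp: "idx_term a (k # ks) \<circ> idx_cons = ?f" by (rule ext) (auto simp: idx_term_cons)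
  have compn: "(\<lambda>x. norm (idx_term a (k # ks) x)) \<circ> idx_cons = (\<lambda>x. norm (?f x))" by (rule ext) (auto simp: idx_term_cons)
  show ?case
    unfolding length_Cons idx_Suc chain_sum_rev_upt_Cons has_sum_reindex[OF inj_idx_cons] summable_on_reindex[OF inj_idx_cons] comp compn
    using abs sum by simp
qed

lemma norm_idx_term: 
  fixes a :: "nat \<Rightarrow> nat \<Rightarrow> nat \<Rightarrow> 'a::real_normed_field"
  shows "norm (idx_term a ks p) = idx_term (\<lambda>k c d. norm (a k c d)) ks p"
  by (cases p) (simp add: idx_term_def prod_norm)

text \<open>Fubini with respect to the first pair. The remaining pairs are covered by
  \<open>has_sum_idx\<close>, applied both to the terms and to their norms; the norm sums are chain
  sums of \<open>B\<close>, bounded by a product, and this gives summability over the first outer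
  variable.\<close>

lemma has_sum_g_index:
  fixes a :: "nat \<Rightarrow> nat \<Rightarrow> nat \<Rightarrow> 'a::{real_normed_field,banach}"
  assumes abs: "\<And>k c. k \<in> set ks \<Longrightarrow> c > 0 \<Longrightarrow> ((\<lambda>d. norm (a k c d)) has_sum B k c) {0<..}"
    and sm: "\<And>k. k \<in> set ks \<Longrightarrow> summable (\<lambda>m. B k (Suc m))"
    and has: "\<And>k c. k \<in> set ks \<Longrightarrow> c > 0 \<Longrightarrow> (a k c has_sum A k c) {0<..}"
  shows "(\<lambda>x. norm (idx_term a ks x)) summable_on g_index (length ks)"
    and "(idx_term a ks has_sum lim (\<lambda>M. chain_sum (\<lambda>k m. A k (Suc m)) (rev [0..<M]) ks)) (g_index (length ks))"
proof -
  have "(\<lambda>x. norm (idx_term a ks x)) summable_on g_index (length ks) \<and>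
    (idx_term a ks has_sum lim (\<lambda>M. chain_sum (\<lambda>k m. A k (Suc m)) (rev [0..<M]) ks)) (g_index (length ks))"
  proof (cases ks)
    case Nil
    have "(idx_term a [] has_sum (\<Sum>x\<in>{([], [])}. idx_term a [] x)) {([], [])}" by (rule has_sum_finite) simp
    moreover have "idx_term a [] = (\<lambda>_. 1)" by (auto simp: idx_term_def fun_eq_iff)
    ultimately show ?thesis using Nil by simp
  next
    case (Cons k ls)
    let ?f = "\<lambda>(m, d, p). a k (Suc m) d * idx_term a ls p"
    let ?G = "\<lambda>m. chain_sum (\<lambda>k m. A k (Suc m)) (rev [0..<m]) ls"
    let ?N = "\<lambda>m. chain_sum (\<lambda>k m. B k (Suc m)) (rev [0..<m]) ls"
    have abs': "(\<lambda>x. norm (a k c x)) summable_on {0<..}" if "k \<in> set ks" "c > 0" for k c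
      using abs[OF that] by (rule has_sum_imp_summable)
    have AB: "norm (A k c) \<le> B k c" if "k \<in> set ks" "c > 0" for k c
      using norm_infsum_bound[OF abs'[OF that]] infsumI[OF abs[OF that]] infsumI[OF has[OF that]] by simp
    have B0: "0 \<le> B k c" if "k \<in> set ks" "c > 0" for k c
      using AB[OF that] norm_ge_zero[of "A k c"] by linarith
    have IH: "(\<lambda>x. norm (idx_term a ls x)) summable_on idx (length ls) m"
      "(idx_term a ls has_sum ?G m) (idx (length ls) m)" for m
      using has_sum_idx[of ls a A m] abs' has Cons by auto
    have IHn: "((\<lambda>p. norm (idx_term a ls p)) has_sum ?N m) (idx (length ls) m)" for m
      using has_sum_idx[of ls "\<lambda>k c d. norm (a k c d)" B m] abs abs' Cons by (simp add: norm_idx_term[abs_def])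
    have kin: "k \<in> set ks" "set ls \<subseteq> set ks" using Cons by auto
    have prod: "(\<lambda>x. norm ((\<lambda>(d, p). a k (Suc m) d * idx_term a ls p) x)) summable_on {0<..} \<times> idx (length ls) m"
      "((\<lambda>(d, p). a k (Suc m) d * idx_term a ls p) has_sum (A k (Suc m) * ?G m)) ({0<..} \<times> idx (length ls) m)" for m
      subgoal by (rule has_sum_product(1)[OF has IH(2) abs' IH(1)]) (use kin in auto)
      subgoal by (rule has_sum_product(2)[OF has IH(2) abs' IH(1)]) (use kin in auto)
      done
    have prodn: "((\<lambda>(d, p). norm (a k (Suc m) d) * norm (idx_term a ls p)) has_sum (B k (Suc m) * ?N m)) ({0<..} \<times> idx (length ls) m)" for m
      by (rule has_sum_product(2)[OF abs IHn]) (use abs' kin IH in auto)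
    have "infsum (\<lambda>y. norm (case (m, y) of (m, d, p) \<Rightarrow> a k (Suc m) d * idx_term a ls p)) ({0<..} \<times> idx (length ls) m) = B k (Suc m) * ?N m" for m
      using infsumI[OF prodn[of m]] by (simp add: case_prod_unfold norm_mult)
    moreover have "(\<lambda>m. B k (Suc m) * ?N m) summable_on UNIV"
    proof (rule summable_nonneg_imp_summable_on)
      let ?C = "\<Prod>k\<leftarrow>ls. suminf (\<lambda>m. B k (Suc m))"
      have N: "norm (?N m) \<le> ?C" for m
        by (rule norm_chain_sum_le_prod_suminf) (use B0 sm kin in auto)
      have N0: "?N m \<ge> 0" for m by (rule chain_sum_nonneg) (use B0 kin in auto)
      then show nn: "0 \<le> B k (Suc m) * ?N m" for m using B0 kin by auto
      show "summable (\<lambda>m. B k (Suc m) * ?N m)"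
      proof (rule summable_comparison_test'[of _ 0])
        show "summable (\<lambda>m. B k (Suc m) * ?C)" by (intro summable_mult2 sm kin)
        show "norm (B k (Suc m) * ?N m) \<le> B k (Suc m) * ?C" for m
          using nn[of m] N[of m] N0[of m] B0[OF kin(1), of "Suc m"] by (auto intro!: mult_left_mono)
      qed
    qed
    ultimately have abs2: "(\<lambda>x. norm (?f x)) summable_on (SIGMA m:UNIV. {0<..} \<times> idx (length ls) m)"
      by (subst Infinite_Sum.abs_summable_on_Sigma_iff)
        (use prod(1) in \<open>auto simp: case_prod_unfold summable_on_iff_abs_summable_on_real[unfolded real_norm_def, symmetric]\<close>)
    from abs_summable_summable[OF this] obtain S where S: "(?f has_sum S) (SIGMA m:UNIV. {0<..} \<times> idx (length ls) m)"
      by (auto simp: summable_on_def)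
    have "((\<lambda>m. A k (Suc m) * ?G m) has_sum S) UNIV"
      by (rule has_sum_SigmaD[OF S]) (use prod(2) in \<open>simp add: case_prod_unfold\<close>)
    then have "(\<lambda>m. A k (Suc m) * ?G m) sums S" by (rule has_sum_imp_sums)
    then have "(\<lambda>M. chain_sum (\<lambda>k m. A k (Suc m)) (rev [0..<M]) ks) \<longlonglongrightarrow> S"
      unfolding Cons chain_sum_rev_upt_Cons sums_def .
    then have lim: "lim (\<lambda>M. chain_sum (\<lambda>k m. A k (Suc m)) (rev [0..<M]) ks) = S" by (rule limI)
    have comp: "idx_term a (k # ls) \<circ> idx_cons = ?f" by (rule ext) (auto simp: idx_term_cons)
    have compn: "(\<lambda>x. norm (idx_term a (k # ls) x)) \<circ> idx_cons = (\<lambda>x. norm (?f x))" by (rule ext) (auto simp: idx_term_cons)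
    show ?thesis unfolding lim
      unfolding Cons length_Cons g_index_Suc has_sum_reindex[OF inj_idx_cons] summable_on_reindex[OF inj_idx_cons] comp compn
      using abs2 S by simp
  qed
  then show "(\<lambda>x. norm (idx_term a ks x)) summable_on g_index (length ks)"
    and "(idx_term a ks has_sum lim (\<lambda>M. chain_sum (\<lambda>k m. A k (Suc m)) (rev [0..<M]) ks)) (g_index (length ks))" by auto
qed

definition gcoef :: "complex \<Rightarrow> nat \<Rightarrow> nat \<Rightarrow> nat \<Rightarrow> complex" where
  "gcoef q k c d = of_nat d ^ (k - 1) / fact (k - 1) * q ^ (c * d)"

lemma gcoef_sums:
  assumes "norm q < 1" "c > 0" "k \<ge> 1"
  shows "(\<lambda>d. gcoef q k c (Suc d)) sums poly (tangent_poly k) (1 / (1 - q ^ c))"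
    and "summable (\<lambda>d. norm (gcoef q k c (Suc d)))"
    and "(\<lambda>d. norm (gcoef q k c (Suc d))) sums Re (poly (tangent_poly k) (1 / (1 - of_real (norm q) ^ c)))"
proof -
  have *: "(\<lambda>d. gcoef q k c (Suc d)) sums poly (tangent_poly k) (1 / (1 - q ^ c))" if "norm q < 1" for q
  proof -
    have "norm (q ^ c) < 1" using that assms(2) by (simp add: norm_power power_less_one_iff)
    from tangent_poly_sums[OF this, of "k - 1"] show ?thesis
      using assms(3) by (simp add: gcoef_def flip: power_mult del: of_nat_Suc power_Suc mult_Suc_right)
  qed
  then show "(\<lambda>d. gcoef q k c (Suc d)) sums poly (tangent_poly k) (1 / (1 - q ^ c))" using assms by blast
  \<comment> \<open>The norms are again coefficients of the same kind, with q replaced by |q|; so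
    the closed form of their sum comes from the same formula.\<close>
  have n: "norm (gcoef q k c (Suc d)) = Re (gcoef (of_real (norm q)) k c (Suc d))" for d
  proof -
    have eq: "gcoef (of_real (norm q)) k c (Suc d) = of_real (of_nat (Suc d) ^ (k - 1) / fact (k - 1) * norm q ^ (c * Suc d))"
      unfolding gcoef_def by simp
    show ?thesis unfolding eq Re_complex_of_real by (simp add: gcoef_def norm_mult norm_divide norm_power del: of_nat_Suc)
  qed
  show s: "(\<lambda>d. norm (gcoef q k c (Suc d))) sums Re (poly (tangent_poly k) (1 / (1 - of_real (norm q) ^ c)))"
    unfolding n by (rule sums_Re[OF *]) (use assms in simp)
  then show "summable (\<lambda>d. norm (gcoef q k c (Suc d)))" by (rule sums_summable)
qed

lemma sums_has_sum_pos:
  fixes f :: "nat \<Rightarrow> 'a::banach"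
  assumes "(\<lambda>d. f (Suc d)) sums S" "summable (\<lambda>d. norm (f (Suc d)))"
  shows "(f has_sum S) {0<..}"
proof -
  have "((f \<circ> Suc) has_sum S) UNIV"
    using norm_summable_imp_has_sum[OF assms(2,1)] by (simp add: o_def)
  then have "(f has_sum S) (range Suc)" by (subst has_sum_reindex) auto
  moreover have "range Suc = {0<..}" by (auto simp: image_iff) (metis gr0_implies_Suc)
  ultimately show ?thesis by simp
qed

lemma uhp_imag: "y > 0 \<Longrightarrow> complex_of_uhp (Abs_uhp (\<i> * of_real y)) = \<i> * of_real y"
  by (rule Abs_uhp_inverse) simp

lemma qpar_imag: "y > 0 \<Longrightarrow> qpar (Abs_uhp (\<i> * of_real y)) = of_real (exp (- 2 * pi * y))"
proof -
  assume "y > 0"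
  then have "qpar (Abs_uhp (\<i> * of_real y)) = exp (of_real (- 2 * pi * y))"
    unfolding qpar_def by (simp add: uhp_imag mult.assoc)
  then show ?thesis by (simp only: exp_of_real)
qed

text \<open>The modulus of q is itself a value of q, taken on the imaginary axis. Summability of the
  norm sums is thereby reduced to that of \<open>qterm\<close> at another point.\<close>

lemma ex_qpar_norm: "\<exists>\<tau>'. qpar \<tau>' = of_real (norm (qpar \<tau>))"
proof -
  have "norm (qpar \<tau>) = exp (- 2 * pi * Im (complex_of_uhp \<tau>))" by (simp add: qpar_def norm_exp_eq_Re)
  then show ?thesis using qpar_imag[OF Im_uhp[of \<tau>]] by metis
qed

lemma gser_has_sum:
  assumes "good_word ks"
  shows "(idx_term (gcoef (qpar \<tau>)) ks has_sum gser ks \<tau>) (g_index (length ks))"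
    and "(\<lambda>x. norm (idx_term (gcoef (qpar \<tau>)) ks x)) summable_on g_index (length ks)"
proof -
  obtain \<tau>' where t: "qpar \<tau>' = of_real (norm (qpar \<tau>))" using ex_qpar_norm by blast
  define B where "B k c = Re (poly (tangent_poly k) (1 / (1 - of_real (norm (qpar \<tau>)) ^ c)))" for k c
  define A where "A k c = poly (tangent_poly k) (1 / (1 - qpar \<tau> ^ c))" for k c
  have k2: "k \<ge> 2" if "k \<in> set ks" for k using assms that by (auto simp: good_word_def)
  have abs: "((\<lambda>d. norm (gcoef (qpar \<tau>) k c d)) has_sum B k c) {0<..}" if "k \<in> set ks" "c > 0" for k c
    by (rule sums_has_sum_pos; use gcoef_sums[of "qpar \<tau>" c k] norm_qpar k2[OF that(1)] that(2) in \<open>simp add: B_def\<close>)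
  have has: "(gcoef (qpar \<tau>) k c has_sum A k c) {0<..}" if "k \<in> set ks" "c > 0" for k c
    by (rule sums_has_sum_pos; use gcoef_sums[of "qpar \<tau>" c k] norm_qpar k2[OF that(1)] that(2) in \<open>simp add: A_def\<close>)
  have sm: "summable (\<lambda>m. B k (Suc m))" if "k \<in> set ks" for k
  proof -
    have "B k (Suc m) = Re (qterm \<tau>' k m)" for m by (simp add: B_def qterm_eq t)
    moreover have "summable (\<lambda>m. Re (qterm \<tau>' k m))"
      by (rule summable_Re[OF summable_norm_cancel[OF summable_qterm[OF k2[OF that]]]])
    ultimately show ?thesis by simp
  qed
  have "chain_sum (\<lambda>k m. A k (Suc m)) (rev [0..<M]) ks = gpart ks M \<tau>" for M
    by (simp add: gpart_def A_def qterm_eq[abs_def])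
  then show "(idx_term (gcoef (qpar \<tau>)) ks has_sum gser ks \<tau>) (g_index (length ks))"
    and "(\<lambda>x. norm (idx_term (gcoef (qpar \<tau>)) ks x)) summable_on g_index (length ks)"
    using has_sum_g_index[of ks "gcoef (qpar \<tau>)" B A, OF abs sm has] by (auto simp: gser_def)
qed

definition g_expo :: "nat list \<times> nat list \<Rightarrow> nat" where
  "g_expo = (\<lambda>(cs, ds). \<Sum>i<length cs. cs ! i * ds ! i)"

definition g_rat :: "nat list \<Rightarrow> nat list \<times> nat list \<Rightarrow> rat" where
  "g_rat ks = (\<lambda>(cs, ds). \<Prod>i<length ks. of_nat (ds ! i) ^ (ks ! i - 1) / fact (ks ! i - 1))"

lemma idx_term_gcoef:
  assumes "p \<in> g_index (length ks)"
  shows "idx_term (gcoef q) ks p = of_rat (g_rat ks p) * q ^ g_expo p"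
proof -
  obtain cs ds where p: "p = (cs, ds)" by (cases p) auto
  have len: "length cs = length ks" using assms p by (simp add: g_index_def)
  have fct: "complex_of_rat (fact n) = fact n" for n by (metis of_nat_fact of_rat_of_nat_eq)
  have "idx_term (gcoef q) ks (cs, ds) =
     (\<Prod>i<length ks. of_nat (ds ! i) ^ (ks ! i - 1) / fact (ks ! i - 1)) * (\<Prod>i<length ks. q ^ (cs ! i * ds ! i))"
    by (simp only: idx_term_def gcoef_def prod.case prod.distrib)
  then show ?thesis unfolding p
    by (simp add: g_rat_def g_expo_def len fct of_rat_prod of_rat_divide of_rat_power power_sum)
qed

theorem g_eq_gser:
  assumes "good_word ks"
  shows "g ks = gser ks"
proof
  fix \<tau>
  let ?P = "\<Prod>i<length ks. fact (ks ! i - 1) :: complex"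
  have eq: "1 / ?P * (case p of (cs, ds) \<Rightarrow> (\<Prod>i<length ks. of_nat (ds ! i) ^ (ks ! i - 1)) *
       qpar \<tau> ^ (\<Sum>i<length ks. cs ! i * ds ! i)) = idx_term (gcoef (qpar \<tau>)) ks p" for p
    by (cases p) (simp add: idx_term_def gcoef_def prod.distrib prod_dividef power_sum)
  have "g ks \<tau> = infsum (\<lambda>p. 1 / ?P * (case p of (cs, ds) \<Rightarrow> (\<Prod>i<length ks. of_nat (ds ! i) ^ (ks ! i - 1)) *
       qpar \<tau> ^ (\<Sum>i<length ks. cs ! i * ds ! i))) (g_index (length ks))"
    unfolding g_def by (subst infsum_cmult_right') (simp add: case_prod_beta)
  also have "\<dots> = gser ks \<tau>"
    unfolding eq by (rule infsumI[OF gser_has_sum(1)[OF assms]])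
  finally show "g ks \<tau> = gser ks \<tau>" .
qed

section \<open>q-expansions and their uniqueness\<close>

definition has_qexp :: "hfun \<Rightarrow> (nat \<Rightarrow> complex) \<Rightarrow> bool" where
  "has_qexp f b \<longleftrightarrow> (\<forall>\<tau>. (\<lambda>n. b n * qpar \<tau> ^ n) sums f \<tau>)"

definition rational_qexp :: "hfun \<Rightarrow> bool" where
  "rational_qexp f \<longleftrightarrow> (\<exists>a :: nat \<Rightarrow> rat. has_qexp f (\<lambda>n. of_rat (a n)))"

lemma finite_g_fiber: "finite {p \<in> g_index r. g_expo p = n}"
proof (rule finite_subset)
  let ?L = "{xs. set xs \<subseteq> {..n} \<and> length xs = r}"
  show "finite (?L \<times> ?L)" by (intro finite_cartesian_product finite_lists_length_eq) auto
  show "{p \<in> g_index r. g_expo p = n} \<subseteq> ?L \<times> ?L"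
  proof
    fix p assume "p \<in> {p \<in> g_index r. g_expo p = n}"
    then obtain cs ds where p: "p = (cs, ds)" "length cs = r" "length ds = r" "\<forall>d\<in>set ds. d > 0" "\<forall>c\<in>set cs. c > 0"
      "(\<Sum>i<length cs. cs ! i * ds ! i) = n" by (auto simp: g_index_def g_expo_def sorted_wrt_append)
    have "cs ! i \<le> n \<and> ds ! i \<le> n" if i: "i < r" for i
    proof -
      have "cs ! i * ds ! i \<le> (\<Sum>i<length cs. cs ! i * ds ! i)" by (rule member_le_sum) (use i p in auto)
      moreover have "cs ! i > 0" "ds ! i > 0" using i p by auto
      then have "cs ! i \<le> cs ! i * ds ! i" "ds ! i \<le> cs ! i * ds ! i" by auto
      ultimately show ?thesis using p by linarith
    qed
    then show "p \<in> ?L \<times> ?L" using p by (auto simp: set_conv_nth)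
  qed
qed

text \<open>The absolutely convergent sum is sorted by the exponent of q. Each fibre is finite
  because all entries are bounded by the exponent, and the coefficients in it are rational.\<close>

lemma rational_qexp_g:
  assumes "good_word ks"
  shows "rational_qexp (g ks)"
proof -
  let ?I = "g_index (length ks)" and ?F = "\<lambda>n. {p \<in> g_index (length ks). g_expo p = n}"
  define a where "a n = (\<Sum>p\<in>?F n. g_rat ks p)" for n
  have "(\<lambda>n. of_rat (a n) * qpar \<tau> ^ n) sums g ks \<tau>" for \<tau>
  proof -
    let ?T = "idx_term (gcoef (qpar \<tau>)) ks"
    have "bij_betw snd (SIGMA n:UNIV. ?F n) ?I"
      by (rule bij_betwI[of _ _ _ "\<lambda>p. (g_expo p, p)"]) auto
    then have "((\<lambda>x. ?T (snd x)) has_sum gser ks \<tau>) (SIGMA n:UNIV. ?F n)"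
      using gser_has_sum(1)[OF assms] by (subst has_sum_reindex_bij_betw)
    then have "((\<lambda>n. of_rat (a n) * qpar \<tau> ^ n) has_sum gser ks \<tau>) UNIV"
    proof (rule has_sum_SigmaD)
      fix n
      have "((\<lambda>y. ?T (snd (n, y))) has_sum (\<Sum>p\<in>?F n. ?T p)) (?F n)"
        using finite_g_fiber[of "length ks" n] by (simp add: has_sum_finite)
      moreover have "(\<Sum>p\<in>?F n. ?T p) = (\<Sum>p\<in>?F n. of_rat (g_rat ks p) * qpar \<tau> ^ n)"
        by (rule sum.cong) (auto simp: idx_term_gcoef)
      ultimately show "((\<lambda>y. ?T (snd (n, y))) has_sum (of_rat (a n) * qpar \<tau> ^ n)) (?F n)"
        by (simp add: a_def of_rat_sum sum_distrib_right)
    qed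
    then show ?thesis using g_eq_gser[OF assms] by (simp add: has_sum_imp_sums)
  qed
  then show ?thesis unfolding rational_qexp_def has_qexp_def by blast
qed

lemma has_qexp_add: "has_qexp f a \<Longrightarrow> has_qexp h b \<Longrightarrow> has_qexp (f + h) (\<lambda>n. a n + b n)"
  unfolding has_qexp_def by (auto simp: ring_distribs intro: sums_add)

lemma has_qexp_scale: "has_qexp f a \<Longrightarrow> has_qexp (cscale c f) (\<lambda>n. c * a n)"
  unfolding has_qexp_def cscale_def by (auto simp: mult.assoc intro: sums_mult)

lemma has_qexp_0: "has_qexp 0 (\<lambda>n. 0)"
  by (simp add: has_qexp_def)

lemma norm_less_qpar:
  assumes "r < 1" obtains \<tau> where "norm (qpar \<tau>) > r"
proof -
  \<comment> \<open>Chosen so that q is the midpoint between max(r, 1/2) and 1; the maximum with 1/2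
    keeps the argument of the logarithm positive.\<close>
  define y where "y = - ln ((max r (1/2) + 1) / 2) / (2 * pi)"
  have "ln ((max r (1/2) + 1) / 2) < 0" using assms by (subst ln_less_zero_iff) auto
  then have y: "y > 0" by (auto simp: y_def field_simps)
  have "exp (- 2 * pi * y) = (max r (1/2) + 1) / 2" by (simp add: y_def exp_ln_iff)
  also have "\<dots> > r" using assms by auto
  finally show ?thesis using that[of "Abs_uhp (\<i> * of_real y)"] unfolding qpar_imag[OF y] by simp
qed

lemma has_qexp_summable:
  assumes "has_qexp f b" "norm z < 1"
  shows "summable (\<lambda>n. norm (b n * z ^ n))"
proof -
  obtain \<tau> where "norm (qpar \<tau>) > norm z" using norm_less_qpar[OF assms(2)] by blast
  moreover have "summable (\<lambda>n. b n * qpar \<tau> ^ n)" using assms by (auto simp: has_qexp_def sums_iff)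
  ultimately show ?thesis by (intro powser_insidea)
qed

lemma has_qexp_mult:
  assumes "has_qexp f a" "has_qexp h b"
  shows "has_qexp (f * h) (\<lambda>n. \<Sum>i\<le>n. a i * b (n - i))"
  unfolding has_qexp_def
proof
  fix \<tau>
  have "(\<lambda>k. \<Sum>i\<le>k. (a i * qpar \<tau> ^ i) * (b (k - i) * qpar \<tau> ^ (k - i))) sums
      (suminf (\<lambda>k. a k * qpar \<tau> ^ k) * suminf (\<lambda>k. b k * qpar \<tau> ^ k))"
    by (rule Cauchy_product_sums) (use has_qexp_summable[OF _ norm_qpar(1)] assms in auto)
  moreover have "suminf (\<lambda>k. a k * qpar \<tau> ^ k) = f \<tau>" "suminf (\<lambda>k. b k * qpar \<tau> ^ k) = h \<tau>"
    using assms by (auto simp: has_qexp_def sums_iff)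
  moreover have "(\<Sum>i\<le>k. (a i * qpar \<tau> ^ i) * (b (k - i) * qpar \<tau> ^ (k - i))) = (\<Sum>i\<le>k. a i * b (k - i)) * qpar \<tau> ^ k" for k
    unfolding sum_distrib_right by (rule sum.cong) (auto simp: power_add[symmetric] mult_ac)
  ultimately show "(\<lambda>n. (\<Sum>i\<le>n. a i * b (n - i)) * qpar \<tau> ^ n) sums (f * h) \<tau>" by simp
qed

text \<open>On the imaginary axis q runs through all of (0, 1), which accumulates at 0, whereas the
  zeros of a nonzero power series are isolated.\<close>

lemma has_qexp_zero_coeffs:
  assumes f: "has_qexp f b" and z: "\<And>y. y > 0 \<Longrightarrow> f (Abs_uhp (\<i> * of_real y)) = 0"
  shows "b n = 0"
proof (rule ccontr)
  assume nz: "b n \<noteq> 0"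
  \<comment> \<open>Multiplication by q forces the value 0 at the origin, as
    \<open>powser_0_nonzero\<close> demands; the nonzero coefficient moves to a positive
    index.\<close>
  define c where "c m = (case m of 0 \<Rightarrow> 0 | Suc k \<Rightarrow> b k)" for m
  define F where "F x = suminf (\<lambda>m. c m * x ^ m)" for x
  have c_sum: "summable (\<lambda>m. c m * x ^ m)" if "norm x < 1" for x
  proof -
    have "summable (\<lambda>m. x * (b m * x ^ m))"
      by (intro summable_mult summable_norm_cancel[OF has_qexp_summable[OF f that]])
    then show ?thesis by (subst summable_Suc_iff[symmetric]) (simp add: c_def mult_ac)
  qed
  obtain s where s: "0 < s" "\<And>z. z \<in> cball 0 s - {0} \<Longrightarrow> F z \<noteq> 0"
    by (rule powser_0_nonzero[of 1 0 c F "Suc n"]) (use nz c_sum in \<open>auto simp: F_def c_def sums_iff\<close>)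
  define y where "y = - ln (min s (1/2)) / (2 * pi)"
  have "ln (min s (1/2)) < 0" using s by (subst ln_less_zero_iff) auto
  then have y: "y > 0" by (auto simp: y_def field_simps)
  have e: "exp (- 2 * pi * y) = min s (1/2)" using s by (simp add: y_def exp_ln_iff)
  let ?\<tau> = "Abs_uhp (\<i> * of_real y)"
  have q: "qpar ?\<tau> = of_real (min s (1/2))" using qpar_imag[OF y] e by simp
  have "(\<lambda>n. b n * qpar ?\<tau> ^ n) sums f ?\<tau>" using f unfolding has_qexp_def by blast
  then have "(\<lambda>n. b n * qpar ?\<tau> ^ n) sums 0" unfolding z[OF y] .
  then have "(\<lambda>n. qpar ?\<tau> * (b n * qpar ?\<tau> ^ n)) sums (qpar ?\<tau> * 0)" by (rule sums_mult)
  then have "(\<lambda>m. c m * qpar ?\<tau> ^ m) sums 0"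
    using sums_Suc_iff[of "\<lambda>m. c m * qpar ?\<tau> ^ m" 0] by (simp add: c_def mult_ac)
  then have "F (qpar ?\<tau>) = 0" by (simp add: F_def sums_iff)
  moreover have "qpar ?\<tau> \<in> cball 0 s - {0}" unfolding q using s by auto
  ultimately show False using s by blast
qed

lemma has_qexp_unique:
  assumes "has_qexp f a" "has_qexp f b"
  shows "a = b"
proof
  fix n
  have "has_qexp (f + cscale (-1) f) (\<lambda>n. a n + (-1) * b n)"
    by (intro has_qexp_add has_qexp_scale assms)
  from has_qexp_zero_coeffs[OF this, of n] show "a n = b n" by (simp add: cscale_def)
qed

lemma has_qexp_vanish:
  assumes "has_qexp f b" "\<And>y. y > 0 \<Longrightarrow> f (Abs_uhp (\<i> * of_real y)) = 0"
  shows "f = 0"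
proof
  fix \<tau>
  have "(\<lambda>n. b n * qpar \<tau> ^ n) sums f \<tau>" using assms by (auto simp: has_qexp_def)
  moreover have "b = (\<lambda>n. 0)" using has_qexp_zero_coeffs[OF assms] by auto
  ultimately show "f \<tau> = 0 \<tau>" by (simp add: sums_iff)
qed

section \<open>Uniform bounds in a vertical strip around a pole\<close>

lemma poly_pole_bound:
  fixes f :: "complex \<Rightarrow> complex"
  assumes cont: "continuous_on (-\<int>) f"
    and big: "f \<in> O[at 0](\<lambda>x. 1 / x ^ e)"
    and dec: "\<And>x. Im x \<ge> 1 \<Longrightarrow> norm (f x) \<le> C * norm (qexp x)"
  obtains B where "\<And>x. \<bar>Re x\<bar> \<le> 3 / 4 \<Longrightarrow> Im x > 0 \<Longrightarrow> norm (f x) \<le> B / norm x ^ e"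
proof -
  from big obtain c where c: "eventually (\<lambda>x. norm (f x) \<le> c * norm (1 / x ^ e)) (at 0)" by (auto elim: landau_o.bigE)
  then obtain r where r: "r > 0" "\<And>x. x \<noteq> 0 \<Longrightarrow> norm x < r \<Longrightarrow> norm (f x) \<le> c * norm (1 / x ^ e)"
    by (auto simp: eventually_at dist_norm)
  \<comment> \<open>Any half-width between 1/2 and 1 keeps 0 as the only integer in the strip; 3/4
    also leaves room for points shifted one step to the right. The strip is cut into a disc about 0,
    this compact set without poles, and the part above height 1, where exponential decay beats the
    power.\<close>
  let ?K = "cbox (Complex (-3/4) 0) (Complex (3/4) 1) - ball 0 r"
  have "compact ?K" by (intro compact_diff compact_cbox open_ball)
  moreover have "?K \<subseteq> -\<int>"
  proof
    fix x assume x: "x \<in> ?K"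
    show "x \<in> -\<int>"
    proof
      assume "x \<in> \<int>"
      then obtain n where n: "x = of_int n" by (auto elim: Ints_cases)
      then have "\<bar>of_int n\<bar> \<le> (3 / 4 :: real)" using x by (auto simp: in_cbox_complex_iff)
      then have "n = 0" by linarith
      then show False using x n r by auto
    qed
  qed
  then have "continuous_on ?K (\<lambda>x. f x * x ^ e)" by (intro continuous_intros continuous_on_subset[OF cont])
  ultimately have "compact ((\<lambda>x. f x * x ^ e) ` ?K)" by (intro compact_continuous_image)
  then obtain D where D: "\<And>x. x \<in> ?K \<Longrightarrow> norm (f x * x ^ e) \<le> D"
    by (metis (no_types, lifting) bounded_iff compact_imp_bounded imageI)
  define B where "B = max (max c D) (\<bar>C\<bar> * fact e)"
  have "norm (f x) \<le> B / norm x ^ e" if x: "\<bar>Re x\<bar> \<le> 3 / 4" "Im x > 0" for x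
  proof -
    have nz: "x \<noteq> 0" using x by auto
    have "norm (f x) * norm x ^ e \<le> B"
    proof -
      consider "norm x < r" | "norm x \<ge> r" "Im x \<le> 1" | "Im x \<ge> 1" by linarith
      then show ?thesis
      proof cases
        case 1
        then have "norm (f x) * norm x ^ e \<le> c * norm (1 / x ^ e) * norm x ^ e"
          using r(2)[OF nz] by (intro mult_right_mono) auto
        also have "\<dots> = c" using nz by (simp add: norm_divide norm_power)
        finally show ?thesis by (simp add: B_def)
      next
        case 2
        then have "x \<in> ?K" using x by (auto simp: in_cbox_complex_iff abs_le_iff)
        from D[OF this] show ?thesis by (simp add: B_def norm_mult norm_power)
      next
        case 3
        have "norm x \<le> \<bar>Re x\<bar> + \<bar>Im x\<bar>" by (rule cmod_le)
        also have "\<dots> \<le> 2 * pi * Im x"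
        proof -
          have "2 * Im x \<le> (2 * pi) * Im x" using pi_gt3 3 by (intro mult_right_mono) auto
          then show ?thesis using x 3 by linarith
        qed
        finally have "norm x ^ e \<le> (2 * pi * Im x) ^ e" by (intro power_mono) auto
        also have "\<dots> \<le> fact e * exp (2 * pi * Im x)"
        proof -
          have "(2 * pi * Im x) ^ e /\<^sub>R fact e \<le> exp (2 * pi * Im x)"
            unfolding exp_def using 3 sum_le_suminf[OF summable_exp_generic[of "2 * pi * Im x"], of "{e}"] by (simp add: field_simps)
          then show ?thesis by (simp add: field_simps)
        qed
        finally have "norm (f x) * norm x ^ e \<le> (\<bar>C\<bar> * norm (qexp x)) * (fact e * exp (2 * pi * Im x))"
          using dec[OF 3] by (intro mult_mono order.trans[OF dec[OF 3]] mult_right_mono) auto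
        also have "\<dots> = \<bar>C\<bar> * fact e" by (simp add: norm_qexp exp_minus)
        finally show ?thesis by (simp add: B_def)
      qed
    qed
    then show ?thesis using nz by (simp add: pos_le_divide_eq)
  qed
  then show ?thesis using that by blast
qed

lemma norm_qexp_le: "Im x \<ge> 1 \<Longrightarrow> norm (qexp x) \<le> exp (- 2 * pi)"
  unfolding norm_qexp using mult_left_mono[of 1 "Im x" "2 * pi"] by simp

text \<open>An exponent above the pole order is allowed: near 0 this only weakens the bound, and far
  up the decay is exponential. The case k+1 is what uses the surplus factor 1/d.\<close>

lemma tangent_poly_pole_bound:
  assumes "k \<ge> 2" "e \<ge> k"
  obtains B where "\<And>x. \<bar>Re x\<bar> \<le> 3 / 4 \<Longrightarrow> Im x > 0 \<Longrightarrow> norm (poly (tangent_poly k) (qden x)) \<le> B / norm x ^ e"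
proof -
  have t: "tangent_like k (\<lambda>x. poly (tangent_poly k) (qden x))" by (rule tangent_like_tangent_poly[OF assms(1)])
  obtain C where C: "\<And>q. norm q \<le> exp (- 2 * pi) \<Longrightarrow> norm (poly (tangent_poly k) (1 / (1 - q))) \<le> C * norm q"
    using tangent_poly_bound[OF assms(1), of "exp (- 2 * pi)"] by auto
  show ?thesis
  proof (rule poly_pole_bound[where f = "\<lambda>x. poly (tangent_poly k) (qden x)" and e = e and C = C])
    show "continuous_on (-\<int>) (\<lambda>x. poly (tangent_poly k) (qden x))"
      using t unfolding tangent_like_def by (blast intro: holomorphic_on_imp_continuous_on)
    show "(\<lambda>x. poly (tangent_poly k) (qden x)) \<in> O[at 0](\<lambda>x. 1 / x ^ e)"
      using t unfolding tangent_like_def by (blast intro: landau_o.big_trans inverse_power_bigo[OF assms(2)])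
    show "norm (poly (tangent_poly k) (qden x)) \<le> C * norm (qexp x)" if "Im x \<ge> 1" for x
      unfolding qden_def by (rule C[OF norm_qexp_le[OF that]])
  qed (use that in blast)
qed

text \<open>\<open>qden\<close> itself tends to 1 far up in the strip; the factor
  \<open>qexp\<close> provides the decay. This product occurs in the remainder of the telescoped
  weight two series.\<close>

lemma qexp_qden_pole_bound:
  obtains B where "\<And>x. \<bar>Re x\<bar> \<le> 3 / 4 \<Longrightarrow> Im x > 0 \<Longrightarrow> norm (qexp x * qden x) \<le> B / norm x"
proof -
  have lim: "((\<lambda>x. x ^ 1 * (qexp x * qden x)) \<longlongrightarrow> qexp 0 * (- 1 / (2 * of_real pi * \<i>))) (at 0)"
  proof -
    have "isCont qexp 0" unfolding qexp_def by (intro continuous_intros)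
    then have "((\<lambda>x. qexp x * (x * qden x)) \<longlongrightarrow> qexp 0 * (- 1 / (2 * of_real pi * \<i>))) (at 0)"
      by (intro tendsto_mult qden_times_bigo) (simp add: isCont_def)
    then show ?thesis by (simp add: mult.left_commute)
  qed
  show ?thesis
  proof (rule poly_pole_bound[where f = "\<lambda>x. qexp x * qden x" and e = 1 and C = "1 / (1 - exp (- pi))"])
    show "continuous_on (-\<int>) (\<lambda>x. qexp x * qden x)"
      by (intro holomorphic_on_imp_continuous_on holomorphic_intros)
    show "(\<lambda>x. qexp x * qden x) \<in> O[at 0](\<lambda>x. 1 / x ^ 1)" by (rule tendsto_imp_bigo_pole[OF lim])
    show "norm (qexp x * qden x) \<le> 1 / (1 - exp (- pi)) * norm (qexp x)" if "Im x \<ge> 1" for x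
      using mult_left_mono[OF qden_bounded[of x], of "norm (qexp x)"] that by (simp add: norm_mult mult.commute)
  qed (use that in auto)
qed

subsection \<open>Series over chains of lattice points\<close>

definition upper_pts :: "(int \<times> int) set" where "upper_pts = {p. p \<succ>\<^sub>L (0, 0)}"

lemma fst_upper_pts: "p \<in> upper_pts \<Longrightarrow> fst p \<ge> 0"
  unfolding upper_pts_def lattice_succ_def by simp linarith

definition below :: "int \<times> int \<Rightarrow> (int \<times> int) set" where "below p = {p' \<in> upper_pts. p \<succ>\<^sub>L p'}"

text \<open>Infinite counterpart of \<open>chain_sum\<close> as nested unordered sums. A family that
  is not summable has \<open>infsum\<close> equal to 0, so a value means something only together
  with a domination argument.\<close>

fun chain_series :: "(nat \<Rightarrow> int \<times> int \<Rightarrow> complex) \<Rightarrow> nat list \<Rightarrow> (int \<times> int) set \<Rightarrow> complex" where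
  "chain_series \<phi> [] D = 1"
| "chain_series \<phi> (k # ks) D = infsum (\<lambda>p. \<phi> k p * chain_series \<phi> ks (below p)) D"

lemma chain_sum_Cons_sorted:
  assumes "sorted_wrt (\<succ>\<^sub>L) xs"
  shows "chain_sum F xs (k # ks) = (\<Sum>p\<in>set xs. F k p * chain_sum F (filter (\<lambda>p'. p \<succ>\<^sub>L p') xs) ks)"
  using assms
proof (induction xs)
  case (Cons x xs)
  have irr: "\<not> p \<succ>\<^sub>L p" and asym: "p \<succ>\<^sub>L p' \<Longrightarrow> \<not> p' \<succ>\<^sub>L p" for p p' by (auto simp: lattice_succ_def)
  have x: "x \<notin> set xs" "\<And>p. p \<in> set xs \<Longrightarrow> x \<succ>\<^sub>L p"
    using Cons.prems irr[of x] by (metis sorted_wrt.simps(2))+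
  have 1: "filter (\<lambda>p'. x \<succ>\<^sub>L p') (x # xs) = xs" using x irr by (auto intro: filter_True)
  have 2: "filter (\<lambda>p'. p \<succ>\<^sub>L p') (x # xs) = filter (\<lambda>p'. p \<succ>\<^sub>L p') xs" if "p \<in> set xs" for p
    using x asym that by auto
  have "chain_sum F (x # xs) (k # ks) = F k x * chain_sum F xs ks + (\<Sum>p\<in>set xs. F k p * chain_sum F (filter (\<lambda>p'. p \<succ>\<^sub>L p') xs) ks)"
    using Cons by (simp add: add.commute)
  also have "\<dots> = (\<Sum>p\<in>set (x # xs). F k p * chain_sum F (filter (\<lambda>p'. p \<succ>\<^sub>L p') (x # xs)) ks)"
    using x(1) by (simp only: list.set sum.insert[OF List.finite_set x(1)] 1 2 cong: sum.cong)
  finally show ?case .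
qed simp

text \<open>\<open>D\<close> is closed under passing to smaller points, so the nested sums stay
  inside \<open>D\<close>, and there all terms off the list vanish.\<close>

lemma chain_series_eq_chain_sum:
  assumes "sorted_wrt (\<succ>\<^sub>L) xs" "set xs \<subseteq> D" "D \<subseteq> upper_pts"
    "\<And>p p'. p \<in> D \<Longrightarrow> p' \<in> below p \<Longrightarrow> p' \<in> D"
    "\<And>k p. k \<in> set ks \<Longrightarrow> p \<in> D - set xs \<Longrightarrow> \<phi> k p = 0"
  shows "chain_series \<phi> ks D = chain_sum \<phi> xs ks"
  using assms
proof (induction ks arbitrary: xs D)
  case (Cons k ks)
  have "chain_series \<phi> (k # ks) D = infsum (\<lambda>p. \<phi> k p * chain_series \<phi> ks (below p)) (set xs)"
    unfolding chain_series.simps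
    by (rule infsum_cong_neutral) (use Cons.prems(2,5) in auto)
  also have "\<dots> = (\<Sum>p\<in>set xs. \<phi> k p * chain_series \<phi> ks (below p))" by simp
  also have "\<dots> = (\<Sum>p\<in>set xs. \<phi> k p * chain_sum \<phi> (filter (\<lambda>p'. p \<succ>\<^sub>L p') xs) ks)"
  proof (rule sum.cong[OF refl])
    fix p assume p: "p \<in> set xs"
    have "chain_series \<phi> ks (below p) = chain_sum \<phi> (filter (\<lambda>p'. p \<succ>\<^sub>L p') xs) ks"
    proof (rule Cons.IH)
      show "sorted_wrt (\<succ>\<^sub>L) (filter (\<lambda>p'. p \<succ>\<^sub>L p') xs)" using Cons.prems(1) by (rule sorted_wrt_filter)
      show "set (filter (\<lambda>p'. p \<succ>\<^sub>L p') xs) \<subseteq> below p" using Cons.prems by (auto simp: below_def)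
      show "below p \<subseteq> upper_pts" by (auto simp: below_def)
      show "p' \<in> below p" if "q \<in> below p" "p' \<in> below q" for q p'
        using that by (auto simp: below_def lattice_succ_def)
      show "\<phi> l q = 0" if "l \<in> set ks" "q \<in> below p - set (filter (\<lambda>p'. p \<succ>\<^sub>L p') xs)" for l q
      proof -
        have "q \<in> D" using Cons.prems(4)[of p q] Cons.prems(2) p that by auto
        moreover have "q \<notin> set xs" using that by (auto simp: below_def)
        ultimately show ?thesis using Cons.prems(5)[of l q] that by auto
      qed
    qed
    then show "\<phi> k p * chain_series \<phi> ks (below p) = \<phi> k p * chain_sum \<phi> (filter (\<lambda>p'. p \<succ>\<^sub>L p') xs) ks" by simp
  qed
  also have "\<dots> = chain_sum \<phi> xs (k # ks)" by (rule chain_sum_Cons_sorted[symmetric]) (rule Cons.prems(1))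
  finally show ?case .
qed simp

text \<open>Dominated convergence for unordered sums: the majorant makes the finite partial sums
  converge uniformly in \<open>N\<close>, which permits exchanging the two limits.\<close>

lemma dominated_infsum:
  fixes w :: "'b \<Rightarrow> real" and f :: "nat \<Rightarrow> 'b \<Rightarrow> complex"
  assumes lim: "\<And>x. x \<in> D \<Longrightarrow> (\<lambda>N. f N x) \<longlonglongrightarrow> F x"
    and bound: "\<And>N x. x \<in> D \<Longrightarrow> norm (f N x) \<le> w x" and g: "w summable_on D"
  shows "(\<lambda>N. infsum (f N) D) \<longlonglongrightarrow> infsum F D" "norm (infsum (f N) D) \<le> infsum w D" "(\<lambda>x. norm (F x)) summable_on D"
proof -
  have absf: "(\<lambda>x. norm (f N x)) summable_on D" for N
    by (rule Infinite_Sum.abs_summable_on_comparison_test'[OF g]) (use bound in auto)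
  have boundF: "norm (F x) \<le> w x" if "x \<in> D" for x
    by (rule LIMSEQ_le_const2[OF tendsto_norm[OF lim[OF that]]]) (use bound[OF that] in auto)
  show absF: "(\<lambda>x. norm (F x)) summable_on D"
    by (rule Infinite_Sum.abs_summable_on_comparison_test'[OF g]) (use boundF in auto)
  have ul: "uniform_limit UNIV (\<lambda>S N. \<Sum>x\<in>S. f N x) (\<lambda>N. infsum (f N) D) (finite_subsets_at_top D)"
    using Weierstrass_m_test_general[of D UNIV "\<lambda>x N. f N x" w] bound g by auto
  have ev: "\<forall>\<^sub>F S in finite_subsets_at_top D. (\<lambda>N. \<Sum>x\<in>S. f N x) \<longlonglongrightarrow> (\<Sum>x\<in>S. F x)"
    by (rule eventually_finite_subsets_at_top_weakI) (auto intro!: tendsto_sum lim)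
  have lm: "((\<lambda>S. \<Sum>x\<in>S. F x) \<longlongrightarrow> infsum F D) (finite_subsets_at_top D)"
    using has_sum_infsum[OF abs_summable_summable[OF absF]] by (simp add: has_sum_def)
  show "(\<lambda>N. infsum (f N) D) \<longlonglongrightarrow> infsum F D"
    by (rule swap_uniform_limit'[OF ev lm ul]) auto
  have "norm (infsum (f N) D) \<le> infsum (\<lambda>x. norm (f N x)) D" by (rule norm_infsum_bound[OF absf])
  also have "\<dots> \<le> infsum w D" by (rule infsum_mono[OF absf g bound])
  finally show "norm (infsum (f N) D) \<le> infsum w D" .
qed

definition pt_size :: "int \<times> int \<Rightarrow> real" where "pt_size p = 1 + of_int \<bar>fst p\<bar> + of_int \<bar>snd p\<bar>"

lemma pt_size_pos: "pt_size p \<ge> 1" by (simp add: pt_size_def)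

lemma summable_int_powr:
  assumes "p > 1"
  shows "(\<lambda>n::int. (1 + of_int \<bar>n\<bar>) powr (- p) :: real) summable_on UNIV"
proof -
  have "summable (\<lambda>n. of_nat n powr (- p))" using assms by (simp add: summable_real_powr_iff)
  then have "summable (\<lambda>n. of_nat (Suc n) powr (- p))" by (subst summable_Suc_iff)
  then have nat: "(\<lambda>n::nat. (1 + real n) powr (- p)) summable_on UNIV"
    by (intro summable_nonneg_imp_summable_on) (auto simp: add.commute)
  have "(\<lambda>n::int. (1 + of_int \<bar>n\<bar>) powr (- p) :: real) summable_on range int"
    using nat by (subst summable_on_reindex) (auto simp: o_def)
  moreover have "(\<lambda>n::int. (1 + of_int \<bar>n\<bar>) powr (- p) :: real) summable_on range (\<lambda>n. - int n)"
    using nat by (subst summable_on_reindex) (auto simp: o_def inj_on_def)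
  ultimately have "(\<lambda>n::int. (1 + of_int \<bar>n\<bar>) powr (- p) :: real) summable_on (range int \<union> range (\<lambda>n. - int n))"
    by (rule summable_on_union)
  moreover have "range int \<union> range (\<lambda>n. - int n) = UNIV"
    by (auto simp: image_iff) (metis int_cases2)
  ultimately show ?thesis by simp
qed

lemma summable_pt_weight:
  assumes "p > 1"
  shows "(\<lambda>x::int\<times>int. (1 + of_int \<bar>fst x\<bar>) powr (- p) * (1 + of_int \<bar>snd x\<bar>) powr (- p) :: real) summable_on A"
proof -
  let ?f = "\<lambda>n::int. (1 + of_int \<bar>n\<bar>) powr (- p) :: real"
  have s: "?f summable_on UNIV" by (rule summable_int_powr[OF assms])
  have "(\<lambda>x. norm (case x of (x, y) \<Rightarrow> ?f x * ?f y)) summable_on UNIV \<times> UNIV"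
    by (rule has_sum_product(1)[OF has_sum_infsum[OF s] has_sum_infsum[OF s]]) (use s in auto)
  then have "(\<lambda>x::int\<times>int. ?f (fst x) * ?f (snd x)) summable_on UNIV" by (simp add: case_prod_unfold abs_mult)
  then show ?thesis by (rule summable_on_subset_banach) auto
qed

lemma pt_size_powr_le:
  assumes "a \<ge> 0" "b \<ge> 0"
  shows "pt_size p powr (- (a + b)) \<le> (1 + of_int \<bar>fst p\<bar>) powr (- a) * (1 + of_int \<bar>snd p\<bar>) powr (- b)"
proof -
  have "pt_size p powr (- (a + b)) = pt_size p powr (- a) * pt_size p powr (- b)" by (simp add: powr_add[symmetric])
  also have "\<dots> \<le> (1 + of_int \<bar>fst p\<bar>) powr (- a) * (1 + of_int \<bar>snd p\<bar>) powr (- b)"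
    by (intro mult_mono powr_mono2') (use assms in \<open>auto simp: pt_size_def\<close>)
  finally show ?thesis .
qed

text \<open>Exponent 2 alone is the divergent borderline in dimension two. The extra
  \<open>\<epsilon>\<close> in the row index is shared so that both coordinates end up with exponent
  1 + \<open>\<epsilon>\<close>/2.\<close>

lemma summable_weight2:
  assumes "\<epsilon> > 0" "\<epsilon> \<le> 1"
  shows "(\<lambda>p. pt_size p powr (- 2) * (1 + of_int \<bar>fst p\<bar>) powr (- \<epsilon>)) summable_on A"
proof (rule summable_on_comparison_test[OF summable_pt_weight[of "1 + \<epsilon> / 2"]])
  fix p :: "int \<times> int"
  have "pt_size p powr (- 2) \<le> (1 + of_int \<bar>fst p\<bar>) powr (- (1 - \<epsilon> / 2)) * (1 + of_int \<bar>snd p\<bar>) powr (- (1 + \<epsilon> / 2))"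
    using pt_size_powr_le[of "1 - \<epsilon> / 2" "1 + \<epsilon> / 2" p] assms by simp
  then have "pt_size p powr (- 2) * (1 + of_int \<bar>fst p\<bar>) powr (- \<epsilon>) \<le> 
    (1 + of_int \<bar>fst p\<bar>) powr (- (1 - \<epsilon> / 2)) * (1 + of_int \<bar>snd p\<bar>) powr (- (1 + \<epsilon> / 2)) * (1 + of_int \<bar>fst p\<bar>) powr (- \<epsilon>)"
    by (intro mult_right_mono) auto
  also have "\<dots> = ((1 + of_int \<bar>fst p\<bar>) powr (- (1 - \<epsilon> / 2)) * (1 + of_int \<bar>fst p\<bar>) powr (- \<epsilon>)) * (1 + of_int \<bar>snd p\<bar>) powr (- (1 + \<epsilon> / 2))"
    by (simp add: mult_ac)
  also have "(1 + of_int \<bar>fst p\<bar>) powr (- (1 - \<epsilon> / 2)) * (1 + of_int \<bar>fst p\<bar>) powr (- \<epsilon>) = (1 + of_int \<bar>fst p\<bar> :: real) powr (- (1 + \<epsilon> / 2))"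
    by (subst powr_add[symmetric], rule arg_cong2[where f = "(powr)"]) (simp_all add: field_simps)
  finally show "pt_size p powr (- 2) * (1 + of_int \<bar>fst p\<bar>) powr (- \<epsilon>) \<le> (1 + of_int \<bar>fst p\<bar>) powr (- (1 + \<epsilon> / 2)) * (1 + of_int \<bar>snd p\<bar>) powr (- (1 + \<epsilon> / 2))" .
qed (use assms in auto)

text \<open>Exponent 3 leaves room to give away a power 1/2 of the row index: 3 is split as 7/4 +
  5/4, and 7/4 - 1/2 = 5/4 is still above 1.\<close>

lemma summable_weight3:
  "(\<lambda>p. pt_size p powr (- 3) * (1 + of_int \<bar>fst p\<bar>) powr (1 / 2)) summable_on A"
proof (rule summable_on_comparison_test[OF summable_pt_weight[of "5 / 4"]])
  fix p :: "int \<times> int"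
  have "pt_size p powr (- 3) \<le> (1 + of_int \<bar>fst p\<bar>) powr (- (7 / 4)) * (1 + of_int \<bar>snd p\<bar>) powr (- (5 / 4))"
    using pt_size_powr_le[of "7 / 4" "5 / 4" p] by simp
  then have "pt_size p powr (- 3) * (1 + of_int \<bar>fst p\<bar>) powr (1 / 2) \<le> 
    (1 + of_int \<bar>fst p\<bar>) powr (- (7 / 4)) * (1 + of_int \<bar>snd p\<bar>) powr (- (5 / 4)) * (1 + of_int \<bar>fst p\<bar>) powr (1 / 2)"
    by (intro mult_right_mono) auto
  also have "\<dots> = ((1 + of_int \<bar>fst p\<bar>) powr (- (7 / 4)) * (1 + of_int \<bar>fst p\<bar>) powr (1 / 2)) * (1 + of_int \<bar>snd p\<bar>) powr (- (5 / 4))"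
    by (simp add: mult_ac)
  also have "(1 + of_int \<bar>fst p\<bar>) powr (- (7 / 4)) * (1 + of_int \<bar>fst p\<bar>) powr (1 / 2) = (1 + of_int \<bar>fst p\<bar> :: real) powr (- (5 / 4))"
    by (simp add: powr_add[symmetric])
  finally show "pt_size p powr (- 3) * (1 + of_int \<bar>fst p\<bar>) powr (1 / 2) \<le> (1 + of_int \<bar>fst p\<bar>) powr (- (5 / 4)) * (1 + of_int \<bar>snd p\<bar>) powr (- (5 / 4))" .
qed auto

text \<open>
  The row of a point majorises the rows of all smaller points; this allows the first point of a chain
  to donate a small power of its row index to the convergence of the sums over the other points.
\<close>

lemma chain_series_bounded:
  fixes \<phi> :: "nat \<Rightarrow> nat \<Rightarrow> int \<times> int \<Rightarrow> complex" and \<epsilon> :: real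
  assumes bound: "\<And>N k p. k \<in> set ks \<Longrightarrow> p \<in> upper_pts \<Longrightarrow> norm (\<phi> N k p) \<le> C k * pt_size p powr (- 2)"
    and lim: "\<And>k p. k \<in> set ks \<Longrightarrow> p \<in> upper_pts \<Longrightarrow> (\<lambda>N. \<phi> N k p) \<longlonglongrightarrow> \<psi> k p"
    and eps: "\<epsilon> > 0" "\<epsilon> \<le> 1"
  shows "\<exists>K\<ge>0. \<forall>D J. D \<subseteq> upper_pts \<longrightarrow> (\<forall>p\<in>D. fst p \<le> J) \<longrightarrow> J \<ge> 0 \<longrightarrow>
     (\<lambda>N. chain_series (\<phi> N) ks D) \<longlonglongrightarrow> chain_series \<psi> ks D \<and>
     (\<forall>N. norm (chain_series (\<phi> N) ks D) \<le> K * (1 + of_int J) powr (\<epsilon> * length ks))"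
  using bound lim
proof (induction ks)
  case Nil
  show ?case by (rule exI[of _ 1]) auto
next
  case (Cons k ks)
  obtain K where K: "K \<ge> 0" and IH: "\<And>D J. D \<subseteq> upper_pts \<Longrightarrow> \<forall>p\<in>D. fst p \<le> J \<Longrightarrow> J \<ge> 0 \<Longrightarrow>
     (\<lambda>N. chain_series (\<phi> N) ks D) \<longlonglongrightarrow> chain_series \<psi> ks D \<and>
     (\<forall>N. norm (chain_series (\<phi> N) ks D) \<le> K * (1 + of_int J) powr (\<epsilon> * length ks))"
    using Cons.IH Cons.prems by auto
  let ?w = "\<lambda>p. pt_size p powr (- 2) * (1 + of_int \<bar>fst p\<bar>) powr (- \<epsilon>)"
  have below: "below p \<subseteq> upper_pts" "\<forall>q\<in>below p. fst q \<le> fst p" for p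
    by (auto simp: below_def lattice_succ_def)
  have C0: "C k * pt_size p powr (- 2) \<ge> 0" if "p \<in> upper_pts" for p
    by (rule order.trans[OF norm_ge_zero Cons.prems(1)[of k p 0]]) (use that in auto)
  have "(1, 0) \<in> upper_pts" by (simp add: upper_pts_def lattice_succ_def)
  from C0[OF this] have C: "C k \<ge> 0" by (simp add: pt_size_def zero_le_mult_iff)
  show ?case
  proof (intro exI[of _ "C k * K * infsum ?w upper_pts"] conjI allI impI)
    show "0 \<le> C k * K * infsum ?w upper_pts" using C K by (intro mult_nonneg_nonneg infsum_nonneg) auto
    fix D :: "(int \<times> int) set" and J :: int
    assume D: "D \<subseteq> upper_pts" "\<forall>p\<in>D. fst p \<le> J" "0 \<le> J"
    let ?Z = "(1 + of_int J) powr (\<epsilon> * real (length (k # ks)))"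
    let ?g = "\<lambda>p. (C k * K * ?Z) * ?w p"
    have bd: "norm (\<phi> N k p * chain_series (\<phi> N) ks (below p)) \<le> ?g p" if p: "p \<in> D" for N p
    proof -
      have j: "fst p \<ge> 0" "fst p \<le> J" using p D by (auto simp: upper_pts_def lattice_succ_def)
      have "norm (chain_series (\<phi> N) ks (below p)) \<le> K * (1 + of_int (fst p)) powr (\<epsilon> * length ks)"
        using IH[OF below[of p] j(1)] by blast
      \<comment> \<open>One power \<open>\<epsilon>\<close> of the row index is split off. The
        positive part goes into the bound in terms of \<open>J\<close>; the negative part is what
        makes the weight \<open>?w\<close> summable.\<close>
      also have "(1 + of_int (fst p)) powr (\<epsilon> * length ks) = (1 + of_int (fst p)) powr (\<epsilon> * real (length (k # ks))) * (1 + of_int (fst p)) powr (- \<epsilon>)"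
        using j by (simp add: powr_add[symmetric] algebra_simps)
      also have "\<dots> \<le> ?Z * (1 + of_int (fst p)) powr (- \<epsilon>)"
        using j eps by (intro mult_right_mono powr_mono2) auto
      finally have 2: "norm (chain_series (\<phi> N) ks (below p)) \<le> K * (?Z * (1 + of_int \<bar>fst p\<bar>) powr (- \<epsilon>))"
        using j K by (simp add: mult_left_mono)
      have "norm (\<phi> N k p) \<le> C k * pt_size p powr (- 2)" using Cons.prems(1)[of k p N] p D by auto
      then have "norm (\<phi> N k p * chain_series (\<phi> N) ks (below p)) \<le> (C k * pt_size p powr (- 2)) * (K * (?Z * (1 + of_int \<bar>fst p\<bar>) powr (- \<epsilon>)))"
        unfolding norm_mult by (intro mult_mono 2) (use C in auto)
      then show ?thesis by (simp add: mult_ac)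
    qed
    have tend: "(\<lambda>N. \<phi> N k p * chain_series (\<phi> N) ks (below p)) \<longlonglongrightarrow> \<psi> k p * chain_series \<psi> ks (below p)" if p: "p \<in> D" for p
    proof (rule tendsto_mult)
      show "(\<lambda>N. \<phi> N k p) \<longlonglongrightarrow> \<psi> k p" using Cons.prems(2)[of k p] p D by auto
      have "fst p \<ge> 0" using p D by (auto simp: upper_pts_def lattice_succ_def)
      then show "(\<lambda>N. chain_series (\<phi> N) ks (below p)) \<longlonglongrightarrow> chain_series \<psi> ks (below p)"
        using IH[OF below[of p]] by blast
    qed
    have g: "?g summable_on D" by (intro summable_on_cmult_right summable_weight2 eps)
    note dom = dominated_infsum[OF tend bd g]
    show "(\<lambda>N. chain_series (\<phi> N) (k # ks) D) \<longlonglongrightarrow> chain_series \<psi> (k # ks) D"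
      using dom(1) by simp
    fix N
    have "norm (chain_series (\<phi> N) (k # ks) D) \<le> infsum ?g D" using dom(2) by simp
    also have "\<dots> = (C k * K * ?Z) * infsum ?w D" by (rule infsum_cmult_right')
    also have "\<dots> \<le> (C k * K * ?Z) * infsum ?w upper_pts"
    proof (rule mult_left_mono)
      show "infsum ?w D \<le> infsum ?w upper_pts"
        by (rule infsum_mono_neutral) (use D summable_weight2[OF eps] in auto)
    qed (use C K in auto)
    also have "\<dots> = C k * K * infsum ?w upper_pts * ?Z" by (rule mult.commute[THEN trans]) (simp add: mult.assoc mult.left_commute)
    finally show "norm (chain_series (\<phi> N) (k # ks) D) \<le> C k * K * infsum ?w upper_pts * ?Z" .
  qed
qed

text \<open>The first point carries its own factor \<open>f\<close>, bounded with exponent 3, since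
  it pays for the growth of all inner sums. A leading entry 2 meets this bound only with an
  additional factor 1/d.\<close>

theorem chain_series_tendsto:
  fixes \<phi> :: "nat \<Rightarrow> nat \<Rightarrow> int \<times> int \<Rightarrow> complex"
  assumes bound: "\<And>N k p. k \<in> set ks \<Longrightarrow> p \<in> upper_pts \<Longrightarrow> norm (\<phi> N k p) \<le> C k * pt_size p powr (- 2)"
    and lim: "\<And>k p. k \<in> set ks \<Longrightarrow> p \<in> upper_pts \<Longrightarrow> (\<lambda>N. \<phi> N k p) \<longlonglongrightarrow> \<psi> k p"
    and bound1: "\<And>N p. p \<in> upper_pts \<Longrightarrow> norm (f N p) \<le> B * pt_size p powr (- 3)"
    and lim1: "\<And>p. p \<in> upper_pts \<Longrightarrow> (\<lambda>N. f N p) \<longlonglongrightarrow> F p"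
  shows "(\<lambda>N. infsum (\<lambda>p. f N p * chain_series (\<phi> N) ks (below p)) upper_pts) \<longlonglongrightarrow>
      infsum (\<lambda>p. F p * chain_series \<psi> ks (below p)) upper_pts"
    and "(\<lambda>p. norm (f N p * chain_series (\<phi> N) ks (below p))) summable_on upper_pts"
    and "(\<lambda>p. norm (F p * chain_series \<psi> ks (below p))) summable_on upper_pts"
proof -
  \<comment> \<open>Chosen such that all remaining points together cost at most the power 1/2 which
    \<open>summable_weight3\<close> can afford.\<close>
  define \<epsilon> where "\<epsilon> = 1 / (2 * (1 + real (length ks)))"
  have eps: "\<epsilon> > 0" "\<epsilon> \<le> 1" "\<epsilon> * length ks \<le> 1 / 2" by (auto simp: \<epsilon>_def field_simps)
  obtain K where K: "K \<ge> 0" and IH: "\<And>D J. D \<subseteq> upper_pts \<Longrightarrow> \<forall>p\<in>D. fst p \<le> J \<Longrightarrow> J \<ge> 0 \<Longrightarrow>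
     (\<lambda>N. chain_series (\<phi> N) ks D) \<longlonglongrightarrow> chain_series \<psi> ks D \<and>
     (\<forall>N. norm (chain_series (\<phi> N) ks D) \<le> K * (1 + of_int J) powr (\<epsilon> * length ks))"
    using chain_series_bounded[where ks = ks and \<phi> = \<phi> and C = C and \<psi> = \<psi> and \<epsilon> = \<epsilon>] bound lim eps by auto
  have below: "below p \<subseteq> upper_pts" "\<forall>q\<in>below p. fst q \<le> fst p" for p
    by (auto simp: below_def lattice_succ_def)
  let ?g = "\<lambda>p. (B * K) * (pt_size p powr (- 3) * (1 + of_int \<bar>fst p\<bar>) powr (1 / 2))"
  have bd: "norm (f N p * chain_series (\<phi> N) ks (below p)) \<le> ?g p" if p: "p \<in> upper_pts" for N p
  proof -
    have j: "fst p \<ge> 0" by (rule fst_upper_pts[OF p])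
    have "norm (chain_series (\<phi> N) ks (below p)) \<le> K * (1 + of_int (fst p)) powr (\<epsilon> * length ks)"
      using IH[OF below[of p] j] by blast
    also have "\<dots> \<le> K * (1 + of_int \<bar>fst p\<bar>) powr (1 / 2)"
      using eps K j by (intro mult_left_mono) (auto intro!: powr_mono)
    finally have "norm (f N p * chain_series (\<phi> N) ks (below p)) \<le> (B * pt_size p powr (- 3)) * (K * (1 + of_int \<bar>fst p\<bar>) powr (1 / 2))"
      unfolding norm_mult
      by (rule mult_mono[OF bound1[OF p] _ order.trans[OF norm_ge_zero bound1[OF p]] norm_ge_zero])
    then show ?thesis by (simp add: mult_ac)
  qed
  have tend: "(\<lambda>N. f N p * chain_series (\<phi> N) ks (below p)) \<longlonglongrightarrow> F p * chain_series \<psi> ks (below p)" if p: "p \<in> upper_pts" for p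
  proof (rule tendsto_mult)
    show "(\<lambda>N. f N p) \<longlonglongrightarrow> F p" by (rule lim1[OF p])
    have "fst p \<ge> 0" by (rule fst_upper_pts[OF p])
    then show "(\<lambda>N. chain_series (\<phi> N) ks (below p)) \<longlonglongrightarrow> chain_series \<psi> ks (below p)"
      using IH[OF below[of p]] by blast
  qed
  have g: "?g summable_on upper_pts" by (intro summable_on_cmult_right summable_weight3)
  note dom = dominated_infsum[OF tend bd g]
  show "(\<lambda>N. infsum (\<lambda>p. f N p * chain_series (\<phi> N) ks (below p)) upper_pts) \<longlonglongrightarrow>
      infsum (\<lambda>p. F p * chain_series \<psi> ks (below p)) upper_pts"
    by (rule dom(1))
  show "(\<lambda>p. norm (f N p * chain_series (\<phi> N) ks (below p))) summable_on upper_pts"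
    by (rule Infinite_Sum.abs_summable_on_comparison_test'[OF g]) (use bd in auto)
  show "(\<lambda>p. norm (F p * chain_series \<psi> ks (below p))) summable_on upper_pts" by (rule dom(3))
qed

lemma pfac_neq_0 [simp]: "pfac \<noteq> 0"
  by (simp add: pfac_def)

subsection \<open>Asymptotics near the real axis\<close>

text \<open>An odd modulus d = 2h+1 has a symmetric system of residues -h, ..., h.\<close>

definition odd_num :: "nat \<Rightarrow> real" where "odd_num h = of_nat (2 * h + 1)"

definition near_cusp :: "real \<Rightarrow> nat \<Rightarrow> uhp" where
  "near_cusp y h = Abs_uhp (of_real (1 / odd_num h) + \<i> * of_real (y / (odd_num h)\<^sup>2))"

text \<open>
  With \<open>d = odd_num h\<close>, the index \<open>m\<close> is written as \<open>j d + n\<close> with \<open>\<bar>n\<bar> \<le> h\<close>; then \<open>m\<close> times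
  \<^const>\<open>near_cusp\<close> differs by the integer \<open>j\<close> from \<open>shrunk_pt\<close>, and \<open>d\<close> times the latter
  tends to \<open>imag_pt\<close>.
\<close>

definition imag_pt :: "real \<Rightarrow> int \<times> int \<Rightarrow> complex" where
  "imag_pt y p = of_int (snd p) + \<i> * of_real (y * of_int (fst p))"

definition shrunk_pt :: "real \<Rightarrow> nat \<Rightarrow> int \<times> int \<Rightarrow> complex" where
  "shrunk_pt y h p = (of_int (snd p) + \<i> * of_real (y * (of_int (fst p) + of_int (snd p) / odd_num h))) / of_real (odd_num h)"

text \<open>Adding \<open>h\<close> before the division and subtracting it afterwards centres the
  remainder at 0.\<close>

definition split_index :: "nat \<Rightarrow> nat \<Rightarrow> int \<times> int" where
  "split_index h m = (let a = int (m + h); d = 2 * int h + 1 in (a div d, a mod d - int h))"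

lemma odd_num_ge_1: "odd_num h \<ge> 1" by (simp add: odd_num_def)

lemma odd_num_neq_0 [simp]: "odd_num h \<noteq> 0" using odd_num_ge_1[of h] by linarith

lemma inverse_odd_num_tendsto: "(\<lambda>h. 1 / odd_num h) \<longlonglongrightarrow> 0"
  unfolding odd_num_def by real_asymp

lemma split_index_eq:
  "\<bar>snd (split_index h m)\<bar> \<le> int h"
  "int m = fst (split_index h m) * (2 * int h + 1) + snd (split_index h m)"
proof -
  let ?d = "2 * int h + 1" and ?a = "int (m + h)"
  have r: "0 \<le> ?a mod ?d" "?a mod ?d < ?d" using pos_mod_sign[of ?d ?a] pos_mod_bound[of ?d ?a] by linarith+
  have e: "?a = ?a div ?d * ?d + ?a mod ?d" by (rule div_mult_mod_eq[symmetric])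
  show "int m = fst (split_index h m) * ?d + snd (split_index h m)"
    unfolding split_index_def Let_def using e by simp
  show "\<bar>snd (split_index h m)\<bar> \<le> int h" unfolding split_index_def Let_def snd_conv using r by linarith
qed

lemma fst_split_index_mono: "m \<le> m' \<Longrightarrow> fst (split_index h m) \<le> fst (split_index h m')"
  unfolding split_index_def Let_def fst_conv by (intro zdiv_mono1) auto

text \<open>The order of lattice points is lexicographic with the row first, and division with
  remainder respects it; so decreasing chains of indices become decreasing chains of lattice
  points.\<close>

lemma split_index_mono:
  assumes "m < m'"
  shows "split_index h m' \<succ>\<^sub>L split_index h m"
proof (cases "fst (split_index h m) = fst (split_index h m')")
  case True
  then have "snd (split_index h m) < snd (split_index h m')"
    using split_index_eq(2)[of m h] split_index_eq(2)[of m' h] assms by simp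
  then show ?thesis using True by (simp add: lattice_succ_def)
next
  case False
  then have "fst (split_index h m) < fst (split_index h m')" using fst_split_index_mono[of m m' h] assms by linarith
  then show ?thesis by (simp add: lattice_succ_def)
qed

lemma split_index_props:
  assumes "m \<ge> 1"
  shows "split_index h m \<in> upper_pts" "\<bar>snd (split_index h m)\<bar> \<le> int h"
    "int m = fst (split_index h m) * (2 * int h + 1) + snd (split_index h m)"
proof -
  define j where "j = fst (split_index h m)"
  define n where "n = snd (split_index h m)"
  have "split_index h 0 = (0, 0)" by (simp add: split_index_def Let_def)
  then have "j \<ge> 0" using fst_split_index_mono[of 0 m h] by (simp add: j_def)
  moreover have "n = int m" if "j = 0" using split_index_eq(2)[of m h] that unfolding j_def[symmetric] n_def[symmetric] by simp
  ultimately have "j > 0 \<or> j = 0 \<and> n > 0" using assms by linarith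
  then show "split_index h m \<in> upper_pts" by (simp add: upper_pts_def lattice_succ_def j_def n_def)
qed (rule split_index_eq)+

lemma inj_split_index: "inj (split_index h)"
proof (rule injI)
  fix m m' assume eq: "split_index h m = split_index h m'"
  show "m = m'"
  proof (rule ccontr)
    assume "m \<noteq> m'"
    then have "split_index h m \<succ>\<^sub>L split_index h m \<or> split_index h m' \<succ>\<^sub>L split_index h m'"
      using split_index_mono[of m m' h] split_index_mono[of m' m h] eq by (auto simp: neq_iff)
    then show False by (simp add: lattice_succ_def)
  qed
qed

lemma split_index_surj:
  assumes "p \<in> upper_pts" "\<bar>snd p\<bar> \<le> int h"
  obtains m where "p = split_index h (Suc m)"
proof -
  let ?d = "2 * int h + 1"
  define a where "a = fst p * ?d + snd p"
  have "a \<ge> 1"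
  proof (cases "fst p = 0")
    case True
    then have "snd p > 0" using assms(1) unfolding upper_pts_def lattice_succ_def by simp
    then show ?thesis using True by (simp add: a_def)
  next
    case False
    then have "fst p \<ge> 1" using fst_upper_pts[OF assms(1)] by linarith
    define u where "u = fst p * ?d"
    have "1 * ?d \<le> u" unfolding u_def using \<open>fst p \<ge> 1\<close> by (intro mult_right_mono) auto
    moreover have "- int h \<le> snd p" using assms(2) by (simp only: abs_le_iff) linarith
    moreover have "0 \<le> int h" by simp
    ultimately show ?thesis unfolding a_def u_def[symmetric] by (smt (verit))
  qed
  then obtain m where m: "a = int (Suc m)" by (intro that[of "nat a - 1"]) (simp add: of_nat_diff)
  have b: "0 \<le> snd p + int h" "snd p + int h < ?d" using assms(2) by auto
  have "int (Suc m + h) = (snd p + int h) + fst p * ?d" using m by (simp add: a_def)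
  then have "int (Suc m + h) div ?d = fst p" "int (Suc m + h) mod ?d = snd p + int h"
    using b by (simp_all only: div_mult_self1[of ?d] mod_mult_self1) (simp_all add: div_pos_pos_trivial)
  then have "split_index h (Suc m) = p" by (simp add: split_index_def Let_def prod_eq_iff del: of_nat_Suc)
  then show ?thesis using that by metis
qed

lemma split_scale:
  fixes d m n j y :: real
  assumes "d \<noteq> 0" "m = j * d + n"
  shows "m * (1 / d) = j + n / d" "m * (y / d\<^sup>2) = y * (j + n / d) / d"
proof -
  have 1: "m / d = j + n / d" unfolding assms(2) add_divide_distrib using assms(1) by simp
  then show "m * (1 / d) = j + n / d" by simp
  have "m * (y / d\<^sup>2) = y * (m / d) / d" unfolding power2_eq_square by (simp only: times_divide_eq_right divide_divide_eq_left mult.commute)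
  then show "m * (y / d\<^sup>2) = y * (j + n / d) / d" unfolding 1 .
qed
lemma split_scale_complex:
  fixes d m n j y :: real
  assumes "d \<noteq> 0" "m = j * d + n"
  shows "of_real m * (complex_of_real (1 / d) + \<i> * of_real (y / d\<^sup>2)) = of_real j + (of_real n + \<i> * of_real (y * (j + n / d))) / of_real d"
proof -
  have "of_real m * (complex_of_real (1 / d) + \<i> * of_real (y / d\<^sup>2)) = of_real (m * (1 / d)) + \<i> * of_real (m * (y / d\<^sup>2))"
    by (simp only: distrib_left of_real_mult mult.left_commute)
    also have "\<dots> = of_real j + (of_real n + \<i> * of_real (y * (j + n / d))) / of_real d"
    unfolding split_scale[OF assms]
    by (simp only: of_real_add of_real_divide add_divide_distrib times_divide_eq_right add.assoc)
  finally show ?thesis .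
qed

section \<open>Points near the cusp and their limits on the lattice of an imaginary point\<close>

locale imag_axis =
  fixes y :: real
  assumes y: "y > 0"
begin

lemma near_cusp_pt: "complex_of_uhp (near_cusp y h) = of_real (1 / odd_num h) + \<i> * of_real (y / (odd_num h)\<^sup>2)"
  unfolding near_cusp_def using y odd_num_ge_1[of h] by (intro Abs_uhp_inverse) simp

lemma imag_uhp_pt: "lattice_pt (Abs_uhp (\<i> * of_real y)) p = imag_pt y p"
  by (simp add: lattice_pt_def uhp_imag[OF y] imag_pt_def)

lemma multiple_near_cusp:
  assumes "m \<ge> 1"
  shows "of_nat m * complex_of_uhp (near_cusp y h) = of_int (fst (split_index h m)) + shrunk_pt y h (split_index h m)"
proof -
  define j where "j = fst (split_index h m)"
  define n where "n = snd (split_index h m)"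
  define d where "d = odd_num h"
  have d: "d \<noteq> 0" "d = of_int (2 * int h + 1)" by (simp_all add: d_def odd_num_def)
  have "real m = of_int (int m)" by simp
  also have "\<dots> = of_int j * d + of_int n"
    using split_index_props(3)[OF assms, of h] by (simp add: j_def n_def d(2))
  finally have m: "real m = of_int j * d + of_int n" .
  have "of_nat m * complex_of_uhp (near_cusp y h) = of_real (real m) * (of_real (1 / d) + \<i> * of_real (y / d\<^sup>2))"
    unfolding near_cusp_pt d_def[symmetric] by simp
  also have "\<dots> = of_int j + shrunk_pt y h (split_index h m)"
    unfolding split_scale_complex[OF d(1) m] shrunk_pt_def j_def[symmetric] n_def[symmetric] d_def[symmetric] by simp
  finally show ?thesis unfolding j_def .
qed

lemma qden_near_cusp:
  assumes "m \<ge> 1"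
  shows "qden (of_nat m * complex_of_uhp (near_cusp y h)) = qden (shrunk_pt y h (split_index h m))"
    "qexp (of_nat m * complex_of_uhp (near_cusp y h)) = qexp (shrunk_pt y h (split_index h m))"
  unfolding multiple_near_cusp[OF assms] by (simp_all add: qden_def qexp_add)

lemma pt_size_le_shrunk:
  assumes p: "p \<in> upper_pts" and n: "- int h \<le> snd p"
  shows "pt_size p \<le> (2 + 4 / y) * norm (of_real (odd_num h) * shrunk_pt y h p)"
    and "Im (shrunk_pt y h p) > 0"
proof -
  define j where "j = (of_int (fst p) :: real)"
  define n' where "n' = (of_int (snd p) :: real)"
  define d where "d = odd_num h"
  have d: "d \<ge> 1" unfolding d_def by (rule odd_num_ge_1)
  have "- real h \<le> n'" using n unfolding n'_def by linarith
  then have nd: "- (d / 2) \<le> n'" by (simp add: d_def odd_num_def)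
  then have nd2: "- (1 / 2) \<le> n' / d" using d by (simp add: field_simps)
  have re: "Re (of_real d * shrunk_pt y h p) = n'" and im: "Im (of_real d * shrunk_pt y h p) = y * (j + n' / d)"
    using d by (simp_all add: shrunk_pt_def d_def[symmetric] n'_def j_def)
  let ?z = "norm (of_real d * shrunk_pt y h p)"
  have z: "\<bar>n'\<bar> \<le> ?z" "\<bar>y * (j + n' / d)\<bar> \<le> ?z"
    using abs_Re_le_cmod[of "of_real d * shrunk_pt y h p"] abs_Im_le_cmod[of "of_real d * shrunk_pt y h p"] unfolding re im by auto
  have cases: "j = 0 \<and> n' \<ge> 1 \<or> j \<ge> 1"
  proof (cases "fst p = 0")
    case True
    then have "snd p \<ge> 1" using p unfolding upper_pts_def lattice_succ_def by simp
    then show ?thesis using True by (simp add: j_def n'_def)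
  next
    case False
    then have "fst p \<ge> 1" using fst_upper_pts[OF p] by linarith
    then show ?thesis by (simp add: j_def)
  qed
  have s: "pt_size p = 1 + j + \<bar>n'\<bar>" using fst_upper_pts[OF p] by (simp add: pt_size_def j_def n'_def)
  show "pt_size p \<le> (2 + 4 / y) * norm (of_real (odd_num h) * shrunk_pt y h p)"
    unfolding d_def[symmetric]
  proof (cases "j = 0")
    case True
    then have "pt_size p \<le> 2 * ?z" using cases z s by auto
    also have "\<dots> \<le> (2 + 4 / y) * ?z" using y by (intro mult_right_mono) auto
    finally show "pt_size p \<le> (2 + 4 / y) * ?z" .
  next
    case False
    then have j: "j \<ge> 1" using cases by auto
    have "j / 2 \<le> j + n' / d" using nd2 j by linarith
    then have "y * (j / 2) \<le> y * (j + n' / d)" using y by (intro mult_left_mono) auto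
    then have "y * (j / 2) \<le> ?z" using z(2) by linarith
    then have "2 * j \<le> 4 / y * ?z" using y by (simp add: field_simps)
    then have "pt_size p \<le> ?z + 4 / y * ?z" using s j z(1) by linarith
    also have "\<dots> \<le> (2 + 4 / y) * ?z" by (simp add: ring_distribs)
    finally show "pt_size p \<le> (2 + 4 / y) * ?z" .
  qed
  have "Im (shrunk_pt y h p) = y * (j + n' / d) / d"
    using d by (simp_all add: shrunk_pt_def d_def[symmetric] n'_def j_def Re_divide_of_real Im_divide_of_real)
  moreover have "j + n' / d > 0"
  proof (cases "j = 0")
    case True
    then show ?thesis using cases d by auto
  next
    case False
    then show ?thesis using cases nd2 by linarith
  qed
  ultimately show "Im (shrunk_pt y h p) > 0" using y d by auto
qed

lemma Re_shrunk_pt: "Re (shrunk_pt y h p) = of_int (snd p) / odd_num h"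
  by (simp add: shrunk_pt_def Re_divide_of_real)

lemma abs_Re_shrunk_pt:
  assumes "\<bar>snd p\<bar> \<le> int h"
  shows "\<bar>Re (shrunk_pt y h p)\<bar> \<le> 3 / 4"
proof -
  have "\<bar>of_int (snd p)\<bar> \<le> real h" using assms by linarith
  then have "4 * \<bar>of_int (snd p)\<bar> \<le> 3 * odd_num h" by (simp add: odd_num_def)
  then show ?thesis using odd_num_ge_1[of h] unfolding Re_shrunk_pt abs_divide by (simp add: pos_divide_le_eq)
qed

lemma inverse_power_le_pt_size:
  assumes "pt_size p \<le> A * z" "z > 0" "A \<ge> 0" "e \<le> k"
  shows "1 / z ^ k \<le> A ^ k * pt_size p powr (- real e)"
proof -
  have s: "pt_size p \<ge> 1" by (rule pt_size_pos)
  have "1 / z \<le> A / pt_size p" using assms s by (simp add: field_simps)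
  then have "(1 / z) ^ k \<le> (A / pt_size p) ^ k" using assms by (intro power_mono) auto
  also have "\<dots> = A ^ k * (1 / pt_size p) ^ k" by (simp add: power_divide)
  also have "\<dots> \<le> A ^ k * (1 / pt_size p) ^ e"
    using s assms by (intro mult_left_mono power_decreasing) auto
  also have "(1 / pt_size p) ^ e = pt_size p powr (- real e)"
    using s by (simp add: powr_minus powr_realpow power_one_over inverse_eq_divide)
  finally show ?thesis by (simp add: power_one_over)
qed

lemma shrunk_pt_tendsto:
  assumes p: "p \<in> upper_pts"
  shows "(\<lambda>h. of_real (odd_num h) * shrunk_pt y h p) \<longlonglongrightarrow> imag_pt y p"
    and "filterlim (\<lambda>h. shrunk_pt y h p) (at 0) sequentially"
    and "imag_pt y p \<noteq> 0"
proof -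
  have "(\<lambda>h. of_int (snd p) + \<i> * of_real (y * (of_int (fst p) + of_int (snd p) * (1 / odd_num h)))) \<longlonglongrightarrow>
     of_int (snd p) + \<i> * of_real (y * (of_int (fst p) + of_int (snd p) * 0))"
    by (intro tendsto_intros inverse_odd_num_tendsto)
  then show l: "(\<lambda>h. of_real (odd_num h) * shrunk_pt y h p) \<longlonglongrightarrow> imag_pt y p"
    by (simp add: shrunk_pt_def imag_pt_def)
  have "(\<lambda>h. complex_of_real (1 / odd_num h) * (of_real (odd_num h) * shrunk_pt y h p)) \<longlonglongrightarrow> of_real 0 * imag_pt y p"
    by (intro tendsto_intros inverse_odd_num_tendsto l)
  then have "(\<lambda>h. shrunk_pt y h p) \<longlonglongrightarrow> 0" by simp
  moreover have "eventually (\<lambda>h. shrunk_pt y h p \<noteq> 0) sequentially"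
    using eventually_ge_at_top[of "nat \<bar>snd p\<bar>"]
  proof eventually_elim
    case (elim h)
    then have "Im (shrunk_pt y h p) > 0" by (intro pt_size_le_shrunk(2) p) auto
    then show ?case by auto
  qed
  ultimately show "filterlim (\<lambda>h. shrunk_pt y h p) (at 0) sequentially" by (simp add: filterlim_at)
  show "imag_pt y p \<noteq> 0"
    using p y unfolding upper_pts_def lattice_succ_def imag_pt_def by (auto simp: complex_eq_iff)
qed

text \<open>Normalised so that the limit is 1/z^k at the lattice point z. Points with |n| > h do not
  come from an index at level \<open>h\<close> and are switched off.\<close>

definition scaled_term :: "nat \<Rightarrow> nat \<Rightarrow> int \<times> int \<Rightarrow> complex" where
  "scaled_term h k p = (if \<bar>snd p\<bar> \<le> int h
     then (pfac / of_real (odd_num h)) ^ k * poly (tangent_poly k) (qden (shrunk_pt y h p)) else 0)"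

lemma scaled_term_tendsto:
  assumes "p \<in> upper_pts" "k \<ge> 1"
  shows "(\<lambda>h. scaled_term h k p) \<longlonglongrightarrow> 1 / imag_pt y p ^ k"
proof -
  have pf: "pfac * (- 1 / (2 * of_real pi * \<i>)) = 1" by (simp add: pfac_def)
  have "(\<lambda>h. pfac ^ k * (shrunk_pt y h p ^ k * poly (tangent_poly k) (qden (shrunk_pt y h p))) / (of_real (odd_num h) * shrunk_pt y h p) ^ k)
    \<longlonglongrightarrow> pfac ^ k * (- 1 / (2 * of_real pi * \<i>)) ^ k / imag_pt y p ^ k"
    using shrunk_pt_tendsto[OF assms(1)] filterlim_compose[OF poly_qden_tendsto[OF assms(2)] shrunk_pt_tendsto(2)[OF assms(1)]]
    by (intro tendsto_divide tendsto_mult tendsto_const tendsto_power) auto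
  also have "pfac ^ k * (- 1 / (2 * of_real pi * \<i>)) ^ k = 1"
    unfolding power_mult_distrib[symmetric] pf by simp
  finally have lim: "(\<lambda>h. pfac ^ k * (shrunk_pt y h p ^ k * poly (tangent_poly k) (qden (shrunk_pt y h p))) / (of_real (odd_num h) * shrunk_pt y h p) ^ k)
    \<longlonglongrightarrow> 1 / imag_pt y p ^ k" .
  show ?thesis
  proof (rule Lim_transform_eventually[OF lim])
    show "eventually (\<lambda>h. pfac ^ k * (shrunk_pt y h p ^ k * poly (tangent_poly k) (qden (shrunk_pt y h p))) / (of_real (odd_num h) * shrunk_pt y h p) ^ k = scaled_term h k p) sequentially"
      using eventually_ge_at_top[of "nat \<bar>snd p\<bar>"]
    proof eventually_elim
      case (elim h)
      then have h: "\<bar>snd p\<bar> \<le> int h" by auto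
      have "Im (shrunk_pt y h p) > 0" using h by (intro pt_size_le_shrunk(2) assms) auto
      then have "shrunk_pt y h p \<noteq> 0" by auto
      then show ?case using h by (simp add: scaled_term_def power_mult_distrib power_divide)
    qed
  qed
qed

text \<open>After scaling by d the pole bound turns into a bound in the size of the lattice point.
  With \<open>c = 1\<close> the extra factor 1/d combines with a pole bound of exponent k+1 and buys
  one more power of the size.\<close>

lemma scaled_term_bound:
  assumes "k \<ge> 2" "c \<le> 1" "e \<le> k + c"
  shows "\<exists>B. \<forall>h. \<forall>p\<in>upper_pts. norm ((1 / of_real (odd_num h)) ^ c * scaled_term h k p) \<le> B * pt_size p powr (- real e)"
proof -
  obtain B where B: "\<And>x. \<bar>Re x\<bar> \<le> 3 / 4 \<Longrightarrow> Im x > 0 \<Longrightarrow> norm (poly (tangent_poly k) (qden x)) \<le> B / norm x ^ (k + c)"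
    using tangent_poly_pole_bound[of k "k + c"] assms by auto
  have B0: "B \<ge> 0" using order.trans[OF norm_ge_zero B[of \<i>]] by simp
  let ?C = "norm pfac ^ k * B * (2 + 4 / y) ^ (k + c)"
  have "norm ((1 / of_real (odd_num h)) ^ c * scaled_term h k p) \<le> ?C * pt_size p powr (- real e)" if p: "p \<in> upper_pts" for h p
  proof (cases "\<bar>snd p\<bar> \<le> int h")
    case True
    let ?x = "shrunk_pt y h p" and ?d = "odd_num h"
    have d: "?d \<ge> 1" by (rule odd_num_ge_1)
    have x: "\<bar>Re ?x\<bar> \<le> 3 / 4" "Im ?x > 0" using pt_size_le_shrunk(2)[OF p, of h] abs_Re_shrunk_pt[OF True] True by auto
    then have nz: "norm ?x > 0" by auto
    have "norm ((1 / of_real ?d) ^ c * scaled_term h k p) = norm pfac ^ k * (1 / ?d ^ (k + c) * norm (poly (tangent_poly k) (qden ?x)))"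
      using True d by (simp add: scaled_term_def norm_mult norm_power norm_divide power_add power_divide)
    also have "\<dots> \<le> norm pfac ^ k * (1 / ?d ^ (k + c) * (B / norm ?x ^ (k + c)))"
      using d by (intro mult_left_mono B x) auto
    also have "\<dots> = norm pfac ^ k * B * (1 / norm (of_real ?d * ?x) ^ (k + c))"
      using d by (simp add: norm_mult power_mult_distrib)
    also have "\<dots> \<le> norm pfac ^ k * B * ((2 + 4 / y) ^ (k + c) * pt_size p powr (- real e))"
      using B0 nz y d by (intro mult_left_mono inverse_power_le_pt_size pt_size_le_shrunk(1) p assms) (use True in \<open>auto simp: norm_mult\<close>)
    finally show ?thesis by (simp add: mult_ac)
  next
    case False
    have "0 \<le> ?C" using B0 y by (intro mult_nonneg_nonneg) auto
    then show ?thesis using False by (simp add: scaled_term_def)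
  qed
  then show ?thesis by blast
qed

lemma scaled_term_split_index:
  "scaled_term h k (split_index h (Suc m)) = (pfac / of_real (odd_num h)) ^ k * qterm (near_cusp y h) k m"
  using split_index_props(2)[of "Suc m" h] qden_near_cusp(1)[of "Suc m" h]
  by (simp add: scaled_term_def qterm_def del: of_nat_Suc)

lemma chain_sum_scale:
  "chain_sum (\<lambda>k x. c ^ k * F k x) xs ks = c ^ sum_list ks * chain_sum F xs ks"
  by (induction F xs ks rule: chain_sum.induct) (auto simp: algebra_simps power_add)

lemma sorted_split_index: "sorted_wrt (\<succ>\<^sub>L) (map (\<lambda>m. split_index h (Suc m)) (rev [0..<M]))"
proof -
  have "sorted_wrt (\<lambda>m n. n < m) (rev [0..<M])" by (induction M) (auto simp: sorted_wrt_append)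
  then show ?thesis unfolding sorted_wrt_map
    by (rule sorted_wrt_mono_rel[rotated]) (auto intro: split_index_mono)
qed

text \<open>Points below the given one that are not split indices have |n| > h, where
  \<open>scaled_term\<close> vanishes; so the nested infinite sums collapse to the truncated
  q-series.\<close>

lemma chain_series_split_index:
  "chain_series (scaled_term h) ks (below (split_index h (Suc m))) = (pfac / of_real (odd_num h)) ^ sum_list ks * gpart ks m (near_cusp y h)"
proof -
  have "chain_series (scaled_term h) ks (below (split_index h (Suc m))) = chain_sum (scaled_term h) (map (\<lambda>m. split_index h (Suc m)) (rev [0..<m])) ks"
  proof (rule chain_series_eq_chain_sum[OF sorted_split_index])
    show "set (map (\<lambda>m. split_index h (Suc m)) (rev [0..<m])) \<subseteq> below (split_index h (Suc m))"
      using split_index_props(1) split_index_mono by (auto simp: below_def)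
    show "below (split_index h (Suc m)) \<subseteq> upper_pts" by (auto simp: below_def)
    show "p' \<in> below (split_index h (Suc m))" if "p \<in> below (split_index h (Suc m))" "p' \<in> below p" for p p'
      using that by (auto simp: below_def lattice_succ_def)
    fix k p assume p: "p \<in> below (split_index h (Suc m)) - set (map (\<lambda>m. split_index h (Suc m)) (rev [0..<m]))"
    show "scaled_term h k p = 0"
    proof (rule ccontr)
      assume "scaled_term h k p \<noteq> 0"
      then have "\<bar>snd p\<bar> \<le> int h" by (auto simp: scaled_term_def split: if_splits)
      moreover have "p \<in> upper_pts" using p by (auto simp: below_def)
      ultimately obtain m' where m': "p = split_index h (Suc m')" using split_index_surj by blast
      have b: "split_index h (Suc m) \<succ>\<^sub>L p" using p by (auto simp: below_def)
      have "m' < m"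
      proof (rule ccontr)
        assume "\<not> m' < m"
        then have "m' = m \<or> Suc m < Suc m'" by auto
        then have "m' = m \<or> p \<succ>\<^sub>L split_index h (Suc m)" using split_index_mono m' by auto
        then show False using b m' by (auto simp: lattice_succ_def)
      qed
      then show False using p m' by auto
    qed
  qed
  then show ?thesis
    unfolding chain_sum_map scaled_term_split_index chain_sum_scale gpart_def .
qed

lemma sums_split_index:
  fixes F :: "int \<times> int \<Rightarrow> complex"
  assumes sm: "(\<lambda>p. norm (F p)) summable_on upper_pts"
    and F: "\<And>p. \<not> \<bar>snd p\<bar> \<le> int h \<Longrightarrow> F p = 0"
  shows "(\<lambda>m. F (split_index h (Suc m))) sums infsum F upper_pts"
proof -
  let ?i = "\<lambda>m. split_index h (Suc m)"
  have inj: "inj ?i" using inj_split_index[of h] by (auto simp: inj_def)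
  have sub: "range ?i \<subseteq> upper_pts" using split_index_props(1) by auto
  have eq: "infsum F upper_pts = infsum F (range ?i)"
  proof (rule infsum_cong_neutral)
    fix p assume p: "p \<in> upper_pts - range ?i"
    then have "\<not> \<bar>snd p\<bar> \<le> int h" using split_index_surj[of p h] by auto
    then show "F p = 0" by (rule F)
  qed (use sub in auto)
  have sm2: "F summable_on range ?i"
    by (rule summable_on_subset_banach[OF abs_summable_summable[OF sm] sub])
  have "((F \<circ> ?i) has_sum infsum F (range ?i)) UNIV"
    using has_sum_infsum[OF sm2] by (subst (asm) has_sum_reindex[OF inj])
  then show ?thesis unfolding eq by (auto simp: o_def dest: has_sum_imp_sums)
qed

lemma infsum_split_index:
  assumes sm: "(\<lambda>p. norm (f p * chain_series (scaled_term h) ks (below p))) summable_on upper_pts"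
    and f: "\<And>p. f p = c * scaled_term h l p" and good: "good_word (l # ks)"
  shows "infsum (\<lambda>p. f p * chain_series (scaled_term h) ks (below p)) upper_pts =
     c * (pfac / of_real (odd_num h)) ^ sum_list (l # ks) * gser (l # ks) (near_cusp y h)"
proof -
  let ?F = "\<lambda>p. f p * chain_series (scaled_term h) ks (below p)" and ?i = "\<lambda>m. split_index h (Suc m)"
  let ?c = "c * (pfac / of_real (odd_num h)) ^ sum_list (l # ks)"
  have "(\<lambda>m. ?F (?i m)) sums infsum ?F upper_pts"
    by (rule sums_split_index[OF sm]) (simp add: f scaled_term_def)
  moreover have "?F (?i m) = ?c * (qterm (near_cusp y h) l m * gpart ks m (near_cusp y h))" for m
    by (simp add: f scaled_term_split_index chain_series_split_index power_add)
  ultimately have "(\<lambda>m. ?c * (qterm (near_cusp y h) l m * gpart ks m (near_cusp y h))) sums infsum ?F upper_pts" by simp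
  then have "(\<lambda>M. ?c * gpart (l # ks) M (near_cusp y h)) \<longlonglongrightarrow> infsum ?F upper_pts"
    unfolding sums_def gpart_Cons sum_distrib_left[symmetric] .
  moreover have "(\<lambda>M. ?c * gpart (l # ks) M (near_cusp y h)) \<longlonglongrightarrow> ?c * gser (l # ks) (near_cusp y h)"
    by (intro tendsto_intros gpart_tendsto good)
  ultimately show ?thesis by (rule LIMSEQ_unique)
qed

text \<open>\<open>c = 0\<close> serves words with first entry at least 3. \<open>c = 1\<close>
  serves all nonempty words when a surplus factor 1/d is present; this factor provides the third
  power and sends the limit to 0. The expression \<open>0 ^ c\<close> is the limit of (1/d)^c, with
  \<open>0 ^ 0 = 1\<close>.\<close>

lemma gser_near_cusp:
  assumes good: "good_word (l # ks)" and lc: "l + c \<ge> 3" "c \<le> 1"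
  defines "\<psi> \<equiv> \<lambda>k p. 1 / imag_pt y p ^ k"
  shows "(\<lambda>h. (1 / of_real (odd_num h)) ^ c * (pfac / of_real (odd_num h)) ^ sum_list (l # ks) * gser (l # ks) (near_cusp y h))
      \<longlonglongrightarrow> infsum (\<lambda>p. 0 ^ c * \<psi> l p * chain_series \<psi> ks (below p)) upper_pts"
    and "(\<lambda>p. norm (0 ^ c * \<psi> l p * chain_series \<psi> ks (below p))) summable_on upper_pts"
proof -
  let ?f = "\<lambda>h p. (1 / of_real (odd_num h)) ^ c * scaled_term h l p"
  have "\<forall>k\<in>set ks. \<exists>B. \<forall>h. \<forall>p\<in>upper_pts. norm (scaled_term h k p) \<le> B * pt_size p powr (- 2)"
    using scaled_term_bound[of _ 0 2] good by (auto simp: good_word_def)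
  from bchoice[OF this] obtain C where C: "\<And>h k p. k \<in> set ks \<Longrightarrow> p \<in> upper_pts \<Longrightarrow> norm (scaled_term h k p) \<le> C k * pt_size p powr (- 2)"
    by blast
  obtain B where B: "\<And>h p. p \<in> upper_pts \<Longrightarrow> norm (?f h p) \<le> B * pt_size p powr (- 3)"
    using scaled_term_bound[of l c 3] good lc by auto
  have lim: "(\<lambda>h. scaled_term h k p) \<longlonglongrightarrow> \<psi> k p" if "k \<in> set ks" "p \<in> upper_pts" for k p
    unfolding \<psi>_def by (rule scaled_term_tendsto) (use that good in \<open>auto simp: good_word_def\<close>)
  have lim1: "(\<lambda>h. ?f h p) \<longlonglongrightarrow> 0 ^ c * \<psi> l p" if "p \<in> upper_pts" for p
  proof -
    have "(\<lambda>h. complex_of_real (1 / odd_num h)) \<longlonglongrightarrow> of_real 0" by (intro tendsto_intros inverse_odd_num_tendsto)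
    then have "(\<lambda>h. 1 / complex_of_real (odd_num h)) \<longlonglongrightarrow> 0" by simp
    then show ?thesis unfolding \<psi>_def using that good by (intro tendsto_intros scaled_term_tendsto) auto
  qed
  note T = chain_series_tendsto[of ks scaled_term C \<psi> ?f B "\<lambda>p. 0 ^ c * \<psi> l p", OF C lim B lim1]
  have "infsum (\<lambda>p. ?f h p * chain_series (scaled_term h) ks (below p)) upper_pts = 
     (1 / of_real (odd_num h)) ^ c * (pfac / of_real (odd_num h)) ^ sum_list (l # ks) * gser (l # ks) (near_cusp y h)" for h
    by (rule infsum_split_index[OF T(2) refl good])
  then show "(\<lambda>h. (1 / of_real (odd_num h)) ^ c * (pfac / of_real (odd_num h)) ^ sum_list (l # ks) * gser (l # ks) (near_cusp y h))
      \<longlonglongrightarrow> infsum (\<lambda>p. 0 ^ c * \<psi> l p * chain_series \<psi> ks (below p)) upper_pts"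
    using T(1) by simp
  show "(\<lambda>p. norm (0 ^ c * \<psi> l p * chain_series \<psi> ks (below p))) summable_on upper_pts" by (rule T(3))
qed

text \<open>Weight strictly below \<open>w\<close> leaves at least one factor 1/d beyond the weight
  of each word: one is used as \<open>c = 1\<close> in \<open>gser_near_cusp\<close>, and the
  remaining \<open>e\<close> stay bounded.\<close>

lemma FilC_near_cusp:
  assumes "f \<in> FilC w"
  shows "(\<lambda>h. (1 / of_real (odd_num h)) ^ w * f (near_cusp y h)) \<longlonglongrightarrow> 0"
  using assms unfolding FilC_def
proof (induction rule: cvs.span_induct_alt)
  case base
  show ?case by simp
next
  case (step c b f)
  then obtain ls where ls: "b = gser ls" "good_word ls" "sum_list ls < w" by blast
  have inv: "(\<lambda>h. 1 / complex_of_real (odd_num h)) \<longlonglongrightarrow> 0"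
  proof -
    have "(\<lambda>h. complex_of_real (1 / odd_num h)) \<longlonglongrightarrow> of_real 0" by (intro tendsto_intros inverse_odd_num_tendsto)
    then show ?thesis by simp
  qed
  have one: "(\<lambda>h. (1 / of_real (odd_num h)) ^ 1 * (pfac / of_real (odd_num h)) ^ sum_list ls * gser ls (near_cusp y h)) \<longlonglongrightarrow> 0"
  proof (cases ls)
    case Nil
    then have "gser ls \<tau> = 1" for \<tau> by (simp add: gser_def gpart_def)
    then show ?thesis using Nil inv by simp
  next
    case (Cons l ks)
    then show ?thesis using gser_near_cusp(1)[of l ks 1] ls(2) by simp
  qed
  define e where "e = w - Suc (sum_list ls)"
  have w: "w = e + (1 + sum_list ls)" using ls(3) by (simp add: e_def)
  have eq: "(1 / of_real (odd_num h)) ^ w * b (near_cusp y h) =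
     (1 / of_real (odd_num h)) ^ e * (1 / pfac ^ sum_list ls) * ((1 / of_real (odd_num h)) ^ 1 * (pfac / of_real (odd_num h)) ^ sum_list ls * gser ls (near_cusp y h))" for h
    unfolding w power_add ls(1) by (simp add: power_divide)
  have "(\<lambda>h. (1 / of_real (odd_num h)) ^ w * b (near_cusp y h)) \<longlonglongrightarrow> 0 ^ e * (1 / pfac ^ sum_list ls) * 0"
    unfolding eq by (intro tendsto_mult tendsto_power inv tendsto_const one)
  then have "(\<lambda>h. c * ((1 / of_real (odd_num h)) ^ w * b (near_cusp y h)) + (1 / of_real (odd_num h)) ^ w * f (near_cusp y h)) \<longlonglongrightarrow> c * 0 + 0"
    using step by (intro tendsto_intros) auto
  then show ?case by (simp add: cscale_def algebra_simps)
qed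

lemma pt_size_le_imag:
  assumes p: "p \<in> upper_pts"
  shows "pt_size p \<le> (2 + 2 / y) * norm (imag_pt y p)"
proof -
  define j where "j = (of_int (fst p) :: real)"
  define n where "n = (of_int (snd p) :: real)"
  let ?z = "norm (imag_pt y p)"
  have "Re (imag_pt y p) = n" "Im (imag_pt y p) = y * j" by (simp_all add: imag_pt_def j_def n_def)
  then have z: "\<bar>n\<bar> \<le> ?z" "\<bar>y * j\<bar> \<le> ?z" using abs_Re_le_cmod[of "imag_pt y p"] abs_Im_le_cmod[of "imag_pt y p"] by auto
  have s: "pt_size p = 1 + j + \<bar>n\<bar>" using fst_upper_pts[OF p] by (simp add: pt_size_def j_def n_def)
  show ?thesis
  proof (cases "fst p = 0")
    case True
    then have "snd p \<ge> 1" using p unfolding upper_pts_def lattice_succ_def by simp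
    then have "pt_size p \<le> 2 * ?z" using True z s by (simp add: j_def n_def)
    also have "\<dots> \<le> (2 + 2 / y) * ?z" using y by (intro mult_right_mono) auto
    finally show ?thesis .
  next
    case False
    then have "fst p \<ge> 1" using fst_upper_pts[OF p] by linarith
    then have j: "j \<ge> 1" by (simp add: j_def)
    have "2 * j \<le> 2 / y * ?z" using z(2) y j by (simp add: field_simps)
    then have "pt_size p \<le> ?z + 2 / y * ?z" using s j z(1) by linarith
    also have "\<dots> \<le> (2 + 2 / y) * ?z" by (simp add: ring_distribs)
    finally show ?thesis .
  qed
qed

lemma imag_pt_bound:
  assumes "p \<in> upper_pts" "e \<le> k"
  shows "norm (1 / imag_pt y p ^ k) \<le> (2 + 2 / y) ^ k * pt_size p powr (- real e)"
  using inverse_power_le_pt_size[OF pt_size_le_imag[OF assms(1)] _ _ assms(2)] shrunk_pt_tendsto(3)[OF assms(1)] y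
  by (simp add: norm_divide norm_power)

text \<open>With the rows bounded by \<open>M\<close>, the powers of the row index are bounded by a
  constant. Dominated convergence then works for every good word, including those with first entry
  2.\<close>

lemma chain_series_rows:
  assumes "good_word ks"
  shows "chain_series (\<lambda>k p. 1 / imag_pt y p ^ k) ks {p \<in> upper_pts. fst p \<le> int M} = eis_part (Abs_uhp (\<i> * of_real y)) M ks"
proof -
  let ?D = "{p \<in> upper_pts. fst p \<le> int M}"
  define \<phi> where "\<phi> N k p = (if \<bar>snd p\<bar> \<le> int N then 1 / imag_pt y p ^ k else 0)" for N :: nat and k :: nat and p
  have b: "norm (\<phi> N k p) \<le> (2 + 2 / y) ^ k * pt_size p powr (- 2)" if "k \<in> set ks" "p \<in> upper_pts" for N k p
    using imag_pt_bound[of p 2 k] that assms y by (auto simp: \<phi>_def good_word_def)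
  have l: "(\<lambda>N. \<phi> N k p) \<longlonglongrightarrow> 1 / imag_pt y p ^ k" for k p
  proof (rule tendsto_eventually)
    show "eventually (\<lambda>N. \<phi> N k p = 1 / imag_pt y p ^ k) sequentially"
      using eventually_ge_at_top[of "nat \<bar>snd p\<bar>"] by eventually_elim (auto simp: \<phi>_def)
  qed
  have "(\<lambda>N. chain_series (\<phi> N) ks ?D) \<longlonglongrightarrow> chain_series (\<lambda>k p. 1 / imag_pt y p ^ k) ks ?D"
    using chain_series_bounded[where ks = ks and \<phi> = \<phi> and C = "\<lambda>k. (2 + 2 / y) ^ k" and \<psi> = "\<lambda>k p. 1 / imag_pt y p ^ k" and \<epsilon> = 1, OF b l]
    by (auto elim!: allE[of _ ?D] allE[of _ "int M"])
  moreover have "chain_series (\<phi> N) ks ?D = chain_sum (\<lambda>k p. 1 / lattice_pt (Abs_uhp (\<i> * of_real y)) p ^ k) (lattice_list M N) ks" for N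
  proof -
    have "chain_series (\<phi> N) ks ?D = chain_sum (\<phi> N) (lattice_list M N) ks"
    proof (rule chain_series_eq_chain_sum[OF sorted_lattice_list])
      show "set (lattice_list M N) \<subseteq> ?D" unfolding set_lattice_list by (auto simp: upper_pts_def)
      show "p' \<in> ?D" if "p \<in> ?D" "p' \<in> below p" for p p' using that by (auto simp: below_def lattice_succ_def)
      show "\<phi> N k p = 0" if p: "p \<in> ?D - set (lattice_list M N)" for k p
      proof -
        have "\<bar>fst p\<bar> < int (Suc M)" using p fst_upper_pts[of p] by auto
        then have "\<not> \<bar>snd p\<bar> < int (Suc N)" using p unfolding set_lattice_list by (auto simp: upper_pts_def)
        then show ?thesis by (simp add: \<phi>_def)
      qed
    qed auto
    also have "\<dots> = chain_sum (\<lambda>k p. 1 / lattice_pt (Abs_uhp (\<i> * of_real y)) p ^ k) (lattice_list M N) ks"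
      by (rule chain_sum_cong) (auto simp: \<phi>_def imag_uhp_pt set_lattice_list)
    finally show ?thesis .
  qed
  ultimately have "(\<lambda>N. chain_sum (\<lambda>k p. 1 / lattice_pt (Abs_uhp (\<i> * of_real y)) p ^ k) (lattice_list M N) ks) \<longlonglongrightarrow> chain_series (\<lambda>k p. 1 / imag_pt y p ^ k) ks ?D" by simp
  moreover have "(\<lambda>N. chain_sum (\<lambda>k p. 1 / lattice_pt (Abs_uhp (\<i> * of_real y)) p ^ k) (lattice_list M N) ks) \<longlonglongrightarrow> eis_part (Abs_uhp (\<i> * of_real y)) M ks"
    by (rule eis_part_lim) (use assms in \<open>auto simp: good_word_def\<close>)
  ultimately show ?thesis by (rule LIMSEQ_unique)
qed

lemma infsum_rows_tendsto:
  fixes F :: "int \<times> int \<Rightarrow> complex"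
  assumes "(\<lambda>p. norm (F p)) summable_on upper_pts"
  shows "(\<lambda>M. infsum F {p \<in> upper_pts. fst p \<le> int M}) \<longlonglongrightarrow> infsum F upper_pts"
proof -
  have "(\<lambda>M. infsum (\<lambda>p. if fst p \<le> int M then F p else 0) upper_pts) \<longlonglongrightarrow> infsum F upper_pts"
  proof (rule dominated_infsum(1)[OF _ _ assms])
    fix p
    show "(\<lambda>M. if fst p \<le> int M then F p else 0) \<longlonglongrightarrow> F p"
      by (rule tendsto_eventually, use eventually_ge_at_top[of "nat (fst p)"] in eventually_elim) auto
  qed auto
  moreover have "infsum (\<lambda>p. if fst p \<le> int M then F p else 0) upper_pts = infsum F {p \<in> upper_pts. fst p \<le> int M}" for M
    by (rule infsum_cong_neutral) auto
  ultimately show ?thesis by simp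
qed

text \<open>The remainder of \<open>mes_expansion\<close> has lower weight and disappears after
  scaling, so the asymptotics of the leading q-series decide.\<close>

lemma mes_near_cusp_of_gser:
  assumes good: "good_word ks"
    and lim: "(\<lambda>h. (pfac / of_real (odd_num h)) ^ sum_list ks * gser ks (near_cusp y h)) \<longlonglongrightarrow> L"
  shows "(\<lambda>h. (1 / of_real (odd_num h)) ^ sum_list ks * mes ks (near_cusp y h)) \<longlonglongrightarrow> L"
proof -
  define R where "R = mes ks - cscale (pfac ^ sum_list ks) (gser ks)"
  have R: "R \<in> FilC (sum_list ks)" unfolding R_def by (rule mes_expansion(1)[OF good])
  have "mes ks \<tau> = pfac ^ sum_list ks * gser ks \<tau> + R \<tau>" for \<tau> by (simp add: R_def cscale_def)
  then have "(1 / of_real (odd_num h)) ^ sum_list ks * mes ks (near_cusp y h) =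
     (pfac / of_real (odd_num h)) ^ sum_list ks * gser ks (near_cusp y h) + (1 / of_real (odd_num h)) ^ sum_list ks * R (near_cusp y h)" for h
    by (simp add: ring_distribs power_divide)
  then show ?thesis using tendsto_add[OF lim FilC_near_cusp[OF R]] by simp
qed

text \<open>The entry 3 makes the sum over the first point absolutely convergent. It may then be
  exhausted by rows, and this is the summation order in the definition of
  \<open>mes\<close>.\<close>

lemma mes_near_cusp_ge_3:
  assumes good: "good_word (l # ks)" and l: "l \<ge> 3"
  shows "(\<lambda>h. (1 / of_real (odd_num h)) ^ sum_list (l # ks) * mes (l # ks) (near_cusp y h)) \<longlonglongrightarrow> mes (l # ks) (Abs_uhp (\<i> * of_real y))"
proof (rule mes_near_cusp_of_gser[OF good])
  let ?\<psi> = "\<lambda>k p. 1 / imag_pt y p ^ k"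
  let ?F = "\<lambda>p. 1 / imag_pt y p ^ l * chain_series ?\<psi> ks (below p)"
  have l0: "l + 0 \<ge> 3" "(0::nat) \<le> 1" using l by auto
  note T = gser_near_cusp[OF good l0, unfolded power_0 mult_1_left]
  have "(\<lambda>M. infsum ?F {p \<in> upper_pts. fst p \<le> int M}) \<longlonglongrightarrow> infsum ?F upper_pts"
    by (rule infsum_rows_tendsto[OF T(2)])
  moreover have "infsum ?F {p \<in> upper_pts. fst p \<le> int M} = eis_part (Abs_uhp (\<i> * of_real y)) M (l # ks)" for M
    using chain_series_rows[OF good, of M] by simp
  ultimately have "(\<lambda>M. eis_part (Abs_uhp (\<i> * of_real y)) M (l # ks)) \<longlonglongrightarrow> infsum ?F upper_pts" by simp
  with eis_part_tendsto[OF good] have "mes (l # ks) (Abs_uhp (\<i> * of_real y)) = infsum ?F upper_pts" by (rule LIMSEQ_unique)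
  then show "(\<lambda>h. (pfac / of_real (odd_num h)) ^ sum_list (l # ks) * gser (l # ks) (near_cusp y h)) \<longlonglongrightarrow> mes (l # ks) (Abs_uhp (\<i> * of_real y))"
    using T(1) by simp
qed

end

section \<open>Telescoping for the Eisenstein series of weight two\<close>

lemma telescope_qden:
  fixes a b :: complex
  assumes "a \<noteq> 1" "a * b \<noteq> 1"
  shows "(b - 1) * (a * (1 / (1 - a))\<^sup>2) =
     (1 / (1 - a * b) - 1 / (1 - a)) - (b - 1)\<^sup>2 * ((a * (1 / (1 - a))\<^sup>2) * (a * (1 / (1 - a * b))))"
proof -
  \<comment> \<open>With a = q^(m+1) and b = q this is the discrete analogue of 1/z^2 = (1/z -
    1/(z+1)) + 1/(z^2 (z+1)): a difference of consecutive values plus a term that behaves like a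
    third power.\<close>
  define u where "u = 1 / (1 - a)"
  define v where "v = 1 / (1 - a * b)"
  have u: "u * (1 - a) = 1" and v: "v * (1 - a * b) = 1" using assms by (auto simp: u_def v_def)
  have "v - u = v * (u * (1 - a)) - u * (v * (1 - a * b))" unfolding u v by simp
  also have "\<dots> = a * (b - 1) * u * v" by (simp add: algebra_simps)
  finally have vu: "v - u = a * (b - 1) * u * v" .
  have "(v - u) - (b - 1)\<^sup>2 * ((a * u\<^sup>2) * (a * v)) = (b - 1) * a * u * (v - a * (b - 1) * u * v)"
    unfolding vu by (simp add: algebra_simps power2_eq_square)
  also have "v - a * (b - 1) * u * v = u" unfolding vu[symmetric] by simp
  finally show ?thesis unfolding u_def v_def by (simp add: power2_eq_square mult_ac)
qed

lemma distinct_lattice_list: "distinct (lattice_list M N)"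
proof -
  have "sorted_wrt (\<succ>\<^sub>L) xs \<Longrightarrow> distinct xs" for xs
    by (induction xs) (auto simp: lattice_succ_def)
  then show ?thesis using sorted_lattice_list by blast
qed

lemma tangent_poly_2: "poly (tangent_poly 2) u = u\<^sup>2 - u"
  by (simp add: numeral_2_eq_2 pderiv_pCons algebra_simps)

lemma tangent_poly_2_qden:
  assumes "a \<noteq> 1"
  shows "poly (tangent_poly 2) (1 / (1 - a)) = a * (1 / (1 - a))\<^sup>2"
proof -
  have "(1 / (1 - a)) * (1 - a) = 1" using assms by simp
  then have "(1 / (1 - a))\<^sup>2 * (1 - a) = 1 / (1 - a)" by (simp add: power2_eq_square)
  then show ?thesis unfolding tangent_poly_2 by (simp add: algebra_simps)
qed

context imag_axis
begin

lemma upper_pts_right: "p \<in> upper_pts \<Longrightarrow> (fst p, snd p + 1) \<in> upper_pts"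
  unfolding upper_pts_def lattice_succ_def by simp linarith

lemma pt_size_right: "pt_size p \<le> 2 * pt_size (fst p, snd p + 1)"
proof -
  have "1 + \<bar>a\<bar> + \<bar>b\<bar> \<le> 2 * (1 + \<bar>a\<bar> + \<bar>b + 1\<bar>)" for a b :: real by (smt (verit))
  from this[of "of_int (fst p)" "of_int (snd p)"] show ?thesis by (simp add: pt_size_def)
qed

lemma imag_pt_right: "imag_pt y (fst p, snd p + 1) = imag_pt y p + 1"
  by (simp add: imag_pt_def)

lemma shrunk_pt_right: "shrunk_pt y h (fst p, snd p + 1) = shrunk_pt y h p + complex_of_uhp (near_cusp y h)"
proof -
  define d where "d = odd_num h"
  have d: "d \<noteq> 0" by (simp add: d_def)
  have "of_real d * (shrunk_pt y h (fst p, snd p + 1)) = of_real d * (shrunk_pt y h p + complex_of_uhp (near_cusp y h))"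
    unfolding near_cusp_pt shrunk_pt_def d_def[symmetric] using d
    by (simp add: complex_eq_iff ring_distribs add_divide_distrib power2_eq_square)
  then show ?thesis using d by simp
qed

lemma abs_Re_shrunk_pt_right:
  assumes "\<bar>snd p\<bar> \<le> int h" "h \<ge> 1"
  shows "\<bar>Re (shrunk_pt y h (fst p, snd p + 1))\<bar> \<le> 3 / 4"
proof -
  have "\<bar>of_int (snd p + 1)\<bar> \<le> real h + 1" using assms(1) by linarith
  moreover have "real h \<ge> 1" using assms(2) by simp
  ultimately have "4 * \<bar>of_int (snd p + 1)\<bar> \<le> 3 * odd_num h" by (simp add: odd_num_def)
  then show ?thesis using odd_num_ge_1[of h] unfolding Re_shrunk_pt abs_divide snd_conv by (simp add: pos_divide_le_eq)
qed

text \<open>What is left of 1/z^2 after subtracting 1/z - 1/(z+1); it is summable over the half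
  lattice because of its third-power decay.\<close>

definition cubic_term :: "int \<times> int \<Rightarrow> complex" where
  "cubic_term p = 1 / (imag_pt y p ^ 2 * (imag_pt y p + 1))"

lemma cubic_term_bound:
  "\<exists>C. \<forall>p\<in>upper_pts. norm (cubic_term p) \<le> C * pt_size p powr (- 3)"
proof (intro exI ballI)
  fix p assume p: "p \<in> upper_pts"
  let ?A = "2 + 2 / y" and ?p' = "(fst p, snd p + 1)"
  have A: "?A \<ge> 0" using y by simp
  have s: "pt_size p \<ge> 1" by (rule pt_size_pos)
  have "norm (1 / imag_pt y p ^ 2) \<le> ?A ^ 2 * pt_size p powr (- 2)" using imag_pt_bound[OF p, of 2 2] by simp
  moreover have "norm (1 / (imag_pt y p + 1)) \<le> 2 * ?A * pt_size p powr (- 1)"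
  proof -
    have "pt_size p \<le> 2 * (?A * norm (imag_pt y ?p'))"
      using pt_size_right[of p] pt_size_le_imag[OF upper_pts_right[OF p]] by linarith
    then have "pt_size p \<le> (2 * ?A) * norm (imag_pt y p + 1)" by (simp only: imag_pt_right mult.assoc)
    moreover have "imag_pt y p + 1 \<noteq> 0" using shrunk_pt_tendsto(3)[OF upper_pts_right[OF p]] by (simp add: imag_pt_right)
    ultimately show ?thesis using inverse_power_le_pt_size[of p "2 * ?A" "norm (imag_pt y p + 1)" 1 1] A
      by (simp add: norm_divide)
  qed
  ultimately have "norm (1 / imag_pt y p ^ 2) * norm (1 / (imag_pt y p + 1)) \<le> (?A ^ 2 * pt_size p powr (- 2)) * (2 * ?A * pt_size p powr (- 1))"
    using A by (intro mult_mono) auto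
  also have "\<dots> = 2 * ?A ^ 3 * (pt_size p powr (- 2) * pt_size p powr (- 1))" by (simp add: power3_eq_cube power2_eq_square)
  also have "pt_size p powr (- 2) * pt_size p powr (- 1) = pt_size p powr (- 3)" by (subst powr_add[symmetric]) simp
  finally show "norm (cubic_term p) \<le> 2 * ?A ^ 3 * pt_size p powr (- 3)"
    unfolding cubic_term_def by (simp add: norm_mult norm_divide)
qed

lemma summable_powr_minus_3: "(\<lambda>p. C * pt_size p powr (- 3)) summable_on upper_pts"
proof (intro summable_on_cmult_right summable_on_comparison_test[OF summable_weight3])
  fix p :: "int \<times> int"
  have "1 \<le> (1 + of_int \<bar>fst p\<bar>) powr (1 / 2 :: real)" by (rule ge_one_powr_ge_zero) auto
  then show "pt_size p powr (- 3) \<le> pt_size p powr (- 3) * (1 + of_int \<bar>fst p\<bar>) powr (1 / 2)"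
    using mult_left_mono[of 1 _ "pt_size p powr (- 3)"] by simp
qed auto

lemma summable_cubic_term: "(\<lambda>p. norm (cubic_term p)) summable_on upper_pts"
proof -
  obtain C where "\<And>p. p \<in> upper_pts \<Longrightarrow> norm (cubic_term p) \<le> C * pt_size p powr (- 3)" using cubic_term_bound by blast
  then show ?thesis by (intro Infinite_Sum.abs_summable_on_comparison_test'[OF summable_powr_minus_3[of C]])
qed

lemma row_telescope:
  "(\<Sum>n\<leftarrow>desc_ints N. 1 / (c + of_int n) - 1 / (c + of_int n + 1)) = 1 / (c - of_nat N) - 1 / (c + of_nat N + 1 :: complex)"
proof (induction N)
  case 0
  show ?case by (simp add: desc_ints_def)
next
  case (Suc N)
  have "desc_ints (Suc N) = (int N + 1) # desc_ints N @ [- (int N + 1)]" by (simp add: desc_ints_def)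
  then show ?case using Suc by (simp add: algebra_simps)
qed

lemma inverse_far_tendsto: "(\<lambda>N. 1 / (c - of_nat N) - 1 / (c + of_nat N + 1 :: complex)) \<longlonglongrightarrow> 0"
proof -
  have inf: "filterlim (\<lambda>N. of_nat N :: complex) at_infinity sequentially" by (rule tendsto_of_nat)
  have "filterlim (\<lambda>N. c + of_nat N :: complex) at_infinity sequentially"
    by (rule tendsto_add_filterlim_at_infinity[OF tendsto_const inf])
  then have "(\<lambda>N. 1 / (c + of_nat N)) \<longlonglongrightarrow> 0" for c :: complex
    by (intro tendsto_divide_0[OF tendsto_const] tendsto_add_filterlim_at_infinity[OF tendsto_const inf])
  from this[of "c + 1"] this[of "-c"] have "(\<lambda>N. - (1 / (- c + of_nat N)) - 1 / (c + 1 + of_nat N)) \<longlonglongrightarrow> - 0 - 0"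
    by (intro tendsto_diff tendsto_minus)
  moreover have "- (1 / (- c + of_nat N)) = 1 / (c - of_nat N)" for N
    by (metis minus_diff_eq minus_divide_right uminus_add_conv_diff)
  ultimately show ?thesis by (simp add: add_ac)
qed

text \<open>Row 0 telescopes to 1 - 1/(N+1), while in every full row both ends go off to infinity
  and cancel to 0. The value 1 thus depends on summing each row before the rows are added.\<close>

lemma lattice_list_telescope:
  "(\<lambda>N. \<Sum>p\<leftarrow>lattice_list M N. 1 / imag_pt y p - 1 / (imag_pt y p + 1)) \<longlonglongrightarrow> 1"
proof (induction M)
  case 0
  have "(\<Sum>p\<leftarrow>lattice_list 0 N. 1 / imag_pt y p - 1 / (imag_pt y p + 1)) = 1 - 1 / (1 + of_nat N)" for N
    by (induction N) (simp_all add: imag_pt_def o_def add_ac)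
  moreover have "(\<lambda>N. 1 - 1 / (1 + of_nat N) :: complex) \<longlonglongrightarrow> 1 - 0"
    by (intro tendsto_diff tendsto_const tendsto_divide_0[OF tendsto_const] tendsto_add_filterlim_at_infinity[OF tendsto_const] tendsto_of_nat)
  ultimately show ?case by simp
next
  case (Suc M)
  let ?c = "\<i> * of_real (y * of_int (int M + 1))"
  have "(\<Sum>p\<leftarrow>lattice_list (Suc M) N. 1 / imag_pt y p - 1 / (imag_pt y p + 1)) =
     (1 / (?c - of_nat N) - 1 / (?c + of_nat N + 1)) + (\<Sum>p\<leftarrow>lattice_list M N. 1 / imag_pt y p - 1 / (imag_pt y p + 1))" for N
    using row_telescope[of ?c N] by (simp add: imag_pt_def o_def add_ac)
  then show ?case using tendsto_add[OF inverse_far_tendsto[of ?c] Suc] by simp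
qed

lemma mes_2_imag: "mes [2] (Abs_uhp (\<i> * of_real y)) = 1 + infsum cubic_term upper_pts"
proof -
  let ?\<tau> = "Abs_uhp (\<i> * of_real y)"
  have good: "good_word [2]" by simp
  have rows: "eis_part ?\<tau> M [2] = infsum cubic_term {p \<in> upper_pts. fst p \<le> int M} + 1" for M
  proof (rule LIMSEQ_unique)
    show "(\<lambda>N. chain_sum (\<lambda>k p. 1 / lattice_pt ?\<tau> p ^ k) (lattice_list M N) [2]) \<longlonglongrightarrow> eis_part ?\<tau> M [2]"
      by (rule eis_part_lim) simp
    have dist: "(\<Sum>p\<leftarrow>lattice_list M N. f p) = (\<Sum>p\<in>set (lattice_list M N). f p)" for N and f :: "int \<times> int \<Rightarrow> complex"
      by (rule sum_list_distinct_conv_sum_set[OF distinct_lattice_list])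
    have *: "1 / z ^ 2 = 1 / (z ^ 2 * (z + 1)) + (1 / z - 1 / (z + 1))" if "z \<noteq> 0" "z + 1 \<noteq> 0" for z :: complex
    proof -
      have "1 / z - 1 / (z + 1) = 1 / (z * (z + 1))" using that by (simp add: diff_divide_eq_iff divide_diff_eq_iff)
      moreover have "1 / z\<^sup>2 = (1 + z) / (z\<^sup>2 * (z + 1))" using that by (simp add: add.commute)
      moreover have "(1 + z) / (z\<^sup>2 * (z + 1)) = 1 / (z\<^sup>2 * (z + 1)) + z / (z\<^sup>2 * (z + 1))" by (rule add_divide_distrib)
      moreover have "z / (z\<^sup>2 * (z + 1)) = 1 / (z * (z + 1))" using that by (simp add: power2_eq_square)
      ultimately show ?thesis by simp
    qed
    have "chain_sum (\<lambda>k p. 1 / lattice_pt ?\<tau> p ^ k) (lattice_list M N) [2] =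
      (\<Sum>p\<in>set (lattice_list M N). cubic_term p) + (\<Sum>p\<leftarrow>lattice_list M N. 1 / imag_pt y p - 1 / (imag_pt y p + 1))" for N
    proof -
      have "chain_sum (\<lambda>k p. 1 / lattice_pt ?\<tau> p ^ k) (lattice_list M N) [2] = (\<Sum>p\<in>set (lattice_list M N). 1 / imag_pt y p ^ 2)"
        by (subst chain_sum_Cons_sorted[OF sorted_lattice_list]) (simp add: imag_uhp_pt)
      also have "\<dots> = (\<Sum>p\<in>set (lattice_list M N). cubic_term p + (1 / imag_pt y p - 1 / (imag_pt y p + 1)))"
      proof (rule sum.cong[OF refl])
        fix p assume "p \<in> set (lattice_list M N)"
        then have p: "p \<in> upper_pts" unfolding set_lattice_list upper_pts_def by auto
        show "1 / imag_pt y p ^ 2 = cubic_term p + (1 / imag_pt y p - 1 / (imag_pt y p + 1))"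
          unfolding cubic_term_def using * shrunk_pt_tendsto(3)[OF p] shrunk_pt_tendsto(3)[OF upper_pts_right[OF p]]
          unfolding imag_pt_right by blast
      qed
      finally show ?thesis unfolding dist by (simp add: sum.distrib)
    qed
    moreover have "(\<lambda>N. \<Sum>p\<in>set (lattice_list M N). cubic_term p) \<longlonglongrightarrow> infsum cubic_term {p \<in> upper_pts. fst p \<le> int M}"
    proof -
      have "(\<lambda>N. infsum (\<lambda>p. if p \<in> set (lattice_list M N) then cubic_term p else 0) upper_pts)
        \<longlonglongrightarrow> infsum (\<lambda>p. if fst p \<le> int M then cubic_term p else 0) upper_pts"
      proof (rule dominated_infsum(1)[OF _ _ summable_cubic_term])
        fix p assume p: "p \<in> upper_pts"
        show "(\<lambda>N. if p \<in> set (lattice_list M N) then cubic_term p else 0) \<longlonglongrightarrow> (if fst p \<le> int M then cubic_term p else 0)"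
        proof (rule tendsto_eventually)
          show "eventually (\<lambda>N. (if p \<in> set (lattice_list M N) then cubic_term p else 0) = (if fst p \<le> int M then cubic_term p else 0)) sequentially"
            using eventually_ge_at_top[of "nat \<bar>snd p\<bar>"]
          proof eventually_elim
            case (elim N)
            have "p \<in> set (lattice_list M N) \<longleftrightarrow> fst p \<le> int M"
              using elim p fst_upper_pts[OF p] unfolding set_lattice_list upper_pts_def by auto
            then show ?case by simp
          qed
        qed
      qed auto
      moreover have "infsum (\<lambda>p. if p \<in> set (lattice_list M N) then cubic_term p else 0) upper_pts = (\<Sum>p\<in>set (lattice_list M N). cubic_term p)" for N
      proof -
        have "infsum (\<lambda>p. if p \<in> set (lattice_list M N) then cubic_term p else 0) upper_pts = infsum cubic_term (set (lattice_list M N))"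
          by (rule infsum_cong_neutral) (auto simp: set_lattice_list upper_pts_def)
        then show ?thesis by simp
      qed
      moreover have "infsum (\<lambda>p. if fst p \<le> int M then cubic_term p else 0) upper_pts = infsum cubic_term {p \<in> upper_pts. fst p \<le> int M}"
        by (rule infsum_cong_neutral) auto
      ultimately show ?thesis by simp
    qed
    ultimately show "(\<lambda>N. chain_sum (\<lambda>k p. 1 / lattice_pt ?\<tau> p ^ k) (lattice_list M N) [2]) \<longlonglongrightarrow> infsum cubic_term {p \<in> upper_pts. fst p \<le> int M} + 1"
      using lattice_list_telescope[of M] by (auto intro: tendsto_add)
  qed
  have "(\<lambda>M. eis_part ?\<tau> M [2]) \<longlonglongrightarrow> infsum cubic_term upper_pts + 1"
    unfolding rows by (intro tendsto_intros infsum_rows_tendsto summable_cubic_term)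
  with eis_part_tendsto[OF good] show ?thesis by (metis LIMSEQ_unique add.commute)
qed

text \<open>Discrete version of \<open>mes_2_imag\<close>: the closed term tends to the 1 there, and
  \<open>f h\<close> to \<open>cubic_term\<close>. Dividing by q in \<open>\<kappa>\<close> turns
  the power q^(m+2) at the shifted point into the q^(m+1) of \<open>telescope_qden\<close>; the
  cancelling factors d and 1/d are distributed so that each factor has a finite limit.\<close>

lemma gser_2_near_cusp:
  defines "q \<equiv> \<lambda>h. qpar (near_cusp y h)"
  defines "\<kappa> \<equiv> \<lambda>h. of_real (odd_num h) * (q h - 1) / q h"
  defines "f \<equiv> \<lambda>h p. - \<kappa> h * (scaled_term h 2 p * (1 / of_real (odd_num h) *
     (qexp (shrunk_pt y h (fst p, snd p + 1)) * qden (shrunk_pt y h (fst p, snd p + 1)))))"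
  assumes sm: "(\<lambda>p. norm (f h p)) summable_on upper_pts"
  shows "(pfac / of_real (odd_num h)) ^ 2 * gser [2] (near_cusp y h) =
     (pfac / of_real (odd_num h)) ^ 2 * (q h * (1 / (1 - q h))\<^sup>2) + infsum (f h) upper_pts"
proof -
  let ?\<sigma> = "near_cusp y h" and ?c = "(pfac / of_real (odd_num h)) ^ 2"
  define Q where "Q = q h"
  have Q: "norm Q < 1" "Q \<noteq> 0" unfolding Q_def q_def by (rule norm_qpar)+
  have Qp: "Q ^ Suc n \<noteq> 1" for n
  proof
    assume "Q ^ Suc n = 1"
    then have "norm Q ^ Suc n = 1" by (metis norm_one norm_power)
    moreover have "norm Q ^ Suc n < 1" using Q by (intro power_Suc_less_one) auto
    ultimately show False by linarith
  qed
  have Q1: "Q \<noteq> 1" using Qp[of 0] by simp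
  have Qe: "qpar ?\<sigma> = Q" by (simp add: Q_def q_def)
  define u where "u m = 1 / (1 - Q ^ Suc m)" for m
  define v where "v m = (Q ^ Suc m * (u m)\<^sup>2) * (Q ^ Suc m * u (Suc m))" for m
  have step: "(Q - 1) * qterm ?\<sigma> 2 m = (u (Suc m) - u m) - (Q - 1)\<^sup>2 * v m" for m
    using telescope_qden[of "Q ^ Suc m" Q] Qp[of m] Qp[of "Suc m"]
    unfolding qterm_eq Qe u_def v_def tangent_poly_2_qden[OF Qp[of m]] power_Suc2[of Q "Suc m"] by simp
  have fv: "f h (split_index h (Suc m)) = - ?c * (Q - 1) * v m" for m
  proof -
    let ?p = "split_index h (Suc m)"
    have "shrunk_pt y h (fst ?p, snd ?p + 1) + of_int (fst ?p) = of_nat (Suc (Suc m)) * complex_of_uhp ?\<sigma>"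
      unfolding shrunk_pt_right using multiple_near_cusp[of "Suc m" h] by (simp add: ring_distribs)
    then have "qexp (shrunk_pt y h (fst ?p, snd ?p + 1)) = qexp (of_nat (Suc (Suc m)) * complex_of_uhp ?\<sigma>)"
      by (metis mult.right_neutral qexp_add qexp_of_int)
    also have "\<dots> = Q ^ Suc (Suc m)" unfolding qexp_multiple Qe ..
    finally have e: "qexp (shrunk_pt y h (fst ?p, snd ?p + 1)) = Q ^ Suc (Suc m)" .
    have "scaled_term h 2 ?p = ?c * (Q ^ Suc m * (u m)\<^sup>2)"
      unfolding scaled_term_split_index qterm_eq Qe tangent_poly_2_qden[OF Qp[of m]] u_def ..
    moreover have "qden (shrunk_pt y h (fst ?p, snd ?p + 1)) = u (Suc m)" unfolding qden_def e u_def ..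
    ultimately show ?thesis
      unfolding f_def \<kappa>_def e Q_def[symmetric] v_def using Q(2) by (simp add: field_simps)
  qed
  have "(\<lambda>m. f h (split_index h (Suc m))) sums infsum (f h) upper_pts"
    by (rule sums_split_index[OF sm]) (simp add: f_def scaled_term_def)
  then have V: "(\<lambda>m. - ?c * (Q - 1) * v m) sums infsum (f h) upper_pts" unfolding fv .
  have "(\<lambda>m. Q ^ Suc m) \<longlonglongrightarrow> 0" using LIMSEQ_Suc[OF LIMSEQ_power_zero[OF Q(1)]] .
  then have "u \<longlonglongrightarrow> 1 / (1 - 0)" unfolding u_def by (intro tendsto_intros) auto
  then have "u \<longlonglongrightarrow> 1" by simp
  from telescope_sums[OF this] have U: "(\<lambda>m. ?c / (Q - 1) * (u (Suc m) - u m)) sums (?c / (Q - 1) * (1 - u 0))" by (rule sums_mult)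
  have "(\<lambda>m. ?c / (Q - 1) * (u (Suc m) - u m) + - ?c * (Q - 1) * v m) sums (?c / (Q - 1) * (1 - u 0) + infsum (f h) upper_pts)"
    by (rule sums_add[OF U V])
  moreover have "?c / (Q - 1) * (u (Suc m) - u m) + - ?c * (Q - 1) * v m = ?c * qterm ?\<sigma> 2 m" for m
  proof -
    have "?c * qterm ?\<sigma> 2 m = ?c / (Q - 1) * ((Q - 1) * qterm ?\<sigma> 2 m)" using Q1 by simp
    also have "\<dots> = ?c / (Q - 1) * (u (Suc m) - u m) - ?c / (Q - 1) * ((Q - 1)\<^sup>2 * v m)" unfolding step by (rule right_diff_distrib)
    also have "?c / (Q - 1) * ((Q - 1)\<^sup>2 * v m) = ?c * (Q - 1) * v m" using Q1 by (simp add: power2_eq_square)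
    finally show ?thesis by simp
  qed
  ultimately have "(\<lambda>m. ?c * qterm ?\<sigma> 2 m) sums (?c / (Q - 1) * (1 - u 0) + infsum (f h) upper_pts)" by simp
  then have "(\<lambda>M. ?c * gpart [2] M ?\<sigma>) \<longlonglongrightarrow> ?c / (Q - 1) * (1 - u 0) + infsum (f h) upper_pts"
    unfolding sums_def gpart_Cons sum_distrib_left[symmetric] by (simp add: gpart_def)
  moreover have "(\<lambda>M. ?c * gpart [2] M ?\<sigma>) \<longlonglongrightarrow> ?c * gser [2] ?\<sigma>"
    by (intro tendsto_intros gpart_tendsto) simp
  moreover have "?c / (Q - 1) * (1 - u 0) = ?c * (Q * (1 / (1 - Q))\<^sup>2)"
  proof -
    define w where "w = 1 / (1 - Q)"
    have w: "w * (1 - Q) = 1" using Q1 by (simp add: w_def)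
    have "1 - w = - Q * w" using w by (simp add: algebra_simps)
    moreover have "1 / (Q - 1) = - w" unfolding w_def by (metis minus_diff_eq minus_divide_right)
    ultimately have "1 / (Q - 1) * (1 - w) = Q * w\<^sup>2" by (simp add: power2_eq_square)
    then have "?c * (1 / (Q - 1) * (1 - w)) = ?c * (Q * w\<^sup>2)" by simp
    then show ?thesis by (simp add: w_def u_def)
  qed
  ultimately show ?thesis unfolding Q_def by (metis LIMSEQ_unique)
qed

lemma near_cusp_tendsto:
  "filterlim (\<lambda>h. complex_of_uhp (near_cusp y h)) (at 0) sequentially"
  "(\<lambda>h. of_real (odd_num h) * complex_of_uhp (near_cusp y h)) \<longlonglongrightarrow> 1"
  "(\<lambda>h. qpar (near_cusp y h)) \<longlonglongrightarrow> 1"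
proof -
  have up: "(0, 1) \<in> upper_pts" by (simp add: upper_pts_def lattice_succ_def)
  \<comment> \<open>The point near the cusp is itself a shrunk lattice point, so its asymptotics are
    instances of \<open>shrunk_pt_tendsto\<close>.\<close>
  have "shrunk_pt y h (0, 1) = complex_of_uhp (near_cusp y h)" for h
    using shrunk_pt_right[of h "(0, 0)"] by (simp add: shrunk_pt_def)
  then show l: "filterlim (\<lambda>h. complex_of_uhp (near_cusp y h)) (at 0) sequentially"
    and "(\<lambda>h. of_real (odd_num h) * complex_of_uhp (near_cusp y h)) \<longlonglongrightarrow> 1"
    using shrunk_pt_tendsto(1,2)[OF up] by (simp_all add: imag_pt_def)
  have "isCont qexp 0" unfolding qexp_def by (intro continuous_intros)
  then have "(\<lambda>h. qexp (complex_of_uhp (near_cusp y h))) \<longlonglongrightarrow> qexp 0"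
    using l by (intro isCont_tendsto_compose[of 0 qexp]) (auto simp: filterlim_at)
  then show "(\<lambda>h. qpar (near_cusp y h)) \<longlonglongrightarrow> 1"
    using qexp_of_int[of 0] qexp_multiple[of 1] by simp
qed

lemma mes_near_cusp_2:
  "(\<lambda>h. (1 / of_real (odd_num h)) ^ sum_list [2] * mes [2] (near_cusp y h)) \<longlonglongrightarrow> mes [2] (Abs_uhp (\<i> * of_real y))"
proof (rule mes_near_cusp_of_gser)
  define q where "q = (\<lambda>h. qpar (near_cusp y h))"
  define \<kappa> where "\<kappa> = (\<lambda>h. of_real (odd_num h) * (q h - 1) / q h)"
  define E where "E = (\<lambda>h p. 1 / of_real (odd_num h) * (qexp (shrunk_pt y h (fst p, snd p + 1)) * qden (shrunk_pt y h (fst p, snd p + 1))))"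
  define f where "f = (\<lambda>h p. - \<kappa> h * (scaled_term h 2 p * E h p))"
  have q1: "(\<lambda>h. q h) \<longlonglongrightarrow> 1" unfolding q_def by (rule near_cusp_tendsto(3))
  have qnz: "q h \<noteq> 0" for h unfolding q_def by (rule norm_qpar)
  let ?\<sigma> = "\<lambda>h. complex_of_uhp (near_cusp y h)"
  have u: "(\<lambda>h. ?\<sigma> h * qden (?\<sigma> h)) \<longlonglongrightarrow> - 1 / (2 * of_real pi * \<i>)"
    by (rule filterlim_compose[OF qden_times_bigo near_cusp_tendsto(1)])
  have pf: "- 1 / (2 * of_real pi * \<i>) = 1 / pfac" by (simp add: pfac_def)
  have qd: "qden (?\<sigma> h) = 1 / (1 - q h)" for h using qexp_multiple[of 1 "near_cusp y h"] by (simp add: qden_def q_def)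
  have snz: "?\<sigma> h \<noteq> 0" for h using Im_uhp[of "near_cusp y h"] by auto
  have qn1: "q h \<noteq> 1" for h using norm_qpar(1)[of "near_cusp y h"] by (auto simp: q_def)
  have \<kappa>: "\<kappa> \<longlonglongrightarrow> - pfac"
  proof -
    have "(\<lambda>h. - ((of_real (odd_num h) * ?\<sigma> h) / (?\<sigma> h * qden (?\<sigma> h))) / q h) \<longlonglongrightarrow> - (1 / (1 / pfac)) / 1"
      by (intro tendsto_divide tendsto_minus near_cusp_tendsto(2) u[unfolded pf] q1) auto
    moreover have "- ((of_real (odd_num h) * ?\<sigma> h) / (?\<sigma> h * qden (?\<sigma> h))) / q h = \<kappa> h" for h
      unfolding \<kappa>_def qd using snz[of h] qn1[of h] by (simp add: algebra_simps)
    ultimately show ?thesis by simp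
  qed
  then obtain K where K: "\<And>h. norm (\<kappa> h) \<le> K" by (metis BseqE convergent_imp_Bseq convergentI)
  obtain B where B: "\<And>h p. p \<in> upper_pts \<Longrightarrow> norm (scaled_term h 2 p) \<le> B * pt_size p powr (- 2)"
    using scaled_term_bound[of 2 0 2] by auto
  obtain D where D: "\<And>x. \<bar>Re x\<bar> \<le> 3 / 4 \<Longrightarrow> Im x > 0 \<Longrightarrow> norm (qexp x * qden x) \<le> D / norm x"
    using qexp_qden_pole_bound by blast
  have D0: "D \<ge> 0" using order.trans[OF norm_ge_zero D[of \<i>]] by simp
  have K0: "K \<ge> 0" using order.trans[OF norm_ge_zero K] .
  let ?A = "2 + 4 / y"
  have bound: "norm (f h p) \<le> (K * B * (D * (2 * ?A))) * pt_size p powr (- 3)" if p: "p \<in> upper_pts" and h: "h \<ge> 1" for h p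
  proof (cases "\<bar>snd p\<bar> \<le> int h")
    case True
    let ?p' = "(fst p, snd p + 1)" and ?d = "odd_num h"
    let ?x = "shrunk_pt y h ?p'"
    have up: "?p' \<in> upper_pts" by (rule upper_pts_right[OF p])
    have n: "- int h \<le> snd ?p'" using True by auto
    have x: "\<bar>Re ?x\<bar> \<le> 3 / 4" "Im ?x > 0" using abs_Re_shrunk_pt_right[OF True h] pt_size_le_shrunk(2)[OF up n] by auto
    then have nz: "norm ?x > 0" by auto
    have d: "?d \<ge> 1" by (rule odd_num_ge_1)
    have sz: "pt_size p \<le> (2 * ?A) * norm (of_real ?d * ?x)"
      using pt_size_right[of p] pt_size_le_shrunk(1)[OF up n] by (simp only: mult.assoc)
    have "norm (E h p) = 1 / ?d * norm (qexp ?x * qden ?x)" unfolding E_def using d by (simp add: norm_mult norm_divide)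
    also have "\<dots> \<le> 1 / ?d * (D / norm ?x)" using d by (intro mult_left_mono D x) auto
    also have "\<dots> = D * (1 / norm (of_real ?d * ?x) ^ 1)" using d by (simp add: norm_mult)
    also have "\<dots> \<le> D * ((2 * ?A) ^ 1 * pt_size p powr (- real 1))"
      using D0 nz d y by (intro mult_left_mono inverse_power_le_pt_size[OF sz]) (auto simp: norm_mult)
    finally have E: "norm (E h p) \<le> D * (2 * ?A) * pt_size p powr (- 1)" by (simp add: mult_ac)
    have nn: "0 \<le> B * pt_size p powr (- 2)" by (rule order.trans[OF norm_ge_zero B[OF p]])
    have "norm (f h p) = norm (\<kappa> h) * (norm (scaled_term h 2 p) * norm (E h p))" by (simp add: f_def norm_mult)
    also have "\<dots> \<le> K * ((B * pt_size p powr (- 2)) * (D * (2 * ?A) * pt_size p powr (- 1)))"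
      by (intro mult_mono K B p E nn K0 mult_nonneg_nonneg norm_ge_zero)
    also have "\<dots> = (K * B * (D * (2 * ?A))) * (pt_size p powr (- 2) * pt_size p powr (- 1))" by (simp only: mult_ac)
    also have "pt_size p powr (- 2) * pt_size p powr (- 1) = pt_size p powr (- 3)" by (subst powr_add[symmetric]) simp
    finally show ?thesis .
  next
    case False
    have "0 \<le> B * pt_size p powr (- 2)" by (rule order.trans[OF norm_ge_zero B[OF p]])
    then have "B \<ge> 0" using pt_size_pos[of p] by (simp add: zero_le_mult_iff)
    then have "0 \<le> K * B * (D * (2 * ?A))" using K0 D0 y by (intro mult_nonneg_nonneg) auto
    then show ?thesis using False by (simp add: f_def scaled_term_def)
  qed
  have lim: "(\<lambda>h. f h p) \<longlonglongrightarrow> cubic_term p" if p: "p \<in> upper_pts" for p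
  proof -
    let ?p' = "(fst p, snd p + 1)"
    have up: "?p' \<in> upper_pts" by (rule upper_pts_right[OF p])
    let ?x = "\<lambda>h. shrunk_pt y h ?p'"
    have "isCont qexp 0" unfolding qexp_def by (intro continuous_intros)
    then have "(\<lambda>h. qexp (?x h)) \<longlonglongrightarrow> qexp 0"
      using shrunk_pt_tendsto(2)[OF up] by (intro isCont_tendsto_compose[of 0 qexp]) (auto simp: filterlim_at)
    then have q0: "(\<lambda>h. qexp (?x h)) \<longlonglongrightarrow> 1" using qexp_of_int[of 0] by simp
    have "(\<lambda>h. qexp (?x h) * ((?x h * qden (?x h)) / (of_real (odd_num h) * ?x h))) \<longlonglongrightarrow> 1 * ((1 / pfac) / imag_pt y ?p')"
      using shrunk_pt_tendsto[OF up]
      by (intro tendsto_mult tendsto_divide q0 filterlim_compose[OF qden_times_bigo[unfolded pf]])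
    moreover have "eventually (\<lambda>h. qexp (?x h) * ((?x h * qden (?x h)) / (of_real (odd_num h) * ?x h)) = E h p) sequentially"
      using eventually_ge_at_top[of "nat \<bar>snd p + 1\<bar>"]
    proof eventually_elim
      case (elim h)
      then have "Im (?x h) > 0" by (intro pt_size_le_shrunk(2)[OF up]) auto
      then have "?x h \<noteq> 0" by auto
      then show ?case by (simp add: E_def)
    qed
    ultimately have "(\<lambda>h. E h p) \<longlonglongrightarrow> 1 * ((1 / pfac) / imag_pt y ?p')" by (rule Lim_transform_eventually)
    then have "(\<lambda>h. f h p) \<longlonglongrightarrow> - (- pfac) * (1 / imag_pt y p ^ 2 * (1 * ((1 / pfac) / imag_pt y ?p')))"
      unfolding f_def by (intro tendsto_mult tendsto_minus \<kappa> scaled_term_tendsto p) auto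
    moreover have "- (- pfac) * (1 / imag_pt y p ^ 2 * (1 * ((1 / pfac) / imag_pt y ?p'))) = cubic_term p"
      unfolding cubic_term_def imag_pt_right by simp
    ultimately show ?thesis by simp
  qed
  \<comment> \<open>The domination holds from \<open>h = 1\<close> on, since for
    \<open>h = 0\<close> a shifted point may leave the strip of half-width 3/4; hence the passage to
    \<open>Suc h\<close>.\<close>
  have "(\<lambda>h. infsum (f (Suc h)) upper_pts) \<longlonglongrightarrow> infsum cubic_term upper_pts"
    by (rule dominated_infsum(1)[OF _ _ summable_powr_minus_3[of "K * B * (D * (2 * ?A))"]])
      (use bound LIMSEQ_Suc[OF lim] in auto)
  then have F: "(\<lambda>h. infsum (f h) upper_pts) \<longlonglongrightarrow> infsum cubic_term upper_pts" by (rule LIMSEQ_imp_Suc)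
  have main: "(\<lambda>h. (pfac / of_real (odd_num h)) ^ 2 * (q h * (1 / (1 - q h))\<^sup>2)) \<longlonglongrightarrow> 1"
  proof -
    have "(\<lambda>h. pfac ^ 2 * (q h * (?\<sigma> h * qden (?\<sigma> h)) ^ 2) / (of_real (odd_num h) * ?\<sigma> h) ^ 2) \<longlonglongrightarrow> pfac ^ 2 * (1 * (1 / pfac) ^ 2) / 1 ^ 2"
      by (intro tendsto_intros near_cusp_tendsto(2) u[unfolded pf] q1) auto
    moreover have "pfac ^ 2 * (q h * (?\<sigma> h * qden (?\<sigma> h)) ^ 2) / (of_real (odd_num h) * ?\<sigma> h) ^ 2 = (pfac / of_real (odd_num h)) ^ 2 * (q h * (1 / (1 - q h))\<^sup>2)" for h
      unfolding qd[symmetric] using snz[of h] by (simp add: power_mult_distrib power_divide)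
    moreover have "pfac ^ 2 * (1 * (1 / pfac) ^ 2) / 1 ^ 2 = 1" by (simp add: power_divide)
    ultimately show ?thesis by simp
  qed
  have "(\<lambda>h. (pfac / of_real (odd_num h)) ^ 2 * (q h * (1 / (1 - q h))\<^sup>2) + infsum (f h) upper_pts) \<longlonglongrightarrow> 1 + infsum cubic_term upper_pts"
    by (intro tendsto_add main F)
  moreover have "eventually (\<lambda>h. (pfac / of_real (odd_num h)) ^ 2 * (q h * (1 / (1 - q h))\<^sup>2) + infsum (f h) upper_pts =
     (pfac / of_real (odd_num h)) ^ sum_list [2] * gser [2] (near_cusp y h)) sequentially"
    using eventually_ge_at_top[of 1]
  proof eventually_elim
    case (elim h)
    have sm: "(\<lambda>p. norm (f h p)) summable_on upper_pts"
      by (rule Infinite_Sum.abs_summable_on_comparison_test'[OF summable_powr_minus_3 bound[OF _ elim]])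
    show ?case using gser_2_near_cusp[of h] sm unfolding f_def \<kappa>_def E_def q_def by simp
  qed
  ultimately show "(\<lambda>h. (pfac / of_real (odd_num h)) ^ sum_list [2] * gser [2] (near_cusp y h)) \<longlonglongrightarrow> mes [2] (Abs_uhp (\<i> * of_real y))"
    unfolding mes_2_imag by (rule Lim_transform_eventually)
qed simp

text \<open>
  A leading entry \<open>2\<close> is outside the range of dominated convergence. Such a word is reduced to the
  others by stuffling \<open>[2]\<close> with the rest of the word, the case of \<open>mes [2]\<close> being handled by telescoping.
\<close>

definition leading_twos :: "nat list \<Rightarrow> nat" where
  "leading_twos ks = length (takeWhile (\<lambda>k. k = 2) ks)"

text \<open>Inserting 2 within the initial run of twos reproduces \<open>2 # w\<close>; inserting it
  later leaves the run unchanged, and merging it with an entry creates one that is at least 4, which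
  can only shorten the run.\<close>

lemma stuffle_two:
  assumes "u \<in> set (stuffle [2] w)" "good_word w"
  shows "u = 2 # w \<or> leading_twos u \<le> leading_twos w"
  using assms
proof (induction w arbitrary: u)
  case (Cons b v)
  then consider "u = 2 # b # v" | u' where "u = b # u'" "u' \<in> set (stuffle [2] v)" | "u = (2 + b) # v"
    by auto
  then show ?case
  proof cases
    case (2 u')
    then have "u' = 2 # v \<or> leading_twos u' \<le> leading_twos v" using Cons by auto
    then show ?thesis using 2 by (auto simp: leading_twos_def)
  next
    case 3
    then show ?thesis using Cons.prems by (simp add: leading_twos_def)
  qed simp
qed simp

theorem mes_near_cusp:
  assumes "good_word ks"
  shows "(\<lambda>h. (1 / of_real (odd_num h)) ^ sum_list ks * mes ks (near_cusp y h)) \<longlonglongrightarrow> mes ks (Abs_uhp (\<i> * of_real y))"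
  using assms
proof (induction "leading_twos ks" arbitrary: ks rule: less_induct)
  case less
  let ?n = "\<lambda>ks h. (1 / of_real (odd_num h)) ^ sum_list ks * mes ks (near_cusp y h)" and ?\<tau> = "Abs_uhp (\<i> * of_real y)"
  consider "ks = []" | l v where "ks = l # v" "l \<ge> 3" | w where "ks = 2 # w"
  proof (cases ks)
    case (Cons l v)
    then show thesis using that(2)[of l v] that(3)[of v] less.prems by (cases "l = 2") auto
  qed (use that(1) in auto)
  then show ?case
  proof cases
    case 1
    then show ?thesis by (simp add: mes_Nil)
  next
    case (2 l v)
    then show ?thesis using mes_near_cusp_ge_3 less.prems by auto
  next
    case (3 w)
    have w: "good_word w" "leading_twos w < leading_twos ks" using less.prems 3 by (auto simp: leading_twos_def)
    let ?S = "stuffle [2] w"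
    let ?O = "filter (\<lambda>u. u \<noteq> 2 # w) ?S"
    \<comment> \<open>The word \<open>2 # w\<close> occurs in the product several times if
      \<open>w\<close> itself starts with 2; its multiplicity is nonzero, so the product formula can
      be solved for it.\<close>
    define c where "c = length (filter (\<lambda>u. u = 2 # w) ?S)"
    have "2 # w \<in> set ?S" by (cases w) auto
    then have c: "c \<noteq> 0" by (auto simp: c_def filter_empty_conv)
    have split: "(\<Sum>u\<leftarrow>?S. F u) = of_nat c * F ks + (\<Sum>u\<leftarrow>?O. F u)" for F :: "nat list \<Rightarrow> complex"
    proof -
      have "(\<Sum>u\<leftarrow>W. F u) = of_nat (length (filter (\<lambda>u. u = 2 # w) W)) * F (2 # w) + (\<Sum>u\<leftarrow>filter (\<lambda>u. u \<noteq> 2 # w) W. F u)" for W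
        by (induction W) (auto simp: algebra_simps)
      from this[of ?S] show ?thesis unfolding c_def 3 .
    qed
    have prod: "mes [2] \<tau> * mes w \<tau> = of_nat c * mes ks \<tau> + (\<Sum>u\<leftarrow>?O. mes u \<tau>)" for \<tau>
    proof -
      have "(mes [2] * mes w) \<tau> = (\<Sum>u\<leftarrow>?S. mes u) \<tau>" using mes_stuffle[of "[2]" w] w by simp
      moreover have "(\<Sum>u\<leftarrow>W. mes u) \<tau> = (\<Sum>u\<leftarrow>W. mes u \<tau>)" for W by (induction W) auto
      ultimately show ?thesis by (simp add: split)
    qed
    have O: "?n u \<longlonglongrightarrow> mes u ?\<tau>" "sum_list u = sum_list ks" if "u \<in> set ?O" for u
    proof -
      have u: "u \<in> set ?S" "u \<noteq> 2 # w" using that by auto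
      then have "leading_twos u \<le> leading_twos w" using stuffle_two w by blast
      moreover have "good_word u" using stuffle_ge[OF u(1), of 2] w by (simp add: good_word_def)
      ultimately show "?n u \<longlonglongrightarrow> mes u ?\<tau>" using less.hyps[of u] w by simp
      show "sum_list u = sum_list ks" using sum_list_stuffle[OF u(1)] 3 by simp
    qed
    have "(\<lambda>h. (?n [2] h * ?n w h - (\<Sum>i<length ?O. ?n (?O ! i) h)) / of_nat c) \<longlonglongrightarrow>
       (mes [2] ?\<tau> * mes w ?\<tau> - (\<Sum>i<length ?O. mes (?O ! i) ?\<tau>)) / of_nat c"
      by (intro tendsto_divide tendsto_diff tendsto_mult tendsto_sum mes_near_cusp_2 less.hyps w O nth_mem tendsto_const) (use c in auto)
    also have "(mes [2] ?\<tau> * mes w ?\<tau> - (\<Sum>i<length ?O. mes (?O ! i) ?\<tau>)) / of_nat c = mes ks ?\<tau>"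
      using prod[of ?\<tau>] c by (simp add: sum_list_sum_nth atLeast0LessThan)
    also have "(\<lambda>h. (?n [2] h * ?n w h - (\<Sum>i<length ?O. ?n (?O ! i) h)) / of_nat c) = ?n ks"
    proof
      fix h
      let ?\<sigma> = "near_cusp y h" and ?d = "(1 / of_real (odd_num h)) ^ sum_list ks :: complex"
      have "(\<Sum>i<length ?O. ?n (?O ! i) h) = (\<Sum>i<length ?O. ?d * mes (?O ! i) ?\<sigma>)"
        by (intro sum.cong refl arg_cong2[where f = "(*)"]) (use O(2)[OF nth_mem] in auto)
      also have "\<dots> = ?d * (\<Sum>u\<leftarrow>?O. mes u ?\<sigma>)" by (simp add: sum_list_sum_nth atLeast0LessThan sum_distrib_left)
      finally have 1: "(\<Sum>i<length ?O. ?n (?O ! i) h) = ?d * (\<Sum>u\<leftarrow>?O. mes u ?\<sigma>)" .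
      have "?d = (1 / of_real (odd_num h)) ^ sum_list [2] * (1 / of_real (odd_num h)) ^ sum_list w"
        unfolding 3 by (simp only: sum_list.Cons sum_list.Nil power_add[symmetric] add_0_right)
      then have "?n [2] h * ?n w h = ?d * (mes [2] ?\<sigma> * mes w ?\<sigma>)" by (simp only: mult_ac)
      also have "\<dots> = of_nat c * (?d * mes ks ?\<sigma>) + ?d * (\<Sum>u\<leftarrow>?O. mes u ?\<sigma>)" unfolding prod by (simp only: ring_distribs mult_ac)
      finally have "?n [2] h * ?n w h - (\<Sum>i<length ?O. ?n (?O ! i) h) = of_nat c * (?d * mes ks ?\<sigma>)" unfolding 1 by simp
      then show "(?n [2] h * ?n w h - (\<Sum>i<length ?O. ?n (?O ! i) h)) / of_nat c = ?n ks h" using c by simp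
    qed
    finally show ?thesis .
  qed
qed

end

subsection \<open>The grading by weight\<close>

lemma (in vector_space) span_UN_decompose:
  assumes "f \<in> span (\<Union>k\<in>K. S k)"
  shows "\<exists>x A. finite A \<and> A \<subseteq> K \<and> (\<forall>k. x k \<in> span (S k)) \<and> (\<forall>k. k \<notin> A \<longrightarrow> x k = 0) \<and> f = (\<Sum>k\<in>A. x k)"
  using assms
proof (induction rule: span_induct_alt)
  case base
  show ?case by (intro exI[of _ "\<lambda>k. 0"] exI[of _ "{}"]) (auto intro: span_zero)
next
  case (step c u v)
  then obtain x A where x: "finite A" "A \<subseteq> K" "\<And>k. x k \<in> span (S k)" "\<And>k. k \<notin> A \<Longrightarrow> x k = 0" "v = (\<Sum>k\<in>A. x k)"
    by blast
  obtain k where k: "k \<in> K" "u \<in> S k" using step by blast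
  let ?x = "x(k := scale c u + x k)" and ?A = "insert k A"
  have "v = (\<Sum>k\<in>?A. x k)"
    unfolding x(5) by (rule sum.mono_neutral_left) (use x in auto)
  moreover have "(\<Sum>j\<in>?A. ?x j) = (\<Sum>j\<in>?A. (if j = k then scale c u else 0) + x j)"
    by (rule sum.cong) auto
  then have "(\<Sum>j\<in>?A. ?x j) = scale c u + (\<Sum>j\<in>?A. x j)"
    using x(1) by (simp add: sum.distrib del: sum.insert_if sum.insert)
  ultimately have "scale c u + v = (\<Sum>j\<in>?A. ?x j)" by simp
  moreover have "?x j \<in> span (S j)" for j
    using x k by (auto intro: span_add span_scale span_base)
  ultimately show ?case using x k by (intro exI[of _ ?x] exI[of _ ?A]) auto
qed

lemma admissible_good_word: "admissible ks \<longleftrightarrow> good_word ks \<and> ks \<noteq> []"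
  by (auto simp: admissible_def good_word_def)

lemma good_word_sum_0: "good_word ks \<Longrightarrow> sum_list ks = 0 \<longleftrightarrow> ks = []"
  by (cases ks) auto

lemma g_Nil: "g [] = 1"
  by (auto simp: g_def fun_eq_iff)

lemma Eis_eq: "Eis = qspan {mes ks | ks. good_word ks}"
proof -
  have "insert 1 {mes ks | ks. admissible ks} = {mes ks | ks. good_word ks}"
    by (force simp: admissible_good_word mes_Nil[symmetric])
  then show ?thesis by (simp add: Eis_def)
qed

lemma weight_zero_words: "{mes ks | ks. good_word ks \<and> sum_list ks = 0} = {1}"
  using good_word_sum_0 by (force simp: mes_Nil[symmetric])

lemma positive_weight_words:
  "k > 0 \<Longrightarrow> {mes ks | ks. admissible ks \<and> sum_list ks = k} = {mes ks | ks. good_word ks \<and> sum_list ks = k}"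
  by (auto simp: admissible_good_word)

lemma Eis_wt_eq: "Eis_wt k = qspan {mes ks | ks. good_word ks \<and> sum_list ks = k}"
  using weight_zero_words positive_weight_words[of k] by (cases "k = 0") (auto simp: Eis_wt_def simp del: sum_list_eq_0_iff)

lemma Eis_wt\<^sub>C_eq: "Eis_wt\<^sub>C k = cspan {mes ks | ks. good_word ks \<and> sum_list ks = k}"
  using weight_zero_words positive_weight_words[of k] by (cases "k = 0") (auto simp: Eis_wt\<^sub>C_def simp del: sum_list_eq_0_iff)

lemma FilW_eq: "FilW k = qspan {g ks | ks. good_word ks \<and> int (sum_list ks) \<le> k}"
proof (cases "k < 0")
  case True
  then have "{g ks | ks. good_word ks \<and> int (sum_list ks) \<le> k} = {}" by auto
  then show ?thesis using True by (simp add: FilW_def)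
next
  case False
  then have "insert 1 {g ks | ks. admissible ks \<and> int (sum_list ks) \<le> k} = {g ks | ks. good_word ks \<and> int (sum_list ks) \<le> k}"
    by (force simp: admissible_good_word g_Nil[symmetric])
  then show ?thesis using False by (simp add: FilW_def)
qed

lemma qscale_cscale: "qscale a = cscale (of_rat a)"
  by (auto simp: qscale_def cscale_def fun_eq_iff)

lemma qspan_subset_cspan: "qspan A \<subseteq> cspan A"
proof
  fix f assume "f \<in> qspan A"
  then show "f \<in> cspan A"
  proof (induction rule: qvs.span_induct_alt)
    case (step c x y)
    then show ?case unfolding qscale_cscale by (intro cvs.span_add[OF cvs.span_scale[OF cvs.span_base]])
  qed (rule cvs.span_zero)
qed

lemma cspan_qspan: "cspan (qspan A) = cspan A"
  by (metis cvs.span_eq cvs.span_superset qspan_subset_cspan qvs.span_superset subset_trans)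

lemma Eis\<^sub>C_eq: "Eis\<^sub>C = cspan {mes ks | ks. good_word ks}"
  by (simp add: Eis\<^sub>C_def Eis_eq cspan_qspan)

lemma subspace_Eis: "qvs.subspace Eis" by (simp add: Eis_eq)

lemma subspace_Eis_wt: "qvs.subspace (Eis_wt k)" by (simp add: Eis_wt_eq)

lemma subspace_FilW: "qvs.subspace (FilW k)" by (simp add: FilW_eq)

lemma subspace_Eis\<^sub>C: "cvs.subspace Eis\<^sub>C" by (simp add: Eis\<^sub>C_eq)

lemma subspace_Eis_wt\<^sub>C: "cvs.subspace (Eis_wt\<^sub>C k)" by (simp add: Eis_wt\<^sub>C_eq)

lemma subspace_FilC: "cvs.subspace (FilC w)" by (simp add: FilC_def)

lemma Eis_wt_subset_Eis_wt\<^sub>C: "Eis_wt k \<subseteq> Eis_wt\<^sub>C k"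
  unfolding Eis_wt_eq Eis_wt\<^sub>C_eq by (rule qspan_subset_cspan)

lemma Eis_wt_subset_Eis: "Eis_wt k \<subseteq> Eis"
  unfolding Eis_wt_eq Eis_eq by (rule qvs.span_mono) auto

lemma FilW_mono: "i \<le> j \<Longrightarrow> FilW i \<subseteq> FilW j"
  unfolding FilW_eq by (rule qvs.span_mono) auto

lemma FilC_mono: "i \<le> j \<Longrightarrow> FilC i \<subseteq> FilC j"
  unfolding FilC_def by (rule cvs.span_mono) auto

lemma FilW_subset_FilC: "FilW (int w - 1) \<subseteq> FilC w"
proof -
  have "{g ks | ks. good_word ks \<and> int (sum_list ks) \<le> int w - 1} \<subseteq> {gser ks | ks. good_word ks \<and> sum_list ks < w}"
    using g_eq_gser by fastforce
  then show ?thesis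
    unfolding FilW_eq FilC_def using qspan_subset_cspan cvs.span_mono by blast
qed

lemma one_in_Eis_wt: "1 \<in> Eis_wt 0"
  unfolding Eis_wt_eq weight_zero_words by (rule qvs.span_base) simp

lemma Eis_decompose:
  assumes "f \<in> Eis"
  shows "\<exists>x A. finite A \<and> (\<forall>k. x k \<in> Eis_wt k) \<and> (\<forall>k. k \<notin> A \<longrightarrow> x k = 0) \<and> f = (\<Sum>k\<in>A. x k)"
proof -
  have "{mes ks | ks. good_word ks} = (\<Union>k\<in>UNIV. {mes ks | ks. good_word ks \<and> sum_list ks = k})" by auto
  then show ?thesis
    using qvs.span_UN_decompose[where f = f and K = UNIV and S = "\<lambda>k. {mes ks | ks. good_word ks \<and> sum_list ks = k}"] assms
    by (auto simp: Eis_eq Eis_wt_eq)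
qed

lemma Eis\<^sub>C_decompose:
  assumes "f \<in> cspan {mes ks | ks. good_word ks \<and> sum_list ks \<in> K}"
  shows "\<exists>x A. finite A \<and> A \<subseteq> K \<and> (\<forall>k. x k \<in> Eis_wt\<^sub>C k) \<and> (\<forall>k. k \<notin> A \<longrightarrow> x k = 0) \<and> f = (\<Sum>k\<in>A. x k)"
proof -
  have "{mes ks | ks. good_word ks \<and> sum_list ks \<in> K} = (\<Union>k\<in>K. {mes ks | ks. good_word ks \<and> sum_list ks = k})" by auto
  then show ?thesis
    using cvs.span_UN_decompose[where f = f and K = K and S = "\<lambda>k. {mes ks | ks. good_word ks \<and> sum_list ks = k}"] assms
    by (auto simp: Eis_wt\<^sub>C_eq)
qed

lemma has_qexp_FilC: "f \<in> FilC w \<Longrightarrow> \<exists>b. has_qexp f b"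
  unfolding FilC_def
proof (induction rule: cvs.span_induct_alt)
  case base
  show ?case using has_qexp_0 by blast
next
  case (step c x y)
  then obtain b ls where "has_qexp y b" "x = gser ls" "good_word ls" by blast
  moreover from this obtain a :: "nat \<Rightarrow> rat" where "has_qexp x (\<lambda>n. of_rat (a n))"
    using rational_qexp_g[of ls] g_eq_gser[of ls] by (auto simp: rational_qexp_def)
  ultimately show ?case using has_qexp_add has_qexp_scale by blast
qed

lemma gser_in_FilC: "good_word ks \<Longrightarrow> gser ks \<in> FilC (Suc (sum_list ks))"
  unfolding FilC_def by (rule cvs.span_base) auto

lemma mes_in_FilC: "good_word ks \<Longrightarrow> mes ks \<in> FilC (Suc (sum_list ks))"
proof -
  assume ks: "good_word ks"
  have "mes ks = cscale (pfac ^ sum_list ks) (gser ks) + (mes ks - cscale (pfac ^ sum_list ks) (gser ks))" by simp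
  also have "\<dots> \<in> FilC (Suc (sum_list ks))"
    using subsetD[OF FilC_mono mes_expansion(1)[OF ks]] gser_in_FilC[OF ks]
    by (intro cvs.subspace_add[OF subspace_FilC] cvs.subspace_scale[OF subspace_FilC]) auto
  finally show ?thesis .
qed

text \<open>\<open>mes_expansion\<close> is triangular with respect to the weight, with the
  invertible diagonal entries \<open>pfac ^ sum_list ks\<close>; it can be inverted by induction on
  the weight bound.\<close>

lemma FilC_eq_mes: "FilC w = cspan {mes ks | ks. good_word ks \<and> sum_list ks < w}"
proof
  show "cspan {mes ks | ks. good_word ks \<and> sum_list ks < w} \<subseteq> FilC w"
    using subsetD[OF FilC_mono mes_in_FilC] by (intro cvs.span_minimal subspace_FilC) auto
  show "FilC w \<subseteq> cspan {mes ks | ks. good_word ks \<and> sum_list ks < w}"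
  proof (induction w rule: less_induct)
    case (less w)
    have "gser ls \<in> cspan {mes ks | ks. good_word ks \<and> sum_list ks < w}" (is "_ \<in> ?V") if ls: "good_word ls" "sum_list ls < w" for ls
    proof -
      let ?p = "pfac ^ sum_list ls"
      have "mes ls - cscale ?p (gser ls) \<in> cspan {mes ks | ks. good_word ks \<and> sum_list ks < sum_list ls}"
        using less ls mes_expansion(1) by blast
      then have "mes ls - cscale ?p (gser ls) \<in> ?V"
        by (rule subsetD[OF cvs.span_mono, rotated]) (use ls in auto)
      moreover have "mes ls \<in> ?V" by (rule cvs.span_base) (use ls in auto)
      ultimately have "cscale (inverse ?p) (mes ls - (mes ls - cscale ?p (gser ls))) \<in> ?V"
        by (rule cvs.span_scale[OF cvs.span_diff[rotated]])
      also have "cscale (inverse ?p) (mes ls - (mes ls - cscale ?p (gser ls))) = gser ls"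
        by (auto simp: cscale_def fun_eq_iff)
      finally show ?thesis .
    qed
    then show ?case unfolding FilC_def by (intro cvs.span_minimal) auto
  qed
qed

lemma Eis_wt\<^sub>C_subset_FilC: "Eis_wt\<^sub>C k \<subseteq> FilC (Suc k)"
  unfolding FilC_eq_mes Eis_wt\<^sub>C_eq by (rule cvs.span_mono) auto

lemma (in imag_axis) Eis_wt\<^sub>C_near_cusp:
  "f \<in> Eis_wt\<^sub>C k \<Longrightarrow> (\<lambda>h. (1 / of_real (odd_num h)) ^ k * f (near_cusp y h)) \<longlonglongrightarrow> f (Abs_uhp (\<i> * of_real y))"
  unfolding Eis_wt\<^sub>C_eq
proof (induction rule: cvs.span_induct_alt)
  case (step c u v)
  then have "(\<lambda>h. (1 / of_real (odd_num h)) ^ k * u (near_cusp y h)) \<longlonglongrightarrow> u (Abs_uhp (\<i> * of_real y))"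
    using mes_near_cusp by blast
  from tendsto_add[OF tendsto_mult_left[OF this, of c] step(2)]
  show ?case by (simp add: cscale_def algebra_simps)
qed auto

lemma sum_fun_apply: "(\<Sum>k\<in>A. F k) t = (\<Sum>k\<in>A. (F k :: 'a \<Rightarrow> 'b::comm_monoid_add) t)"
  by (induction A rule: infinite_finite_induct) auto

text \<open>The top weight component dominates along \<^const>\<open>near_cusp\<close>, hence vanishes on the imaginary axis.\<close>

lemma Eis_wt\<^sub>C_independent:
  assumes "finite A" "\<And>k. k \<in> A \<Longrightarrow> x k \<in> Eis_wt\<^sub>C k" "(\<Sum>k\<in>A. x k) = 0" "k \<in> A"
  shows "x k = 0"
  using assms
proof (induction A arbitrary: k rule: finite_linorder_max_induct)
  case (insert b A)
  have nb: "b \<notin> A" using insert by auto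
  have "x b (Abs_uhp (\<i> * of_real y)) = 0" if "y > 0" for y
  proof -
    interpret imag_axis y by unfold_locales (rule that)
    let ?d = "\<lambda>h. 1 / of_real (odd_num h) :: complex" and ?t = "Abs_uhp (\<i> * of_real y)"
    have d0: "?d \<longlonglongrightarrow> 0" using tendsto_of_real[OF inverse_odd_num_tendsto, where 'a = complex] by simp
    have "(\<lambda>h. ?d h ^ (b - j) * (?d h ^ j * x j (near_cusp y h))) \<longlonglongrightarrow> 0 ^ (b - j) * x j ?t" if "j \<in> A" for j
      using insert that by (intro tendsto_mult tendsto_power d0 Eis_wt\<^sub>C_near_cusp) auto
    then have "(\<lambda>h. \<Sum>j\<in>A. ?d h ^ (b - j) * (?d h ^ j * x j (near_cusp y h))) \<longlonglongrightarrow> (\<Sum>j\<in>A. 0 ^ (b - j) * x j ?t)"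
      by (rule tendsto_sum)
    moreover have "(\<Sum>j\<in>A. 0 ^ (b - j) * x j ?t) = 0"
      by (rule sum.neutral) (use insert in auto)
    moreover have "(\<Sum>j\<in>A. ?d h ^ (b - j) * (?d h ^ j * x j (near_cusp y h))) = - (?d h ^ b * x b (near_cusp y h))" for h
    proof -
      have "(\<Sum>j\<in>A. ?d h ^ (b - j) * (?d h ^ j * x j (near_cusp y h))) = ?d h ^ b * (\<Sum>j\<in>A. x j (near_cusp y h))"
        unfolding sum_distrib_left
      proof (rule sum.cong)
        fix j assume "j \<in> A"
        then have "b = (b - j) + j" using insert by auto
        then have "?d h ^ b = ?d h ^ (b - j) * ?d h ^ j" by (metis power_add)
        then show "?d h ^ (b - j) * (?d h ^ j * x j (near_cusp y h)) = ?d h ^ b * x j (near_cusp y h)" by simp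
      qed simp
      moreover have "x b (near_cusp y h) + (\<Sum>j\<in>A. x j (near_cusp y h)) = 0"
        using fun_cong[OF insert.prems(2), of "near_cusp y h"] nb insert.hyps by (simp add: sum_fun_apply)
      then have "(\<Sum>j\<in>A. x j (near_cusp y h)) = - x b (near_cusp y h)" by (simp add: eq_neg_iff_add_eq_0 add.commute)
      ultimately show ?thesis by simp
    qed
    ultimately have "(\<lambda>h. - (?d h ^ b * x b (near_cusp y h))) \<longlonglongrightarrow> 0" by simp
    moreover have "(\<lambda>h. - (?d h ^ b * x b (near_cusp y h))) \<longlonglongrightarrow> - x b ?t"
      using insert by (intro tendsto_minus Eis_wt\<^sub>C_near_cusp) auto
    ultimately show ?thesis using LIMSEQ_unique by fastforce
  qed
  moreover have "x b \<in> FilC (Suc b)" using insert Eis_wt\<^sub>C_subset_FilC by blast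
  ultimately have b0: "x b = 0" using has_qexp_FilC has_qexp_vanish by blast
  have "(\<Sum>k\<in>A. x k) = 0" using insert.prems(2) unfolding sum.insert[OF insert.hyps(1) nb] b0 by (simp add: zero_fun_def)
  then have "x j = 0" if "j \<in> A" for j
    by (intro insert.IH) (use insert.prems(1) that in auto)
  then show ?case using insert.prems(3) b0 by auto
qed auto

text \<open>In terms of \<open>mes\<close> the space \<open>FilC w\<close> involves only weights
  below \<open>w\<close>, so an element of weight \<open>w\<close> in it produces a relation between
  different weights. This is the source of injectivity of the maps to the graded pieces.\<close>

lemma Eis_wt\<^sub>C_Int_FilC:
  assumes "f \<in> Eis_wt\<^sub>C w" "f \<in> FilC w"
  shows "f = 0"
proof -
  have "f \<in> cspan {mes ks | ks. good_word ks \<and> sum_list ks \<in> {..<w}}"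
    using assms(2) by (simp add: FilC_eq_mes)
  then obtain x A where x: "finite A" "A \<subseteq> {..<w}" "\<And>k. x k \<in> Eis_wt\<^sub>C k" "f = (\<Sum>k\<in>A. x k)"
    by (blast dest: Eis\<^sub>C_decompose)
  have w: "w \<notin> A" using x by auto
  let ?x = "x(w := - f)"
  have "?x w = 0"
  proof (rule Eis_wt\<^sub>C_independent[where A = "insert w A" and x = ?x and k = w])
    show "(\<Sum>k\<in>insert w A. ?x k) = 0"
    proof -
      have "(\<Sum>k\<in>A. ?x k) = (\<Sum>k\<in>A. x k)" by (rule sum.cong) (use w in auto)
      then show ?thesis using w x by simp
    qed
    show "finite (insert w A)" "w \<in> insert w A" using x(1) by auto
    show "?x k \<in> Eis_wt\<^sub>C k" for k using x(3) cvs.subspace_neg[OF subspace_Eis_wt\<^sub>C assms(1)] by simp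
  qed
  then show ?thesis by simp
qed

section \<open>Products\<close>

lemma cspan_mult:
  assumes "\<And>a b. a \<in> A \<Longrightarrow> b \<in> B \<Longrightarrow> a * b \<in> cspan C" "f \<in> cspan A" "h \<in> cspan B"
  shows "f * h \<in> cspan C"
  using assms(2)
proof (induction rule: cvs.span_induct_alt)
  case (step c x y)
  have "x * h \<in> cspan C"
    using assms(3)
  proof (induction rule: cvs.span_induct_alt)
    case (step d u v)
    have "x * (cscale d u + v) = cscale d (x * u) + x * v" by (auto simp: cscale_def algebra_simps fun_eq_iff)
    then show ?case
      using cvs.span_add[OF cvs.span_scale[OF assms(1)[OF \<open>x \<in> A\<close> step(1)], of d] step(2)] by (simp only:)
  qed (use cvs.span_zero[of C] in \<open>simp add: zero_fun_def\<close>)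
  moreover have "(cscale c x + y) * h = cscale c (x * h) + y * h" by (auto simp: cscale_def algebra_simps fun_eq_iff)
  ultimately show ?case using cvs.span_add[OF cvs.span_scale[of "x * h" C c] step(2)] by (simp only:)
qed (use cvs.span_zero[of C] in \<open>simp add: zero_fun_def\<close>)

lemma qspan_mult:
  assumes "\<And>a b. a \<in> A \<Longrightarrow> b \<in> B \<Longrightarrow> a * b \<in> qspan C" "f \<in> qspan A" "h \<in> qspan B"
  shows "f * h \<in> qspan C"
  using assms(2)
proof (induction rule: qvs.span_induct_alt)
  case (step c x y)
  have "x * h \<in> qspan C"
    using assms(3)
  proof (induction rule: qvs.span_induct_alt)
    case (step d u v)
    have "x * (qscale d u + v) = qscale d (x * u) + x * v" by (auto simp: qscale_def algebra_simps fun_eq_iff)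
    then show ?case
      using qvs.span_add[OF qvs.span_scale[OF assms(1)[OF \<open>x \<in> A\<close> step(1)], of d] step(2)] by (simp only:)
  qed (use qvs.span_zero[of C] in \<open>simp add: zero_fun_def\<close>)
  moreover have "(qscale c x + y) * h = qscale c (x * h) + y * h" by (auto simp: qscale_def algebra_simps fun_eq_iff)
  ultimately show ?case using qvs.span_add[OF qvs.span_scale[of "x * h" C c] step(2)] by (simp only:)
qed (use qvs.span_zero[of C] in \<open>simp add: zero_fun_def\<close>)

lemma good_word_stuffle: "w \<in> set (stuffle u v) \<Longrightarrow> good_word u \<Longrightarrow> good_word v \<Longrightarrow> good_word w"
  using stuffle_ge[of w u v 2] by (simp add: good_word_def)

lemma mes_mult_qspan:
  assumes "good_word u" "good_word v" "\<And>w. good_word w \<Longrightarrow> sum_list w = sum_list u + sum_list v \<Longrightarrow> mes w \<in> V" "qvs.subspace V"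
  shows "mes u * mes v \<in> V"
  unfolding mes_stuffle[OF assms(1,2)] sum_list_sum_nth
proof (rule qvs.subspace_sum[OF assms(4)])
  fix i assume "i \<in> {0..<length (map mes (stuffle u v))}"
  then have i: "i < length (stuffle u v)" by simp
  then show "map mes (stuffle u v) ! i \<in> V"
    using assms(3)[OF good_word_stuffle[OF nth_mem[OF i] assms(1,2)] sum_list_stuffle[OF nth_mem[OF i]]] by simp
qed

lemma mes_mult_cspan:
  assumes "good_word u" "good_word v" "\<And>w. good_word w \<Longrightarrow> sum_list w = sum_list u + sum_list v \<Longrightarrow> mes w \<in> V" "cvs.subspace V"
  shows "mes u * mes v \<in> V"
  unfolding mes_stuffle[OF assms(1,2)] sum_list_sum_nth
proof (rule cvs.subspace_sum[OF assms(4)])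
  fix i assume "i \<in> {0..<length (map mes (stuffle u v))}"
  then have i: "i < length (stuffle u v)" by simp
  then show "map mes (stuffle u v) ! i \<in> V"
    using assms(3)[OF good_word_stuffle[OF nth_mem[OF i] assms(1,2)] sum_list_stuffle[OF nth_mem[OF i]]] by simp
qed

lemma Eis_wt_mult: "f \<in> Eis_wt k \<Longrightarrow> h \<in> Eis_wt l \<Longrightarrow> f * h \<in> Eis_wt (k + l)"
  unfolding Eis_wt_eq
  by (erule (1) qspan_mult[rotated]) (auto intro!: mes_mult_qspan intro: qvs.span_base)

lemma Eis_mult: "f \<in> Eis \<Longrightarrow> h \<in> Eis \<Longrightarrow> f * h \<in> Eis"
  unfolding Eis_eq
  by (erule (1) qspan_mult[rotated]) (auto intro!: mes_mult_qspan intro: qvs.span_base)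

lemma Eis\<^sub>C_mult: "f \<in> Eis\<^sub>C \<Longrightarrow> h \<in> Eis\<^sub>C \<Longrightarrow> f * h \<in> Eis\<^sub>C"
  unfolding Eis\<^sub>C_eq
  by (erule (1) cspan_mult[rotated]) (auto intro!: mes_mult_cspan intro: cvs.span_base)

text \<open>Weights below \<open>a\<close> and weights at most \<open>b\<close> add up to weights
  below \<open>a + b\<close>; the asymmetric \<open>Suc\<close> keeps the strict bound
  sharp.\<close>

lemma FilC_mult: "f \<in> FilC a \<Longrightarrow> h \<in> FilC (Suc b) \<Longrightarrow> f * h \<in> FilC (a + b)"
  unfolding FilC_eq_mes
  by (erule (1) cspan_mult[rotated]) (auto intro!: mes_mult_cspan, rule cvs.span_base, force)

subsection \<open>Rationality and leading terms\<close>

interpretation cqs: vector_space "\<lambda>(r::rat) (z::complex). of_rat r * z"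
  by unfold_locales (auto simp: algebra_simps of_rat_add of_rat_mult)

text \<open>A Hamel basis of the complex numbers over the rationals that contains 1; its coordinate
  at 1 is a rational linear projection onto the rationals.\<close>

definition qbasis :: "complex set" where "qbasis = cqs.extend_basis {1}"

definition qcoord :: "complex \<Rightarrow> complex \<Rightarrow> rat" where "qcoord b z = cqs.representation qbasis z b"

definition rat_linear :: "(complex \<Rightarrow> rat) \<Rightarrow> bool" where
  "rat_linear \<pi> \<longleftrightarrow> (\<forall>z w. \<pi> (z + w) = \<pi> z + \<pi> w) \<and> (\<forall>r z. \<pi> (of_rat r * z) = r * \<pi> z)"

lemma rat_linear_0: "rat_linear \<pi> \<Longrightarrow> \<pi> 0 = 0"
  by (metis mult_zero_left of_rat_0 rat_linear_def)

lemma independent_one: "cqs.independent {1}" by simp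

lemma qbasis_props: "cqs.independent qbasis" "cqs.span qbasis = UNIV" "1 \<in> qbasis"
  unfolding qbasis_def using cqs.independent_extend_basis[OF independent_one] cqs.span_extend_basis[OF independent_one]
    cqs.extend_basis_superset[OF independent_one] by auto

lemma rat_linear_qcoord: "rat_linear (qcoord b)"
  unfolding rat_linear_def qcoord_def
  using cqs.representation_add[OF qbasis_props(1)] cqs.representation_scale[OF qbasis_props(1)] qbasis_props(2) by simp

lemma qcoord_one: "qcoord 1 1 = 1"
  unfolding qcoord_def using cqs.representation_basis[OF qbasis_props(1,3)] by simp

lemma finite_qcoord: "finite {b. qcoord b z \<noteq> 0}"
  unfolding qcoord_def by (rule cqs.finite_representation)

lemma sum_qcoord:
  assumes "finite S" "{b. qcoord b z \<noteq> 0} \<subseteq> S"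
  shows "(\<Sum>b\<in>S. of_rat (qcoord b z) * b) = z"
proof -
  have "(\<Sum>b\<in>S. of_rat (qcoord b z) * b) = (\<Sum>b | qcoord b z \<noteq> 0. of_rat (qcoord b z) * b)"
    by (rule sum.mono_neutral_right) (use assms in auto)
  also have "\<dots> = z"
    unfolding qcoord_def by (rule cqs.sum_nonzero_representation_eq[OF qbasis_props(1)]) (simp add: qbasis_props(2))
  finally show ?thesis .
qed

lemma rational_qexp_add: "rational_qexp f \<Longrightarrow> rational_qexp h \<Longrightarrow> rational_qexp (f + h)"
  unfolding rational_qexp_def
  by (elim exE, rule_tac x = "\<lambda>n. a n + aa n" in exI) (drule (1) has_qexp_add, simp add: of_rat_add)

lemma rational_qexp_qscale: "rational_qexp f \<Longrightarrow> rational_qexp (qscale r f)"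
  unfolding rational_qexp_def qscale_cscale
  by (elim exE, rule_tac x = "\<lambda>n. r * a n" in exI) (drule has_qexp_scale[where c = "of_rat r"], simp add: of_rat_mult)

lemma rational_qexp_mult: "rational_qexp f \<Longrightarrow> rational_qexp h \<Longrightarrow> rational_qexp (f * h)"
  unfolding rational_qexp_def
  by (elim exE, rule_tac x = "\<lambda>n. \<Sum>i\<le>n. a i * aa (n - i)" in exI)
    (drule (1) has_qexp_mult, simp add: of_rat_mult of_rat_sum)

lemma rational_qexp_0: "rational_qexp 0"
  unfolding rational_qexp_def using has_qexp_0 by (intro exI[of _ "\<lambda>n. 0"]) simp

lemma rational_qexp_FilW: "f \<in> FilW k \<Longrightarrow> rational_qexp f"
  unfolding FilW_eq
proof (induction rule: qvs.span_induct_alt)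
  case (step c x y)
  then show ?case using rational_qexp_g by (intro rational_qexp_add rational_qexp_qscale) auto
qed (rule rational_qexp_0)

text \<open>The generators have rational coefficients, so applying \<open>\<pi>\<close> to the
  coefficients of a complex combination is the same as applying it to the scalars. The result stays
  in the rational span of the same generators.\<close>

lemma FilC_rat_linear:
  assumes "rat_linear \<pi>" "f \<in> FilC w"
  shows "\<exists>b F. has_qexp f b \<and> F \<in> FilW (int w - 1) \<and> has_qexp F (\<lambda>n. of_rat (\<pi> (b n)))"
  using assms(2) unfolding FilC_def
proof (induction rule: cvs.span_induct_alt)
  case base
  have "has_qexp 0 (\<lambda>n. of_rat (\<pi> 0))" using has_qexp_0 by (simp only: rat_linear_0[OF assms(1)] of_rat_0)
  then show ?case using has_qexp_0 qvs.subspace_0[OF subspace_FilW] by blast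
next
  case (step c x y)
  then obtain ls b F where *: "x = gser ls" "good_word ls" "sum_list ls < w" "has_qexp y b" "F \<in> FilW (int w - 1)"
    "has_qexp F (\<lambda>n. of_rat (\<pi> (b n)))" by blast
  have x: "x = g ls" using * g_eq_gser by simp
  obtain a :: "nat \<Rightarrow> rat" where a: "has_qexp x (\<lambda>n. of_rat (a n))"
    using rational_qexp_g[of ls] * x by (auto simp: rational_qexp_def)
  have "has_qexp (cscale c x + y) (\<lambda>n. c * of_rat (a n) + b n)"
    by (intro has_qexp_add has_qexp_scale a *)
  moreover have "x \<in> FilW (int w - 1)"
    unfolding FilW_eq x by (rule qvs.span_base) (use * in auto)
  then have "qscale (\<pi> c) x + F \<in> FilW (int w - 1)"
    using * by (intro qvs.subspace_add[OF subspace_FilW] qvs.subspace_scale[OF subspace_FilW])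
  moreover have F': "has_qexp (qscale (\<pi> c) x + F) (\<lambda>n. of_rat (\<pi> c) * of_rat (a n) + of_rat (\<pi> (b n)))"
    unfolding qscale_cscale by (intro has_qexp_add has_qexp_scale a *)
  have "of_rat (\<pi> c) * of_rat (a n) + of_rat (\<pi> (b n)) = (of_rat (\<pi> (c * of_rat (a n) + b n)) :: complex)" for n
    using assms(1) by (simp add: rat_linear_def of_rat_add of_rat_mult mult.commute[of c] mult.commute[of "a n"])
  then have "has_qexp (qscale (\<pi> c) x + F) (\<lambda>n. of_rat (\<pi> (c * of_rat (a n) + b n)))" using F' by (simp only:)
  ultimately show ?case by blast
qed

lemma has_qexp_determines: "has_qexp f b \<Longrightarrow> has_qexp h b \<Longrightarrow> f = h"
  by (auto simp: has_qexp_def fun_eq_iff intro: sums_unique2)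

text \<open>The coordinate at 1 fixes every rational expansion, so the element itself is the image
  that \<open>FilC_rat_linear\<close> places in the rational filtration. Multiplicativity of
  \<open>FilW\<close> follows, since both conditions on the right are stable under products.\<close>

lemma FilW_iff: "f \<in> FilW (int w - 1) \<longleftrightarrow> f \<in> FilC w \<and> rational_qexp f"
proof
  assume "f \<in> FilW (int w - 1)"
  then show "f \<in> FilC w \<and> rational_qexp f" using FilW_subset_FilC rational_qexp_FilW by blast
next
  assume f: "f \<in> FilC w \<and> rational_qexp f"
  then obtain a :: "nat \<Rightarrow> rat" where a: "has_qexp f (\<lambda>n. of_rat (a n))" by (auto simp: rational_qexp_def)
  obtain b F where F: "has_qexp f b" "F \<in> FilW (int w - 1)" "has_qexp F (\<lambda>n. of_rat (qcoord 1 (b n)))"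
    using FilC_rat_linear[OF rat_linear_qcoord, of f w 1] f by blast
  have "b = (\<lambda>n. of_rat (a n))" using has_qexp_unique[OF F(1) a] .
  moreover have "qcoord 1 (of_rat r) = r" for r
    using rat_linear_qcoord[of 1] qcoord_one unfolding rat_linear_def by (metis mult.right_neutral)
  ultimately have "F = f" using has_qexp_determines[OF F(3)] a by simp
  then show "f \<in> FilW (int w - 1)" using F by simp
qed

lemma FilW_nat_iff: "f \<in> FilW (int w) \<longleftrightarrow> f \<in> FilC (Suc w) \<and> rational_qexp f"
  using FilW_iff[of f "Suc w"] by simp

lemma FilW_mult: "f \<in> FilW (int i) \<Longrightarrow> h \<in> FilW (int j) \<Longrightarrow> f * h \<in> FilW (int (i + j))"
  unfolding FilW_nat_iff using FilC_mult[of f "Suc i" h j] rational_qexp_mult by simp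

text \<open>A relation and not a function, because \<open>h\<close> is determined only up to
  \<open>FilW (int k - 1)\<close>. It is the graph of the desired map, with the power of -2 pi i
  divided out.\<close>

definition leading_term :: "nat \<Rightarrow> hfun \<Rightarrow> hfun \<Rightarrow> bool" where
  "leading_term k f h \<longleftrightarrow> h \<in> FilW (int k) \<and> f - cscale (pfac ^ k) h \<in> FilC k"

lemma leading_term_add:
  assumes "leading_term k f h" "leading_term k f' h'"
  shows "leading_term k (f + f') (h + h')"
proof -
  have "f + f' - cscale (pfac ^ k) (h + h') = (f - cscale (pfac ^ k) h) + (f' - cscale (pfac ^ k) h')"
    by (auto simp: cscale_def algebra_simps fun_eq_iff)
  then show ?thesis using assms unfolding leading_term_def
    by (metis cvs.subspace_add[OF subspace_FilC] qvs.subspace_add[OF subspace_FilW])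
qed

lemma leading_term_qscale:
  assumes "leading_term k f h"
  shows "leading_term k (qscale r f) (qscale r h)"
proof -
  have "qscale r f - cscale (pfac ^ k) (qscale r h) = cscale (of_rat r) (f - cscale (pfac ^ k) h)"
    by (auto simp: cscale_def qscale_def algebra_simps fun_eq_iff)
  then show ?thesis using assms unfolding leading_term_def
    by (metis cvs.subspace_scale[OF subspace_FilC] qvs.subspace_scale[OF subspace_FilW])
qed

lemma cscale_pfac_FilC: "cscale (pfac ^ k) h \<in> FilC w \<longleftrightarrow> h \<in> FilC w"
proof
  assume "cscale (pfac ^ k) h \<in> FilC w"
  then have "cscale (inverse (pfac ^ k)) (cscale (pfac ^ k) h) \<in> FilC w"
    by (rule cvs.subspace_scale[OF subspace_FilC])
  moreover have "cscale (inverse (pfac ^ k)) (cscale (pfac ^ k) h) = h" by (auto simp: cscale_def fun_eq_iff)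
  ultimately show "h \<in> FilC w" by simp
qed (rule cvs.subspace_scale[OF subspace_FilC])

text \<open>The scalar \<open>pfac ^ k\<close> is invisible to the complex filtration, and
  \<open>h\<close> has a rational expansion, so membership descends by \<open>FilW_iff\<close>. One
  direction gives well-definedness of the map to the graded piece, the other its
  injectivity.\<close>

lemma leading_term_lower: "leading_term k f h \<Longrightarrow> f \<in> FilC k \<longleftrightarrow> h \<in> FilW (int k - 1)"
proof -
  assume l: "leading_term k f h"
  then have d: "f - cscale (pfac ^ k) h \<in> FilC k" and r: "rational_qexp h"
    using rational_qexp_FilW by (auto simp: leading_term_def)
  have "f \<in> FilC k \<longleftrightarrow> cscale (pfac ^ k) h \<in> FilC k"
    (is "_ \<longleftrightarrow> ?c \<in> _")
  proof
    have "f - (f - ?c) = ?c" by (rule ext) simp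
    then show "?c \<in> FilC k" if "f \<in> FilC k" using cvs.subspace_diff[OF subspace_FilC that d] by (simp only:)
    have "(f - ?c) + ?c = f" by (rule ext) simp
    then show "f \<in> FilC k" if "?c \<in> FilC k" using cvs.subspace_add[OF subspace_FilC d that] by (simp only:)
  qed
  then show ?thesis using r by (simp add: FilW_iff cscale_pfac_FilC)
qed

lemma leading_term_0:
  assumes "h \<in> FilW (int k - 1)"
  shows "leading_term k 0 h"
proof -
  have "cscale (pfac ^ k) h \<in> FilC k" using assms FilW_subset_FilC[of k] by (simp only: cscale_pfac_FilC) auto
  from cvs.subspace_diff[OF subspace_FilC cvs.subspace_0[OF subspace_FilC] this]
  show ?thesis using assms FilW_mono[of "int k - 1" "int k"] unfolding leading_term_def by auto
qed

lemma leading_term_mes: "good_word ks \<Longrightarrow> leading_term (sum_list ks) (mes ks) (g ks)"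
  unfolding leading_term_def FilW_eq using mes_expansion(1)[of ks] g_eq_gser[of ks]
  by (intro conjI qvs.span_base) force+

lemma leading_term_mult:
  assumes "leading_term k f h" "leading_term l f' h'"
  shows "leading_term (k + l) (f * f') (h * h')"
proof -
  have "cscale (pfac ^ l) h' \<in> FilC (Suc l)"
    using assms(2) by (simp add: leading_term_def FilW_nat_iff cscale_pfac_FilC)
  moreover have "f' - cscale (pfac ^ l) h' \<in> FilC (Suc l)"
    using assms(2) FilC_mono[of l "Suc l"] by (auto simp: leading_term_def)
  ultimately have f': "f' \<in> FilC (Suc l)"
    using cvs.subspace_add[OF subspace_FilC, of "f' - cscale (pfac ^ l) h'" "Suc l" "cscale (pfac ^ l) h'"] by simp
  have "cscale (pfac ^ k) h \<in> FilC (Suc k)"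
    using assms(1) by (simp add: leading_term_def FilW_nat_iff cscale_pfac_FilC)
  then have "(f' - cscale (pfac ^ l) h') * cscale (pfac ^ k) h \<in> FilC (l + k)"
    using assms(2) by (intro FilC_mult) (auto simp: leading_term_def)
  moreover have "(f - cscale (pfac ^ k) h) * f' \<in> FilC (k + l)"
    using assms(1) f' by (intro FilC_mult) (auto simp: leading_term_def)
  ultimately have "(f - cscale (pfac ^ k) h) * f' + (f' - cscale (pfac ^ l) h') * cscale (pfac ^ k) h \<in> FilC (k + l)"
    using cvs.subspace_add[OF subspace_FilC] by (simp add: add.commute)
  also have "(f - cscale (pfac ^ k) h) * f' + (f' - cscale (pfac ^ l) h') * cscale (pfac ^ k) h
      = f * f' - cscale (pfac ^ (k + l)) (h * h')"
    by (auto simp: cscale_def fun_eq_iff algebra_simps power_add)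
  finally show ?thesis using assms FilW_mult unfolding leading_term_def by blast
qed

lemma leading_term_sum:
  assumes "\<And>i. i \<in> I \<Longrightarrow> leading_term k (f i) (h i)"
  shows "leading_term k (\<Sum>i\<in>I. qscale (c i) (f i)) (\<Sum>i\<in>I. qscale (c i) (h i))"
  using assms
proof (induction I rule: infinite_finite_induct)
  case (insert i I)
  then show ?case unfolding sum.insert[OF insert(1,2)] by (intro leading_term_add leading_term_qscale) auto
qed (use leading_term_0[OF qvs.subspace_0[OF subspace_FilW]] in \<open>simp_all add: zero_fun_def\<close>)

lemma ex_leading_term: "f \<in> Eis_wt k \<Longrightarrow> \<exists>h. leading_term k f h"
  unfolding Eis_wt_eq
proof (induction rule: qvs.span_induct_alt)
  case base
  show ?case using leading_term_0[OF qvs.subspace_0[OF subspace_FilW]] by blast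
next
  case (step c x y)
  then show ?case using leading_term_mes leading_term_add[OF leading_term_qscale] by blast
qed

lemma ex_leading_term_inv: "h \<in> FilW (int k) \<Longrightarrow> \<exists>f\<in>Eis_wt k. leading_term k f h"
  unfolding FilW_eq
proof (induction rule: qvs.span_induct_alt)
  case base
  show ?case
    using leading_term_0[OF qvs.subspace_0[OF subspace_FilW]] qvs.subspace_0[OF subspace_Eis_wt] by blast
next
  case (step c x y)
  then obtain ks f where *: "x = g ks" "good_word ks" "sum_list ks \<le> k" "f \<in> Eis_wt k" "leading_term k f y" by auto
  have "\<exists>f'\<in>Eis_wt k. leading_term k f' x"
  proof (cases "sum_list ks = k")
    case True
    then have "mes ks \<in> Eis_wt k" unfolding Eis_wt_eq by (intro qvs.span_base) (use * in auto)
    then show ?thesis using leading_term_mes[of ks] * True by auto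
  next
    case False
    then have "x \<in> FilW (int k - 1)" unfolding FilW_eq by (intro qvs.span_base) (use * in auto)
    then show ?thesis using leading_term_0 qvs.subspace_0[OF subspace_Eis_wt] by blast
  qed
  then obtain f' where "f' \<in> Eis_wt k" "leading_term k f' x" by blast
  moreover from this have "leading_term k (qscale c f' + f) (qscale c x + y)"
    using * by (intro leading_term_add leading_term_qscale)
  moreover have "qscale c f' + f \<in> Eis_wt k"
    using calculation * by (intro qvs.subspace_add[OF subspace_Eis_wt] qvs.subspace_scale[OF subspace_Eis_wt])
  ultimately show ?case by blast
qed

lemma leading_term_eq_0:
  assumes "leading_term k f h" "f \<in> Eis_wt\<^sub>C k" "h \<in> FilW (int k - 1)"
  shows "f = 0"
  using leading_term_lower[OF assms(1)] assms Eis_wt\<^sub>C_Int_FilC by blast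

lemma has_qexp_sum:
  assumes "\<And>i. i \<in> I \<Longrightarrow> has_qexp (f i) (b i)"
  shows "has_qexp (\<Sum>i\<in>I. f i) (\<lambda>n. \<Sum>i\<in>I. b i n)"
  using assms
proof (induction I rule: infinite_finite_induct)
  case (insert i I)
  have "has_qexp (f i + (\<Sum>i\<in>I. f i)) (\<lambda>n. b i n + (\<Sum>i\<in>I. b i n))"
    by (rule has_qexp_add[OF insert.prems insert.IH[OF insert.prems]]) auto
  then show ?case by (simp only: sum.insert[OF insert(1,2)])
qed (use has_qexp_0 in \<open>simp_all add: zero_fun_def\<close>)

text \<open>Linear disjointness: passing to leading terms turns a complex relation into one between
  rational \<open>q\<close>-expansions, to which a rational functional may be applied coefficientwise.\<close>

lemma Eis_wt_rat_linear:
  assumes \<pi>: "rat_linear \<pi>" and f: "\<And>i. i \<in> I \<Longrightarrow> f i \<in> Eis_wt k" and "(\<Sum>i\<in>I. cscale (z i) (f i)) = 0"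
  shows "(\<Sum>i\<in>I. qscale (\<pi> (z i)) (f i)) = 0"
proof -
  have "\<exists>h. \<forall>i\<in>I. leading_term k (f i) (h i)" using f ex_leading_term by (intro bchoice) auto
  then obtain h where h: "\<And>i. i \<in> I \<Longrightarrow> leading_term k (f i) (h i)" by blast
  have "\<exists>a :: _ \<Rightarrow> nat \<Rightarrow> rat. \<forall>i\<in>I. has_qexp (h i) (\<lambda>n. of_rat (a i n))"
  proof (intro bchoice ballI)
    fix i assume "i \<in> I"
    then have "rational_qexp (h i)" using h rational_qexp_FilW by (auto simp: leading_term_def)
    then show "\<exists>a :: nat \<Rightarrow> rat. has_qexp (h i) (\<lambda>n. of_rat (a n))" by (simp only: rational_qexp_def)
  qed
  then obtain a :: "_ \<Rightarrow> nat \<Rightarrow> rat" where a: "\<And>i. i \<in> I \<Longrightarrow> has_qexp (h i) (\<lambda>n. of_rat (a i n))" by blast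
  let ?H = "\<Sum>i\<in>I. cscale (z i) (h i)"
  have "(\<Sum>i\<in>I. cscale (z i) (f i - cscale (pfac ^ k) (h i))) \<in> FilC k"
    using h by (intro cvs.subspace_sum[OF subspace_FilC] cvs.subspace_scale[OF subspace_FilC]) (auto simp: leading_term_def)
  moreover have "(\<Sum>i\<in>I. cscale (z i) (f i - cscale (pfac ^ k) (h i))) = (\<Sum>i\<in>I. cscale (z i) (f i)) - cscale (pfac ^ k) ?H"
    by (simp add: cvs.scale_right_diff_distrib sum_subtractf cvs.scale_sum_right mult.commute)
  ultimately have "- cscale (pfac ^ k) ?H \<in> FilC k" using assms(3) by simp
  then have "cscale (pfac ^ k) ?H \<in> FilC k" using cvs.subspace_neg[OF subspace_FilC] by (metis minus_minus)
  then have "?H \<in> FilC k" by (simp add: cscale_pfac_FilC)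
  \<comment> \<open>The relation between the \<open>f i\<close> makes the complex combination
    \<open>?H\<close> of leading terms drop in the filtration. Applying \<open>\<pi>\<close>
    coefficientwise carries this drop over to the rational combination.\<close>
  then obtain b F where F: "has_qexp ?H b" "F \<in> FilW (int k - 1)" "has_qexp F (\<lambda>n. of_rat (\<pi> (b n)))"
    using FilC_rat_linear[OF \<pi>] by blast
  have "has_qexp ?H (\<lambda>n. \<Sum>i\<in>I. z i * of_rat (a i n))" by (intro has_qexp_sum has_qexp_scale a)
  then have b: "b = (\<lambda>n. \<Sum>i\<in>I. z i * of_rat (a i n))" using has_qexp_unique F by blast
  have \<pi>_sum: "\<pi> (\<Sum>i\<in>I. z i * of_rat (r i)) = (\<Sum>i\<in>I. \<pi> (z i) * r i)" for r
  proof (induction I rule: infinite_finite_induct)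
    case (insert i I)
    have "\<pi> (z i * of_rat (r i)) = \<pi> (z i) * r i" using \<pi> unfolding rat_linear_def by (metis mult.commute)
    moreover have "\<pi> (x + y) = \<pi> x + \<pi> y" for x y using \<pi> by (simp add: rat_linear_def)
    ultimately show ?case by (simp add: sum.insert[OF insert(1,2)] insert.IH del: sum.insert)
  qed (use rat_linear_0[OF \<pi>] in auto)
  let ?F = "\<Sum>i\<in>I. qscale (\<pi> (z i)) (h i)"
  have "has_qexp ?F (\<lambda>n. \<Sum>i\<in>I. of_rat (\<pi> (z i)) * of_rat (a i n))"
    unfolding qscale_cscale by (intro has_qexp_sum has_qexp_scale a)
  then have "has_qexp ?F (\<lambda>n. of_rat (\<pi> (b n)))" by (simp add: b \<pi>_sum of_rat_sum of_rat_mult)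
  then have "?F \<in> FilW (int k - 1)" using has_qexp_determines F by blast
  moreover have "leading_term k (\<Sum>i\<in>I. qscale (\<pi> (z i)) (f i)) ?F" using h by (rule leading_term_sum)
  moreover have "(\<Sum>i\<in>I. qscale (\<pi> (z i)) (f i)) \<in> Eis_wt\<^sub>C k"
    using f Eis_wt_subset_Eis_wt\<^sub>C
    by (intro subsetD[OF Eis_wt_subset_Eis_wt\<^sub>C] qvs.subspace_sum[OF subspace_Eis_wt] qvs.subspace_scale[OF subspace_Eis_wt])
  ultimately show ?thesis using leading_term_eq_0 by blast
qed

text \<open>A complex relation splits into one relation for each weight, where
  \<open>Eis_wt_rat_linear\<close> applies; the rational relations are then added up again.\<close>

lemma Eis_rat_linear:
  assumes \<pi>: "rat_linear \<pi>" and I: "finite I" and f: "\<And>i. i \<in> I \<Longrightarrow> f i \<in> Eis" and z: "(\<Sum>i\<in>I. cscale (z i) (f i)) = 0"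
  shows "(\<Sum>i\<in>I. qscale (\<pi> (z i)) (f i)) = 0"
proof -
  let ?P = "\<lambda>i x A. finite A \<and> (\<forall>k. x k \<in> Eis_wt k) \<and> (\<forall>k. k \<notin> A \<longrightarrow> x k = 0) \<and> f i = (\<Sum>k\<in>A. x k)"
  have "\<forall>i\<in>I. \<exists>x. \<exists>A. ?P i x A" using f Eis_decompose by blast
  from bchoice[OF this] obtain x where "\<forall>i\<in>I. \<exists>A. ?P i (x i) A" ..
  from bchoice[OF this] obtain B where p: "\<forall>i\<in>I. ?P i (x i) (B i)" ..
  define A where "A = (\<Union>i\<in>I. B i)"
  have A: "finite A" using p I by (auto simp: A_def)
  have fx: "f i = (\<Sum>k\<in>A. x i k)" if "i \<in> I" for i
  proof -
    have "(\<Sum>k\<in>B i. x i k) = (\<Sum>k\<in>A. x i k)"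
      by (rule sum.mono_neutral_left) (use A p that in \<open>auto simp: A_def\<close>)
    then show ?thesis using p that by simp
  qed
  have "(\<Sum>k\<in>A. \<Sum>i\<in>I. cscale (z i) (x i k)) = (\<Sum>i\<in>I. cscale (z i) (f i))"
    by (subst sum.swap) (simp add: fx cvs.scale_sum_right)
  then have sum0: "(\<Sum>k\<in>A. \<Sum>i\<in>I. cscale (z i) (x i k)) = 0" using z by simp
  have "(\<Sum>i\<in>I. cscale (z i) (x i k)) = 0" if "k \<in> A" for k
  proof (rule Eis_wt\<^sub>C_independent[OF A _ sum0 that])
    fix k show "(\<Sum>i\<in>I. cscale (z i) (x i k)) \<in> Eis_wt\<^sub>C k"
      using p Eis_wt_subset_Eis_wt\<^sub>C
      by (intro cvs.subspace_sum[OF subspace_Eis_wt\<^sub>C] cvs.subspace_scale[OF subspace_Eis_wt\<^sub>C]) blast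
  qed
  then have zero: "(\<Sum>i\<in>I. qscale (\<pi> (z i)) (x i k)) = 0" if "k \<in> A" for k
    using that p by (intro Eis_wt_rat_linear[OF \<pi>]) auto
  have "(\<Sum>i\<in>I. qscale (\<pi> (z i)) (f i)) = (\<Sum>k\<in>A. \<Sum>i\<in>I. qscale (\<pi> (z i)) (x i k))"
    by (subst sum.swap) (simp add: fx qvs.scale_sum_right)
  also have "\<dots> = 0" by (rule sum.neutral) (use zero in blast)
  finally show ?thesis .
qed

subsection \<open>Direct sums and associated graded algebras\<close>

text \<open>A finitely supported family \<open>x\<close> is encoded as the polynomial with coefficients \<open>x k\<close>: its
  total sum is the value at \<open>1\<close>, and products of families are products of polynomials.\<close>

definition weight_polys :: "(nat \<Rightarrow> 'v set) \<Rightarrow> 'v::comm_ring_1 poly set" where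
  "weight_polys W = {p. \<forall>k. Polynomial.coeff p k \<in> W k}"

lemma sum_coeff_eq_poly: "(\<Sum>k | Polynomial.coeff p k \<noteq> 0. Polynomial.coeff p k) = poly p (1::'a::comm_ring_1)"
  unfolding poly_altdef
  by (simp, rule sum.mono_neutral_left) (auto intro: le_degree)

lemma coeff_Abs_poly_finite:
  assumes "finite {k. x k \<noteq> 0}"
  shows "Polynomial.coeff (Abs_poly x) = x"
  by (rule Abs_poly_inverse) (use assms in \<open>auto simp: eventually_cofinite\<close>)

lemma internal_direct_sum_iff_poly:
  fixes V :: "'v::comm_ring_1 set"
  shows "internal_direct_sum V W \<longleftrightarrow> bij_betw (\<lambda>p. poly p 1) (weight_polys W) V"
proof -
  let ?X = "{x. (\<forall>k. x k \<in> W k) \<and> finite {k. x k \<noteq> 0}}"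
  have "bij_betw Polynomial.coeff (weight_polys W) ?X"
    by (rule bij_betwI[of _ _ _ Abs_poly])
      (auto simp: weight_polys_def coeff_Abs_poly_finite coeff_inverse MOST_coeff_eq_0[unfolded eventually_cofinite])
  then have "bij_betw (\<lambda>x. \<Sum>k | x k \<noteq> 0. x k) ?X V \<longleftrightarrow> bij_betw ((\<lambda>x. \<Sum>k | x k \<noteq> 0. x k) \<circ> Polynomial.coeff) (weight_polys W) V"
    by (rule bij_betw_comp_iff)
  then show ?thesis by (simp add: internal_direct_sum_def comp_def sum_coeff_eq_poly)
qed

lemma internal_direct_sumI:
  fixes V :: "'v::comm_ring_1 set"
  assumes decompose: "\<And>f. f \<in> V \<Longrightarrow> \<exists>x A. finite A \<and> (\<forall>k. x k \<in> W k) \<and> (\<forall>k. k \<notin> A \<longrightarrow> x k = 0) \<and> f = (\<Sum>k\<in>A. x k)"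
    and sum: "\<And>x A. finite A \<Longrightarrow> (\<And>k. x k \<in> W k) \<Longrightarrow> (\<Sum>k\<in>A. x k) \<in> V"
    and diff: "\<And>k f h. f \<in> W k \<Longrightarrow> h \<in> W k \<Longrightarrow> f - h \<in> W k"
    and independent: "\<And>x A k. finite A \<Longrightarrow> (\<And>k. x k \<in> W k) \<Longrightarrow> (\<Sum>k\<in>A. x k) = 0 \<Longrightarrow> k \<in> A \<Longrightarrow> x k = 0"
  shows "internal_direct_sum V W"
  unfolding internal_direct_sum_iff_poly
proof (rule bij_betwI')
  fix p q assume p: "p \<in> weight_polys W" and q: "q \<in> weight_polys W"
  show "poly p 1 = poly q 1 \<longleftrightarrow> p = q"
  proof
    assume eq: "poly p 1 = poly q 1"
    have "Polynomial.coeff (p - q) k = 0" for k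
    proof (cases "k \<le> Polynomial.degree (p - q)")
      case True
      have "(\<Sum>k\<le>Polynomial.degree (p - q). Polynomial.coeff (p - q) k) = 0"
        using eq poly_altdef[of "p - q" 1] by simp
      then show ?thesis
        by (rule independent[rotated 2]) (use p q diff True in \<open>auto simp: weight_polys_def\<close>)
    qed (use coeff_eq_0[of "p - q" k] in \<open>simp only: not_le\<close>)
    then show "p = q" by (simp add: poly_eq_iff)
  qed simp
next
  fix p assume "p \<in> weight_polys W"
  then show "poly p 1 \<in> V" unfolding poly_altdef by (simp add: weight_polys_def sum)
next
  fix f assume "f \<in> V"
  then obtain x A where x: "finite A" "\<And>k. x k \<in> W k" "\<And>k. k \<notin> A \<Longrightarrow> x k = 0" "f = (\<Sum>k\<in>A. x k)"
    using decompose by blast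
  have sub: "{k. x k \<noteq> 0} \<subseteq> A" using x(3) by auto
  then have fin: "finite {k. x k \<noteq> 0}" using x(1) finite_subset by blast
  have "f = (\<Sum>k | x k \<noteq> 0. x k)"
    unfolding x(4) by (rule sum.mono_neutral_right) (use x sub in auto)
  also have "\<dots> = poly (Abs_poly x) 1"
    using sum_coeff_eq_poly[of "Abs_poly x"] by (simp add: coeff_Abs_poly_finite[OF fin])
  finally show "\<exists>p\<in>weight_polys W. f = poly p 1"
    by (intro bexI[of _ "Abs_poly x"]) (use x in \<open>auto simp: weight_polys_def coeff_Abs_poly_finite[OF fin]\<close>)
qed

lemma internal_direct_sum_Eis\<^sub>C: "internal_direct_sum Eis\<^sub>C Eis_wt\<^sub>C"
proof (rule internal_direct_sumI)
  show "\<exists>x A. finite A \<and> (\<forall>k. x k \<in> Eis_wt\<^sub>C k) \<and> (\<forall>k. k \<notin> A \<longrightarrow> x k = 0) \<and> f = (\<Sum>k\<in>A. x k)" if "f \<in> Eis\<^sub>C" for f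
    using Eis\<^sub>C_decompose[of f UNIV] that by (auto simp: Eis\<^sub>C_eq)
  have "Eis_wt\<^sub>C k \<subseteq> Eis\<^sub>C" for k
    unfolding Eis_wt\<^sub>C_eq Eis\<^sub>C_eq by (rule cvs.span_mono) auto
  then show "(\<Sum>k\<in>A. x k) \<in> Eis\<^sub>C" if "\<And>k. x k \<in> Eis_wt\<^sub>C k" for x and A :: "nat set"
    using that by (intro cvs.subspace_sum[OF subspace_Eis\<^sub>C]) blast
  show "f - h \<in> Eis_wt\<^sub>C k" if "f \<in> Eis_wt\<^sub>C k" "h \<in> Eis_wt\<^sub>C k" for f h k
    by (rule cvs.subspace_diff[OF subspace_Eis_wt\<^sub>C that])
  show "x k = 0" if "finite A" "\<And>k. x k \<in> Eis_wt\<^sub>C k" "(\<Sum>k\<in>A. x k) = 0" "k \<in> A" for x and A :: "nat set" and k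
    by (rule Eis_wt\<^sub>C_independent[OF that(1) that(2) that(3,4)])
qed

lemma internal_direct_sum_Eis: "internal_direct_sum Eis Eis_wt"
proof (rule internal_direct_sumI)
  show "\<exists>x A. finite A \<and> (\<forall>k. x k \<in> Eis_wt k) \<and> (\<forall>k. k \<notin> A \<longrightarrow> x k = 0) \<and> f = (\<Sum>k\<in>A. x k)" if "f \<in> Eis" for f
    by (rule Eis_decompose[OF that])
  show "(\<Sum>k\<in>A. x k) \<in> Eis" if "\<And>k. x k \<in> Eis_wt k" for x and A :: "nat set"
    using that Eis_wt_subset_Eis by (intro qvs.subspace_sum[OF subspace_Eis]) blast
  show "f - h \<in> Eis_wt k" if "f \<in> Eis_wt k" "h \<in> Eis_wt k" for f h k
    by (rule qvs.subspace_diff[OF subspace_Eis_wt that])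
  show "x k = 0" if "finite A" "\<And>k. x k \<in> Eis_wt k" "(\<Sum>k\<in>A. x k) = 0" "k \<in> A" for x and A :: "nat set" and k
    by (rule Eis_wt\<^sub>C_independent[OF that(1) subsetD[OF Eis_wt_subset_Eis_wt\<^sub>C that(2)] that(3,4)])
qed

lemma graded_algebra_Eis: "graded_algebra Eis Eis_wt"
  unfolding graded_algebra_def using internal_direct_sum_Eis one_in_Eis_wt Eis_wt_mult by blast

section \<open>Module and algebra structures by transport\<close>

lemma module_sub_algebra:
  fixes sc :: "'k::comm_ring_1 \<Rightarrow> 'v::comm_ring_1 \<Rightarrow> 'v"
  assumes "Modules.module sc" "Modules.module.subspace sc V"
  shows "Module.module ring_of_type_algebra (sub_algebra sc V)"
proof -
  interpret sc: Modules.module sc by fact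
  note V = sc.subspace_0[OF assms(2)] sc.subspace_add[OF assms(2)] sc.subspace_neg[OF assms(2)] sc.subspace_scale[OF assms(2)]
  show ?thesis
  proof (rule moduleI)
    show "cring (ring_of_type_algebra :: 'k ring)" by (rule cring_from_type_algebra)
    show "abelian_group (sub_algebra sc V)"
      by (rule abelian_groupI) (use V in \<open>auto simp: sub_algebra_def add_ac intro: bexI[of _ "- _"]\<close>)
  qed (use V in \<open>auto simp: sub_algebra_def ring_of_type_algebra_def sc.scale_left_distrib sc.scale_right_distrib\<close>)
qed

lemma algebra_sub_algebra:
  fixes sc :: "'k::comm_ring_1 \<Rightarrow> 'v::comm_ring_1 \<Rightarrow> 'v"
  assumes "Modules.module sc" "Modules.module.subspace sc V" "1 \<in> V" "\<And>x y. x \<in> V \<Longrightarrow> y \<in> V \<Longrightarrow> x * y \<in> V"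
    and "\<And>a x y. sc a x * y = sc a (x * y)"
  shows "Module.algebra ring_of_type_algebra (sub_algebra sc V)"
proof -
  interpret M: Module.module "ring_of_type_algebra :: 'k ring" "sub_algebra sc V" by (rule module_sub_algebra) fact+
  have "cring (sub_algebra sc V)"
  proof (rule cringI)
    show "comm_monoid (sub_algebra sc V)"
      by (rule comm_monoidI) (use assms(3,4) in \<open>auto simp: sub_algebra_def mult_ac\<close>)
  qed (rule M.abelian_group_axioms, simp add: sub_algebra_def distrib_right)
  then show ?thesis
    by (intro Module.algebra.intro M.module_axioms algebra_axioms.intro) (simp_all add: sub_algebra_def assms(5))
qed

text \<open>The laws of the target are inherited along the bijection. For structures built from
  cosets it is then enough to compare their operations with images of known ones.\<close>

lemma module_iso_transport:
  assumes A: "Module.module K A" and bij: "bij_betw \<phi> (carrier A) (carrier B)"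
    and zero: "\<phi> \<zero>\<^bsub>A\<^esub> = \<zero>\<^bsub>B\<^esub>"
    and add: "\<And>x y. x \<in> carrier A \<Longrightarrow> y \<in> carrier A \<Longrightarrow> \<phi> (x \<oplus>\<^bsub>A\<^esub> y) = \<phi> x \<oplus>\<^bsub>B\<^esub> \<phi> y"
    and smult: "\<And>a x. a \<in> carrier K \<Longrightarrow> x \<in> carrier A \<Longrightarrow> \<phi> (a \<odot>\<^bsub>A\<^esub> x) = a \<odot>\<^bsub>B\<^esub> \<phi> x"
  shows "module_iso K A B \<phi>"
proof -
  interpret A: Module.module K A by fact
  have B: "carrier B = \<phi> ` carrier A" using bij by (simp add: bij_betw_def)
  have "abelian_group B"
  proof (rule abelian_groupI)
    fix x assume "x \<in> carrier B"
    then obtain a where "a \<in> carrier A" "x = \<phi> a" using B by auto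
    then have "\<phi> (\<ominus>\<^bsub>A\<^esub> a) \<oplus>\<^bsub>B\<^esub> x = \<zero>\<^bsub>B\<^esub>" "\<phi> (\<ominus>\<^bsub>A\<^esub> a) \<in> carrier B"
      using add[symmetric] zero B by (auto simp: A.M.l_neg)
    then show "\<exists>y\<in>carrier B. y \<oplus>\<^bsub>B\<^esub> x = \<zero>\<^bsub>B\<^esub>" by blast
  qed (auto simp: B add[symmetric] zero[symmetric] A.M.a_assoc A.M.a_comm A.M.a_lcomm)
  then have "Module.module K B"
    by (rule moduleI[OF A.R.is_cring])
      (auto simp: B add[symmetric] smult[symmetric] A.smult_l_distr A.smult_r_distr A.smult_assoc1)
  then show ?thesis using assms by (simp add: module_iso_def)
qed

lemma algebra_iso_transport:
  assumes A: "Module.algebra K A" and bij: "bij_betw \<phi> (carrier A) (carrier B)"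
    and zero: "\<phi> \<zero>\<^bsub>A\<^esub> = \<zero>\<^bsub>B\<^esub>" and one: "\<phi> \<one>\<^bsub>A\<^esub> = \<one>\<^bsub>B\<^esub>"
    and add: "\<And>x y. x \<in> carrier A \<Longrightarrow> y \<in> carrier A \<Longrightarrow> \<phi> (x \<oplus>\<^bsub>A\<^esub> y) = \<phi> x \<oplus>\<^bsub>B\<^esub> \<phi> y"
    and mult: "\<And>x y. x \<in> carrier A \<Longrightarrow> y \<in> carrier A \<Longrightarrow> \<phi> (x \<otimes>\<^bsub>A\<^esub> y) = \<phi> x \<otimes>\<^bsub>B\<^esub> \<phi> y"
    and smult: "\<And>a x. a \<in> carrier K \<Longrightarrow> x \<in> carrier A \<Longrightarrow> \<phi> (a \<odot>\<^bsub>A\<^esub> x) = a \<odot>\<^bsub>B\<^esub> \<phi> x"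
  shows "algebra_iso K A B \<phi>"
proof -
  interpret A': cring A by (rule Module.algebra.axioms(2)[OF A])
  interpret A: Module.algebra K A by fact
  have iso: "module_iso K A B \<phi>"
    by (rule module_iso_transport) (use assms A.module_axioms in auto)
  then interpret B: Module.module K B by (simp add: module_iso_def)
  have B: "carrier B = \<phi> ` carrier A" using bij by (simp add: bij_betw_def)
  have "comm_monoid B"
    by (rule comm_monoidI) (auto simp: B mult[symmetric] one[symmetric] A'.m_assoc A'.m_comm A'.m_lcomm)
  then have "cring B"
    by (rule cringI[OF B.abelian_group_axioms]) (auto simp: B mult[symmetric] add[symmetric] A'.l_distr)
  then have "Module.algebra K B"
    by (intro Module.algebra.intro B.module_axioms algebra_axioms.intro)
      (auto simp: B mult[symmetric] smult[symmetric] A.smult_assoc2)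
  moreover have "\<phi> \<in> ring_iso A B"
    by (rule ring_iso_memI) (use bij B in \<open>auto simp: add mult one\<close>)
  ultimately show ?thesis using iso A by (simp add: algebra_iso_def)
qed

lemma algebra_iso_inverse:
  assumes "algebra_iso K A B \<phi>"
  shows "algebra_iso K B A (inv_into (carrier A) \<phi>)"
proof -
  interpret A': cring A using assms by (auto simp: algebra_iso_def dest: Module.algebra.axioms(2))
  interpret A: Module.algebra K A using assms by (simp add: algebra_iso_def)
  interpret B: Module.algebra K B using assms by (simp add: algebra_iso_def)
  have bij: "bij_betw \<phi> (carrier A) (carrier B)"
    and add: "\<And>x y. x \<in> carrier A \<Longrightarrow> y \<in> carrier A \<Longrightarrow> \<phi> (x \<oplus>\<^bsub>A\<^esub> y) = \<phi> x \<oplus>\<^bsub>B\<^esub> \<phi> y"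
    and smult: "\<And>a x. a \<in> carrier K \<Longrightarrow> x \<in> carrier A \<Longrightarrow> \<phi> (a \<odot>\<^bsub>A\<^esub> x) = a \<odot>\<^bsub>B\<^esub> \<phi> x"
    and iso: "\<phi> \<in> ring_iso A B"
    using assms by (auto simp: algebra_iso_def module_iso_def)
  let ?\<psi> = "inv_into (carrier A) \<phi>"
  note mem = ring_iso_memE[OF iso] and inv = bij_betw_inv_into_left[OF bij] bij_betw_inv_into_right[OF bij]
  have "?\<psi> \<in> ring_iso B A" using ring_iso_set_sym[OF A'.ring_axioms iso] .
  moreover have "?\<psi> (a \<odot>\<^bsub>B\<^esub> y) = a \<odot>\<^bsub>A\<^esub> ?\<psi> y" if "a \<in> carrier K" "y \<in> carrier B" for a y
  proof -
    have "?\<psi> y \<in> carrier A" using bij_betwE[OF bij_betw_inv_into[OF bij]] that by blast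
    moreover from this have "a \<odot>\<^bsub>B\<^esub> y = \<phi> (a \<odot>\<^bsub>A\<^esub> ?\<psi> y)" using that smult inv by simp
    ultimately show ?thesis using inv that by simp
  qed
  ultimately show ?thesis
    using A.algebra_axioms B.algebra_axioms A.module_axioms B.module_axioms bij_betw_inv_into[OF bij] ring_iso_memE[of ?\<psi> B A]
    by (simp add: algebra_iso_def module_iso_def)
qed

section \<open>Cosets and the isomorphisms onto the graded pieces\<close>

lemma (in Modules.module) subspace_set_plus:
  assumes "subspace F"
  shows "F + F = F"
  using subspace_add[OF assms] subspace_0[OF assms] unfolding set_plus_def by force

text \<open>Elementwise products and multiples of cosets may fill only part of a coset; adding
  \<open>F\<close> completes them, which is the convention of \<open>gr_piece\<close>,
  \<open>gr_algebra\<close> and \<open>tensor_algebra\<close>.\<close>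

lemma (in Modules.module) coset_absorb:
  assumes "subspace F" "t \<in> S" "S \<subseteq> t +o F"
  shows "S + F = t +o F"
proof
  show "S + F \<subseteq> t +o F"
    using set_plus_mono2[OF assms(3), of F F] by (simp add: set_plus_rearrange3 subspace_set_plus[OF assms(1)])
  show "t +o F \<subseteq> S + F" using assms(2) by (rule set_plus_mono3)
qed

lemma (in Modules.module) sum_coset_absorb:
  assumes F: "subspace F" and "finite I" and S: "\<And>i. i \<in> I \<Longrightarrow> t i \<in> S i \<and> S i \<subseteq> t i +o F"
  shows "sum S I + F = sum t I +o F"
  using assms(2) S
proof (induction I rule: finite_induct)
  case (insert i I)
  have "sum S (insert i I) + F = S i + (sum S I + F)" using insert.hyps by (simp add: add.assoc)
  also have "\<dots> = sum t I +o (S i + F)" using insert by (simp add: set_plus_rearrange4)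
  also have "S i + F = t i +o F" using insert by (intro coset_absorb[OF F]) auto
  also have "sum t I +o (t i +o F) = sum t (insert i I) +o F"
    using insert.hyps by (simp add: set_plus_rearrange2 add.commute)
  finally show ?case .
qed simp

text \<open>The set of all leading terms is already the coset (\<open>Phi_eq\<close>), so no
  representative has to be chosen and independence of the choice of generators is built in.\<close>

definition Phi :: "nat \<Rightarrow> hfun \<Rightarrow> hfun set" where
  "Phi k f = {h. leading_term k f h}"

lemma leading_term_diff: "leading_term k f h \<Longrightarrow> leading_term k f' h' \<Longrightarrow> leading_term k (f - f') (h - h')"
  using leading_term_add[OF _ leading_term_qscale[of k f' h' "-1"]] by (simp add: qvs.scale_minus_left)

lemma Phi_eq:
  assumes "leading_term k f h"
  shows "Phi k f = h +o FilW (int k - 1)"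
proof (intro equalityI subsetI)
  fix h' assume "h' \<in> Phi k f"
  then have "leading_term k 0 (h' - h)" using leading_term_diff[OF _ assms, of f h'] by (simp add: Phi_def zero_fun_def)
  then have "h' - h \<in> FilW (int k - 1)"
    using leading_term_lower cvs.subspace_0[OF subspace_FilC] by blast
  then show "h' \<in> h +o FilW (int k - 1)" by (rule set_minus_imp_plus)
next
  fix h' assume "h' \<in> h +o FilW (int k - 1)"
  then obtain u where "h' = h + u" "u \<in> FilW (int k - 1)" by (auto simp: elt_set_plus_def)
  then show "h' \<in> Phi k f"
    using leading_term_add[OF assms leading_term_0[of u k]] by (simp add: Phi_def)
qed

lemma Phi_0: "Phi k 0 = FilW (int k - 1)"
  using Phi_eq[OF leading_term_0[OF qvs.subspace_0[OF subspace_FilW]]] by (simp only: set_zero_plus)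

lemma Phi_mes: "admissible ks \<Longrightarrow> Phi (sum_list ks) (mes ks) = g ks +o FilW (int (sum_list ks) - 1)"
  by (rule Phi_eq[OF leading_term_mes]) (simp add: admissible_good_word)

lemma leading_term_one: "leading_term 0 1 1"
  using leading_term_mes[of "[]"] by (simp add: mes_Nil g_Nil)

lemma Phi_one: "Phi 0 1 = 1 +o FilW (-1)"
  using Phi_eq[OF leading_term_one] by simp

lemma gr_piece_simps [simp]:
  "carrier (gr_piece sc F k) = {f +o F (int k - 1) | f. f \<in> F (int k)}"
  "\<zero>\<^bsub>gr_piece sc F k\<^esub> = F (int k - 1)"
  "x \<oplus>\<^bsub>gr_piece sc F k\<^esub> y = x + y"
  "a \<odot>\<^bsub>gr_piece sc F k\<^esub> x = sc a ` x + F (int k - 1)"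
  by (simp_all add: gr_piece_def)

lemma sub_algebra_simps [simp]:
  "carrier (sub_algebra sc V) = V" "\<zero>\<^bsub>sub_algebra sc V\<^esub> = 0" "\<one>\<^bsub>sub_algebra sc V\<^esub> = 1"
  "x \<oplus>\<^bsub>sub_algebra sc V\<^esub> y = x + y" "x \<otimes>\<^bsub>sub_algebra sc V\<^esub> y = x * y" "a \<odot>\<^bsub>sub_algebra sc V\<^esub> x = sc a x"
  by (simp_all add: sub_algebra_def)

lemma Phi_add:
  assumes "f \<in> Eis_wt k" "f' \<in> Eis_wt k"
  shows "Phi k (f + f') = Phi k f + Phi k f'"
proof -
  obtain h h' where h: "leading_term k f h" "leading_term k f' h'" using assms ex_leading_term by blast
  then show ?thesis
    by (simp only: Phi_eq[OF leading_term_add[OF h]] Phi_eq[OF h(1)] Phi_eq[OF h(2)] set_plus_rearrange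
      qvs.subspace_set_plus[OF subspace_FilW])
qed

lemma Phi_qscale:
  assumes "f \<in> Eis_wt k"
  shows "Phi k (qscale a f) = qscale a ` Phi k f + FilW (int k - 1)"
proof -
  obtain h where h: "leading_term k f h" using assms ex_leading_term by blast
  have "qscale a ` Phi k f \<subseteq> Phi k (qscale a f)"
    using leading_term_qscale by (auto simp: Phi_def)
  then have "qscale a ` Phi k f \<subseteq> qscale a h +o FilW (int k - 1)"
    by (simp add: Phi_eq[OF leading_term_qscale[OF h]])
  then have "qscale a ` Phi k f + FilW (int k - 1) = qscale a h +o FilW (int k - 1)"
    by (intro qvs.coset_absorb[OF subspace_FilW]) (use h in \<open>auto simp: Phi_def\<close>)
  then show ?thesis by (simp add: Phi_eq[OF leading_term_qscale[OF h]])
qed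

text \<open>Equal cosets share a leading term, so the difference of two preimages has leading term 0
  and vanishes by \<open>leading_term_eq_0\<close>. For surjectivity, words of weight
  \<open>k\<close> lift to \<open>mes\<close> and shorter weights lift to 0.\<close>

lemma bij_Phi: "bij_betw (Phi k) (Eis_wt k) (carrier (gr_piece qscale FilW k))"
proof (rule bij_betwI')
  fix f f' assume f: "f \<in> Eis_wt k" "f' \<in> Eis_wt k"
  show "Phi k f = Phi k f' \<longleftrightarrow> f = f'"
  proof
    assume eq: "Phi k f = Phi k f'"
    obtain h where "leading_term k f h" using f ex_leading_term by blast
    moreover from this have "leading_term k f' h" using eq by (auto simp: Phi_def)
    ultimately have "leading_term k (f - f') (h - h)" by (rule leading_term_diff)
    then have "f - f' = 0"
    proof (rule leading_term_eq_0)
      show "f - f' \<in> Eis_wt\<^sub>C k" by (rule subsetD[OF Eis_wt_subset_Eis_wt\<^sub>C qvs.subspace_diff[OF subspace_Eis_wt f]])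
      show "h - h \<in> FilW (int k - 1)" using qvs.subspace_0[OF subspace_FilW] by (simp only: diff_self)
    qed
    then show "f = f'" by (simp only: right_minus_eq)
  qed simp
next
  fix f assume "f \<in> Eis_wt k"
  then obtain h where "leading_term k f h" using ex_leading_term by blast
  then show "Phi k f \<in> carrier (gr_piece qscale FilW k)"
    by (auto simp: Phi_eq leading_term_def)
next
  fix A assume "A \<in> carrier (gr_piece qscale FilW k)"
  then obtain h where "h \<in> FilW (int k)" "A = h +o FilW (int k - 1)" by auto
  then show "\<exists>f\<in>Eis_wt k. A = Phi k f" using ex_leading_term_inv[of h k] Phi_eq by blast
qed

lemma module_iso_Phi: "module_iso rat_ring (sub_algebra qscale (Eis_wt k)) (gr_piece qscale FilW k) (Phi k)"
proof (rule module_iso_transport)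
  show "Module.module rat_ring (sub_algebra qscale (Eis_wt k))"
    by (rule module_sub_algebra[OF qvs.module_axioms subspace_Eis_wt])
  show "bij_betw (Phi k) (carrier (sub_algebra qscale (Eis_wt k))) (carrier (gr_piece qscale FilW k))"
    using bij_Phi by (simp only: sub_algebra_simps)
qed (simp_all add: Phi_0 Phi_add Phi_qscale del: zero_fun_def)

section \<open>The isomorphism of graded algebras\<close>

definition weight_poly :: "hfun \<Rightarrow> hfun poly" where
  "weight_poly = inv_into (weight_polys Eis_wt) (\<lambda>p. poly p 1)"

lemma bij_poly_Eis: "bij_betw (\<lambda>p. poly p 1) (weight_polys Eis_wt) Eis"
  using internal_direct_sum_Eis by (simp only: internal_direct_sum_iff_poly)

lemma weight_poly:
  assumes "f \<in> Eis"
  shows "weight_poly f \<in> weight_polys Eis_wt" "poly (weight_poly f) 1 = f" "Polynomial.coeff (weight_poly f) k \<in> Eis_wt k"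
proof -
  show 1: "weight_poly f \<in> weight_polys Eis_wt"
    unfolding weight_poly_def using assms bij_betw_imp_surj_on[OF bij_poly_Eis] by (intro inv_into_into) auto
  show "poly (weight_poly f) 1 = f"
    unfolding weight_poly_def by (rule bij_betw_inv_into_right[OF bij_poly_Eis assms])
  show "Polynomial.coeff (weight_poly f) k \<in> Eis_wt k" using 1 by (simp add: weight_polys_def)
qed

lemma weight_poly_unique: "p \<in> weight_polys Eis_wt \<Longrightarrow> poly p 1 = f \<Longrightarrow> weight_poly f = p"
  unfolding weight_poly_def using bij_betw_inv_into_left[OF bij_poly_Eis, of p] by simp

lemma weight_poly_add: "f \<in> Eis \<Longrightarrow> h \<in> Eis \<Longrightarrow> weight_poly (f + h) = weight_poly f + weight_poly h"
  by (rule weight_poly_unique)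
    (simp_all only: weight_polys_def mem_Collect_eq coeff_add poly_add weight_poly qvs.subspace_add[OF subspace_Eis_wt] simp_thms)

lemma weight_poly_mult: "f \<in> Eis \<Longrightarrow> h \<in> Eis \<Longrightarrow> weight_poly (f * h) = weight_poly f * weight_poly h"
proof (rule weight_poly_unique)
  assume fh: "f \<in> Eis" "h \<in> Eis"
  have "Polynomial.coeff (weight_poly f) i * Polynomial.coeff (weight_poly h) (k - i) \<in> Eis_wt k" if "i \<le> k" for i k
    using Eis_wt_mult[OF weight_poly(3)[OF fh(1), of i] weight_poly(3)[OF fh(2), of "k - i"]] that by simp
  then show "weight_poly f * weight_poly h \<in> weight_polys Eis_wt"
    unfolding weight_polys_def mem_Collect_eq coeff_mult by (intro allI qvs.subspace_sum[OF subspace_Eis_wt]) simp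
qed (simp only: poly_mult weight_poly)

lemma weight_poly_qscale: "f \<in> Eis \<Longrightarrow> weight_poly (qscale r f) = Polynomial.smult (\<lambda>\<tau>. of_rat r) (weight_poly f)"
proof (rule weight_poly_unique)
  assume f: "f \<in> Eis"
  have q: "(\<lambda>\<tau>. of_rat r) * h = qscale r h" for h :: hfun by (auto simp: qscale_def fun_eq_iff)
  show "Polynomial.smult (\<lambda>\<tau>. of_rat r) (weight_poly f) \<in> weight_polys Eis_wt"
    using qvs.subspace_scale[OF subspace_Eis_wt weight_poly(3)[OF f]] by (auto simp only: weight_polys_def mem_Collect_eq coeff_smult q)
  show "poly (Polynomial.smult (\<lambda>\<tau>. of_rat r) (weight_poly f)) 1 = qscale r f"
    by (simp only: poly_smult q weight_poly[OF f])
qed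

lemma weight_poly_Eis_wt: "f \<in> Eis_wt k \<Longrightarrow> weight_poly f = Polynomial.monom f k"
  by (rule weight_poly_unique) (auto simp: weight_polys_def poly_monom qvs.subspace_0[OF subspace_Eis_wt])

definition Psi :: "hfun \<Rightarrow> nat \<Rightarrow> hfun set" where
  "Psi f k = Phi k (Polynomial.coeff (weight_poly f) k)"

lemma Phi_mult_coset:
  assumes "leading_term i f a" "leading_term j h b"
  shows "Phi i f * Phi j h \<subseteq> a * b +o FilW (int (i + j) - 1)" "a * b \<in> Phi i f * Phi j h"
proof -
  have "Phi i f * Phi j h \<subseteq> Phi (i + j) (f * h)"
    using leading_term_mult by (auto simp: Phi_def set_times_def)
  then show "Phi i f * Phi j h \<subseteq> a * b +o FilW (int (i + j) - 1)" by (simp only: Phi_eq[OF leading_term_mult[OF assms]])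
  show "a * b \<in> Phi i f * Phi j h" using assms by (intro set_times_intro) (simp_all add: Phi_def)
qed

text \<open>Multiplication of polynomials and multiplication in the graded algebra are the same
  convolution, so the comparison reduces to products of leading terms in each degree.\<close>

lemma Phi_coeff_mult:
  assumes p: "p \<in> weight_polys Eis_wt" and q: "q \<in> weight_polys Eis_wt"
  shows "Phi n (Polynomial.coeff (p * q) n) =
    (\<Sum>i\<le>n. Phi i (Polynomial.coeff p i) * Phi (n - i) (Polynomial.coeff q (n - i))) + FilW (int n - 1)"
proof -
  have "\<forall>i. \<exists>h. leading_term i (Polynomial.coeff p i) h" "\<forall>i. \<exists>h. leading_term i (Polynomial.coeff q i) h"
    using p q ex_leading_term by (auto simp: weight_polys_def)
  then obtain a b where a: "\<And>i. leading_term i (Polynomial.coeff p i) (a i)" and b: "\<And>i. leading_term i (Polynomial.coeff q i) (b i)"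
    by metis
  have l: "leading_term n (Polynomial.coeff p i * Polynomial.coeff q (n - i)) (a i * b (n - i))" if "i \<le> n" for i
    using leading_term_mult[OF a[of i] b[of "n - i"]] that by simp
  \<comment> \<open>The scalars 1 merely bring the sum into the form of
    \<open>leading_term_sum\<close>.\<close>
  have "leading_term n (\<Sum>i\<le>n. qscale 1 (Polynomial.coeff p i * Polynomial.coeff q (n - i))) (\<Sum>i\<le>n. qscale 1 (a i * b (n - i)))"
    by (rule leading_term_sum) (use l in auto)
  then have "leading_term n (Polynomial.coeff (p * q) n) (\<Sum>i\<le>n. a i * b (n - i))"
    by (simp only: qvs.scale_one coeff_mult)
  then have "Phi n (Polynomial.coeff (p * q) n) = (\<Sum>i\<le>n. a i * b (n - i)) +o FilW (int n - 1)" by (rule Phi_eq)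
  also have "\<dots> = (\<Sum>i\<le>n. Phi i (Polynomial.coeff p i) * Phi (n - i) (Polynomial.coeff q (n - i))) + FilW (int n - 1)"
  proof (rule qvs.sum_coset_absorb[OF subspace_FilW, symmetric])
    fix i assume "i \<in> {..n}"
    then have "i + (n - i) = n" by simp
    then show "a i * b (n - i) \<in> Phi i (Polynomial.coeff p i) * Phi (n - i) (Polynomial.coeff q (n - i)) \<and>
        Phi i (Polynomial.coeff p i) * Phi (n - i) (Polynomial.coeff q (n - i)) \<subseteq> a i * b (n - i) +o FilW (int n - 1)"
      using Phi_mult_coset[OF a[of i] b[of "n - i"]] by (simp only: simp_thms)
  qed simp
  finally show ?thesis .
qed

lemma gr_algebra_simps [simp]:
  "carrier (gr_algebra sc F) = {x. (\<forall>k. x k \<in> carrier (gr_piece sc F k)) \<and> finite {k. x k \<noteq> F (int k - 1)}}"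
  "\<zero>\<^bsub>gr_algebra sc F\<^esub> = (\<lambda>k. F (int k - 1))"
  "\<one>\<^bsub>gr_algebra sc F\<^esub> = (\<lambda>k. F (int k - 1))(0 := 1 +o F (-1))"
  "x \<oplus>\<^bsub>gr_algebra sc F\<^esub> y = (\<lambda>k. x k + y k)"
  "x \<otimes>\<^bsub>gr_algebra sc F\<^esub> y = (\<lambda>n. (\<Sum>i\<le>n. x i * y (n - i)) + F (int n - 1))"
  "a \<odot>\<^bsub>gr_algebra sc F\<^esub> x = (\<lambda>k. sc a ` x k + F (int k - 1))"
  by (simp_all add: gr_algebra_def)

lemma Phi_in_gr_piece: "f \<in> Eis_wt k \<Longrightarrow> Phi k f \<in> carrier (gr_piece qscale FilW k)"
  using bij_betwE[OF bij_Phi] by blast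

lemma bij_Psi: "bij_betw Psi Eis (carrier (gr_algebra qscale FilW))"
proof (rule bij_betwI')
  fix f h assume fh: "f \<in> Eis" "h \<in> Eis"
  show "Psi f = Psi h \<longleftrightarrow> f = h"
  proof
    assume "Psi f = Psi h"
    then have "Phi k (Polynomial.coeff (weight_poly f) k) = Phi k (Polynomial.coeff (weight_poly h) k)" for k
      unfolding Psi_def by (rule fun_cong)
    then have "Polynomial.coeff (weight_poly f) k = Polynomial.coeff (weight_poly h) k" for k
      using bij_betw_imp_inj_on[OF bij_Phi] weight_poly(3) fh by (blast dest: inj_onD)
    then have "weight_poly f = weight_poly h" by (rule poly_eqI)
    then show "f = h" using weight_poly(2) fh by metis
  qed simp
next
  fix f assume f: "f \<in> Eis"
  have "{k. Psi f k \<noteq> FilW (int k - 1)} \<subseteq> {k. Polynomial.coeff (weight_poly f) k \<noteq> 0}"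
    using Phi_0 by (auto simp only: Psi_def)
  then have "finite {k. Psi f k \<noteq> FilW (int k - 1)}"
    using MOST_coeff_eq_0[unfolded eventually_cofinite] by (rule finite_subset)
  moreover have "Psi f k \<in> carrier (gr_piece qscale FilW k)" for k
    unfolding Psi_def by (rule Phi_in_gr_piece[OF weight_poly(3)[OF f]])
  ultimately show "Psi f \<in> carrier (gr_algebra qscale FilW)"
    by (simp only: gr_algebra_simps mem_Collect_eq simp_thms)
next
  fix y assume "y \<in> carrier (gr_algebra qscale FilW)"
  then have y: "\<And>k. y k \<in> carrier (gr_piece qscale FilW k)" "finite {k. y k \<noteq> FilW (int k - 1)}"
    by (simp_all only: gr_algebra_simps mem_Collect_eq)
  define x where "x k = inv_into (Eis_wt k) (Phi k) (y k)" for k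
  have x: "x k \<in> Eis_wt k" "Phi k (x k) = y k" for k
    unfolding x_def using bij_betwE[OF bij_betw_inv_into[OF bij_Phi]] bij_betw_inv_into_right[OF bij_Phi] y(1) by blast+
  have "x k = 0" if "y k = FilW (int k - 1)" for k
    using bij_betw_imp_inj_on[OF bij_Phi] x[of k] Phi_0[of k] qvs.subspace_0[OF subspace_Eis_wt] that by (metis inj_onD)
  then have "{k. x k \<noteq> 0} \<subseteq> {k. y k \<noteq> FilW (int k - 1)}" by blast
  then have fin: "finite {k. x k \<noteq> 0}" using y(2) by (rule finite_subset)
  let ?p = "Abs_poly x"
  have p: "?p \<in> weight_polys Eis_wt" using x by (simp add: weight_polys_def coeff_Abs_poly_finite[OF fin])
  then have "poly ?p 1 \<in> Eis" using bij_betwE[OF bij_poly_Eis] by blast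
  moreover have "Psi (poly ?p 1) = y"
    unfolding Psi_def weight_poly_unique[OF p refl] coeff_Abs_poly_finite[OF fin] x by (rule refl)
  ultimately show "\<exists>f\<in>Eis. y = Psi f" by blast
qed

lemma Psi_Eis_wt: "f \<in> Eis_wt k \<Longrightarrow> Psi f = gr_incl FilW k (Phi k f)"
  by (rule ext) (simp only: Psi_def weight_poly_Eis_wt gr_incl_def coeff_monom fun_upd_apply if_distrib[of "Phi _"] Phi_0 cong: if_cong, simp add: Phi_0)

lemma algebra_Eis: "Module.algebra rat_ring (sub_algebra qscale Eis)"
  by (rule algebra_sub_algebra[OF qvs.module_axioms subspace_Eis _ Eis_mult])
    (use one_in_Eis_wt Eis_wt_subset_Eis in \<open>auto simp: qscale_def fun_eq_iff\<close>)

lemma algebra_iso_Psi: "algebra_iso rat_ring (sub_algebra qscale Eis) (gr_algebra qscale FilW) Psi"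
proof (rule algebra_iso_transport[OF algebra_Eis], unfold sub_algebra_simps)
  show "bij_betw Psi Eis (carrier (gr_algebra qscale FilW))" by (rule bij_Psi)
  have "weight_poly 0 = 0"
    by (rule weight_poly_unique) (auto simp: weight_polys_def qvs.subspace_0[OF subspace_Eis_wt])
  then show "Psi 0 = \<zero>\<^bsub>gr_algebra qscale FilW\<^esub>" by (intro ext) (simp only: Psi_def coeff_0 Phi_0 gr_algebra_simps)
  show "Psi 1 = \<one>\<^bsub>gr_algebra qscale FilW\<^esub>"
    by (simp only: Psi_Eis_wt[OF one_in_Eis_wt] gr_incl_def Phi_one gr_algebra_simps)
  fix f h assume fh: "f \<in> Eis" "h \<in> Eis"
  show "Psi (f + h) = Psi f \<oplus>\<^bsub>gr_algebra qscale FilW\<^esub> Psi h"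
    by (intro ext) (simp only: Psi_def weight_poly_add[OF fh] coeff_add gr_algebra_simps Phi_add weight_poly(3) fh)
  show "Psi (f * h) = Psi f \<otimes>\<^bsub>gr_algebra qscale FilW\<^esub> Psi h"
    by (intro ext) (simp only: Psi_def weight_poly_mult[OF fh] gr_algebra_simps Phi_coeff_mult weight_poly(1) fh)
next
  fix a :: rat and f assume f: "f \<in> Eis"
  have "(\<lambda>\<tau>. of_rat a) * h = qscale a h" for h :: hfun by (auto simp: qscale_def fun_eq_iff)
  then show "Psi (qscale a f) = a \<odot>\<^bsub>gr_algebra qscale FilW\<^esub> Psi f"
    by (intro ext) (simp only: Psi_def weight_poly_qscale[OF f] coeff_smult gr_algebra_simps Phi_qscale weight_poly(3) f)
qed

subsection \<open>Extension of scalars\<close>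

definition frag_eval :: "('a \<Rightarrow> 'v) \<Rightarrow> ('a \<Rightarrow>\<^sub>0 int) \<Rightarrow> 'v::comm_ring_1" where
  "frag_eval \<phi> p = (\<Sum>x\<in>Poly_Mapping.keys p. of_int (Poly_Mapping.lookup p x) * \<phi> x)"

lemma frag_eval_superset:
  assumes "finite S" "Poly_Mapping.keys p \<subseteq> S"
  shows "frag_eval \<phi> p = (\<Sum>x\<in>S. of_int (Poly_Mapping.lookup p x) * \<phi> x)"
  unfolding frag_eval_def by (rule sum.mono_neutral_left) (use assms in \<open>auto simp: in_keys_iff\<close>)

lemma frag_eval_0 [simp]: "frag_eval \<phi> 0 = 0"
  by (simp add: frag_eval_def)

lemma frag_eval_of [simp]: "frag_eval \<phi> (frag_of x) = \<phi> x"
  by (simp add: frag_eval_def)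

lemma frag_eval_add: "frag_eval \<phi> (p + q) = frag_eval \<phi> p + frag_eval \<phi> q"
proof -
  let ?S = "Poly_Mapping.keys p \<union> Poly_Mapping.keys q"
  have "Poly_Mapping.keys (p + q) \<subseteq> ?S" by (rule Poly_Mapping.keys_add)
  then show ?thesis
    by (simp add: frag_eval_superset[of ?S] lookup_add distrib_right sum.distrib)
qed

lemma frag_eval_minus: "frag_eval \<phi> (- p) = - frag_eval \<phi> p"
  by (simp add: frag_eval_def sum_negf)

lemma frag_eval_diff: "frag_eval \<phi> (p - q) = frag_eval \<phi> p - frag_eval \<phi> q"
  using frag_eval_add[of \<phi> p "- q"] by (simp add: frag_eval_minus)

lemma frag_eval_cmul: "frag_eval \<phi> (frag_cmul c p) = of_int c * frag_eval \<phi> p"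
  using frag_eval_superset[of "Poly_Mapping.keys p" "frag_cmul c p" \<phi>] keys_cmul[of c p]
  by (simp add: frag_eval_def sum_distrib_left mult.assoc)

lemma frag_eval_mult_right: "frag_eval \<phi> p * c = frag_eval (\<lambda>x. \<phi> x * c) p"
  by (simp add: frag_eval_def sum_distrib_right mult.assoc)

lemma frag_eval_mult_left: "c * frag_eval \<phi> p = frag_eval (\<lambda>x. c * \<phi> x) p"
  by (simp add: frag_eval_def sum_distrib_left mult.left_commute)

lemma frag_eval_extend: "frag_eval \<phi> (frag_extend \<psi> p) = frag_eval (\<lambda>x. frag_eval \<phi> (\<psi> x)) p"
proof -
  have "Poly_Mapping.keys p \<subseteq> UNIV" by simp
  then show ?thesis
    by (induction p rule: frag_induction) (simp_all add: frag_extend_diff frag_eval_diff)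
qed

text \<open>The natural map on representatives, sending f tensor z to z f.\<close>

definition tensor_eval :: "(hfun \<times> complex \<Rightarrow>\<^sub>0 int) \<Rightarrow> hfun" where
  "tensor_eval = frag_eval (\<lambda>(f, z). cscale z f)"

lemma tensor_eval_simps:
  "tensor_eval 0 = 0" "tensor_eval (frag_of (f, z)) = cscale z f"
  "tensor_eval (p + q) = tensor_eval p + tensor_eval q" "tensor_eval (p - q) = tensor_eval p - tensor_eval q"
  "tensor_eval (frag_cmul c p) = of_int c * tensor_eval p"
  unfolding tensor_eval_def frag_eval_add frag_eval_diff frag_eval_cmul frag_eval_0 by (simp_all only: frag_eval_of split)

interpretation frag: Modules.module frag_cmul by (rule module_frag_cmul)

abbreviation Eis_frags :: "(hfun \<times> complex \<Rightarrow>\<^sub>0 int) set" where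
  "Eis_frags \<equiv> {p. Poly_Mapping.keys p \<subseteq> Eis \<times> UNIV}"

lemma Eis_frags_diff: "p \<in> Eis_frags \<Longrightarrow> q \<in> Eis_frags \<Longrightarrow> p - q \<in> Eis_frags"
  using keys_diff[of p q] by auto

lemma Eis_frags_add: "p \<in> Eis_frags \<Longrightarrow> q \<in> Eis_frags \<Longrightarrow> p + q \<in> Eis_frags"
  using Poly_Mapping.keys_add[of p q] by auto

lemma Eis_frags_of: "frag_of (f, z) \<in> Eis_frags \<longleftrightarrow> f \<in> Eis"
  by simp

text \<open>Besides evaluating to 0, relations are supported on \<open>Eis \<times> UNIV\<close>;
  both properties together will characterise them.\<close>

lemma tensor_rel_subset: "tensor_rel Eis \<subseteq> {p \<in> Eis_frags. tensor_eval p = 0}"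
  unfolding tensor_rel_def
proof (rule frag.span_minimal)
  let ?R = "{p \<in> Eis_frags. tensor_eval p = 0}"
  have E: "f + h \<in> Eis" "qscale a f \<in> Eis" if "f \<in> Eis" "h \<in> Eis" for f h a
    using that qvs.subspace_add[OF subspace_Eis] qvs.subspace_scale[OF subspace_Eis] by auto
  have "frag_of (f + h, z) - frag_of (f, z) - frag_of (h, z) \<in> ?R" if f: "f \<in> Eis" "h \<in> Eis" for f h z
  proof -
    have "frag_of (f + h, z) - frag_of (f, z) - frag_of (h, z) \<in> Eis_frags"
      by (intro Eis_frags_diff Eis_frags_of[THEN iffD2] E f)
    moreover have "tensor_eval (frag_of (f + h, z) - frag_of (f, z) - frag_of (h, z)) = 0"
      unfolding tensor_eval_simps by (auto simp: cscale_def algebra_simps fun_eq_iff)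
    ultimately show ?thesis by blast
  qed
  moreover have "frag_of (f, z + w) - frag_of (f, z) - frag_of (f, w) \<in> ?R" if f: "f \<in> Eis" for f z w
  proof -
    have "frag_of (f, z + w) - frag_of (f, z) - frag_of (f, w) \<in> Eis_frags"
      by (intro Eis_frags_diff Eis_frags_of[THEN iffD2] f)
    moreover have "tensor_eval (frag_of (f, z + w) - frag_of (f, z) - frag_of (f, w)) = 0"
      unfolding tensor_eval_simps by (auto simp: cscale_def algebra_simps fun_eq_iff)
    ultimately show ?thesis by blast
  qed
  moreover have "frag_of (qscale a f, z) - frag_of (f, of_rat a * z) \<in> ?R" if f: "f \<in> Eis" for a f z
  proof -
    have "frag_of (qscale a f, z) - frag_of (f, of_rat a * z) \<in> Eis_frags"
      by (intro Eis_frags_diff Eis_frags_of[THEN iffD2] E(2)[OF f f] f)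
    moreover have "tensor_eval (frag_of (qscale a f, z) - frag_of (f, of_rat a * z)) = 0"
      unfolding tensor_eval_simps by (auto simp: cscale_def qscale_def algebra_simps fun_eq_iff)
    ultimately show ?thesis by blast
  qed
  ultimately show "{frag_of (f + h, z) - frag_of (f, z) - frag_of (h, z) | f h z. f \<in> Eis \<and> h \<in> Eis} \<union>
     {frag_of (f, z + w) - frag_of (f, z) - frag_of (f, w) | f z w. f \<in> Eis} \<union>
     {frag_of (qscale a f, z) - frag_of (f, of_rat a * z) | a f z. f \<in> Eis} \<subseteq> ?R"
    by (intro Un_least subsetI; elim CollectE exE conjE; simp only:)
  have "p + q \<in> ?R" if "p \<in> ?R" "q \<in> ?R" for p q
    using Eis_frags_add[of p q] that tensor_eval_simps(3)[of p q] by simp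
  moreover have "frag_cmul c p \<in> ?R" if "p \<in> ?R" for c p
    using keys_cmul[of c p] that tensor_eval_simps(5)[of c p] by auto
  moreover have "0 \<in> ?R" using tensor_eval_simps(1) by simp
  ultimately show "frag.subspace ?R" unfolding frag.subspace_def by (intro conjI ballI allI)
qed

lemma subspace_tensor_rel: "frag.subspace (tensor_rel Eis)"
  unfolding tensor_rel_def by (rule frag.subspace_span)

lemma tensor_relI:
  "f \<in> Eis \<Longrightarrow> h \<in> Eis \<Longrightarrow> frag_of (f + h, z) - frag_of (f, z) - frag_of (h, z) \<in> tensor_rel Eis"
  "f \<in> Eis \<Longrightarrow> frag_of (f, z + w) - frag_of (f, z) - frag_of (f, w) \<in> tensor_rel Eis"
  "f \<in> Eis \<Longrightarrow> frag_of (qscale a f, z) - frag_of (f, of_rat a * z) \<in> tensor_rel Eis"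
  unfolding tensor_rel_def by (rule frag.span_base; blast)+

lemma tensor_rel_0:
  "frag_of (0, z) \<in> tensor_rel Eis" "f \<in> Eis \<Longrightarrow> frag_of (f, 0) \<in> tensor_rel Eis"
proof -
  have neg: "p \<in> tensor_rel Eis" if "- p \<in> tensor_rel Eis" for p
    using frag.subspace_neg[OF subspace_tensor_rel that] by simp
  have "0 \<in> Eis" by (rule qvs.subspace_0[OF subspace_Eis])
  from tensor_relI(1)[OF this this, of z] have "- frag_of (0, z) \<in> tensor_rel Eis"
    by (simp only: add_0 diff_self diff_0)
  then show "frag_of (0, z) \<in> tensor_rel Eis" by (rule neg)
  assume "f \<in> Eis"
  from tensor_relI(2)[OF this, of 0 0] have "- frag_of (f, 0) \<in> tensor_rel Eis"
    by (simp only: add_0 diff_self diff_0)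
  then show "frag_of (f, 0) \<in> tensor_rel Eis" by (rule neg)
qed

text \<open>
  The representative of a tensor with scalars in a fixed rational basis: its coefficients are
  determined by the value of the tensor, which makes the evaluation map injective.
\<close>

definition collect_coords :: "complex set \<Rightarrow> (hfun \<times> complex \<Rightarrow>\<^sub>0 int) \<Rightarrow> (hfun \<times> complex \<Rightarrow>\<^sub>0 int)" where
  "collect_coords S p = (\<Sum>b\<in>S. frag_of (frag_eval (\<lambda>(f, z). qscale (qcoord b z) f) p, b))"

lemma frag_of_sum_right:
  assumes "f \<in> Eis" "finite S"
  shows "frag_of (f, \<Sum>b\<in>S. c b) - (\<Sum>b\<in>S. frag_of (f, c b)) \<in> tensor_rel Eis"
  using assms(2)
proof (induction S rule: finite_induct)
  case empty
  then show ?case using tensor_rel_0(2)[OF assms(1)] by simp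
next
  case (insert b S)
  have "(frag_of (f, c b + (\<Sum>b\<in>S. c b)) - frag_of (f, c b) - frag_of (f, \<Sum>b\<in>S. c b)) +
      (frag_of (f, \<Sum>b\<in>S. c b) - (\<Sum>b\<in>S. frag_of (f, c b))) \<in> tensor_rel Eis"
    by (intro frag.subspace_add[OF subspace_tensor_rel] tensor_relI(2) assms insert.IH)
  then show ?case using insert.hyps by (simp add: algebra_simps)
qed

text \<open>Each scalar is expanded in the rational basis and its rational coordinates are moved
  across the tensor sign: f tensor z becomes the sum of q_b f tensor b. The set \<open>S\<close> has
  to contain all basis elements that occur.\<close>

lemma collect_coords_equiv:
  assumes "finite S" "Poly_Mapping.keys p \<subseteq> Eis \<times> {z. {b. qcoord b z \<noteq> 0} \<subseteq> S}"
  shows "(\<forall>b. frag_eval (\<lambda>(f, z). qscale (qcoord b z) f) p \<in> Eis) \<and> p - collect_coords S p \<in> tensor_rel Eis"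
  using assms(2)
proof (induction p rule: frag_induction)
  case zero
  have "collect_coords S 0 \<in> tensor_rel Eis"
    unfolding collect_coords_def frag_eval_0
    by (intro frag.subspace_sum[OF subspace_tensor_rel] tensor_rel_0)
  then show ?case
    using frag.subspace_neg[OF subspace_tensor_rel] qvs.subspace_0[OF subspace_Eis]
    unfolding frag_eval_0 diff_0 by blast
next
  case (one x)
  obtain f z where x: "x = (f, z)" by force
  have f: "f \<in> Eis" and z: "{b. qcoord b z \<noteq> 0} \<subseteq> S" using one x by auto
  let ?c = "\<lambda>b. of_rat (qcoord b z) * b"
  have "frag_of (f, \<Sum>b\<in>S. ?c b) - (\<Sum>b\<in>S. frag_of (f, ?c b)) \<in> tensor_rel Eis"
    by (rule frag_of_sum_right[OF f assms(1)])
  moreover have "(\<Sum>b\<in>S. frag_of (qscale (qcoord b z) f, b) - frag_of (f, ?c b)) \<in> tensor_rel Eis"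
    by (intro frag.subspace_sum[OF subspace_tensor_rel] tensor_relI(3) f)
  ultimately have "(frag_of (f, \<Sum>b\<in>S. ?c b) - (\<Sum>b\<in>S. frag_of (f, ?c b))) -
      (\<Sum>b\<in>S. frag_of (qscale (qcoord b z) f, b) - frag_of (f, ?c b)) \<in> tensor_rel Eis"
    by (rule frag.subspace_diff[OF subspace_tensor_rel])
  then have "frag_of (f, z) - (\<Sum>b\<in>S. frag_of (qscale (qcoord b z) f, b)) \<in> tensor_rel Eis"
    by (simp add: sum_subtractf sum_qcoord[OF assms(1) z])
  then show ?case
    using qvs.subspace_scale[OF subspace_Eis f] by (simp only: x collect_coords_def frag_eval_of split) blast
next
  case (diff p q)
  let ?e = "\<lambda>b. frag_eval (\<lambda>(f, z). qscale (qcoord b z) f)"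
  have e: "?e b p \<in> Eis" "?e b q \<in> Eis" "?e b p - ?e b q \<in> Eis" for b
    using diff qvs.subspace_diff[OF subspace_Eis] by blast+
  have "(\<Sum>b\<in>S. frag_of ((?e b p - ?e b q) + ?e b q, b) - frag_of (?e b p - ?e b q, b) - frag_of (?e b q, b)) \<in> tensor_rel Eis"
    by (intro frag.subspace_sum[OF subspace_tensor_rel] tensor_relI(1) e)
  then have "collect_coords S p - collect_coords S (p - q) - collect_coords S q \<in> tensor_rel Eis"
    unfolding collect_coords_def frag_eval_diff by (simp only: diff_add_cancel sum_subtractf)
  then have "(p - collect_coords S p) - (q - collect_coords S q) + (collect_coords S p - collect_coords S (p - q) - collect_coords S q) \<in> tensor_rel Eis"
    using diff by (intro frag.subspace_add[OF subspace_tensor_rel frag.subspace_diff[OF subspace_tensor_rel]]) auto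
  also have "(p - collect_coords S p) - (q - collect_coords S q) + (collect_coords S p - collect_coords S (p - q) - collect_coords S q)
      = (p - q) - collect_coords S (p - q)" by (simp add: algebra_simps)
  finally show ?case using e unfolding frag_eval_diff by blast
qed

text \<open>Injectivity of the natural map. If the evaluation vanishes,
  \<open>Eis_rat_linear\<close> applied to each coordinate functional makes every collected
  coefficient 0, so the representative reduces to a sum of terms 0 tensor b.\<close>

lemma tensor_rel_eq: "tensor_rel Eis = {p \<in> Eis_frags. tensor_eval p = 0}"
proof (intro equalityI tensor_rel_subset subsetI)
  fix p :: "hfun \<times> complex \<Rightarrow>\<^sub>0 int" assume "p \<in> {p \<in> Eis_frags. tensor_eval p = 0}"
  then have keys: "Poly_Mapping.keys p \<subseteq> Eis \<times> UNIV" and ev: "tensor_eval p = 0" by auto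
  let ?K = "Poly_Mapping.keys p" and ?n = "Poly_Mapping.lookup p"
  define S where "S = (\<Union>x\<in>?K. {b. qcoord b (snd x) \<noteq> 0})"
  have S: "finite S" unfolding S_def using finite_qcoord by auto
  have sub: "?K \<subseteq> Eis \<times> {z. {b. qcoord b z \<noteq> 0} \<subseteq> S}"
  proof
    fix x assume "x \<in> ?K"
    moreover from this have "fst x \<in> Eis" using keys by auto
    ultimately show "x \<in> Eis \<times> {z. {b. qcoord b z \<noteq> 0} \<subseteq> S}" by (cases x) (auto simp: S_def)
  qed
  have "frag_eval (\<lambda>(f, z). qscale (qcoord b z) f) p = 0" for b
  proof -
    have of_int_mult: "of_int n * h = cscale (of_int n) h" for n and h :: hfun
      by (induction n) (auto simp: cscale_def fun_eq_iff algebra_simps)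
    have "tensor_eval p = (\<Sum>x\<in>?K. cscale (of_int (?n x) * snd x) (fst x))"
      unfolding tensor_eval_def frag_eval_def by (simp add: of_int_mult case_prod_beta)
    then have "(\<Sum>x\<in>?K. qscale (qcoord b (of_int (?n x) * snd x)) (fst x)) = 0"
      using ev keys by (intro Eis_rat_linear[OF rat_linear_qcoord]) auto
    moreover have "qcoord b (of_int m * z) = of_int m * qcoord b z" for m z
      using rat_linear_qcoord[of b] unfolding rat_linear_def by (metis of_rat_of_int_eq)
    ultimately have "(\<Sum>x\<in>?K. qscale (of_int (?n x) * qcoord b (snd x)) (fst x)) = 0" by simp
    moreover have "qscale (of_int m * r) h = of_int m * qscale r h" for m r h
      unfolding of_int_mult by (auto simp: qscale_def cscale_def fun_eq_iff of_rat_mult)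
    ultimately show ?thesis by (simp add: frag_eval_def case_prod_beta)
  qed
  then have "collect_coords S p \<in> tensor_rel Eis"
    unfolding collect_coords_def by (simp only:) (intro frag.subspace_sum[OF subspace_tensor_rel] tensor_rel_0)
  from frag.subspace_add[OF subspace_tensor_rel this, of "p - collect_coords S p"] collect_coords_equiv[OF S sub]
  show "p \<in> tensor_rel Eis" by simp
qed

text \<open>The inverse of the natural map: a function is sent to the coset of all its
  representatives. Working in this direction lets the tensor algebra inherit its laws from an
  algebra of functions.\<close>

definition tensor_fiber :: "hfun \<Rightarrow> (hfun \<times> complex \<Rightarrow>\<^sub>0 int) set" where
  "tensor_fiber f = {p \<in> Eis_frags. tensor_eval p = f}"

lemma tensor_fiber_eq:
  assumes "p \<in> Eis_frags"
  shows "tensor_fiber (tensor_eval p) = p +o tensor_rel Eis"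
proof (intro equalityI subsetI)
  fix q assume "q \<in> tensor_fiber (tensor_eval p)"
  then have q: "q \<in> Eis_frags" "tensor_eval q = tensor_eval p" by (auto simp: tensor_fiber_def)
  have "tensor_eval (q - p) = 0" unfolding tensor_eval_simps q(2) by (rule diff_self)
  then have "q - p \<in> tensor_rel Eis" unfolding tensor_rel_eq using Eis_frags_diff[OF q(1) assms] by blast
  then show "q \<in> p +o tensor_rel Eis" by (rule set_minus_imp_plus)
next
  fix q assume "q \<in> p +o tensor_rel Eis"
  then obtain r where r: "q = p + r" "r \<in> Eis_frags" "tensor_eval r = 0" by (auto simp: elt_set_plus_def tensor_rel_eq)
  then have "tensor_eval q = tensor_eval p" by (simp only: tensor_eval_simps add_0_right)
  then show "q \<in> tensor_fiber (tensor_eval p)"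
    unfolding tensor_fiber_def r(1) using Eis_frags_add[OF assms r(2)] by blast
qed

lemma tensor_eval_in_Eis\<^sub>C:
  assumes "p \<in> Eis_frags"
  shows "tensor_eval p \<in> Eis\<^sub>C"
proof -
  have "Poly_Mapping.keys p \<subseteq> Eis \<times> UNIV" using assms by simp
  then show ?thesis
  proof (induction p rule: frag_induction)
    case (one x)
    obtain f z where x: "x = (f, z)" by force
    with one have "f \<in> Eis\<^sub>C" unfolding Eis\<^sub>C_def by (auto intro: cvs.span_base)
    then show ?case unfolding x tensor_eval_simps by (rule cvs.subspace_scale[OF subspace_Eis\<^sub>C])
  qed (simp_all only: tensor_eval_simps cvs.subspace_0[OF subspace_Eis\<^sub>C] cvs.subspace_diff[OF subspace_Eis\<^sub>C])
qed

lemma ex_tensor_eval: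
  assumes "f \<in> Eis\<^sub>C"
  obtains p where "p \<in> Eis_frags" "tensor_eval p = f"
proof -
  have "f \<in> cspan Eis" using assms by (simp only: Eis\<^sub>C_def)
  then have "\<exists>p\<in>Eis_frags. tensor_eval p = f"
  proof (induction rule: cvs.span_induct_alt)
    case base
    show ?case using tensor_eval_simps(1) by (intro bexI[of _ 0]) auto
  next
    case (step c x y)
    then obtain p where p: "p \<in> Eis_frags" "tensor_eval p = y" by blast
    moreover have "frag_of (x, c) \<in> Eis_frags" using step by (simp only: Eis_frags_of)
    ultimately have "frag_of (x, c) + p \<in> Eis_frags" "tensor_eval (frag_of (x, c) + p) = cscale c x + y"
      using Eis_frags_add by (blast, simp only: tensor_eval_simps)
    then show ?case by blast
  qed
  then show thesis using that by blast
qed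

lemma tensor_fiber_absorb:
  assumes "S \<subseteq> tensor_fiber f" "p \<in> S"
  shows "S + tensor_rel Eis = tensor_fiber f"
proof -
  have p: "p \<in> Eis_frags" "f = tensor_eval p" using assms by (auto simp: tensor_fiber_def)
  show ?thesis
    unfolding p(2) tensor_fiber_eq[OF p(1)]
    by (rule frag.coset_absorb[OF subspace_tensor_rel assms(2)]) (use assms(1) p tensor_fiber_eq[OF p(1)] in simp)
qed

lemma tensor_scale_props:
  assumes "p \<in> Eis_frags"
  shows "tensor_scale c p \<in> Eis_frags" "tensor_eval (tensor_scale c p) = cscale c (tensor_eval p)"
proof -
  show "tensor_scale c p \<in> Eis_frags"
    using assms keys_frag_extend[of "\<lambda>(f, z). frag_of (f, c * z)" p] by (fastforce simp: tensor_scale_def)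
  have c: "cscale c h = (\<lambda>\<tau>. c) * h" for h :: hfun by (auto simp: cscale_def fun_eq_iff)
  have "tensor_eval (tensor_scale c p) = frag_eval (\<lambda>x. cscale c (case x of (f, z) \<Rightarrow> cscale z f)) p"
    unfolding tensor_scale_def tensor_eval_def frag_eval_extend
    by (rule arg_cong[where f = "\<lambda>F. frag_eval F p"]) (auto simp: fun_eq_iff cscale_def)
  then show "tensor_eval (tensor_scale c p) = cscale c (tensor_eval p)"
    by (simp only: c tensor_eval_def frag_eval_mult_left)
qed

lemma tensor_mult_props:
  assumes "p \<in> Eis_frags" "q \<in> Eis_frags"
  shows "tensor_mult p q \<in> Eis_frags" "tensor_eval (tensor_mult p q) = tensor_eval p * tensor_eval q"
proof -
  let ?m = "\<lambda>f z. frag_extend (\<lambda>(h, w). frag_of (f * h, z * w)) q"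
  have inner: "?m f z \<in> Eis_frags" if "f \<in> Eis" for f z
    using keys_frag_extend[of "\<lambda>(h, w). frag_of (f * h, z * w)" q] assms(2) Eis_mult[OF that] by fastforce
  show "tensor_mult p q \<in> Eis_frags"
    using keys_frag_extend[of "\<lambda>(f, z). ?m f z" p] assms(1) inner unfolding tensor_mult_def by fastforce
  have "tensor_eval (?m f z) = cscale z f * tensor_eval q" for f z
    unfolding tensor_eval_def frag_eval_extend frag_eval_mult_left
    by (rule arg_cong[where f = "\<lambda>F. frag_eval F q"]) (auto simp: fun_eq_iff cscale_def)
  then have "(\<lambda>x. tensor_eval (case x of (f, z) \<Rightarrow> ?m f z)) = (\<lambda>x. (case x of (f, z) \<Rightarrow> cscale z f) * tensor_eval q)"
    by (intro ext) (simp only: case_prod_beta)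
  then have "tensor_eval (tensor_mult p q) = frag_eval (\<lambda>x. (case x of (f, z) \<Rightarrow> cscale z f) * tensor_eval q) p"
    unfolding tensor_mult_def tensor_eval_def frag_eval_extend by (simp only:)
  then show "tensor_eval (tensor_mult p q) = tensor_eval p * tensor_eval q"
    by (simp only: tensor_eval_def frag_eval_mult_right)
qed

lemma tensor_algebra_simps [simp]:
  "carrier (tensor_algebra V) = {p +o tensor_rel V | p. Poly_Mapping.keys p \<subseteq> V \<times> UNIV}"
  "\<zero>\<^bsub>tensor_algebra V\<^esub> = tensor_rel V" "\<one>\<^bsub>tensor_algebra V\<^esub> = pure_tensor V 1 1"
  "A \<oplus>\<^bsub>tensor_algebra V\<^esub> B = A + B"
  "A \<otimes>\<^bsub>tensor_algebra V\<^esub> B = {tensor_mult p q | p q. p \<in> A \<and> q \<in> B} + tensor_rel V"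
  "c \<odot>\<^bsub>tensor_algebra V\<^esub> A = tensor_scale c ` A + tensor_rel V"
  by (simp_all add: tensor_algebra_def)

lemma pure_tensor_eq: "f \<in> Eis \<Longrightarrow> pure_tensor Eis f z = tensor_fiber (cscale z f)"
  using tensor_fiber_eq[of "frag_of (f, z)"] by (simp only: Eis_frags_of pure_tensor_def tensor_eval_simps)

lemma Eis_subset_Eis\<^sub>C: "Eis \<subseteq> Eis\<^sub>C"
  unfolding Eis\<^sub>C_def by (rule cvs.span_superset)

lemma one_in_Eis: "1 \<in> Eis"
  using one_in_Eis_wt Eis_wt_subset_Eis by blast

lemma algebra_iso_tensor_fiber:
  "algebra_iso complex_ring (sub_algebra cscale Eis\<^sub>C) (tensor_algebra Eis) tensor_fiber"
proof (rule algebra_iso_transport, unfold sub_algebra_simps)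
  show "Module.algebra complex_ring (sub_algebra cscale Eis\<^sub>C)"
    by (rule algebra_sub_algebra[OF cvs.module_axioms subspace_Eis\<^sub>C _ Eis\<^sub>C_mult])
      (use one_in_Eis Eis_subset_Eis\<^sub>C in \<open>auto simp: cscale_def fun_eq_iff\<close>)
  show "bij_betw tensor_fiber Eis\<^sub>C (carrier (tensor_algebra Eis))"
  proof (rule bij_betwI')
    fix f h assume "f \<in> Eis\<^sub>C" "h \<in> Eis\<^sub>C"
    then obtain p where "p \<in> tensor_fiber f" using ex_tensor_eval unfolding tensor_fiber_def by blast
    moreover have "tensor_eval p = f'" if "p \<in> tensor_fiber f'" for f' using that by (simp only: tensor_fiber_def mem_Collect_eq)
    ultimately show "tensor_fiber f = tensor_fiber h \<longleftrightarrow> f = h" by metis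
  next
    fix f assume "f \<in> Eis\<^sub>C"
    then obtain p where "p \<in> Eis_frags" "tensor_eval p = f" using ex_tensor_eval by blast
    then show "tensor_fiber f \<in> carrier (tensor_algebra Eis)" using tensor_fiber_eq[of p] by auto
  next
    fix A assume "A \<in> carrier (tensor_algebra Eis)"
    then obtain p where "p \<in> Eis_frags" "A = p +o tensor_rel Eis" by auto
    then show "\<exists>f\<in>Eis\<^sub>C. A = tensor_fiber f" using tensor_fiber_eq[of p] tensor_eval_in_Eis\<^sub>C[of p] by blast
  qed
  show "tensor_fiber 0 = \<zero>\<^bsub>tensor_algebra Eis\<^esub>" by (simp only: tensor_fiber_def tensor_rel_eq tensor_algebra_simps)
  show "tensor_fiber 1 = \<one>\<^bsub>tensor_algebra Eis\<^esub>"
    by (simp only: tensor_algebra_simps pure_tensor_eq[OF one_in_Eis] cvs.scale_one)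
next
  fix f h assume "f \<in> Eis\<^sub>C" "h \<in> Eis\<^sub>C"
  then obtain p q where p: "p \<in> Eis_frags" "tensor_eval p = f" and q: "q \<in> Eis_frags" "tensor_eval q = h"
    using ex_tensor_eval by metis
  show "tensor_fiber (f + h) = tensor_fiber f \<oplus>\<^bsub>tensor_algebra Eis\<^esub> tensor_fiber h"
    using tensor_fiber_eq[OF p(1)] tensor_fiber_eq[OF q(1)] tensor_fiber_eq[OF Eis_frags_add[OF p(1) q(1)]]
    by (simp only: p(2) q(2) tensor_eval_simps tensor_algebra_simps set_plus_rearrange frag.subspace_set_plus[OF subspace_tensor_rel])
  have "{tensor_mult p q | p q. p \<in> tensor_fiber f \<and> q \<in> tensor_fiber h} \<subseteq> tensor_fiber (f * h)"
    using tensor_mult_props unfolding tensor_fiber_def by blast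
  moreover have "tensor_mult p q \<in> {tensor_mult p q | p q. p \<in> tensor_fiber f \<and> q \<in> tensor_fiber h}"
    using p q unfolding tensor_fiber_def by blast
  ultimately show "tensor_fiber (f * h) = tensor_fiber f \<otimes>\<^bsub>tensor_algebra Eis\<^esub> tensor_fiber h"
    unfolding tensor_algebra_simps by (rule tensor_fiber_absorb[symmetric])
next
  fix c :: complex and f assume "f \<in> Eis\<^sub>C"
  then obtain p where p: "p \<in> Eis_frags" "tensor_eval p = f" using ex_tensor_eval by blast
  have "tensor_scale c ` tensor_fiber f \<subseteq> tensor_fiber (cscale c f)"
    using tensor_scale_props unfolding tensor_fiber_def by blast
  moreover have "tensor_scale c p \<in> tensor_scale c ` tensor_fiber f"
    using p unfolding tensor_fiber_def by blast
  ultimately show "tensor_fiber (cscale c f) = c \<odot>\<^bsub>tensor_algebra Eis\<^esub> tensor_fiber f"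
    unfolding tensor_algebra_simps by (rule tensor_fiber_absorb[symmetric])
qed

theorem theorem2:
  shows "(internal_direct_sum Eis\<^sub>C Eis_wt\<^sub>C \<and> graded_algebra Eis Eis_wt) \<and>
    (\<exists>\<Phi> :: nat \<Rightarrow> hfun \<Rightarrow> hfun set.
       (\<forall>k. module_iso rat_ring (sub_algebra qscale (Eis_wt k)) (gr_piece qscale FilW k) (\<Phi> k)) \<and>
       (\<forall>ks. admissible ks \<longrightarrow>
          \<Phi> (sum_list ks) (mes ks) = g ks +o FilW (int (sum_list ks) - 1)) \<and>
       \<Phi> 0 1 = 1 +o FilW (-1) \<and>
       (\<exists>\<Psi>. algebra_iso rat_ring (sub_algebra qscale Eis) (gr_algebra qscale FilW) \<Psi> \<and>
          (\<forall>k. \<forall>f\<in>Eis_wt k. \<Psi> f = gr_incl FilW k (\<Phi> k f)))) \<and>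
    (\<exists>\<Theta>. algebra_iso complex_ring (tensor_algebra Eis) (sub_algebra cscale Eis\<^sub>C) \<Theta> \<and>
       (\<forall>f\<in>Eis. \<forall>z. \<Theta> (pure_tensor Eis f z) = cscale z f))"
proof (intro conjI)
  show "internal_direct_sum Eis\<^sub>C Eis_wt\<^sub>C" by (rule internal_direct_sum_Eis\<^sub>C)
  show "graded_algebra Eis Eis_wt" by (rule graded_algebra_Eis)
  show "\<exists>\<Phi> :: nat \<Rightarrow> hfun \<Rightarrow> hfun set.
       (\<forall>k. module_iso rat_ring (sub_algebra qscale (Eis_wt k)) (gr_piece qscale FilW k) (\<Phi> k)) \<and>
       (\<forall>ks. admissible ks \<longrightarrow>
          \<Phi> (sum_list ks) (mes ks) = g ks +o FilW (int (sum_list ks) - 1)) \<and>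
       \<Phi> 0 1 = 1 +o FilW (-1) \<and>
       (\<exists>\<Psi>. algebra_iso rat_ring (sub_algebra qscale Eis) (gr_algebra qscale FilW) \<Psi> \<and>
          (\<forall>k. \<forall>f\<in>Eis_wt k. \<Psi> f = gr_incl FilW k (\<Phi> k f)))"
    using module_iso_Phi Phi_mes Phi_one algebra_iso_Psi Psi_Eis_wt by (intro exI[of _ Phi]) blast
  \<comment> \<open>The natural map is obtained as the inverse of \<open>tensor_fiber\<close>;
    injectivity identifies its values on pure tensors.\<close>
  have "inj_on tensor_fiber Eis\<^sub>C"
    using algebra_iso_tensor_fiber by (simp add: algebra_iso_def module_iso_def bij_betw_def)
  then have "inv_into Eis\<^sub>C tensor_fiber (pure_tensor Eis f z) = cscale z f" if "f \<in> Eis" for f z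
    unfolding pure_tensor_eq[OF that] using that Eis_subset_Eis\<^sub>C cvs.subspace_scale[OF subspace_Eis\<^sub>C]
    by (intro inv_into_f_f) auto
  then show "\<exists>\<Theta>. algebra_iso complex_ring (tensor_algebra Eis) (sub_algebra cscale Eis\<^sub>C) \<Theta> \<and>
       (\<forall>f\<in>Eis. \<forall>z. \<Theta> (pure_tensor Eis f z) = cscale z f)"
    using algebra_iso_inverse[OF algebra_iso_tensor_fiber] by auto
qed

end
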